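(* Let $K,K'\in\mathbb{R}$, let $(X,d)$ be a geodesic length space with curvature bounded below (respectively above) by $K$, let $I\subseteq\mathbb{R}$ be an open interval and $f:I\to(0,\infty)$ continuous. If the generalized cone $I\times_f\mathbb{M}^2(K)$ has timelike curvature bounded below (respectively above) by $K'$, then $Y=I\times_f X$ has timelike curvature bounded below (respectively above) by $K'$.
   Context: $\mathbb{M}^2(K)$ is the two-dimensional Riemannian model space of constant curvature $K$ (round sphere of radius $1/\sqrt K$ for $K>0$, Euclidean plane for $K=0$, hyperbolic plane of curvature $K$ for $K<0$), viewed as a metric space. Curvature bounded below/above by $K$ for a geodesic length space is meant in the usual Alexandrov (triangle comparison with $\mathbb{M}^2(K)$) sense. Generalized cone $I\times_f Z$ over a metric space $(Z,d)$: the set $I\times Z$ with metric $D((t,x),(t',x'))=|t-t'|+d(x,x')$; a curve $\gamma=(\alpha,\beta)$ is causal if $D$-absolutely continuous, $\alpha$ strictly monotone and $-\dot\alpha^2+(f\circ\alpha)^2v_\beta^2\le0$ a.e. ($v_\beta$ the metric derivative; timelike if $<0$ a.e.), future directed if $\dot\alpha>0$ a.e.; $L(\gamma)=\int\sqrt{\dot\alpha^2-(f\circ\alpha)^2v_\beta^2}$; $\tau(y,y')$ is the supremum of $L$ over future directed causal curves from $y$ to $y'$ ($0$ if none); $y\ll y'$ (resp. $y\le y'$) iff there is a future directed timelike (resp. causal) curve from $y$ to $y'$ (or $y=y'$ for $\le$). Timelike curvature bounds: let $\mathbb{L}^2(K')$ be the two-dimensional simply connected Lorentzian model space of constant curvature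 $K'$. A timelike geodesic triangle is $(x,y,z)$ with $x\ll y\ll z$, $\tau(x,z)<\infty$, sides realized by maximal future directed causal curves. The space has timelike curvature bounded below (above) by $K'$ if each point has a neighborhood $U$ with: $\tau|_{U\times U}$ finite and continuous; any $x\ll y$ in $U$ joined by a causal curve in $U$ of $\tau$-length $\tau(x,y)$; and for every timelike geodesic triangle in $U$ with side lengths $a=\tau(x,y)$, $b=\tau(y,z)$, $c=\tau(x,z)$ satisfying the size bounds for $K'$ ($c\ge a+b$, and if $c=a+b$ and $K'>0$ or $c>a+b$ and $K'<0$ then $c<\pi/\sqrt{|K'|}$), and any points $p,q$ on its sides with corresponding points $p',q'$ on a comparison triangle in $\mathbb{L}^2(K')$, one has $\tau(p,q)\le\tau'(p',q')$ (resp. $\ge$). *)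

theory Defs
  imports "HOL-Analysis.Analysis"
begin

definition metric_ac :: "('p \<Rightarrow> 'p \<Rightarrow> real) \<Rightarrow> real \<Rightarrow> real \<Rightarrow> (real \<Rightarrow> 'p) \<Rightarrow> bool" where
  "metric_ac D a b c \<longleftrightarrow>
     (\<forall>e>0. \<exists>\<delta>>0. \<forall>(n::nat) (s::nat \<Rightarrow> real) (t::nat \<Rightarrow> real).
        (\<forall>i<n. a \<le> s i \<and> s i \<le> t i \<and> t i \<le> b) \<and>
        (\<forall>i<n. \<forall>j<n. i < j \<longrightarrow> t i \<le> s j) \<and>
        (\<Sum>i<n. t i - s i) < \<delta> \<longrightarrow> (\<Sum>i<n. D (c (s i)) (c (t i))) < e)"

definition metric_deriv :: "('p \<Rightarrow> 'p \<Rightarrow> real) \<Rightarrow> (real \<Rightarrow> 'p) \<Rightarrow> real \<Rightarrow> real" where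
  "metric_deriv d c t = Lim (at 0) (\<lambda>h. d (c (t + h)) (c t) / \<bar>h\<bar>)"

definition is_geod :: "('a \<Rightarrow> 'a \<Rightarrow> real) \<Rightarrow> 'a set \<Rightarrow> 'a \<Rightarrow> 'a \<Rightarrow> (real \<Rightarrow> 'a) \<Rightarrow> bool" where
  "is_geod d X p q c \<longleftrightarrow> c 0 = p \<and> c (d p q) = q \<and> c ` {0..d p q} \<subseteq> X \<and>
     (\<forall>s\<in>{0..d p q}. \<forall>t\<in>{0..d p q}. d (c s) (c t) = \<bar>s - t\<bar>)"

definition geodesic_length_space :: "'a set \<Rightarrow> ('a \<Rightarrow> 'a \<Rightarrow> real) \<Rightarrow> bool" where
  "geodesic_length_space X d \<longleftrightarrow> Metric_space X d \<and> (\<forall>p\<in>X. \<forall>q\<in>X. \<exists>c. is_geod d X p q c)"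

definition lor3 :: "real^3 \<Rightarrow> real^3 \<Rightarrow> real" where
  "lor3 x y = - (x$1 * y$1) + x$2 * y$2 + x$3 * y$3"

definition MK_set :: "real \<Rightarrow> (real^3) set" where
  "MK_set K = (if K > 0 then {x. x \<bullet> x = 1 / K}
               else if K = 0 then {x. x$3 = 0}
               else {x. lor3 x x = 1 / K \<and> x$1 > 0})"

definition MK_dist :: "real \<Rightarrow> real^3 \<Rightarrow> real^3 \<Rightarrow> real" where
  "MK_dist K x y = (if K > 0 then arccos (K * (x \<bullet> y)) / sqrt K
                    else if K = 0 then dist x y
                    else arcosh (K * lor3 x y) / sqrt (- K))"

definition alex_curv_bound :: "bool \<Rightarrow> real \<Rightarrow> 'a set \<Rightarrow> ('a \<Rightarrow> 'a \<Rightarrow> real) \<Rightarrow> bool" where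
  "alex_curv_bound lower K X d \<longleftrightarrow>
    (\<forall>x\<in>X. \<exists>r>0. \<forall>p q s c1 c2 c3.
       p \<in> X \<and> q \<in> X \<and> s \<in> X \<and>
       is_geod d X p q c1 \<and> is_geod d X q s c2 \<and> is_geod d X p s c3 \<and>
       c1 ` {0..d p q} \<subseteq> {y\<in>X. d x y < r} \<and>
       c2 ` {0..d q s} \<subseteq> {y\<in>X. d x y < r} \<and>
       c3 ` {0..d p s} \<subseteq> {y\<in>X. d x y < r} \<and>
       (K > 0 \<longrightarrow> d p q + d q s + d p s < 2 * pi / sqrt K) \<longrightarrow>
       (\<forall>p' q' s' e1 e2 e3.
          p' \<in> MK_set K \<and> q' \<in> MK_set K \<and> s' \<in> MK_set K \<and>
          MK_dist K p' q' = d p q \<and> MK_dist K q' s' = d q s \<and> MK_dist K p' s' = d p s \<and>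
          is_geod (MK_dist K) (MK_set K) p' q' e1 \<and>
          is_geod (MK_dist K) (MK_set K) q' s' e2 \<and>
          is_geod (MK_dist K) (MK_set K) p' s' e3 \<longrightarrow>
          (let P = {(c1 t, e1 t) | t. t \<in> {0..d p q}} \<union>
                   {(c2 t, e2 t) | t. t \<in> {0..d q s}} \<union>
                   {(c3 t, e3 t) | t. t \<in> {0..d p s}}
           in \<forall>(u, u')\<in>P. \<forall>(v, v')\<in>P.
                (if lower then MK_dist K u' v' \<le> d u v else d u v \<le> MK_dist K u' v'))))"

definition cone_dist :: "('a \<Rightarrow> 'a \<Rightarrow> real) \<Rightarrow> real \<times> 'a \<Rightarrow> real \<times> 'a \<Rightarrow> real" where
  "cone_dist d p q = \<bar>fst p - fst q\<bar> + d (snd p) (snd q)"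

definition cone_fd :: "bool \<Rightarrow> real set \<Rightarrow> (real \<Rightarrow> real) \<Rightarrow> 'a set \<Rightarrow> ('a \<Rightarrow> 'a \<Rightarrow> real)
    \<Rightarrow> real \<Rightarrow> real \<Rightarrow> (real \<Rightarrow> real \<times> 'a) \<Rightarrow> bool" where
  "cone_fd timelike I f X d a b \<gamma> \<longleftrightarrow>
     a < b \<and> \<gamma> ` {a..b} \<subseteq> I \<times> X \<and> metric_ac (cone_dist d) a b \<gamma> \<and>
     (strict_mono_on {a..b} (\<lambda>t. fst (\<gamma> t)) \<or> strict_mono_on {a..b} (\<lambda>t. - fst (\<gamma> t))) \<and>
     (AE t in lebesgue_on {a..b}.
        (\<lambda>t. fst (\<gamma> t)) differentiable (at t) \<and>
        deriv (\<lambda>t. fst (\<gamma> t)) t > 0 \<and>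
        (let q = - (deriv (\<lambda>t. fst (\<gamma> t)) t)\<^sup>2
                 + (f (fst (\<gamma> t)))\<^sup>2 * (metric_deriv d (\<lambda>t. snd (\<gamma> t)) t)\<^sup>2
         in if timelike then q < 0 else q \<le> 0))"

definition cone_L :: "(real \<Rightarrow> real) \<Rightarrow> ('a \<Rightarrow> 'a \<Rightarrow> real) \<Rightarrow> real \<Rightarrow> real \<Rightarrow> (real \<Rightarrow> real \<times> 'a) \<Rightarrow> real" where
  "cone_L f d a b \<gamma> =
     (\<integral>t. sqrt ((deriv (\<lambda>t. fst (\<gamma> t)) t)\<^sup>2
                 - (f (fst (\<gamma> t)))\<^sup>2 * (metric_deriv d (\<lambda>t. snd (\<gamma> t)) t)\<^sup>2) \<partial>lebesgue_on {a..b})"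

definition gtau :: "(real \<Rightarrow> real \<Rightarrow> (real \<Rightarrow> 'p) \<Rightarrow> bool) \<Rightarrow> (real \<Rightarrow> real \<Rightarrow> (real \<Rightarrow> 'p) \<Rightarrow> real)
    \<Rightarrow> 'p \<Rightarrow> 'p \<Rightarrow> ereal" where
  "gtau C L p q = (if \<exists>a b \<gamma>. C a b \<gamma> \<and> \<gamma> a = p \<and> \<gamma> b = q
     then Sup {ereal (L a b \<gamma>) | a b \<gamma>. C a b \<gamma> \<and> \<gamma> a = p \<and> \<gamma> b = q} else 0)"

definition grel :: "(real \<Rightarrow> real \<Rightarrow> (real \<Rightarrow> 'p) \<Rightarrow> bool) \<Rightarrow> 'p \<Rightarrow> 'p \<Rightarrow> bool" where
  "grel T p q \<longleftrightarrow> (\<exists>a b \<gamma>. T a b \<gamma> \<and> \<gamma> a = p \<and> \<gamma> b = q)"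

text \<open>K'=0: Minkowski plane; K'>0: universal cover of de Sitter space of radius
  r = 1/sqrt K' with metric -dt^2 + r^2 cosh^2(t/r) dx^2 on R^2;
  K'<0: universal cover of anti-de Sitter space of radius r = 1/sqrt(-K') with metric
  r^2/cos^2 x (-dt^2 + dx^2) on R \<times> (-pi/2, pi/2). Time orientation: dt > 0.\<close>
definition LM_dom :: "real \<Rightarrow> (real \<times> real) set" where
  "LM_dom K' = (if K' < 0 then UNIV \<times> {-pi/2<..<pi/2} else UNIV)"

definition LM_g :: "real \<Rightarrow> real \<times> real \<Rightarrow> real \<times> real \<Rightarrow> real" where
  "LM_g K' p v = (if K' = 0 then - (fst v)\<^sup>2 + (snd v)\<^sup>2
     else if K' > 0 then - (fst v)\<^sup>2 + (1 / K') * (cosh (fst p * sqrt K'))\<^sup>2 * (snd v)\<^sup>2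
     else (1 / (- K')) / (cos (snd p))\<^sup>2 * (- (fst v)\<^sup>2 + (snd v)\<^sup>2))"

definition LM_fd :: "bool \<Rightarrow> real \<Rightarrow> real \<Rightarrow> real \<Rightarrow> (real \<Rightarrow> real \<times> real) \<Rightarrow> bool" where
  "LM_fd timelike K' a b \<gamma> \<longleftrightarrow>
     a < b \<and> \<gamma> ` {a..b} \<subseteq> LM_dom K' \<and> metric_ac dist a b \<gamma> \<and>
     (AE t in lebesgue_on {a..b}.
        \<gamma> differentiable (at t) \<and> fst (vector_derivative \<gamma> (at t)) > 0 \<and>
        (if timelike then LM_g K' (\<gamma> t) (vector_derivative \<gamma> (at t)) < 0
         else LM_g K' (\<gamma> t) (vector_derivative \<gamma> (at t)) \<le> 0))"

definition LM_L :: "real \<Rightarrow> real \<Rightarrow> real \<Rightarrow> (real \<Rightarrow> real \<times> real) \<Rightarrow> real" where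
  "LM_L K' a b \<gamma> = (\<integral>t. sqrt (- LM_g K' (\<gamma> t) (vector_derivative \<gamma> (at t))) \<partial>lebesgue_on {a..b})"

definition LM_tau :: "real \<Rightarrow> real \<times> real \<Rightarrow> real \<times> real \<Rightarrow> ereal" where
  "LM_tau K' = gtau (LM_fd False K') (LM_L K')"

definition size_bounds :: "real \<Rightarrow> real \<Rightarrow> real \<Rightarrow> real \<Rightarrow> bool" where
  "size_bounds K' a b c \<longleftrightarrow> c \<ge> a + b \<and>
     ((c = a + b \<and> K' > 0) \<or> (c > a + b \<and> K' < 0) \<longrightarrow> c < pi / sqrt \<bar>K'\<bar>)"

text \<open>Timelike curvature bounded below (lower = True: \<tau> \<le> \<tau>') / above (lower = False)
  by K' for the space with point set Y, metric D (for the topology), future directed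
  causal curves C, future directed timelike curves T and length functional L.\<close>
definition tl_curv_bound :: "bool \<Rightarrow> real \<Rightarrow> 'p set \<Rightarrow> ('p \<Rightarrow> 'p \<Rightarrow> real)
    \<Rightarrow> (real \<Rightarrow> real \<Rightarrow> (real \<Rightarrow> 'p) \<Rightarrow> bool) \<Rightarrow> (real \<Rightarrow> real \<Rightarrow> (real \<Rightarrow> 'p) \<Rightarrow> bool)
    \<Rightarrow> (real \<Rightarrow> real \<Rightarrow> (real \<Rightarrow> 'p) \<Rightarrow> real) \<Rightarrow> bool" where
  "tl_curv_bound lower K' Y D C T L \<longleftrightarrow>
    (let \<tau> = gtau C L; \<tau>' = LM_tau K'; mt = Metric_space.mtopology Y D in
     \<forall>y\<in>Y. \<exists>U. U \<subseteq> Y \<and> (\<exists>r>0. {z\<in>Y. D y z < r} \<subseteq> U) \<and>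
       (\<forall>p\<in>U. \<forall>q\<in>U. \<tau> p q < \<infinity>) \<and>
       continuous_map (subtopology (prod_topology mt mt) (U \<times> U)) euclideanreal
          (\<lambda>(p, q). real_of_ereal (\<tau> p q)) \<and>
       (\<forall>p\<in>U. \<forall>q\<in>U. grel T p q \<longrightarrow>
          (\<exists>a b \<gamma>. C a b \<gamma> \<and> \<gamma> a = p \<and> \<gamma> b = q \<and> \<gamma> ` {a..b} \<subseteq> U \<and> ereal (L a b \<gamma>) = \<tau> p q)) \<and>
       (\<forall>x y z a1 b1 \<sigma>1 a2 b2 \<sigma>2 a3 b3 \<sigma>3.
          x \<in> U \<and> y \<in> U \<and> z \<in> U \<and> grel T x y \<and> grel T y z \<and> \<tau> x z < \<infinity> \<and>
          C a1 b1 \<sigma>1 \<and> \<sigma>1 a1 = x \<and> \<sigma>1 b1 = y \<and> ereal (L a1 b1 \<sigma>1) = \<tau> x y \<and> \<sigma>1 ` {a1..b1} \<subseteq> U \<and>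
          C a2 b2 \<sigma>2 \<and> \<sigma>2 a2 = y \<and> \<sigma>2 b2 = z \<and> ereal (L a2 b2 \<sigma>2) = \<tau> y z \<and> \<sigma>2 ` {a2..b2} \<subseteq> U \<and>
          C a3 b3 \<sigma>3 \<and> \<sigma>3 a3 = x \<and> \<sigma>3 b3 = z \<and> ereal (L a3 b3 \<sigma>3) = \<tau> x z \<and> \<sigma>3 ` {a3..b3} \<subseteq> U \<and>
          size_bounds K' (real_of_ereal (\<tau> x y)) (real_of_ereal (\<tau> y z)) (real_of_ereal (\<tau> x z))
          \<longrightarrow>
          (\<forall>x' y' z' a1' b1' \<sigma>1' a2' b2' \<sigma>2' a3' b3' \<sigma>3'.
             x' \<in> LM_dom K' \<and> y' \<in> LM_dom K' \<and> z' \<in> LM_dom K' \<and>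
             grel (LM_fd True K') x' y' \<and> grel (LM_fd True K') y' z' \<and>
             \<tau>' x' y' = \<tau> x y \<and> \<tau>' y' z' = \<tau> y z \<and> \<tau>' x' z' = \<tau> x z \<and>
             LM_fd False K' a1' b1' \<sigma>1' \<and> \<sigma>1' a1' = x' \<and> \<sigma>1' b1' = y' \<and> ereal (LM_L K' a1' b1' \<sigma>1') = \<tau>' x' y' \<and>
             LM_fd False K' a2' b2' \<sigma>2' \<and> \<sigma>2' a2' = y' \<and> \<sigma>2' b2' = z' \<and> ereal (LM_L K' a2' b2' \<sigma>2') = \<tau>' y' z' \<and>
             LM_fd False K' a3' b3' \<sigma>3' \<and> \<sigma>3' a3' = x' \<and> \<sigma>3' b3' = z' \<and> ereal (LM_L K' a3' b3' \<sigma>3') = \<tau>' x' z'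
             \<longrightarrow>
             (let P = {(\<sigma>1 t, \<sigma>1' t') | t t'. t \<in> {a1..b1} \<and> t' \<in> {a1'..b1'} \<and> \<tau>' x' (\<sigma>1' t') = \<tau> x (\<sigma>1 t)} \<union>
                      {(\<sigma>2 t, \<sigma>2' t') | t t'. t \<in> {a2..b2} \<and> t' \<in> {a2'..b2'} \<and> \<tau>' y' (\<sigma>2' t') = \<tau> y (\<sigma>2 t)} \<union>
                      {(\<sigma>3 t, \<sigma>3' t') | t t'. t \<in> {a3..b3} \<and> t' \<in> {a3'..b3'} \<and> \<tau>' x' (\<sigma>3' t') = \<tau> x (\<sigma>3 t)}
              in \<forall>(p, p')\<in>P. \<forall>(q, q')\<in>P.
                   (if lower then \<tau> p q \<le> \<tau>' p' q' else \<tau>' p' q' \<le> \<tau> p q)))))"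

definition cone_tl_curv_bound :: "bool \<Rightarrow> real \<Rightarrow> real set \<Rightarrow> (real \<Rightarrow> real) \<Rightarrow> 'a set
    \<Rightarrow> ('a \<Rightarrow> 'a \<Rightarrow> real) \<Rightarrow> bool" where
  "cone_tl_curv_bound lower K' I f X d =
     tl_curv_bound lower K' (I \<times> X) (cone_dist d)
       (cone_fd False I f X d) (cone_fd True I f X d) (cone_L f d)"

end

theory Submission
  imports Defs
begin

text \<open>The time separation of \<open>I \<times>\<^sub>f X\<close> depends on the fibre only through the distance of the fibre
  components, and decreases with it: a causal curve is transplanted to another fibre by letting it
  run along a geodesic at the (at most equal) speed with which the distance to the starting point
  changes. Hence maximal curves project to minimizing geodesics, and a timelike triangle in
  \<open>I \<times>\<^sub>f X\<close> becomes one with the same side lengths in the cone over the model surface, by replacing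
  its projection by the comparison triangle. The curvature bound of \<open>X\<close> compares fibre distances of
  corresponding points, hence time separations, and the assumed curvature bound of the model cone
  compares the latter with the Lorentzian model plane.

  Continuity of the time separation is not transported from the model cone: off the model surface
  \<^const>\<open>MK_dist\<close> takes junk values, so \<^const>\<open>cone_dist\<close> over it need not satisfy the axioms of
  \<^const>\<open>Metric_space\<close>, and these are needed to unfold the topology. It is proved by comparison with
  the cone over the real line.\<close>

section \<open>Monotone functions are differentiable almost everywhere\<close>

text \<open>\<open>metric_deriv\<close> is a \<open>Lim\<close>, and the inequalities in
  \<open>cone_fd\<close> hold only almost everywhere, so neither controls a curve by itself. They
  become usable because the variation of an absolutely continuous curve is monotone, continuous and
  absolutely continuous: it is differentiable off a null set, its derivative there is the metric
  derivative, and an absolutely continuous function with nonnegative derivative almost everywhere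
  does not decrease. The first section treats continuous monotone functions because the variation is
  one, and because closed intervals then have Stieltjes measure \<open>F v - F u\<close>.

  All geometric choices are local. The neighbourhood in \<open>Y\<close> is so small that maximal
  sides project into the ball where the bound of \<open>X\<close> applies, and that a comparison
  triangle based at one fixed point \<open>z0\<close> of the surface stays in the neighbourhood
  given by the hypothesis on the model cone.

  For continuity the cone over the line is compared with itself: a curve is deformed to nearby
  endpoints at the cost of a factor close to 1, as long as the fibre displacement stays below that
  of a null curve; otherwise the time separation tends to 0.\<close>

text \<open>Coding an interval by midpoint and radius turns it into a ball, so Vitali's covering
  theorem for balls applies. The open set \<open>W\<close> is a margin for the measure estimates:
  every selected interval lies in it.\<close>

lemma vitali_intervals:
  fixes S W :: "real set" and P :: "real \<Rightarrow> real \<Rightarrow> bool"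
  assumes W: "open W" "S \<subseteq> W"
    and P: "\<And>x \<delta>. x \<in> S \<Longrightarrow> \<delta> > 0 \<Longrightarrow> \<exists>u v. u \<le> x \<and> x \<le> v \<and> u < v \<and> v - u < \<delta> \<and> P u v"
  obtains C where "countable C" "\<And>u v. (u, v) \<in> C \<Longrightarrow> u < v \<and> P u v \<and> {u..v} \<subseteq> W"
    "disjoint_family_on (\<lambda>i. {fst i..snd i}) C"
    "negligible (S - (\<Union>i\<in>C. {fst i..snd i}))"
proof -
  define K where "K = {i. fst i < snd i \<and> P (fst i) (snd i) \<and> {fst i..snd i} \<subseteq> W}"
  define m r where "m = (\<lambda>i::real\<times>real. (fst i + snd i) / 2)" and "r = (\<lambda>i::real\<times>real. (snd i - fst i) / 2)"
  have cb: "cball (m i) (r i) = {fst i..snd i}" for i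
    by (auto simp: m_def r_def cball_eq_atLeastAtMost field_simps)
  have S: "\<exists>i. i \<in> K \<and> x \<in> cball (m i) (r i) \<and> r i < \<delta>" if x: "x \<in> S" and \<delta>: "\<delta> > 0" for x \<delta>
  proof -
    obtain \<rho> where \<rho>: "\<rho> > 0" "ball x \<rho> \<subseteq> W"
      using W x by (meson open_contains_ball subsetD)
    obtain u v where uv: "u \<le> x" "x \<le> v" "u < v" "v - u < min \<delta> \<rho>" "P u v"
      using P[OF x, of "min \<delta> \<rho>"] \<delta> \<rho> by auto
    have "{u..v} \<subseteq> ball x \<rho>" using uv by (auto simp: dist_real_def)
    then have "(u, v) \<in> K" using uv \<rho> by (auto simp: K_def)
    then show ?thesis using uv cb[of "(u, v)"] by (intro exI[of _ "(u, v)"]) (auto simp: r_def)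
  qed
  have r: "0 < r i" if "i \<in> K" for i using that by (auto simp: K_def r_def)
  obtain C where C: "countable C" "C \<subseteq> K"
     "pairwise (\<lambda>i j. disjnt (cball (m i) (r i)) (cball (m j) (r j))) C"
     "negligible (S - (\<Union>i \<in> C. cball (m i) (r i)))"
    by (rule Vitali_covering_theorem_cballs[of K r S m, OF r S])
  show ?thesis
  proof (rule that[of C])
    show "disjoint_family_on (\<lambda>i. {fst i..snd i}) C"
      using C(3) unfolding cb by (auto simp: disjoint_family_on_def pairwise_def disjnt_def)
    show "u < v \<and> P u v \<and> {u..v} \<subseteq> W" if "(u, v) \<in> C" for u v
      using subsetD[OF C(2) that] by (simp add: K_def)
  qed (use C cb in auto)
qed

lemma emeasure_interval_measure_cont:
  fixes F :: "real \<Rightarrow> real"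
  assumes "mono F" "continuous_on UNIV F" "u \<le> v"
  shows "emeasure (interval_measure F) {u..v} = ennreal (F v - F u)"
  by (rule emeasure_interval_measure_Icc)
     (use assms in \<open>auto simp: mono_def intro: continuous_on_subset\<close>)

text \<open>Disjointness makes both measures of the union sums over \<open>C\<close>, so an
  inequality for single intervals survives the union.\<close>

lemma emeasure_intervals_le:
  fixes C :: "(real \<times> real) set"
  assumes "countable C" "disjoint_family_on (\<lambda>i. {fst i..snd i}) C"
    and "sets M = sets borel" "sets N = sets borel"
    and "\<And>u v. (u, v) \<in> C \<Longrightarrow> ennreal p * emeasure M {u..v} \<le> ennreal q * emeasure N {u..v}"
  shows "ennreal p * emeasure M (\<Union>i\<in>C. {fst i..snd i}) \<le> ennreal q * emeasure N (\<Union>i\<in>C. {fst i..snd i})"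
proof -
  have "ennreal p * (\<integral>\<^sup>+ i. emeasure M {fst i..snd i} \<partial>count_space C) 
     \<le> ennreal q * (\<integral>\<^sup>+ i. emeasure N {fst i..snd i} \<partial>count_space C)"
    by (subst (1 2) nn_integral_cmult[symmetric]) (auto intro!: nn_integral_mono assms)
  then show ?thesis
    using assms by (subst (1 2) emeasure_UN_countable) auto
qed

lemma lmeasurable_Un_negligible:
  assumes "T \<in> lmeasurable" "negligible N"
  shows "T \<union> N \<in> lmeasurable" "measure lebesgue (T \<union> N) = measure lebesgue T"
proof -
  have neg: "negligible ((T - (T \<union> N)) \<union> (T \<union> N - T))"
    by (rule negligible_subset[OF assms(2)]) auto
  show "T \<union> N \<in> lmeasurable" by (rule lmeasurable_negligible_symdiff[OF assms(1) neg])
  show "measure lebesgue (T \<union> N) = measure lebesgue T" by (rule measure_negligible_symdiff[OF assms(1) neg])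
qed

text \<open>Disjoint intervals of mean slope at least \<open>q\<close> inside \<open>W\<close> have
  total length at most the Stieltjes measure of \<open>W\<close> divided by \<open>q\<close>. The
  part of \<open>S\<close> missed by Vitali's selection is null and is added to
  \<open>T\<close>.\<close>

lemma steep_cover:
  fixes F :: "real \<Rightarrow> real"
  assumes F: "mono F" "continuous_on UNIV F" and W: "open W" "S \<subseteq> W" and q: "q > 0"
    and m: "emeasure (interval_measure F) W \<le> ennreal m" "m \<ge> 0"
    and S: "\<And>x \<delta>. x \<in> S \<Longrightarrow> \<delta> > 0 \<Longrightarrow> \<exists>u v. u \<le> x \<and> x \<le> v \<and> u < v \<and> v - u < \<delta> \<and> q * (v - u) \<le> F v - F u"
  shows "\<exists>T\<in>lmeasurable. S \<subseteq> T \<and> q * measure lebesgue T \<le> m"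
proof -
  obtain C where C: "countable C" "\<And>u v. (u, v) \<in> C \<Longrightarrow> u < v \<and> q * (v - u) \<le> F v - F u \<and> {u..v} \<subseteq> W"
    "disjoint_family_on (\<lambda>i. {fst i..snd i}) C"
    "negligible (S - (\<Union>i\<in>C. {fst i..snd i}))"
    by (rule vitali_intervals[OF W, of "\<lambda>u v. q * (v - u) \<le> F v - F u"]) (use S in auto)
  define E where "E = (\<Union>i\<in>C. {fst i..snd i})"
  have EW: "E \<subseteq> W" unfolding E_def using C(2) by (intro UN_least) (metis prod.collapse)
  have Eb: "E \<in> sets borel" unfolding E_def using C(1) by (intro sets.countable_UN') auto
  have "ennreal q * emeasure lborel E \<le> ennreal 1 * emeasure (interval_measure F) E"
    unfolding E_def
  proof (rule emeasure_intervals_le[OF C(1) C(3)])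
    fix u v assume "(u, v) \<in> C"
    with C(2) have *: "u < v" "q * (v - u) \<le> F v - F u" by auto
    show "ennreal q * emeasure lborel {u..v} \<le> ennreal 1 * emeasure (interval_measure F) {u..v}"
      using * q by (simp add: emeasure_interval_measure_cont[OF F] ennreal_mult[symmetric] ennreal_leI)
  qed auto
  also have "ennreal 1 * emeasure (interval_measure F) E \<le> emeasure (interval_measure F) W"
    using EW W by (simp add: emeasure_mono)
  also have "\<dots> \<le> ennreal m" by fact
  finally have le: "ennreal q * emeasure lborel E \<le> ennreal m" .
  then have fin: "emeasure lborel E \<noteq> \<infinity>"
    using q by (auto simp: ennreal_mult_top top_unique)
  have "E \<in> lmeasurable"
    using Eb fin by (auto simp: fmeasurable_def top.not_eq_extremum intro: sets_completionI_sets)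
  moreover have "measure lebesgue E = measure lborel E" using Eb by (simp add: measure_completion)
  moreover have "q * measure lborel E \<le> m"
    using le fin q m(2) by (simp add: emeasure_eq_ennreal_measure ennreal_mult[symmetric])
  ultimately show ?thesis
    using lmeasurable_Un_negligible[of E "S - E"] C(4)
    by (intro bexI[of _ "E \<union> (S - E)"]) (auto simp: E_def)
qed

text \<open>Vitali's theorem is used twice: flat intervals bound the Stieltjes measure of their
  union by \<open>p * measure lebesgue W\<close>, and steep intervals chosen inside that union then
  have total length at most this bound divided by \<open>q\<close>.\<close>

lemma flat_steep_cover:
  fixes F :: "real \<Rightarrow> real"
  assumes F: "mono F" "continuous_on UNIV F" and W: "open W" "S \<subseteq> W" "W \<in> lmeasurable" and q: "0 \<le> p" "q > 0"
    and flat: "\<And>x \<delta>. x \<in> S \<Longrightarrow> \<delta> > 0 \<Longrightarrow> \<exists>u v. u \<le> x \<and> x \<le> v \<and> u < v \<and> v - u < \<delta> \<and> F v - F u \<le> p * (v - u)"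
    and steep: "\<And>x \<delta>. x \<in> S \<Longrightarrow> \<delta> > 0 \<Longrightarrow> \<exists>u v. u \<le> x \<and> x \<le> v \<and> u < v \<and> v - u < \<delta> \<and> q * (v - u) \<le> F v - F u"
  shows "\<exists>T\<in>lmeasurable. S \<subseteq> T \<and> q * measure lebesgue T \<le> p * measure lebesgue W"
proof -
  obtain C where C: "countable C" "\<And>u v. (u, v) \<in> C \<Longrightarrow> u < v \<and> F v - F u \<le> p * (v - u) \<and> {u..v} \<subseteq> W"
    "disjoint_family_on (\<lambda>i. {fst i..snd i}) C"
    "negligible (S - (\<Union>i\<in>C. {fst i..snd i}))"
    by (rule vitali_intervals[OF W(1,2), of "\<lambda>u v. F v - F u \<le> p * (v - u)"]) (use flat in auto)
  define E where "E = (\<Union>i\<in>C. {fst i..snd i})"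
  define G where "G = (\<Union>i\<in>C. {fst i<..<snd i})"
  have EW: "E \<subseteq> W" unfolding E_def using C(2) by (intro UN_least) (metis prod.collapse)
  have Eb: "E \<in> sets borel" unfolding E_def using C(1) by (intro sets.countable_UN') auto
  have "ennreal 1 * emeasure (interval_measure F) E \<le> ennreal p * emeasure lborel E"
    unfolding E_def
  proof (rule emeasure_intervals_le[OF C(1) C(3)])
    fix u v assume "(u, v) \<in> C"
    with C(2) have *: "u < v" "F v - F u \<le> p * (v - u)" by auto
    show "ennreal 1 * emeasure (interval_measure F) {u..v} \<le> ennreal p * emeasure lborel {u..v}"
      using * q by (simp add: emeasure_interval_measure_cont[OF F] ennreal_mult[symmetric] ennreal_leI)
  qed auto
  also have "\<dots> \<le> ennreal p * emeasure lborel W"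
    using EW W by (intro mult_left_mono emeasure_mono) auto
  also have "emeasure lborel W = emeasure lebesgue W"
    using W(1) by simp
  also have "\<dots> = ennreal (measure lebesgue W)"
    using W(3) by (simp add: emeasure_eq_measure2)
  finally have le: "emeasure (interval_measure F) E \<le> ennreal (p * measure lebesgue W)"
    using q by (simp add: ennreal_mult)
  \<comment> \<open>The second covering needs an open set, so the intervals are opened; only
    countably many endpoints are lost.\<close>
  have G: "open G" "G \<subseteq> E" by (force simp: G_def E_def)+
  have "E - G \<subseteq> fst ` C \<union> snd ` C" by (force simp: G_def E_def)
  then have "negligible (E - G)"
    using C(1) by (meson countable_Un countable_image countable_subset countable_imp_null_set_lborel negligible_iff_null_sets null_sets_completionI)
  then have neg: "negligible (S - G)"
    using C(4) unfolding E_def[symmetric]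
    by (rule_tac negligible_subset[of "(E - G) \<union> (S - E)"]) auto
  have "emeasure (interval_measure F) G \<le> ennreal (p * measure lebesgue W)"
    using emeasure_mono[of G E "interval_measure F"] le G Eb by simp
  then obtain T where T: "T \<in> lmeasurable" "S \<inter> G \<subseteq> T" "q * measure lebesgue T \<le> p * measure lebesgue W"
    using steep_cover[OF F G(1) _ q(2), of "S \<inter> G" "p * measure lebesgue W"] steep q by auto
  show ?thesis using T lmeasurable_Un_negligible[OF T(1) neg]
    by (intro bexI[of _ "T \<union> (S - G)"]) auto
qed

lemma lmeasurable_outer_open:
  assumes "T \<in> lmeasurable" "e > 0"
  obtains U where "open U" "T \<subseteq> U" "U \<in> lmeasurable" "measure lebesgue U < measure lebesgue T + e"
proof -
  obtain U where U: "open U" "T \<subseteq> U" "U - T \<in> lmeasurable" "emeasure lebesgue (U - T) < ennreal e"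
    using sets_lebesgue_outer_open[of T e] assms by (auto simp: fmeasurableD)
  have eq: "T \<union> (U - T) = U" using U by auto
  have "U \<in> lmeasurable" using fmeasurable.Un[OF assms(1) U(3)] eq by simp
  moreover have "measure lebesgue (U - T) < e"
    using U(3,4) assms by (simp add: emeasure_eq_measure2 ennreal_less_iff)
  moreover have "measure lebesgue U \<le> measure lebesgue T + measure lebesgue (U - T)"
    using measure_Un_le[of T lebesgue "U - T"] assms U eq by (simp add: fmeasurableD)
  ultimately show ?thesis using that U by force
qed

text \<open>\<open>S\<close> is not known to be measurable, so the argument runs on the infimum
  \<open>s\<close> of the measures of its open supersets. From a nearly optimal superset the double
  covering produces another one, whose measure times \<open>q\<close> is at most
  \<open>p * s\<close> up to a small error; with \<open>p < q\<close> this leaves only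
  \<open>s = 0\<close>.\<close>

lemma flat_steep_negligible:
  fixes F :: "real \<Rightarrow> real"
  assumes F: "mono F" "continuous_on UNIV F" and S: "bounded S" and pq: "0 \<le> p" "p < q"
    and flat: "\<And>x \<delta>. x \<in> S \<Longrightarrow> \<delta> > 0 \<Longrightarrow> \<exists>u v. u \<le> x \<and> x \<le> v \<and> u < v \<and> v - u < \<delta> \<and> F v - F u \<le> p * (v - u)"
    and steep: "\<And>x \<delta>. x \<in> S \<Longrightarrow> \<delta> > 0 \<Longrightarrow> \<exists>u v. u \<le> x \<and> x \<le> v \<and> u < v \<and> v - u < \<delta> \<and> q * (v - u) \<le> F v - F u"
  shows "negligible S"
proof -
  define A where "A = {measure lebesgue W | W. open W \<and> S \<subseteq> W \<and> W \<in> lmeasurable}"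
  obtain r where r: "S \<subseteq> ball 0 r" using S bounded_subset_ballD by blast
  have A0: "A \<noteq> {}" using r by (auto simp: A_def intro!: exI[of _ "ball 0 r"])
  have bdd: "bdd_below A" by (auto simp: A_def intro!: bdd_belowI[of _ 0])
  define s where "s = Inf A"
  have s0: "s \<ge> 0" unfolding s_def using A0 by (intro cInf_greatest) (auto simp: A_def)
  have key: "q * s \<le> p * (s + e) + q * e" if e: "e > 0" for e
  proof -
    obtain W where W: "open W" "S \<subseteq> W" "W \<in> lmeasurable" "measure lebesgue W < s + e"
      using cInf_lessD[OF A0, of "s + e"] e by (auto simp: s_def A_def)
    obtain T where T: "T \<in> lmeasurable" "S \<subseteq> T" "q * measure lebesgue T \<le> p * measure lebesgue W"
      using flat_steep_cover[OF F W(1-3) pq(1) _ flat steep] pq by force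
    obtain U where U: "open U" "T \<subseteq> U" "U \<in> lmeasurable" "measure lebesgue U < measure lebesgue T + e"
      using lmeasurable_outer_open[OF T(1) e] by metis
    have "s \<le> measure lebesgue U"
      unfolding s_def A_def using U T by (intro cInf_lower bdd[unfolded A_def] CollectI exI[of _ U]) auto
    then have "q * s \<le> q * (measure lebesgue T + e)"
      using pq U by (intro mult_left_mono) auto
    also have "\<dots> \<le> p * measure lebesgue W + q * e" using T by (simp add: algebra_simps)
    also have "\<dots> \<le> p * (s + e) + q * e" using W pq by (intro add_right_mono mult_left_mono) auto
    finally show ?thesis .
  qed
  have "q * s \<le> p * s"
  proof (rule field_le_epsilon)
    fix e :: real assume e: "e > 0"
    \<comment> \<open>The two error terms of \<open>key\<close> add up to \<open>p + q\<close> times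
      its parameter.\<close>
    have "q * s \<le> p * (s + e / (p + q)) + q * (e / (p + q))"
      using e pq by (intro key) auto
    also have "\<dots> = p * s + (p + q) * (e / (p + q))" by (simp only: algebra_simps)
    also have "(p + q) * (e / (p + q)) = e" using pq by simp
    finally show "q * s \<le> p * s + e" .
  qed
  then have "s = 0" using s0 pq by (smt (verit) mult_right_less_imp_less mult_le_cancel_right)
  show ?thesis
  proof (subst negligible_outer, intro allI impI)
    fix e :: real assume "e > 0"
    then obtain W where W: "open W" "S \<subseteq> W" "W \<in> lmeasurable" "measure lebesgue W < e"
      using cInf_lessD[OF A0, of e] \<open>s = 0\<close> by (auto simp: s_def A_def)
    then show "\<exists>T. S \<subseteq> T \<and> T \<in> lmeasurable \<and> measure lebesgue T < e" by blast
  qed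
qed

text \<open>Where slopes are unbounded, \<open>steep_cover\<close> applies with every
  \<open>q\<close>, while the Stieltjes measure of the ball stays at most \<open>m\<close>;
  \<open>q = (m + 1) / e\<close> makes the cover smaller than \<open>e\<close>.\<close>

lemma steep_negligible:
  fixes F :: "real \<Rightarrow> real"
  assumes F: "mono F" "continuous_on UNIV F" and S: "bounded S"
    and steep: "\<And>x \<delta> q. x \<in> S \<Longrightarrow> \<delta> > 0 \<Longrightarrow> q > 0 \<Longrightarrow> \<exists>u v. u \<le> x \<and> x \<le> v \<and> u < v \<and> v - u < \<delta> \<and> q * (v - u) \<le> F v - F u"
  shows "negligible S"
proof -
  obtain r where r: "r > 0" "S \<subseteq> ball 0 r" using S bounded_subset_ballD by blast
  define m where "m = F r - F (- r)"
  have m0: "m \<ge> 0" using F(1) r by (auto simp: m_def mono_def)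
  have "emeasure (interval_measure F) (ball 0 r) \<le> emeasure (interval_measure F) {-r..r}"
    by (intro emeasure_mono) (auto simp: dist_real_def)
  then have m: "emeasure (interval_measure F) (ball 0 r) \<le> ennreal m"
    using r by (simp add: emeasure_interval_measure_cont[OF F] m_def)
  show ?thesis
  proof (subst negligible_outer, intro allI impI)
    fix e :: real assume e: "e > 0"
    have q: "(m + 1) / e > 0" using e m0 by auto
    obtain T where T: "T \<in> lmeasurable" "S \<subseteq> T" "(m + 1) / e * measure lebesgue T \<le> m"
      using steep_cover[OF F open_ball r(2) q m m0 steep[OF _ _ q]] by blast
    have "measure lebesgue T < e"
    proof -
      have "(m + 1) * measure lebesgue T \<le> m * e" using T(3) e by (simp add: field_simps)
      also have "\<dots> < (m + 1) * e" using e by (simp add: algebra_simps)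
      finally show ?thesis using m0 by simp
    qed
    then show "\<exists>T. S \<subseteq> T \<and> T \<in> lmeasurable \<and> measure lebesgue T < e" using T by blast
  qed
qed

text \<open>Lebesgue's theorem. Where the derivative fails to exist, either the slopes are
  unbounded, or for some rationals \<open>p < q\<close> slopes at most \<open>p\<close> and slopes
  at least \<open>q\<close> both occur at arbitrarily small scales. Each of these countably many
  sets is null.\<close>

theorem mono_continuous_differentiable_ae:
  fixes F :: "real \<Rightarrow> real"
  assumes F: "mono F" "continuous_on UNIV F"
  shows "negligible {x. \<not> F differentiable (at x)}"
proof -
  \<comment> \<open>\<open>Up\<close> and \<open>Dn\<close> express upper and lower derivates along
    intervals that contain \<open>x\<close>, possibly as an endpoint, which is the form the covering
    lemmas use.\<close>
  define Up where "Up = (\<lambda>q x. \<forall>\<delta>>0. \<exists>u v. u \<le> x \<and> x \<le> v \<and> u < v \<and> v - u < \<delta> \<and> q * (v - u) \<le> F v - F u)"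
  define Dn where "Dn = (\<lambda>p x. \<forall>\<delta>>0. \<exists>u v. u \<le> x \<and> x \<le> v \<and> u < v \<and> v - u < \<delta> \<and> F v - F u \<le> p * (v - u))"
  have Up_mono: "Up p x" if up: "Up q x" and pq: "p \<le> q" for p q x
    unfolding Up_def
  proof (intro allI impI)
    fix \<delta> :: real assume "\<delta> > 0"
    then obtain u v where uv: "u \<le> x" "x \<le> v" "u < v" "v - u < \<delta>" "q * (v - u) \<le> F v - F u"
      using up unfolding Up_def by meson
    have "p * (v - u) \<le> q * (v - u)" using pq uv by (intro mult_right_mono) auto
    then have "p * (v - u) \<le> F v - F u" using uv by linarith
    with uv show "\<exists>u v. u \<le> x \<and> x \<le> v \<and> u < v \<and> v - u < \<delta> \<and> p * (v - u) \<le> F v - F u"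
      by blast
  qed
  have diff: "F differentiable (at x)" if fin: "q0 > 0" "\<not> Up q0 x" 
    and no: "\<And>p q. p \<in> \<rat> \<Longrightarrow> q \<in> \<rat> \<Longrightarrow> 0 \<le> p \<Longrightarrow> p < q \<Longrightarrow> \<not> (Dn p x \<and> Up q x)" for x q0
  proof -
    define A where "A = {q. q \<ge> 0 \<and> Up q x}"
    have "0 \<in> A" unfolding A_def Up_def
    proof (clarsimp)
      fix \<delta> :: real assume "\<delta> > 0"
      then show "\<exists>u\<le>x. \<exists>v\<ge>x. u < v \<and> v - u < \<delta> \<and> F u \<le> F v"
        using F(1) by (intro exI[of _ x] conjI exI[of _ "x + \<delta>/2"]) (auto simp: mono_def)
    qed
    have bdd: "bdd_above A"
      using fin Up_mono by (intro bdd_aboveI[of _ q0]) (auto simp: A_def intro: leI)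
    \<comment> \<open>The upper derivate, which turns out to be the derivative.\<close>
    define L where "L = Sup A"
    have L0: "L \<ge> 0" using \<open>0 \<in> A\<close> bdd by (auto simp: L_def intro: cSup_upper)
    have "\<exists>\<delta>>0. \<forall>u v. u \<le> x \<longrightarrow> x \<le> v \<longrightarrow> u < v \<longrightarrow> v - u < \<delta> \<longrightarrow> \<bar>(F v - F u) / (v - u) - L\<bar> < e" if e: "e > 0" for e
    proof -
      have "L + e \<notin> A" using cSup_upper[OF _ bdd] e by (force simp: L_def)
      then have "\<not> Up (L + e) x" using L0 e by (auto simp: A_def)
      then obtain \<delta>1 where \<delta>1: "\<delta>1 > 0" "\<And>u v. u \<le> x \<Longrightarrow> x \<le> v \<Longrightarrow> u < v \<Longrightarrow> v - u < \<delta>1 \<Longrightarrow> F v - F u < (L + e) * (v - u)"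
        unfolding Up_def by (meson not_le)
      have "\<exists>\<delta>2>0. \<forall>u v. u \<le> x \<longrightarrow> x \<le> v \<longrightarrow> u < v \<longrightarrow> v - u < \<delta>2 \<longrightarrow> F v - F u > (L - e) * (v - u)"
      proof (cases "L - e < 0")
        \<comment> \<open>\<open>no\<close> speaks of \<open>p \<ge> 0\<close> only; for a negative
          slope \<open>L - e\<close> monotonicity alone gives the lower bound.\<close>
        case True
        have "(L - e) * (v - u) < F v - F u" if "u < v" for u v
        proof -
          have "(L - e) * (v - u) < 0" using True that by (simp add: mult_neg_pos)
          also have "0 \<le> F v - F u" using F(1) that by (auto simp: mono_def)
          finally show ?thesis .
        qed
        then show ?thesis by (intro exI[of _ 1]) auto
      next
        case False
        obtain q where q: "q \<in> \<rat>" "L - e < q" "q < L" using Rats_dense_in_real[of "L - e" L] e by auto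
        obtain p where p: "p \<in> \<rat>" "L - e < p" "p < q" using Rats_dense_in_real[of "L - e" q] q by auto
        obtain q' where q': "q' \<in> A" "q < q'"
          using less_cSupD[of A q] q \<open>0 \<in> A\<close> by (auto simp: L_def)
        then have "Up q x" using Up_mono by (auto simp: A_def)
        then have "\<not> Dn p x" using no[OF p(1) q(1)] p q False by auto
        then obtain \<delta>2 where \<delta>2: "\<delta>2 > 0" "\<And>u v. u \<le> x \<Longrightarrow> x \<le> v \<Longrightarrow> u < v \<Longrightarrow> v - u < \<delta>2 \<Longrightarrow> F v - F u > p * (v - u)"
          unfolding Dn_def by (meson not_le)
        have "F v - F u > (L - e) * (v - u)" if "u \<le> x" "x \<le> v" "u < v" "v - u < \<delta>2" for u v
        proof -
          have "(L - e) * (v - u) \<le> p * (v - u)" using p that by (intro mult_right_mono) auto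
          with \<delta>2(2)[OF that] show ?thesis by linarith
        qed
        then show ?thesis using \<delta>2(1) by blast
      qed
      then obtain \<delta>2 where \<delta>2: "\<delta>2 > 0" "\<And>u v. u \<le> x \<Longrightarrow> x \<le> v \<Longrightarrow> u < v \<Longrightarrow> v - u < \<delta>2 \<Longrightarrow> F v - F u > (L - e) * (v - u)"
        by blast
      show ?thesis
      proof (intro exI[of _ "min \<delta>1 \<delta>2"] conjI allI impI)
        fix u v assume uv: "u \<le> x" "x \<le> v" "u < v" "v - u < min \<delta>1 \<delta>2"
        have "(F v - F u) / (v - u) < L + e" "L - e < (F v - F u) / (v - u)"
          using \<delta>1(2)[of u v] \<delta>2(2)[of u v] uv by (auto simp: field_simps)
        then show "\<bar>(F v - F u) / (v - u) - L\<bar> < e" by linarith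
      qed (use \<delta>1 \<delta>2 in auto)
    qed
    note * = this
    have "(F has_real_derivative L) (at x)"
      unfolding DERIV_def LIM_eq
    proof (intro allI impI)
      fix e :: real assume "e > 0"
      from *[OF this] obtain \<delta> where \<delta>: "\<delta> > 0" "\<And>u v. u \<le> x \<Longrightarrow> x \<le> v \<Longrightarrow> u < v \<Longrightarrow> v - u < \<delta> \<Longrightarrow> \<bar>(F v - F u) / (v - u) - L\<bar> < e"
        by blast
      have "\<bar>(F (x + h) - F x) / h - L\<bar> < e" if "h \<noteq> 0" "\<bar>h\<bar> < \<delta>" for h
      proof (cases "h > 0")
        case True then show ?thesis using \<delta>(2)[of x "x + h"] that by auto
      next
        case False
        have "(F x - F (x + h)) / (- h) = (F (x + h) - F x) / h" using that by (simp add: field_simps)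
        then show ?thesis using \<delta>(2)[of "x + h" x] that False by auto
      qed
      then show "\<exists>s>0. \<forall>xa. xa \<noteq> 0 \<and> norm (xa - 0) < s \<longrightarrow> norm ((F (x + xa) - F x) / xa - L) < e"
        using \<delta>(1) by auto
    qed
    then show ?thesis by (auto simp: real_differentiable_def)
  qed
  \<comment> \<open>The covering estimates are for bounded sets; balls of integer radius exhaust the
    line.\<close>
  have negI: "negligible S" if "\<And>k::nat. negligible (S \<inter> ball 0 (real k))" for S :: "real set"
  proof -
    have "S = (\<Union>k::nat. S \<inter> ball 0 (real k))" using reals_Archimedean2 by (auto simp: dist_real_def)
    then show ?thesis using negligible_countable_Union[of "range (\<lambda>k::nat. S \<inter> ball 0 (real k))"] that by auto
  qed
  have inf: "negligible {x. \<forall>q>0. Up q x}"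
  proof (rule negI, rule steep_negligible[OF F])
    fix k :: nat and x \<delta> q :: real assume "x \<in> {x. \<forall>q>0. Up q x} \<inter> ball 0 (real k)" "0 < \<delta>" "0 < q"
    then show "\<exists>u v. u \<le> x \<and> x \<le> v \<and> u < v \<and> v - u < \<delta> \<and> q * (v - u) \<le> F v - F u" by (auto simp: Up_def)
  qed (auto intro: bounded_Int)
  have osc: "negligible {x. Dn p x \<and> Up q x}" if "0 \<le> p" "p < q" for p q
  proof (rule negI, rule flat_steep_negligible[OF F _ that])
    fix k :: nat and x \<delta> :: real assume *: "x \<in> {x. Dn p x \<and> Up q x} \<inter> ball 0 (real k)" "0 < \<delta>"
    show "\<exists>u v. u \<le> x \<and> x \<le> v \<and> u < v \<and> v - u < \<delta> \<and> F v - F u \<le> p * (v - u)" using * by (auto simp: Dn_def)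
    show "\<exists>u v. u \<le> x \<and> x \<le> v \<and> u < v \<and> v - u < \<delta> \<and> q * (v - u) \<le> F v - F u" using * by (auto simp: Up_def)
  qed (auto intro: bounded_Int)
  define R where "R = {(p, q). p \<in> \<rat> \<and> q \<in> \<rat> \<and> 0 \<le> p \<and> p < (q::real)}"
  have "countable R"
    by (rule countable_subset[of _ "\<rat> \<times> \<rat>"]) (auto simp: R_def countable_rat)
  then have "negligible (\<Union>((\<lambda>(p, q). {x. Dn p x \<and> Up q x}) ` R))"
    by (intro negligible_countable_Union) (auto simp: R_def osc)
  with inf have "negligible ({x. \<forall>q>0. Up q x} \<union> (\<Union>((\<lambda>(p, q). {x. Dn p x \<and> Up q x}) ` R)))"
    by (rule negligible_Un)
  then show ?thesis
    by (rule negligible_subset) (use diff in \<open>force simp: R_def\<close>)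
qed

section \<open>Metric derivatives of absolutely continuous curves\<close>

lemma DERIV_eps:
  fixes F :: "real \<Rightarrow> real"
  assumes "(F has_real_derivative D) (at t)" "e > 0"
  obtains \<delta> where "\<delta> > 0" "\<And>h. h \<noteq> 0 \<Longrightarrow> \<bar>h\<bar> < \<delta> \<Longrightarrow> \<bar>(F (t + h) - F t) / h - D\<bar> < e"
  using assms unfolding DERIV_def LIM_eq by (metis diff_zero real_norm_def)

text \<open>The axioms are asked only for points of \<open>X\<close>, so that
  \<open>MK_set K\<close> with \<open>MK_dist K\<close> can be an instance.\<close>

locale metric_carrier =
  fixes X :: "'a set" and d :: "'a \<Rightarrow> 'a \<Rightarrow> real"
  assumes nonneg: "x \<in> X \<Longrightarrow> y \<in> X \<Longrightarrow> 0 \<le> d x y"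
    and zero_iff: "x \<in> X \<Longrightarrow> y \<in> X \<Longrightarrow> d x y = 0 \<longleftrightarrow> x = y"
    and sym: "x \<in> X \<Longrightarrow> y \<in> X \<Longrightarrow> d x y = d y x"
    and tri: "x \<in> X \<Longrightarrow> y \<in> X \<Longrightarrow> z \<in> X \<Longrightarrow> d x z \<le> d x y + d y z"
begin

lemma dist_diff_le:
  assumes "x \<in> X" "y \<in> X" "x' \<in> X" "y' \<in> X"
  shows "\<bar>d x y - d x' y'\<bar> \<le> d x x' + d y y'"
  using tri[of x x' y] tri[of x' y' y] tri[of x' x y'] tri[of x y y'] sym[of x x'] sym[of y y'] assms by linarith

lemma refl0: "x \<in> X \<Longrightarrow> d x x = 0"
  using zero_iff by blast

end

section \<open>Total variation of an absolutely continuous curve\<close>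

text \<open>The curve lives on the whole line and is constant outside \<open>[a, b]\<close>. Hence
  \<open>ac\<close> carries no range restriction, and the variation becomes a function on the line,
  as the differentiation theorem requires.\<close>

locale ac_line = metric_carrier X d for X :: "'a set" and d +
  fixes c :: "real \<Rightarrow> 'a" and a b :: real
  assumes ab: "a \<le> b"
    and inX: "c t \<in> X"
    and below: "t \<le> a \<Longrightarrow> c t = c a"
    and above: "b \<le> t \<Longrightarrow> c t = c b"
    and ac: "e > 0 \<Longrightarrow> \<exists>\<delta>>0. \<forall>(n::nat) s t. (\<forall>i<n. s i \<le> t i) \<and> (\<forall>i<n. \<forall>j<n. i < j \<longrightarrow> t i \<le> s j) \<and>
        (\<Sum>i<n. t i - s i) < \<delta> \<longrightarrow> (\<Sum>i<n. d (c (s i)) (c (t i))) < e"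
begin

text \<open>A partition is an infinite monotone sequence of which the first \<open>n\<close> steps
  count; truncating it by \<open>min\<close> or \<open>max\<close> gives a partition again, without
  any reindexing.\<close>

definition T :: "(nat \<Rightarrow> real) \<Rightarrow> nat \<Rightarrow> real" where
  "T p n = (\<Sum>i<n. d (c (p i)) (c (p (Suc i))))"

lemma T_small:
  assumes "e > 0"
  shows "\<exists>\<delta>>0. \<forall>p n. mono p \<and> p n - p 0 < \<delta> \<longrightarrow> T p n < e"
proof -
  obtain \<delta> where \<delta>: "\<delta> > 0" "\<And>(n::nat) s t. (\<forall>i<n. s i \<le> t i) \<Longrightarrow> (\<forall>i<n. \<forall>j<n. i < j \<longrightarrow> t i \<le> s j) \<Longrightarrow>
        (\<Sum>i<n. t i - s i) < \<delta> \<Longrightarrow> (\<Sum>i<n. d (c (s i)) (c (t i))) < e"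
    using ac[OF assms] by blast
  have "T p n < e" if "mono p" "p n - p 0 < \<delta>" for p n
    unfolding T_def using that
    by (intro \<delta>(2)) (auto simp: sum_lessThan_telescope mono_def Suc_le_eq)
  then show ?thesis using \<delta>(1) by blast
qed

lemma d_split:
  assumes "x \<le> y"
  shows "d (c x) (c y) \<le> d (c (min x u)) (c (min y u)) + d (c (max x u)) (c (max y u))"
proof -
  consider "y \<le> u" | "u \<le> x" | "x < u" "u < y" by linarith
  then show ?thesis
    using assms by cases (auto simp: min_def max_def refl0 inX tri)
qed

lemma T_split:
  assumes "mono p"
  shows "T p n \<le> T (\<lambda>i. min (p i) u) n + T (\<lambda>i. max (p i) u) n"
  unfolding T_def sum.distrib[symmetric]
  using assms by (intro sum_mono d_split) (auto simp: mono_def)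

text \<open>Absolute continuity bounds the variation over a stretch shorter than
  \<open>\<delta>\<close> by 1. Finitely many cuts \<open>u k\<close> at distance
  \<open>\<delta> / 2\<close> reach from \<open>a\<close> to \<open>b\<close>, and outside the curve
  is constant.\<close>

lemma T_bounded: "\<exists>B. \<forall>p n. mono p \<longrightarrow> T p n \<le> B"
proof -
  obtain \<delta> where \<delta>: "\<delta> > 0" "\<And>p n. mono p \<Longrightarrow> p n - p 0 < \<delta> \<Longrightarrow> T p n < 1"
    using T_small[of 1] by auto
  define u where "u = (\<lambda>k::nat. a + real k * (\<delta> / 2))"
  have *: "T (\<lambda>i. min (p i) (u k)) n \<le> real k" if "mono p" for k p n
    using that
  proof (induction k arbitrary: p)
    case 0
    have "c (min (p i) (u 0)) = c a" for i using below[of "min (p i) a"] by (simp add: u_def)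
    then show ?case by (simp add: T_def refl0 inX)
  next
    case (Suc k)
    define q where "q = (\<lambda>i. min (p i) (u (Suc k)))"
    have q: "mono q" using Suc.prems by (fastforce simp: q_def mono_def min_def)
    have uu: "u k \<le> u (Suc k)" "u (Suc k) - u k < \<delta>" using \<delta>(1) by (auto simp: u_def field_simps)
    have "T (\<lambda>i. max (q i) (u k)) n < 1"
    proof (rule \<delta>(2))
      show "mono (\<lambda>i. max (q i) (u k))" using q by (fastforce simp: mono_def max_def)
      show "max (q n) (u k) - max (q 0) (u k) < \<delta>" using uu by (auto simp: q_def)
    qed
    moreover have "min (q i) (u k) = min (p i) (u k)" for i using uu by (auto simp: q_def)
    ultimately show ?case using T_split[OF q, of n "u k"] Suc.IH[OF Suc.prems] by (simp add: q_def)
  qed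
  obtain N :: nat where N: "real N \<ge> (b - a) / (\<delta> / 2)" using real_arch_simple by blast
  have uN: "b \<le> u N" using N \<delta>(1) by (simp add: u_def field_simps)
  have "c (min x (u N)) = c x" for x using uN above[of x] above[of "u N"] by (auto simp: min_def)
  then have "T (\<lambda>i. min (p i) (u N)) n = T p n" for p n by (simp add: T_def)
  with * show ?thesis by metis
qed

text \<open>Partitions may start anywhere below \<open>t\<close>; as the curve is constant before
  \<open>a\<close>, this is the variation on \<open>[a, t]\<close> for
  \<open>t \<ge> a\<close>.\<close>

definition V :: "real \<Rightarrow> real" where
  "V t = Sup {T p n | p n. mono p \<and> (\<forall>i. p i \<le> t)}"

lemma V_bdd: "bdd_above {T p n | p n. mono p \<and> (\<forall>i. p i \<le> t)}"
  using T_bounded by (auto simp: bdd_above_def)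

lemma V_upper: "mono p \<Longrightarrow> (\<And>i. p i \<le> t) \<Longrightarrow> T p n \<le> V t"
  unfolding V_def by (rule cSup_upper[OF _ V_bdd]) auto

lemma V_ne: "{T p n | p n. mono p \<and> (\<forall>i. p i \<le> t)} \<noteq> {}"
  by (auto intro!: exI[of _ "\<lambda>_. t"] simp: mono_def)

lemma V_least: "(\<And>p n. mono p \<Longrightarrow> (\<And>i. p i \<le> t) \<Longrightarrow> T p n \<le> B) \<Longrightarrow> V t \<le> B"
  unfolding V_def by (rule cSup_least[OF V_ne]) auto

lemma V_superadd:
  assumes "s \<le> t"
  shows "V s + d (c s) (c t) \<le> V t"
proof -
  have "V s \<le> V t - d (c s) (c t)"
  proof (rule V_least)
    fix p :: "nat \<Rightarrow> real" and n assume p: "mono p" "\<And>i. p i \<le> s"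
    \<comment> \<open>A partition below \<open>s\<close> is cut off after \<open>n\<close> and
      continued by \<open>s\<close> and \<open>t\<close>; the extra step from \<open>p n\<close> to
      \<open>s\<close> only adds length.\<close>
    define q where "q = (\<lambda>i. if i \<le> n then p i else if i = Suc n then s else t)"
    have q: "mono q" "\<And>i. q i \<le> t"
      using p assms by (auto simp: q_def mono_def intro: order_trans)
    have "T q n = T p n" unfolding T_def by (rule sum.cong) (auto simp: q_def)
    then have "T q (Suc (Suc n)) = T p n + d (c (p n)) (c s) + d (c s) (c t)"
      by (simp add: T_def) (simp add: q_def)
    with V_upper[OF q, of "Suc (Suc n)"] nonneg[OF inX inX, of "p n" s]
    show "T p n \<le> V t - d (c s) (c t)" by linarith
  qed
  then show ?thesis by linarith
qed

lemma d_le_V: "s \<le> t \<Longrightarrow> d (c s) (c t) \<le> V t - V s"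
  using V_superadd by fastforce

lemma V_mono: "mono V"
  using V_superadd nonneg inX by (smt (verit, best) monoI)

lemma T_le_V: "mono p \<Longrightarrow> T p n \<le> V (p n) - V (p 0)"
proof (induction n)
  case (Suc n)
  have "d (c (p n)) (c (p (Suc n))) \<le> V (p (Suc n)) - V (p n)"
    using Suc.prems by (intro d_le_V) (simp add: mono_def)
  then show ?case using Suc by (simp add: T_def)
qed (simp add: T_def)

text \<open>Cutting a partition at \<open>s\<close> splits its length into a part bounded by
  \<open>V s\<close> and a part inside \<open>[s, t]\<close>, which is bounded by
  \<open>e\<close>.\<close>

lemma V_diff_le:
  assumes st: "s \<le> t" and e: "\<And>p n. mono p \<Longrightarrow> (\<And>i. s \<le> p i \<and> p i \<le> t) \<Longrightarrow> T p n \<le> e"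
  shows "V t - V s \<le> e"
proof -
  have "V t \<le> V s + e"
  proof (rule V_least)
    fix p :: "nat \<Rightarrow> real" and n assume p: "mono p" "\<And>i. p i \<le> t"
    have "T (\<lambda>i. min (p i) s) n \<le> V s"
      using p by (intro V_upper) (fastforce simp: mono_def min_def)+
    moreover have "T (\<lambda>i. max (p i) s) n \<le> e"
      using p st by (intro e) (fastforce simp: mono_def max_def)+
    ultimately show "T p n \<le> V s + e" using T_split[OF p(1), of n s] by linarith
  qed
  then show ?thesis by linarith
qed

lemma V_continuous: "continuous_on UNIV V"
proof (rule continuous_at_imp_continuous_on, safe)
  fix x
  show "isCont V x"
    unfolding continuous_at_eps_delta
  proof (intro allI impI)
    fix e :: real assume e: "e > 0"
    obtain \<delta> where \<delta>: "\<delta> > 0" "\<And>p n. mono p \<Longrightarrow> p n - p 0 < \<delta> \<Longrightarrow> T p n < e / 2"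
      using T_small[of "e/2"] e by auto
    have *: "V t - V s \<le> e / 2" if "s \<le> t" "t - s < \<delta>" for s t
    proof (rule V_diff_le[OF that(1)])
      fix p :: "nat \<Rightarrow> real" and n assume p: "mono p" "\<And>i. s \<le> p i \<and> p i \<le> t"
      have "p n - p 0 < \<delta>" using p(2)[of n] p(2)[of 0] that by linarith
      then show "T p n \<le> e / 2" using \<delta>(2)[OF p(1)] by force
    qed
    have "dist (V y) (V x) < e" if "dist y x < \<delta>" for y
      using *[of x y] *[of y x] that e V_mono by (cases "x \<le> y") (auto simp: dist_real_def mono_def)
    then show "\<exists>\<delta>>0. \<forall>y. dist y x < \<delta> \<longrightarrow> dist (V y) (V x) < e" using \<delta>(1) by blast
  qed
qed

text \<open>Each interval is replaced by a nearly optimal partition of it. All the small intervals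
  together again form an ordered family without overlaps and of no larger total length, to which
  absolute continuity of \<open>c\<close> applies.\<close>

lemma V_ac:
  assumes "e > 0"
  shows "\<exists>\<delta>>0. \<forall>(n::nat) s t. (\<forall>i<n. s i \<le> t i) \<and> (\<forall>i<n. \<forall>j<n. i < j \<longrightarrow> t i \<le> s j) \<and>
        (\<Sum>i<n. t i - s i) < \<delta> \<longrightarrow> (\<Sum>i<n. V (t i) - V (s i)) < e"
proof -
  obtain \<delta> where \<delta>: "\<delta> > 0" "\<And>(n::nat) s t. (\<forall>i<n. s i \<le> t i) \<Longrightarrow> (\<forall>i<n. \<forall>j<n. i < j \<longrightarrow> t i \<le> s j) \<Longrightarrow>
        (\<Sum>i<n. t i - s i) < \<delta> \<Longrightarrow> (\<Sum>i<n. d (c (s i)) (c (t i))) < e / 2"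
    using ac[of "e/2"] assms by auto
  have "(\<Sum>i<n. V (t i) - V (s i)) < e"
    if st: "\<forall>i<n. s i \<le> t i" "\<forall>i<n. \<forall>j<n. i < j \<longrightarrow> t i \<le> s j" "(\<Sum>i<n. t i - s i) < \<delta>" for n :: nat and s t
  proof -
    define \<eta> where "\<eta> = e / (2 * (real n + 1))"
    have \<eta>: "\<eta> > 0" using assms by (simp add: \<eta>_def)
    have "\<exists>p m. mono p \<and> (\<forall>j. s i \<le> p j \<and> p j \<le> t i) \<and> V (t i) - V (s i) \<le> T p m + \<eta>" if "i < n" for i
    proof (rule ccontr)
      assume no: "\<not> ?thesis"
      have "V (t i) - V (s i) \<le> V (t i) - V (s i) - \<eta>"
      proof (rule V_diff_le)
        show "s i \<le> t i" using st that by blast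
        fix p :: "nat \<Rightarrow> real" and m assume "mono p" "\<And>j. s i \<le> p j \<and> p j \<le> t i"
        then have "\<not> V (t i) - V (s i) \<le> T p m + \<eta>" using no by blast
        then show "T p m \<le> V (t i) - V (s i) - \<eta>" by linarith
      qed
      then show False using \<eta> by simp
    qed
    then obtain pp mm where pm: "\<And>i. i < n \<Longrightarrow> mono (pp i)" "\<And>i j. i < n \<Longrightarrow> s i \<le> pp i j"
      "\<And>i j. i < n \<Longrightarrow> pp i j \<le> t i" "\<And>i. i < n \<Longrightarrow> V (t i) - V (s i) \<le> T (pp i) (mm i) + \<eta>"
      by metis
    \<comment> \<open>The partitions are padded to a common number \<open>M\<close> of steps by
      repeating their last point, so that the double sum can be flattened by \<open>div\<close> and
      \<open>mod\<close>.\<close>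
    define M where "M = Suc (\<Sum>i<n. mm i)"
    have mmM: "mm i \<le> M" if "i < n" for i
      using member_le_sum[of i "{..<n}" mm] that by (simp add: M_def)
    define q where "q = (\<lambda>i j. pp i (min j (mm i)))"
    have q: "mono (q i)" "s i \<le> q i j" "q i j \<le> t i" if "i < n" for i j
      using pm that by (auto simp: q_def mono_def)
    have Tq: "T (pp i) (mm i) \<le> T (q i) M" if "i < n" for i
    proof -
      have "T (pp i) (mm i) = T (q i) (mm i)" unfolding T_def by (rule sum.cong) (auto simp: q_def)
      also have "\<dots> \<le> T (q i) M"
        unfolding T_def by (rule sum_mono2) (use mmM[OF that] in \<open>auto intro: nonneg inX\<close>)
      finally show ?thesis .
    qed
    define S where "S = (\<lambda>k. q (k div M) (k mod M))"
    define S' where "S' = (\<lambda>k. q (k div M) (Suc (k mod M)))"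
    have M0: "M > 0" by (simp add: M_def)
    have flat: "(\<Sum>k<n*M. f (k div M) (k mod M)) = (\<Sum>i<n. \<Sum>j<M. f i j)" for f :: "nat \<Rightarrow> nat \<Rightarrow> real"
    proof -
      have "(\<Sum>k<n*M. f (k div M) (k mod M)) = (\<Sum>i<n. \<Sum>k\<in>{i*M..<i*M+M}. f (k div M) (k mod M))"
        by (simp add: sum.nat_group)
      also have "\<dots> = (\<Sum>i<n. \<Sum>j<M. f i j)"
      proof (rule sum.cong[OF refl])
        fix i
        have "(\<Sum>k\<in>{i*M..<i*M+M}. f (k div M) (k mod M)) = (\<Sum>j\<in>{0..<M}. f ((j + i*M) div M) ((j + i*M) mod M))"
          using sum.shift_bounds_nat_ivl[of "\<lambda>k. f (k div M) (k mod M)" 0 "i*M" M] by (simp add: add.commute)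
        also have "\<dots> = (\<Sum>j<M. f i j)"
          using M0 by (intro sum.cong) auto
        finally show "(\<Sum>k\<in>{i*M..<i*M+M}. f (k div M) (k mod M)) = (\<Sum>j<M. f i j)" .
      qed
      finally show ?thesis .
    qed
    have kn: "k div M < n" if "k < n * M" for k
      using that by (simp add: less_mult_imp_div_less)
    have "(\<Sum>k<n*M. d (c (S k)) (c (S' k))) < e / 2"
    proof (rule \<delta>(2); (intro allI impI)?)
      show "S k \<le> S' k" if "k < n * M" for k
        using q(1)[OF kn[OF that]] by (auto simp: S_def S'_def mono_def)
      show "S' k \<le> S l" if kl: "k < n * M" "l < n * M" "k < l" for k l
      proof (cases "k div M = l div M")
        case True
        then have "k mod M < l mod M"
          using kl(3) by (metis add_less_cancel_left div_mult_mod_eq)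
        then show ?thesis using True q(1)[OF kn[OF kl(1)]] by (auto simp: S_def S'_def mono_def Suc_le_eq)
      next
        case False
        then have "k div M < l div M" using kl(3) by (meson div_le_mono le_neq_implies_less less_imp_le)
        then have "t (k div M) \<le> s (l div M)" using st(2) kn kl by blast
        then show ?thesis using q(3)[OF kn[OF kl(1)], of "Suc (k mod M)"] q(2)[OF kn[OF kl(2)], of "l mod M"]
          by (simp add: S_def S'_def)
      qed
      have "(\<Sum>k<n*M. S' k - S k) = (\<Sum>i<n. \<Sum>j<M. q i (Suc j) - q i j)"
        unfolding S_def S'_def by (rule flat)
      also have "\<dots> = (\<Sum>i<n. q i M - q i 0)" by (simp add: sum_lessThan_telescope)
      also have "\<dots> \<le> (\<Sum>i<n. t i - s i)" using q by (intro sum_mono diff_mono) auto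
      finally show "(\<Sum>k<n*M. S' k - S k) < \<delta>" using st(3) by simp
    qed
    also have "(\<Sum>k<n*M. d (c (S k)) (c (S' k))) = (\<Sum>i<n. T (q i) M)"
      unfolding S_def S'_def T_def by (rule flat)
    finally have "(\<Sum>i<n. T (q i) M) < e / 2" .
    moreover have "(\<Sum>i<n. V (t i) - V (s i)) \<le> (\<Sum>i<n. T (q i) M + \<eta>)"
      using pm(4) Tq by (intro sum_mono) (force intro: order_trans)
    moreover have "(\<Sum>i<n. T (q i) M + \<eta>) = (\<Sum>i<n. T (q i) M) + real n * \<eta>" by (simp add: sum.distrib)
    moreover have "real n * \<eta> \<le> e / 2" using assms by (simp add: \<eta>_def field_simps)
    ultimately show ?thesis by linarith
  qed
  then show ?thesis using \<delta>(1) by blast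
qed

section \<open>The metric derivative is the derivative of the variation\<close>

text \<open>Length of the polygon inscribed at the nodes \<open>p\<close>, cut off at time
  \<open>t\<close>. It approximates \<open>V\<close> from below, yet away from the nodes it changes
  only through a single distance to \<open>c t\<close>.\<close>

definition g :: "(nat \<Rightarrow> real) \<Rightarrow> nat \<Rightarrow> real \<Rightarrow> real" where
  "g p n t = (\<Sum>i<n. d (c (min (p i) t)) (c (min (p (Suc i)) t)))"

text \<open>Clamping the nodes to \<open>[s, t]\<close> gives a partition whose length dominates the
  increment; the edge across \<open>s\<close> is handled by the triangle inequality.\<close>

lemma g_diff_le:
  assumes p: "mono p" and st: "s \<le> t"
  shows "g p n t - g p n s \<le> V t - V s"
proof -
  define q where "q = (\<lambda>i. max s (min (p i) t))"
  have q: "mono q" "s \<le> q 0" "q n \<le> t" using p st by (auto simp: q_def mono_def max_def min_def intro: order_trans)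
  have "d (c (min (p i) t)) (c (min (p (Suc i)) t)) - d (c (min (p i) s)) (c (min (p (Suc i)) s)) \<le> d (c (q i)) (c (q (Suc i)))" for i
  proof -
    have "p i \<le> p (Suc i)" using p by (simp add: mono_def)
    then consider "p (Suc i) \<le> s" | "p i \<le> s" "s < p (Suc i)" | "s < p i" by linarith
    then show ?thesis
    proof cases
      case 1 then show ?thesis using \<open>p i \<le> p (Suc i)\<close> st nonneg[OF inX inX] by (simp add: min_def)
    next
      case 2 then show ?thesis
        using st tri[of "c (p i)" "c s" "c (min (p (Suc i)) t)"] inX by (simp add: q_def)
    next
      case 3 then show ?thesis
        using \<open>p i \<le> p (Suc i)\<close> st by (simp add: q_def refl0 inX)
    qed
  qed
  then have "g p n t - g p n s \<le> T q n"
    unfolding g_def T_def sum_subtractf[symmetric] by (rule sum_mono)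
  also have "\<dots> \<le> V (q n) - V (q 0)" by (rule T_le_V[OF q(1)])
  also have "\<dots> \<le> V t - V s" using V_mono q by (intro diff_mono) (auto simp: mono_def)
  finally show ?thesis .
qed

lemma g_abs_diff_le:
  assumes st: "s \<le> t"
  shows "\<bar>g p n t - g p n s\<bar> \<le> 2 * real n * (V t - V s)"
proof -
  have m: "d (c (min x t)) (c (min x s)) \<le> V t - V s" for x
  proof -
    have "d (c (min x s)) (c (min x t)) \<le> V (min x t) - V (min x s)" using st by (intro d_le_V) auto
    also have "\<dots> \<le> V t - V s" using V_mono st by (auto simp: min_def mono_def)
    finally show ?thesis using sym inX by metis
  qed
  have "\<bar>g p n t - g p n s\<bar> \<le> (\<Sum>i<n. \<bar>d (c (min (p i) t)) (c (min (p (Suc i)) t)) - d (c (min (p i) s)) (c (min (p (Suc i)) s))\<bar>)"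
    unfolding g_def sum_subtractf[symmetric] by (rule sum_abs)
  also have "\<dots> \<le> (\<Sum>i<n. 2 * (V t - V s))"
  proof (rule sum_mono)
    fix i
    show "\<bar>d (c (min (p i) t)) (c (min (p (Suc i)) t)) - d (c (min (p i) s)) (c (min (p (Suc i)) s))\<bar> \<le> 2 * (V t - V s)"
      unfolding mult_2 by (rule order_trans[OF dist_diff_le[OF inX inX inX inX] add_mono[OF m m]])
  qed
  finally show ?thesis by (simp add: algebra_simps)
qed

lemma g_continuous: "continuous_on UNIV (g p n)"
proof (rule continuous_at_imp_continuous_on, safe)
  fix x
  have "((\<lambda>y. V y - V x) \<longlongrightarrow> 0) (at x)"
    using V_continuous by (auto simp: continuous_on_eq_continuous_at isCont_def LIM_zero_iff)
  then have "((\<lambda>y. 2 * real n * \<bar>V y - V x\<bar>) \<longlongrightarrow> 0) (at x)"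
    by (intro tendsto_mult_right_zero tendsto_rabs_zero)
  moreover have "\<forall>\<^sub>F y in at x. norm (g p n y - g p n x) \<le> 2 * real n * \<bar>V y - V x\<bar>"
  proof (rule always_eventually, rule allI)
    fix y show "norm (g p n y - g p n x) \<le> 2 * real n * \<bar>V y - V x\<bar>"
      using g_abs_diff_le[of x y p n] g_abs_diff_le[of y x p n] V_mono
      by (cases "x \<le> y") (auto simp: mono_def abs_minus_commute)
  qed
  ultimately have "((\<lambda>y. g p n y - g p n x) \<longlongrightarrow> 0) (at x)" by (rule Lim_null_comparison[rotated])
  then show "isCont (g p n) x" by (simp add: isCont_def LIM_zero_iff)
qed

text \<open>Between nodes at most one edge, indexed by \<open>J\<close>, ends at the moving point,
  and the triangle inequality bounds its change by the displacement of that point.\<close>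

lemma g_local:
  assumes p: "mono p" and t: "t \<notin> p ` {..n}"
  shows "\<exists>\<delta>>0. \<forall>h. \<bar>h\<bar> < \<delta> \<longrightarrow> \<bar>g p n (t + h) - g p n t\<bar> \<le> d (c (t + h)) (c t)"
proof -
  define \<delta> where "\<delta> = Min ((\<lambda>i. \<bar>t - p i\<bar>) ` {..n})"
  have \<delta>: "\<delta> > 0" unfolding \<delta>_def using t by (subst Min_gr_iff) auto
  have \<delta>i: "\<delta> \<le> \<bar>t - p i\<bar>" if "i \<le> n" for i unfolding \<delta>_def using that by (intro Min_le) auto
  have "\<bar>g p n (t + h) - g p n t\<bar> \<le> d (c (t + h)) (c t)" if h: "\<bar>h\<bar> < \<delta>" for h
  proof -
    define D where "D = d (c (t + h)) (c t)"
    define J where "J = {i. i < n \<and> p i < t \<and> t < p (Suc i)}"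
    have D0: "D \<ge> 0" by (simp add: D_def nonneg inX)
    have tm: "\<bar>d (c (min (p i) (t+h))) (c (min (p (Suc i)) (t+h))) - d (c (min (p i) t)) (c (min (p (Suc i)) t))\<bar>
        \<le> (if i \<in> J then D else 0)" if i: "i < n" for i
    proof -
      have pp: "p i \<le> p (Suc i)" using p by (simp add: mono_def)
      have *: "\<bar>h\<bar> < \<bar>t - p i\<bar>" "\<bar>h\<bar> < \<bar>t - p (Suc i)\<bar>" using \<delta>i[of i] \<delta>i[of "Suc i"] i h by auto
      then consider "p (Suc i) < t" | "t < p i" | "p i < t" "t < p (Suc i)" by linarith
      then show ?thesis
      proof cases
        case 1
        then have "p (Suc i) \<le> t + h" "p i \<le> t + h" "p (Suc i) \<le> t" "p i \<le> t" using * pp by linarith+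
        then show ?thesis using D0 by (simp add: min_def)
      next
        case 2
        then have "t + h < p (Suc i)" "t + h < p i" "t < p (Suc i)" "t < p i" using * pp by linarith+
        then show ?thesis using D0 by (simp add: min_def refl0 inX)
      next
        case 3
        then have "\<bar>d (c (p i)) (c (t + h)) - d (c (p i)) (c t)\<bar> \<le> D"
          using dist_diff_le[OF inX inX inX inX, of "p i" "t+h" "p i" t] by (simp add: D_def refl0 inX)
        moreover have "p i \<le> t + h" "t + h < p (Suc i)" using 3 * by linarith+
        ultimately show ?thesis using 3 i by (simp add: min_def J_def)
      qed
    qed
    have "\<bar>g p n (t + h) - g p n t\<bar> \<le> (\<Sum>i<n. \<bar>d (c (min (p i) (t+h))) (c (min (p (Suc i)) (t+h))) - d (c (min (p i) t)) (c (min (p (Suc i)) t))\<bar>)"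
      unfolding g_def sum_subtractf[symmetric] by (rule sum_abs)
    also have "\<dots> \<le> (\<Sum>i<n. if i \<in> J then D else 0)" by (rule sum_mono) (use tm in auto)
    also have "\<dots> = real (card J) * D"
      by (subst sum.inter_restrict[symmetric]) (auto simp: J_def Int_def lessThan_def)
    also have "\<dots> \<le> 1 * D"
    proof (rule mult_right_mono[OF _ D0])
      have "i = j" if "i \<in> J" "j \<in> J" for i j
      proof (rule ccontr)
        assume "i \<noteq> j"
        then consider "Suc i \<le> j" | "Suc j \<le> i" by linarith
        then show False using that p by cases (force simp: J_def mono_def)+
      qed
      moreover have "finite J" by (simp add: J_def)
      ultimately have "card J \<le> Suc 0" by (subst card_le_Suc0_iff_eq) auto
      then show "real (card J) \<le> 1" by simp
    qed
    finally show ?thesis by (simp add: D_def)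
  qed
  with \<delta> show ?thesis by blast
qed

text \<open>At a bad point \<open>V\<close> has slope \<open>D\<close>, while along arbitrarily
  short intervals \<open>c\<close>, and with it \<open>g\<close>, moves at a rate below
  \<open>D - e\<close>; there \<open>V - g\<close> has slope at least \<open>e / 2\<close>. But
  \<open>V - g\<close> is monotone with total increase below \<open>\<eta>\<close>, so
  \<open>steep_cover\<close> leaves little room for such points.\<close>

lemma bad_negligible:
  assumes e: "e > 0"
  shows "negligible {t\<in>{a<..<b}. \<exists>D. (V has_real_derivative D) (at t) \<and>
    (\<forall>\<delta>>0. \<exists>h. h \<noteq> 0 \<and> \<bar>h\<bar> < \<delta> \<and> d (c (t + h)) (c t) < (D - e) * \<bar>h\<bar>)}" (is "negligible ?B")
proof (subst negligible_outer, intro allI impI)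
  fix \<epsilon> :: real assume \<epsilon>: "\<epsilon> > 0"
  \<comment> \<open>\<open>steep_cover\<close> will give
    \<open>e / 2 * measure lebesgue U \<le> \<eta>\<close>, that is, measure at most
    \<open>\<epsilon> / 2\<close>.\<close>
  define \<eta> where "\<eta> = e * \<epsilon> / 4"
  have \<eta>: "\<eta> > 0" using e \<epsilon> by (simp add: \<eta>_def)
  have Va: "V a = 0"
  proof (rule antisym)
    show "V a \<le> 0"
    proof (rule V_least)
      fix p :: "nat \<Rightarrow> real" and n assume "\<And>i. p i \<le> a"
      then have "c (p i) = c a" for i by (rule below)
      then show "T p n \<le> 0" by (simp add: T_def refl0 inX)
    qed
    show "0 \<le> V a" using V_upper[of "\<lambda>_. a" a 0] by (simp add: T_def mono_def)
  qed
  obtain p n where p: "mono p" "\<And>i. p i \<le> b" "V b - \<eta> < T p n"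
  proof -
    have "V b - \<eta> < V b" using \<eta> by simp
    then obtain x where "x \<in> {T p n | p n. mono p \<and> (\<forall>i. p i \<le> b)}" "V b - \<eta> < x"
      unfolding V_def[of b] using less_cSupD[OF V_ne] by blast
    then show ?thesis using that by blast
  qed
  define F where "F = (\<lambda>t. V t - g p n t)"
  have F: "mono F" "continuous_on UNIV F"
  proof -
    show "mono F" unfolding F_def
    proof (rule monoI)
      fix x y :: real assume "x \<le> y"
      then show "V x - g p n x \<le> V y - g p n y" using g_diff_le[OF p(1), of x y n] by linarith
    qed
    show "continuous_on UNIV F"
      unfolding F_def by (intro continuous_on_diff V_continuous g_continuous)
  qed
  have gb: "g p n b = T p n" using p(2) by (simp add: g_def T_def)
  have ga: "g p n a = 0" using below[of "min _ a"] by (simp add: g_def refl0 inX)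
  have Fab: "F b - F a < \<eta>" using Va gb ga p(3) by (simp add: F_def)
  have "emeasure (interval_measure F) {a<..<b} \<le> emeasure (interval_measure F) {a..b}"
    by (intro emeasure_mono) auto
  also have "\<dots> = ennreal (F b - F a)" by (rule emeasure_interval_measure_cont[OF F ab])
  also have "\<dots> \<le> ennreal \<eta>" using Fab by (intro ennreal_leI) auto
  finally have em: "emeasure (interval_measure F) {a<..<b} \<le> ennreal \<eta>" .
  define S where "S = ?B - p ` {..n}"
  have steep: "\<exists>u v. u \<le> t \<and> t \<le> v \<and> u < v \<and> v - u < \<delta> \<and> e / 2 * (v - u) \<le> F v - F u"
    if t: "t \<in> S" and \<delta>: "\<delta> > 0" for t \<delta>
  proof -
    obtain D where D: "(V has_real_derivative D) (at t)"
      "\<And>\<delta>. \<delta> > 0 \<Longrightarrow> \<exists>h. h \<noteq> 0 \<and> \<bar>h\<bar> < \<delta> \<and> d (c (t + h)) (c t) < (D - e) * \<bar>h\<bar>"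
      using t unfolding S_def by blast
    obtain \<delta>1 where \<delta>1: "\<delta>1 > 0" "\<And>h. h \<noteq> 0 \<Longrightarrow> \<bar>h\<bar> < \<delta>1 \<Longrightarrow> \<bar>(V (t + h) - V t) / h - D\<bar> < e / 2"
      using DERIV_eps[OF D(1) half_gt_zero[OF e]] by blast
    obtain \<delta>2 where \<delta>2: "\<delta>2 > 0" "\<And>h. \<bar>h\<bar> < \<delta>2 \<Longrightarrow> \<bar>g p n (t + h) - g p n t\<bar> \<le> d (c (t + h)) (c t)"
      using g_local[OF p(1), of t n] t unfolding S_def by blast
    obtain h where h: "h \<noteq> 0" "\<bar>h\<bar> < min \<delta> (min \<delta>1 \<delta>2)" "d (c (t + h)) (c t) < (D - e) * \<bar>h\<bar>"
      using D(2)[of "min \<delta> (min \<delta>1 \<delta>2)"] \<delta> \<delta>1 \<delta>2 by auto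
    have g: "\<bar>g p n (t + h) - g p n t\<bar> < (D - e) * \<bar>h\<bar>" using \<delta>2(2)[of h] h by auto
    have V: "D - e / 2 < (V (t + h) - V t) / h" 
    proof -
      have "\<bar>(V (t + h) - V t) / h - D\<bar> < e / 2" using \<delta>1(2)[of h] h by auto
      then show ?thesis by linarith
    qed
    show ?thesis
    proof (cases "h > 0")
      case True
      then have "V (t + h) - V t > (D - e / 2) * h" using V by (simp add: pos_less_divide_eq)
      then have "e / 2 * h \<le> F (t + h) - F t" using g True by (simp add: F_def algebra_simps abs_less_iff)
      then show ?thesis using True h by (intro exI[of _ t] exI[of _ "t + h"]) auto
    next
      case False
      then have h0: "h < 0" using h by simp
      then have "V t - V (t + h) > (D - e / 2) * (- h)" using V by (simp add: neg_less_divide_eq)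
      then have "e / 2 * (- h) \<le> F t - F (t + h)" using g h0 by (simp add: F_def algebra_simps abs_less_iff)
      then show ?thesis using h0 h by (intro exI[of _ "t + h"] exI[of _ t]) auto
    qed
  qed
  have "\<exists>U\<in>lmeasurable. S \<subseteq> U \<and> e / 2 * measure lebesgue U \<le> \<eta>"
    by (rule steep_cover[OF F open_greaterThanLessThan _ _ em _ steep]) (use \<eta> e in \<open>auto simp: S_def\<close>)
  then obtain U where U: "U \<in> lmeasurable" "S \<subseteq> U" "e / 2 * measure lebesgue U \<le> \<eta>" by blast
  have fin: "negligible (p ` {..n})" by (rule negligible_finite) auto
  have "e / 2 * measure lebesgue U < e / 2 * \<epsilon>" 
  proof -
    have "e / 2 * \<epsilon> = 2 * \<eta>" by (simp add: \<eta>_def)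
    then show ?thesis using U(3) \<eta> by linarith
  qed
  then have "measure lebesgue U < \<epsilon>" using e by simp
  then show "\<exists>T. ?B \<subseteq> T \<and> T \<in> lmeasurable \<and> measure lebesgue T < \<epsilon>"
    using lmeasurable_Un_negligible[OF U(1) fin] U(2) by (intro exI[of _ "U \<union> p ` {..n}"]) (auto simp: S_def)
qed

text \<open>Difference quotients of \<open>c\<close> never exceed those of \<open>V\<close>, and
  \<open>bad_negligible\<close> for \<open>e = 1 / Suc m\<close> rules out, off a null set, that
  they fall short by a fixed amount at arbitrarily small scales. So both have the same
  limit.\<close>

theorem metric_derivative_ae:
  "\<exists>N. negligible N \<and> (\<forall>t\<in>{a<..<b} - N. \<exists>D. (V has_real_derivative D) (at t) \<and>
      ((\<lambda>h. d (c (t + h)) (c t) / \<bar>h\<bar>) \<longlongrightarrow> D) (at 0))"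
proof -
  define B where "B = (\<lambda>e. {t\<in>{a<..<b}. \<exists>D. (V has_real_derivative D) (at t) \<and>
    (\<forall>\<delta>>0. \<exists>h. h \<noteq> 0 \<and> \<bar>h\<bar> < \<delta> \<and> d (c (t + h)) (c t) < (D - e) * \<bar>h\<bar>)})"
  define N where "N = {x. \<not> V differentiable (at x)} \<union> (\<Union>m::nat. B (1 / Suc m))"
  have "negligible (\<Union>(range (\<lambda>m::nat. B (1 / Suc m))))"
    by (rule negligible_countable_Union) (auto simp: B_def simp del: greaterThanLessThan_iff of_nat_Suc intro!: bad_negligible)
  then have "negligible N"
    unfolding N_def using mono_continuous_differentiable_ae[OF V_mono V_continuous] by (intro negligible_Un) auto
  moreover have "\<exists>D. (V has_real_derivative D) (at t) \<and>
      ((\<lambda>h. d (c (t + h)) (c t) / \<bar>h\<bar>) \<longlongrightarrow> D) (at 0)" if t: "t \<in> {a<..<b} - N" for t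
  proof -
    obtain D where D: "(V has_real_derivative D) (at t)"
      using t by (auto simp: N_def real_differentiable_def)
    have "((\<lambda>h. d (c (t + h)) (c t) / \<bar>h\<bar>) \<longlongrightarrow> D) (at 0)"
      unfolding LIM_eq
    proof (intro allI impI)
      fix e :: real assume e: "e > 0"
      obtain m :: nat where m: "1 / Suc m < e" using e nat_approx_posE by metis
      have "t \<notin> B (1 / Suc m)" using t by (auto simp: N_def)
      then have "\<not> (\<forall>\<delta>>0. \<exists>h. h \<noteq> 0 \<and> \<bar>h\<bar> < \<delta> \<and> d (c (t + h)) (c t) < (D - 1 / Suc m) * \<bar>h\<bar>)"
        using t D unfolding B_def by blast
      then obtain \<delta>1 where \<delta>1: "\<delta>1 > 0" "\<And>h. h \<noteq> 0 \<Longrightarrow> \<bar>h\<bar> < \<delta>1 \<Longrightarrow> (D - 1 / Suc m) * \<bar>h\<bar> \<le> d (c (t + h)) (c t)"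
        by (meson not_le)
      obtain \<delta>2 where \<delta>2: "\<delta>2 > 0" "\<And>h. h \<noteq> 0 \<Longrightarrow> \<bar>h\<bar> < \<delta>2 \<Longrightarrow> \<bar>(V (t + h) - V t) / h - D\<bar> < e"
        using DERIV_eps[OF D(1) e] by blast
      have "\<bar>d (c (t + h)) (c t) / \<bar>h\<bar> - D\<bar> < e" if h: "h \<noteq> 0" "\<bar>h\<bar> < min \<delta>1 \<delta>2" for h
      proof -
        have "D - 1 / Suc m \<le> d (c (t + h)) (c t) / \<bar>h\<bar>"
          using \<delta>1(2)[of h] h by (subst pos_le_divide_eq) auto
        moreover have "d (c (t + h)) (c t) / \<bar>h\<bar> \<le> (V (t + h) - V t) / h"
        proof (cases "h > 0")
          case True
          then show ?thesis using d_le_V[of t "t + h"] sym[OF inX inX] by (simp add: divide_right_mono)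
        next
          case False
          then have "d (c (t + h)) (c t) / \<bar>h\<bar> \<le> (V t - V (t + h)) / (- h)"
            using h d_le_V[of "t + h" t] by (simp add: divide_right_mono del: divide_minus_right minus_divide_right)
          also have "\<dots> = (V (t + h) - V t) / h" using h by (simp add: field_simps)
          finally show ?thesis .
        qed
        ultimately show ?thesis using \<delta>2(2)[of h] h m by auto
      qed
      then show "\<exists>s>0. \<forall>x. x \<noteq> 0 \<and> norm (x - 0) < s \<longrightarrow> norm (d (c (t + x)) (c t) / \<bar>x\<bar> - D) < e"
        using \<delta>1(1) \<delta>2(1) by (intro exI[of _ "min \<delta>1 \<delta>2"]) auto
    qed
    with D show ?thesis by blast
  qed
  ultimately show ?thesis by blast
qed

end

section \<open>Absolutely continuous curves on compact intervals\<close>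

lemma metric_ac_subinterval:
  "metric_ac D a b c \<Longrightarrow> a \<le> a' \<Longrightarrow> b' \<le> b \<Longrightarrow> metric_ac D a' b' c"
proof (subst metric_ac_def, intro allI impI)
  fix e :: real assume ac: "metric_ac D a b c" and ab: "a \<le> a'" "b' \<le> b" and e: "e > 0"
  obtain \<delta> where \<delta>: "\<delta> > 0" "\<forall>(n::nat) s t. (\<forall>i<n. a \<le> s i \<and> s i \<le> t i \<and> t i \<le> b) \<and> (\<forall>i<n. \<forall>j<n. i < j \<longrightarrow> t i \<le> s j) \<and>
      (\<Sum>i<n. t i - s i) < \<delta> \<longrightarrow> (\<Sum>i<n. D (c (s i)) (c (t i))) < e"
    using ac e unfolding metric_ac_def by blast
  show "\<exists>\<delta>>0. \<forall>(n::nat) s t. (\<forall>i<n. a' \<le> s i \<and> s i \<le> t i \<and> t i \<le> b') \<and> (\<forall>i<n. \<forall>j<n. i < j \<longrightarrow> t i \<le> s j) \<and>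
      (\<Sum>i<n. t i - s i) < \<delta> \<longrightarrow> (\<Sum>i<n. D (c (s i)) (c (t i))) < e"
  proof (intro exI[of _ \<delta>] conjI allI impI \<delta>(1))
    fix n :: nat and s t :: "nat \<Rightarrow> real"
    assume *: "(\<forall>i<n. a' \<le> s i \<and> s i \<le> t i \<and> t i \<le> b') \<and> (\<forall>i<n. \<forall>j<n. i < j \<longrightarrow> t i \<le> s j) \<and>
      (\<Sum>i<n. t i - s i) < \<delta>"
    then have "\<forall>i<n. a \<le> s i \<and> s i \<le> t i \<and> t i \<le> b" using ab by force
    with * \<delta>(2) show "(\<Sum>i<n. D (c (s i)) (c (t i))) < e" by blast
  qed
qed

lemma metric_acE:
  assumes "metric_ac D a b c" "e > 0"
  obtains \<delta> where "\<delta> > 0" "\<And>(n::nat) s t. (\<forall>i<n. a \<le> s i \<and> s i \<le> t i \<and> t i \<le> b) \<Longrightarrow>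
    (\<forall>i<n. \<forall>j<n. i < j \<longrightarrow> t i \<le> s j) \<Longrightarrow> (\<Sum>i<n. t i - s i) < \<delta> \<Longrightarrow> (\<Sum>i<n. D (c (s i)) (c (t i))) < e"
proof -
  obtain \<delta> where \<delta>: "\<delta> > 0" "\<forall>(n::nat) s t. (\<forall>i<n. a \<le> s i \<and> s i \<le> t i \<and> t i \<le> b) \<and> (\<forall>i<n. \<forall>j<n. i < j \<longrightarrow> t i \<le> s j) \<and>
      (\<Sum>i<n. t i - s i) < \<delta> \<longrightarrow> (\<Sum>i<n. D (c (s i)) (c (t i))) < e"
    using assms unfolding metric_ac_def by blast
  show thesis
    using \<delta> that by blast
qed

text \<open>One domination principle serves for Lipschitz images, sums and components; where a
  single curve dominates, it is supplied twice.\<close>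

lemma metric_ac_comparison:
  assumes 1: "metric_ac D1 a b c1" and 2: "metric_ac D2 a b c2" and k: "k > 0"
    and le: "\<And>s t. a \<le> s \<Longrightarrow> s \<le> t \<Longrightarrow> t \<le> b \<Longrightarrow> D (c s) (c t) \<le> k * (D1 (c1 s) (c1 t) + D2 (c2 s) (c2 t))"
  shows "metric_ac D a b c"
  unfolding metric_ac_def
proof (intro allI impI)
  fix e :: real assume e: "e > 0"
  have e': "e / (2 * k) > 0" using e k by simp
  obtain \<delta>1 where \<delta>1: "\<delta>1 > 0" "\<And>(n::nat) s t. (\<forall>i<n. a \<le> s i \<and> s i \<le> t i \<and> t i \<le> b) \<Longrightarrow>
    (\<forall>i<n. \<forall>j<n. i < j \<longrightarrow> t i \<le> s j) \<Longrightarrow> (\<Sum>i<n. t i - s i) < \<delta>1 \<Longrightarrow> (\<Sum>i<n. D1 (c1 (s i)) (c1 (t i))) < e / (2 * k)"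
    using metric_acE[OF 1 e'] by blast
  obtain \<delta>2 where \<delta>2: "\<delta>2 > 0" "\<And>(n::nat) s t. (\<forall>i<n. a \<le> s i \<and> s i \<le> t i \<and> t i \<le> b) \<Longrightarrow>
    (\<forall>i<n. \<forall>j<n. i < j \<longrightarrow> t i \<le> s j) \<Longrightarrow> (\<Sum>i<n. t i - s i) < \<delta>2 \<Longrightarrow> (\<Sum>i<n. D2 (c2 (s i)) (c2 (t i))) < e / (2 * k)"
    using metric_acE[OF 2 e'] by blast
  show "\<exists>\<delta>>0. \<forall>(n::nat) s t. (\<forall>i<n. a \<le> s i \<and> s i \<le> t i \<and> t i \<le> b) \<and> (\<forall>i<n. \<forall>j<n. i < j \<longrightarrow> t i \<le> s j) \<and>
      (\<Sum>i<n. t i - s i) < \<delta> \<longrightarrow> (\<Sum>i<n. D (c (s i)) (c (t i))) < e"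
  proof (intro exI[of _ "min \<delta>1 \<delta>2"] conjI allI impI; (elim conjE)?)
    fix n :: nat and s t :: "nat \<Rightarrow> real"
    assume st: "\<forall>i<n. a \<le> s i \<and> s i \<le> t i \<and> t i \<le> b" "\<forall>i<n. \<forall>j<n. i < j \<longrightarrow> t i \<le> s j" "(\<Sum>i<n. t i - s i) < min \<delta>1 \<delta>2"
    have "(\<Sum>i<n. D (c (s i)) (c (t i))) \<le> (\<Sum>i<n. k * (D1 (c1 (s i)) (c1 (t i)) + D2 (c2 (s i)) (c2 (t i))))"
      using st by (intro sum_mono le) auto
    also have "\<dots> = k * ((\<Sum>i<n. D1 (c1 (s i)) (c1 (t i))) + (\<Sum>i<n. D2 (c2 (s i)) (c2 (t i))))"
      by (simp add: sum_distrib_left[symmetric] sum.distrib)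
    also have "\<dots> < k * (e / (2 * k) + e / (2 * k))"
      using st by (intro mult_strict_left_mono k add_strict_mono \<delta>1(2) \<delta>2(2)) auto
    also have "\<dots> = e" using k by simp
    finally show "(\<Sum>i<n. D (c (s i)) (c (t i))) < e" .
  qed (use \<delta>1 \<delta>2 in auto)
qed

text \<open>Composition with this clamping map extends a curve from \<open>[a, b]\<close> to the
  line by constants, as \<open>ac_line\<close> demands.\<close>

definition cl :: "real \<Rightarrow> real \<Rightarrow> real \<Rightarrow> real" where "cl a b t = max a (min b t)"

lemma cl_in: "a \<le> b \<Longrightarrow> cl a b t \<in> {a..b}"
  and cl_mono: "s \<le> t \<Longrightarrow> cl a b s \<le> cl a b t"
  and cl_id: "t \<in> {a..b} \<Longrightarrow> cl a b t = t"
  by (auto simp: cl_def)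

lemma cl_lip: "s \<le> t \<Longrightarrow> cl a b t - cl a b s \<le> t - s"
  by (auto simp: cl_def max_def min_def)

lemma cl_continuous: "continuous_on S (cl a b)"
  unfolding cl_def by (intro continuous_intros)

lemma mono_cl:
  fixes F :: "real \<Rightarrow> real"
  assumes "a \<le> b" "\<And>s t. a \<le> s \<Longrightarrow> s \<le> t \<Longrightarrow> t \<le> b \<Longrightarrow> F s \<le> F t"
  shows "mono (\<lambda>t. F (cl a b t))"
  using assms cl_in[OF assms(1)] cl_mono by (auto simp: mono_def)

lemma continuous_cl:
  fixes F :: "real \<Rightarrow> real"
  assumes "a \<le> b" "continuous_on {a..b} F"
  shows "continuous_on UNIV (\<lambda>t. F (cl a b t))"
  by (rule continuous_on_compose2[OF assms(2) cl_continuous]) (use cl_in[OF assms(1)] in auto)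

lemma eventually_cl:
  assumes "t \<in> {a<..<b}"
  shows "\<forall>\<^sub>F h in at 0. cl a b (t + h) = t + h"
proof -
  have "((\<lambda>h. t + h) \<longlongrightarrow> t + 0) (at 0)" by (intro tendsto_intros)
  then have "\<forall>\<^sub>F h in at 0. t + h \<in> {a<..<b}"
    using assms by (intro topological_tendstoD) auto
  then show ?thesis by (rule eventually_mono) (auto simp: cl_def)
qed

context metric_carrier begin

lemma ac_line_cl:
  assumes "a \<le> b" "metric_ac d a b c" "c ` {a..b} \<subseteq> X"
  shows "ac_line X d (\<lambda>t. c (cl a b t)) a b"
proof
  show "a \<le> b" by fact
  show "t \<le> a \<Longrightarrow> c (cl a b t) = c (cl a b a)" "b \<le> t \<Longrightarrow> c (cl a b t) = c (cl a b b)" for t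
    using assms(1) by (auto simp: cl_def)
  show "c (cl a b t) \<in> X" for t using cl_in[OF assms(1)] assms(3) by blast
  fix e :: real assume e: "e > 0"
  show "\<exists>\<delta>>0. \<forall>(n::nat) s t. (\<forall>i<n. s i \<le> t i) \<and> (\<forall>i<n. \<forall>j<n. i < j \<longrightarrow> t i \<le> s j) \<and>
        (\<Sum>i<n. t i - s i) < \<delta> \<longrightarrow> (\<Sum>i<n. d (c (cl a b (s i))) (c (cl a b (t i)))) < e"
  proof (rule metric_acE[OF assms(2) e])
    fix \<delta> :: real assume \<delta>: "\<delta> > 0" "\<And>(n::nat) s t. (\<forall>i<n. a \<le> s i \<and> s i \<le> t i \<and> t i \<le> b) \<Longrightarrow>
    (\<forall>i<n. \<forall>j<n. i < j \<longrightarrow> t i \<le> s j) \<Longrightarrow> (\<Sum>i<n. t i - s i) < \<delta> \<Longrightarrow> (\<Sum>i<n. d (c (s i)) (c (t i))) < e"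
    have "(\<Sum>i<n. d (c (cl a b (s i))) (c (cl a b (t i)))) < e"
      if st: "\<forall>i<n. s i \<le> t i" "\<forall>i<n. \<forall>j<n. i < j \<longrightarrow> t i \<le> s j" "(\<Sum>i<n. t i - s i) < \<delta>" for n :: nat and s t
    proof (rule \<delta>(2))
      have "(\<Sum>i<n. cl a b (t i) - cl a b (s i)) \<le> (\<Sum>i<n. t i - s i)"
        using st by (intro sum_mono cl_lip) auto
      then show "(\<Sum>i<n. cl a b (t i) - cl a b (s i)) < \<delta>" using st by simp
    qed (use st cl_in[OF assms(1)] cl_mono in auto)
    then show ?thesis using \<delta>(1) by blast
  qed
qed

text \<open>\<open>metric_deriv\<close> has some value even where no limit exists; the last
  conclusion certifies that off \<open>N\<close> it is a genuine limit, so that estimates of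
  difference quotients pass to it.\<close>

theorem ac_curve_variation:
  assumes "a < b" "metric_ac d a b c" "c ` {a..b} \<subseteq> X"
  obtains V N where "mono V" "continuous_on UNIV V" "metric_ac dist a b V"
    "\<forall>s t. s \<le> t \<longrightarrow> d (c (cl a b s)) (c (cl a b t)) \<le> V t - V s"
    "negligible N"
    "\<forall>t\<in>{a<..<b} - N. (V has_real_derivative metric_deriv d c t) (at t)"
    "\<forall>t\<in>{a<..<b} - N. ((\<lambda>h. d (c (t + h)) (c t) / \<bar>h\<bar>) \<longlongrightarrow> metric_deriv d c t) (at 0)"
proof -
  interpret L: ac_line X d "\<lambda>t. c (cl a b t)" a b
    using assms by (intro ac_line_cl) auto
  obtain N where N: "negligible N" "\<And>t. t \<in> {a<..<b} - N \<Longrightarrow> \<exists>D. (L.V has_real_derivative D) (at t) \<and>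
      ((\<lambda>h. d (c (cl a b (t + h))) (c (cl a b t)) / \<bar>h\<bar>) \<longlongrightarrow> D) (at 0)"
    using L.metric_derivative_ae by blast
  have *: "\<exists>D. (L.V has_real_derivative D) (at t) \<and> ((\<lambda>h. d (c (t + h)) (c t) / \<bar>h\<bar>) \<longlongrightarrow> D) (at 0) \<and> metric_deriv d c t = D"
    if t: "t \<in> {a<..<b} - N" for t
  proof -
    obtain D where D: "(L.V has_real_derivative D) (at t)"
      "((\<lambda>h. d (c (cl a b (t + h))) (c (cl a b t)) / \<bar>h\<bar>) \<longlongrightarrow> D) (at 0)" using N t by blast
    have ev: "\<forall>\<^sub>F h in at 0. d (c (cl a b (t + h))) (c (cl a b t)) / \<bar>h\<bar> = d (c (t + h)) (c t) / \<bar>h\<bar>"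
      using eventually_cl[of t a b] t by (auto elim!: eventually_mono simp: cl_id)
    have "((\<lambda>h. d (c (t + h)) (c t) / \<bar>h\<bar>) \<longlongrightarrow> D) (at 0)"
      using D(2) tendsto_cong[OF ev] by blast
    then show ?thesis using D(1) tendsto_Lim[of "at (0::real)"] unfolding metric_deriv_def by auto
  qed
  have "metric_ac dist a b L.V"
    unfolding metric_ac_def
  proof (intro allI impI)
    fix e :: real assume "e > 0"
    from L.V_ac[OF this] obtain \<delta> where \<delta>: "\<delta> > 0" "\<And>(n::nat) s t. (\<forall>i<n. s i \<le> t i) \<Longrightarrow> (\<forall>i<n. \<forall>j<n. i < j \<longrightarrow> t i \<le> s j) \<Longrightarrow>
        (\<Sum>i<n. t i - s i) < \<delta> \<Longrightarrow> (\<Sum>i<n. L.V (t i) - L.V (s i)) < e" by blast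
    have "(\<Sum>i<n. dist (L.V (s i)) (L.V (t i))) < e"
      if st: "\<forall>i<n. s i \<le> t i" "\<forall>i<n. \<forall>j<n. i < j \<longrightarrow> t i \<le> s j" "(\<Sum>i<n. t i - s i) < \<delta>" for n :: nat and s t
    proof -
      have "(\<Sum>i<n. dist (L.V (s i)) (L.V (t i))) = (\<Sum>i<n. L.V (t i) - L.V (s i))"
        using st L.V_mono by (intro sum.cong) (auto simp: dist_real_def mono_def)
      then show ?thesis using \<delta>(2)[OF st] by simp
    qed
    then show "\<exists>\<delta>>0. \<forall>(n::nat) s t. (\<forall>i<n. a \<le> s i \<and> s i \<le> t i \<and> t i \<le> b) \<and> (\<forall>i<n. \<forall>j<n. i < j \<longrightarrow> t i \<le> s j) \<and>
      (\<Sum>i<n. t i - s i) < \<delta> \<longrightarrow> (\<Sum>i<n. dist (L.V (s i)) (L.V (t i))) < e"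
      by (intro exI[of _ \<delta>] conjI \<delta>(1) allI impI) auto
  qed
  moreover have "(L.V has_real_derivative metric_deriv d c t) (at t)"
    "((\<lambda>h. d (c (t + h)) (c t) / \<bar>h\<bar>) \<longlongrightarrow> metric_deriv d c t) (at 0)" if "t \<in> {a<..<b} - N" for t
    using *[OF that] by auto
  ultimately show ?thesis
    using L.d_le_V by (intro that[OF L.V_mono L.V_continuous _ _ N(1)]) auto
qed

text \<open>Since \<open>u\<close> changes no faster than \<open>c\<close> moves, its difference
  quotients are bounded by those defining the metric derivative, and the bound passes to the
  limit.\<close>

lemma deriv_le_metric_deriv:
  assumes t: "t \<in> {a<..<b}" and le: "\<And>s. s \<in> {a..b} \<Longrightarrow> \<bar>u s - u t\<bar> \<le> d (c s) (c t)"
    and D: "(u has_real_derivative D) (at t)" and l: "((\<lambda>h. d (c (t + h)) (c t) / \<bar>h\<bar>) \<longlongrightarrow> l) (at 0)"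
  shows "\<bar>D\<bar> \<le> l"
proof (rule tendsto_le[OF _ l])
  show "((\<lambda>h. \<bar>(u (t + h) - u t) / h\<bar>) \<longlongrightarrow> \<bar>D\<bar>) (at 0)"
    using D unfolding DERIV_def by (intro tendsto_intros)
  show "\<forall>\<^sub>F h in at 0. \<bar>(u (t + h) - u t) / h\<bar> \<le> d (c (t + h)) (c t) / \<bar>h\<bar>"
    using eventually_cl[OF t]
  proof (rule eventually_mono)
    fix h assume "cl a b (t + h) = t + h"
    then have "t + h \<in> {a..b}" using cl_in[of a b "t+h"] t by auto
    then show "\<bar>(u (t + h) - u t) / h\<bar> \<le> d (c (t + h)) (c t) / \<bar>h\<bar>"
      using le by (simp add: divide_right_mono abs_divide)
  qed
qed auto

end

section \<open>Absolutely continuous real functions: differentiability and monotonicity\<close>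

interpretation real_metric: metric_carrier "UNIV :: real set" dist
  by unfold_locales (auto simp: dist_commute dist_triangle)

text \<open>Jordan decomposition: after clamping, \<open>\<psi>\<close> is the difference of the
  continuous monotone functions \<open>\<psi> + V\<close> and \<open>V\<close>, both differentiable
  almost everywhere.\<close>

lemma ac_real_differentiable:
  fixes \<psi> :: "real \<Rightarrow> real"
  assumes "a < b" "metric_ac dist a b \<psi>"
  obtains N where "negligible N" "\<forall>t\<in>{a<..<b} - N. \<psi> differentiable (at t)"
proof -
  obtain V N where V: "mono V" "continuous_on UNIV V" and "metric_ac dist a b V"
    and V3': "\<forall>s t. s \<le> t \<longrightarrow> dist (\<psi> (cl a b s)) (\<psi> (cl a b t)) \<le> V t - V s"
    and N: "negligible N"
    and VD: "\<forall>t\<in>{a<..<b} - N. (V has_real_derivative metric_deriv dist \<psi> t) (at t)"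
    by (rule real_metric.ac_curve_variation[OF assms subset_UNIV]) (rule that)
  from V3' have V3: "dist (\<psi> (cl a b s)) (\<psi> (cl a b t)) \<le> V t - V s" if "s \<le> t" for s t
    using that by blast
  define F where "F = (\<lambda>t. \<psi> (cl a b t) + V t)"
  have le: "\<bar>\<psi> (cl a b s) - \<psi> (cl a b t)\<bar> \<le> \<bar>V s - V t\<bar>" for s t
    using V3[of s t] V3[of t s] by (cases "s \<le> t") (auto simp: dist_real_def)
  have "mono F" unfolding F_def
  proof (rule monoI)
    fix s t :: real assume "s \<le> t"
    then show "\<psi> (cl a b s) + V s \<le> \<psi> (cl a b t) + V t"
      using V3[of s t] by (auto simp: dist_real_def)
  qed
  moreover have "continuous_on UNIV (\<lambda>t. \<psi> (cl a b t))"
  proof (rule continuous_at_imp_continuous_on, safe)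
    fix x
    have "((\<lambda>y. \<bar>V y - V x\<bar>) \<longlongrightarrow> 0) (at x)"
      using V(2) by (auto simp: continuous_on_eq_continuous_at isCont_def LIM_zero_iff intro!: tendsto_rabs_zero)
    then have "((\<lambda>y. \<psi> (cl a b y) - \<psi> (cl a b x)) \<longlongrightarrow> 0) (at x)"
      by (rule Lim_null_comparison[rotated]) (use le in \<open>auto intro!: always_eventually\<close>)
    then show "isCont (\<lambda>t. \<psi> (cl a b t)) x" by (simp add: isCont_def LIM_zero_iff)
  qed
  then have "continuous_on UNIV F" unfolding F_def by (intro continuous_intros V(2))
  ultimately have neg: "negligible {x. \<not> F differentiable (at x)}"
    by (rule mono_continuous_differentiable_ae)
  show ?thesis
  proof (rule that)
    show "negligible (N \<union> {x. \<not> F differentiable (at x)})" using N neg by (rule negligible_Un)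
    show "\<forall>t\<in>{a<..<b} - (N \<union> {x. \<not> F differentiable (at x)}). \<psi> differentiable (at t)"
    proof
    fix t assume t: "t \<in> {a<..<b} - (N \<union> {x. \<not> F differentiable (at x)})"
    then have "(\<lambda>t. F t - V t) differentiable (at t)"
      using VD by (intro differentiable_diff) (auto simp: real_differentiable_def)
    then obtain D where "((\<lambda>t. F t - V t) has_real_derivative D) (at t)" by (auto simp: real_differentiable_def)
    then have "(\<psi> has_real_derivative D) (at t)"
    proof (rule has_field_derivative_transform_within_open[of _ _ _ "{a<..<b}"])
      show "F x - V x = \<psi> x" if "x \<in> {a<..<b}" for x using that by (simp add: F_def cl_id)
    qed (use t in auto)
    then show "\<psi> differentiable (at t)" by (auto simp: real_differentiable_def)
    qed
  qed
qed

text \<open>Bisection instead of integration. Around a point with nonnegative derivative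
  \<open>\<psi>\<close> drops at rate at most \<open>e\<close>. Intervals around the remaining
  points are recorded; their total length is charged to an open set \<open>U\<close> of measure
  below \<open>\<delta>\<close>, so absolute continuity bounds the drop over all of them by
  \<open>e0 / 2\<close>.\<close>

theorem ac_deriv_nonneg:
  fixes \<psi> :: "real \<Rightarrow> real"
  assumes ab: "a \<le> b" and ac: "metric_ac dist a b \<psi>" and N: "negligible N"
    and D: "\<And>t. t \<in> {a<..<b} - N \<Longrightarrow> \<exists>D\<ge>0. (\<psi> has_real_derivative D) (at t)"
  shows "\<psi> a \<le> \<psi> b"
proof (rule field_le_epsilon)
  fix e0 :: real assume e0: "e0 > 0"
  define e where "e = e0 / (2 * (b - a + 1))"
  have e: "e > 0" "e * (b - a) \<le> e0 / 2" using e0 ab by (auto simp: e_def field_simps)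
  obtain \<delta> where \<delta>: "\<delta> > 0" "\<And>(n::nat) s t. (\<forall>i<n. a \<le> s i \<and> s i \<le> t i \<and> t i \<le> b) \<Longrightarrow>
    (\<forall>i<n. \<forall>j<n. i < j \<longrightarrow> t i \<le> s j) \<Longrightarrow> (\<Sum>i<n. t i - s i) < \<delta> \<Longrightarrow> (\<Sum>i<n. dist (\<psi> (s i)) (\<psi> (t i))) < e0 / 2"
    using metric_acE[OF ac half_gt_zero[OF e0]] by blast
  \<comment> \<open>The endpoints join the exceptional set, because the derivative is known only in
    the open interval.\<close>
  have "negligible (N \<union> {a, b})" by (rule negligible_Un[OF N negligible_finite]) simp
  then obtain U0 where U0: "N \<union> {a, b} \<subseteq> U0" "U0 \<in> lmeasurable" "measure lebesgue U0 < \<delta> / 2"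
    using half_gt_zero[OF \<delta>(1)] unfolding negligible_outer by metis
  obtain U where U: "open U" "U0 \<subseteq> U" "U \<in> lmeasurable" "measure lebesgue U < measure lebesgue U0 + \<delta> / 2"
    using lmeasurable_outer_open[OF U0(2) half_gt_zero[OF \<delta>(1)]] by metis
  define \<Lambda> where "\<Lambda> = (\<lambda>u v. measure lebesgue (U \<inter> {u<..v}))"
  have Um: "U \<inter> {u<..v} \<in> lmeasurable" for u v by (rule fmeasurable_Int_fmeasurable[OF U(3)]) auto
  \<comment> \<open>\<open>P u v\<close> carries the recorded intervals along. Their length is
    charged to the part of \<open>U\<close> in \<open>(u, v]\<close>, half open so that the charges
    add up exactly when two intervals are joined.\<close>
  define P where "P = (\<lambda>u v. a \<le> u \<and> v \<le> b \<longrightarrow> (\<exists>(n::nat) s t. (\<forall>i<n. u \<le> s i \<and> s i \<le> t i \<and> t i \<le> v) \<and>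
     (\<forall>i<n. \<forall>j<n. i < j \<longrightarrow> t i \<le> s j) \<and> (\<Sum>i<n. t i - s i) \<le> \<Lambda> u v \<and>
     \<psi> u - e * (v - u) - (\<Sum>i<n. dist (\<psi> (s i)) (\<psi> (t i))) \<le> \<psi> v))"
  have "P a b"
    using ab
  proof (induction rule: Bolzano)
    case (trans u w v)
    show ?case unfolding P_def
    proof
      assume uv: "a \<le> u \<and> v \<le> b"
      obtain n :: nat and s t where 1: "\<forall>i<n. u \<le> s i \<and> s i \<le> t i \<and> t i \<le> w" "\<forall>i<n. \<forall>j<n. i < j \<longrightarrow> t i \<le> s j"
        "(\<Sum>i<n. t i - s i) \<le> \<Lambda> u w" "\<psi> u - e * (w - u) - (\<Sum>i<n. dist (\<psi> (s i)) (\<psi> (t i))) \<le> \<psi> w"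
        using trans uv unfolding P_def by auto
      obtain n' :: nat and s' t' where 2: "\<forall>i<n'. w \<le> s' i \<and> s' i \<le> t' i \<and> t' i \<le> v" "\<forall>i<n'. \<forall>j<n'. i < j \<longrightarrow> t' i \<le> s' j"
        "(\<Sum>i<n'. t' i - s' i) \<le> \<Lambda> w v" "\<psi> w - e * (v - w) - (\<Sum>i<n'. dist (\<psi> (s' i)) (\<psi> (t' i))) \<le> \<psi> v"
        using trans uv unfolding P_def by auto
      define S where "S = (\<lambda>i. if i < n then s i else s' (i - n))"
      define T where "T = (\<lambda>i. if i < n then t i else t' (i - n))"
      have split: "(\<Sum>i<n + n'. f (S i) (T i)) = (\<Sum>i<n. f (s i) (t i)) + (\<Sum>i<n'. f (s' i) (t' i))" for f :: "real \<Rightarrow> real \<Rightarrow> real"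
      proof -
        have "(\<Sum>i<n + n'. f (S i) (T i)) = (\<Sum>i<n. f (S i) (T i)) + (\<Sum>i<n'. f (S (n + i)) (T (n + i)))"
          by (induction n') (auto simp: add.assoc)
        then show ?thesis by (simp add: S_def T_def)
      qed
      have "U \<inter> {u<..v} = (U \<inter> {u<..w}) \<union> (U \<inter> {w<..v})" using trans by auto
      moreover have "(U \<inter> {u<..w}) \<inter> (U \<inter> {w<..v}) = {}" by auto
      ultimately have "\<Lambda> u v = \<Lambda> u w + \<Lambda> w v"
        unfolding \<Lambda>_def using measure_Union[OF _ _ fmeasurableD[OF Um] fmeasurableD[OF Um], of u w w v] fmeasurableD2[OF Um]
        by simp
      then have sum: "(\<Sum>i<n + n'. T i - S i) \<le> \<Lambda> u v"
        using 1(3) 2(3) split[of "\<lambda>x y. y - x"] by simp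
      have rng: "\<forall>i<n + n'. u \<le> S i \<and> S i \<le> T i \<and> T i \<le> v"
      proof (intro allI impI)
        fix i assume "i < n + n'"
        then show "u \<le> S i \<and> S i \<le> T i \<and> T i \<le> v"
          using 1(1) 2(1)[rule_format, of "i - n"] trans(3,4) by (cases "i < n") (force simp: S_def T_def)+
      qed
      have ord: "\<forall>i<n + n'. \<forall>j<n + n'. i < j \<longrightarrow> T i \<le> S j"
      proof (intro allI impI)
        fix i j assume ij: "i < n + n'" "j < n + n'" "i < j"
        consider "j < n" | "i < n" "\<not> j < n" | "\<not> i < n" "\<not> j < n" by blast
        then show "T i \<le> S j"
        proof cases
          case 1 then show ?thesis using ij 1 \<open>\<forall>i<n. \<forall>j<n. i < j \<longrightarrow> t i \<le> s j\<close> by (simp add: S_def T_def)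
        next
          case 2
          then have "t i \<le> w" "w \<le> s' (j - n)" using 1(1) \<open>\<forall>i<n'. w \<le> s' i \<and> s' i \<le> t' i \<and> t' i \<le> v\<close> ij by auto
          then show ?thesis using 2 by (simp add: S_def T_def)
        next
          case 3
          then show ?thesis using ij 2(2)[rule_format, of "i - n" "j - n"] by (simp add: S_def T_def)
        qed
      qed
      show "\<exists>(n::nat) s t. (\<forall>i<n. u \<le> s i \<and> s i \<le> t i \<and> t i \<le> v) \<and> (\<forall>i<n. \<forall>j<n. i < j \<longrightarrow> t i \<le> s j) \<and>
          (\<Sum>i<n. t i - s i) \<le> \<Lambda> u v \<and> \<psi> u - e * (v - u) - (\<Sum>i<n. dist (\<psi> (s i)) (\<psi> (t i))) \<le> \<psi> v"
      proof (intro exI conjI)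
        show "\<psi> u - e * (v - u) - (\<Sum>i<n + n'. dist (\<psi> (S i)) (\<psi> (T i))) \<le> \<psi> v"
          using 1(4) 2(4) split[of "\<lambda>x y. dist (\<psi> x) (\<psi> y)"] by (simp add: algebra_simps)
      qed (fact rng ord sum)+
    qed
  next
    case (local x)
    show ?case
    proof (cases "x \<in> N \<union> {a, b}")
      \<comment> \<open>Close to an exceptional point the interval lies in \<open>U\<close>, and
        \<open>[u, v]\<close> itself is recorded as the only entry.\<close>
      case True
      then obtain r where r: "r > 0" "ball x r \<subseteq> U" using U U0 by (meson open_contains_ball subsetD)
      have "P u v" if "u \<le> x" "x \<le> v" "v - u < r" for u v
        unfolding P_def
      proof
        have "{u<..v} \<subseteq> ball x r" using that by (auto simp: dist_real_def)
        then have "U \<inter> {u<..v} = {u<..v}" using r by auto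
        then have "\<Lambda> u v = v - u" using that by (simp add: \<Lambda>_def)
        show "\<exists>(n::nat) s t. (\<forall>i<n. u \<le> s i \<and> s i \<le> t i \<and> t i \<le> v) \<and> (\<forall>i<n. \<forall>j<n. i < j \<longrightarrow> t i \<le> s j) \<and>
          (\<Sum>i<n. t i - s i) \<le> \<Lambda> u v \<and> \<psi> u - e * (v - u) - (\<Sum>i<n. dist (\<psi> (s i)) (\<psi> (t i))) \<le> \<psi> v"
        proof (rule exI[of _ "1::nat"], rule exI[of _ "\<lambda>_. u"], rule exI[of _ "\<lambda>_. v"], intro conjI)
          have "0 \<le> e * (v - u)" using that e(1) by simp
          then show "\<psi> u - e * (v - u) - (\<Sum>i<(1::nat). dist (\<psi> u) (\<psi> v)) \<le> \<psi> v"
            unfolding dist_real_def by simp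
        qed (use that \<open>\<Lambda> u v = v - u\<close> in auto)
      qed
      then show ?thesis using r(1) by blast
    next
      case False
      then obtain D where "D \<ge> 0" "(\<psi> has_real_derivative D) (at x)" using D[of x] local by auto
      obtain r where r: "r > 0" "\<And>h. h \<noteq> 0 \<Longrightarrow> \<bar>h\<bar> < r \<Longrightarrow> \<bar>(\<psi> (x + h) - \<psi> x) / h - D\<bar> < e"
        using DERIV_eps[OF \<open>(\<psi> has_real_derivative D) (at x)\<close> e(1)] by metis
      have up: "\<psi> v - \<psi> x \<ge> - e * (v - x)" if "x \<le> v" "v - x < r" for v
      proof (cases "v = x")
        case False
        then have "(\<psi> v - \<psi> x) / (v - x) > - e" using r(2)[of "v - x"] that \<open>D \<ge> 0\<close> by auto
        then show ?thesis using that False by (simp add: pos_less_divide_eq)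
      qed auto
      have dn: "\<psi> x - \<psi> u \<ge> - e * (x - u)" if "u \<le> x" "x - u < r" for u
      proof (cases "u = x")
        case False
        then have "(\<psi> u - \<psi> x) / (u - x) > - e" using r(2)[of "u - x"] that \<open>D \<ge> 0\<close> by auto
        then show ?thesis using that False by (simp add: neg_less_divide_eq algebra_simps)
      qed auto
      \<comment> \<open>Near a regular point nothing is recorded: \<open>up\<close> and
        \<open>dn\<close> bound the drop on the two sides of \<open>x\<close>.\<close>
      have "P u v" if "u \<le> x" "x \<le> v" "v - u < r" for u v
        unfolding P_def using that up[of v] dn[of u]
        by (intro impI exI[of _ "0::nat"]) (auto simp: \<Lambda>_def algebra_simps)
      then show ?thesis using r(1) by blast
    qed
  qed
  then obtain n :: nat and s t where *: "\<forall>i<n. a \<le> s i \<and> s i \<le> t i \<and> t i \<le> b" "\<forall>i<n. \<forall>j<n. i < j \<longrightarrow> t i \<le> s j"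
        "(\<Sum>i<n. t i - s i) \<le> \<Lambda> a b" "\<psi> a - e * (b - a) - (\<Sum>i<n. dist (\<psi> (s i)) (\<psi> (t i))) \<le> \<psi> b"
    unfolding P_def by auto
  have "\<Lambda> a b \<le> measure lebesgue U" unfolding \<Lambda>_def using U Um by (intro measure_mono_fmeasurable) auto
  then have "(\<Sum>i<n. dist (\<psi> (s i)) (\<psi> (t i))) < e0 / 2"
    using * U U0 by (intro \<delta>(2)) auto
  then show "\<psi> a \<le> \<psi> b + e0" using *(4) e by linarith
qed

text \<open>The distance \<open>u\<close> from the starting point changes at most at the metric
  speed, hence at most as fast as \<open>G\<close> grows; so \<open>ac_deriv_nonneg\<close> applies
  to \<open>G - u\<close>.\<close>

lemma (in metric_carrier) dist_le_increment:
  assumes ab: "a \<le> b" and c: "metric_ac d a b c" "c ` {a..b} \<subseteq> X" and G: "metric_ac dist a b G" and N: "negligible N"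
    and le: "\<And>t. t \<in> {a<..<b} - N \<Longrightarrow> \<exists>l g. ((\<lambda>h. d (c (t + h)) (c t) / \<bar>h\<bar>) \<longlongrightarrow> l) (at 0) \<and> (G has_real_derivative g) (at t) \<and> l \<le> g"
  shows "d (c a) (c b) \<le> G b - G a"
proof (cases "a = b")
  case True then show ?thesis using c by (auto simp: refl0)
next
  case False
  then have ab': "a < b" using ab by simp
  define u where "u = (\<lambda>t. d (c a) (c t))"
  have u_lip: "\<bar>u s - u t\<bar> \<le> d (c s) (c t)" if "s \<in> {a..b}" "t \<in> {a..b}" for s t
  proof -
    have "c a \<in> X" "c s \<in> X" "c t \<in> X" using that c(2) ab by auto
    then show ?thesis using dist_diff_le[of "c a" "c s" "c a" "c t"] by (simp add: u_def refl0)
  qed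
  have u_ac: "metric_ac dist a b u"
  proof (rule metric_ac_comparison[OF c(1) c(1), of 1])
    fix s t assume st: "a \<le> s" "s \<le> t" "t \<le> b"
    then have "d (c s) (c t) \<ge> 0" using c(2) by (intro nonneg) auto
    then show "dist (u s) (u t) \<le> 1 * (d (c s) (c t) + d (c s) (c t))"
      using u_lip[of s t] st by (simp add: dist_real_def)
  qed simp
  obtain M where M: "negligible M" "\<forall>t\<in>{a<..<b} - M. u differentiable (at t)"
    using ac_real_differentiable[OF ab' u_ac] by blast
  have "G a - u a \<le> G b - u b"
  proof (rule ac_deriv_nonneg[OF ab _ negligible_Un[OF N M(1)]])
    show "metric_ac dist a b (\<lambda>t. G t - u t)"
      by (rule metric_ac_comparison[OF G u_ac, of 1]) (auto simp: dist_real_def)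
    fix t assume t: "t \<in> {a<..<b} - (N \<union> M)"
    obtain D where D: "(u has_real_derivative D) (at t)" 
    proof -
      have "u differentiable (at t)" using M(2) t by blast
      then show ?thesis using that by (auto simp: real_differentiable_def)
    qed
    obtain l g where lg: "((\<lambda>h. d (c (t + h)) (c t) / \<bar>h\<bar>) \<longlongrightarrow> l) (at 0)" "(G has_real_derivative g) (at t)" "l \<le> g"
      using le t by blast
    have "\<bar>D\<bar> \<le> l" using t by (intro deriv_le_metric_deriv[OF _ u_lip D lg(1)]) auto
    then show "\<exists>D\<ge>0. ((\<lambda>t. G t - u t) has_real_derivative D) (at t)"
      using lg(3) DERIV_diff[OF lg(2) D] by (intro exI[of _ "g - D"]) auto
  qed
  moreover have "u a = 0" using c(2) ab by (auto simp: u_def intro!: refl0)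
  ultimately show ?thesis by (simp add: u_def)
qed

section \<open>Measurability and integrability of derivatives\<close>

text \<open>The limit may be taken along \<open>h = 1 / Suc n\<close>, which exhibits
  \<open>g\<close> as an almost everywhere limit of continuous functions.\<close>

lemma ae_derivative_measurable:
  fixes A :: "real \<Rightarrow> real \<Rightarrow> real"
  assumes A: "\<And>h. continuous_on UNIV (A h)" and N: "negligible N"
    and lim: "\<And>t. t \<in> {a<..<b} - N \<Longrightarrow> ((\<lambda>h. A h t / \<bar>h\<bar>) \<longlongrightarrow> g t) (at_right 0)"
  shows "g \<in> borel_measurable (lebesgue_on {a..b})"
proof -
  have "g measurable_on {a..b}"
  proof (rule measurable_on_limit)
    show "negligible (N \<union> {a, b})" by (rule negligible_Un[OF N negligible_finite]) simp
    show "(\<lambda>t. A (1 / Suc n) t / \<bar>1 / Suc n\<bar>) measurable_on {a..b}" for n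
    proof -
      have "continuous_on {a..b} (\<lambda>t. A (1 / Suc n) t / \<bar>1 / Suc n\<bar>)"
        by (intro continuous_intros continuous_on_subset[OF A]) auto
      then show ?thesis by (simp add: measurable_on_iff_borel_measurable continuous_imp_measurable_on_sets_lebesgue)
    qed
    fix t assume t: "t \<in> {a..b} - (N \<union> {a, b})"
    have "filterlim (\<lambda>n. 1 / real (Suc n)) (at_right 0) sequentially"
      using LIMSEQ_inverse_real_of_nat by (auto simp: filterlim_at inverse_eq_divide)
    then show "(\<lambda>n. A (1 / Suc n) t / \<bar>1 / Suc n\<bar>) \<longlonglongrightarrow> g t"
      using lim[of t] t by (intro filterlim_compose[OF lim]) auto
  qed
  then show ?thesis by (simp add: measurable_on_iff_borel_measurable)
qed

lemma AE_lebesgue_onI: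
  fixes a b :: real
  assumes N: "negligible N" and P: "\<And>t. t \<in> {a<..<b} - N \<Longrightarrow> P t"
  shows "AE t in lebesgue_on {a..b}. P t"
proof -
  have "negligible (N \<union> {a, b})" by (rule negligible_Un[OF N negligible_finite]) simp
  then have "AE t in lebesgue. t \<in> {a..b} \<longrightarrow> P t"
    unfolding eventually_ae_filter_negligible
    by (rule_tac exI[of _ "N \<union> {a, b}"]) (use P in force)
  then show ?thesis by (subst AE_restrict_space_iff) auto
qed

lemma AE_lebesgue_onE:
  fixes a b :: real
  assumes "AE t in lebesgue_on {a..b}. P t"
  obtains N where "negligible N" "\<forall>t\<in>{a..b} - N. P t"
proof -
  have "AE t in lebesgue. t \<in> {a..b} \<longrightarrow> P t"
    using assms by (subst (asm) AE_restrict_space_iff) auto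
  then show ?thesis
    unfolding eventually_ae_filter_negligible using that by blast
qed

text \<open>Fatou's lemma for the difference quotients \<open>H n\<close>: after a shift of the
  variable, their integral is a difference of averages of the extension \<open>A\<close> over short
  intervals at \<open>b\<close> and \<open>a\<close>, hence at most \<open>A b - A a\<close>. For
  general monotone functions the inequality can be strict; an upper bound is what length estimates
  require.\<close>

lemma mono_derivative_integrable:
  fixes \<alpha> g :: "real \<Rightarrow> real"
  assumes ab: "a < b" and mono: "\<And>s t. a \<le> s \<Longrightarrow> s \<le> t \<Longrightarrow> t \<le> b \<Longrightarrow> \<alpha> s \<le> \<alpha> t"
    and cont: "continuous_on {a..b} \<alpha>" and N: "negligible N"
    and D: "\<And>t. t \<in> {a<..<b} - N \<Longrightarrow> (\<alpha> has_real_derivative g t) (at t)"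
  shows "integrable (lebesgue_on {a..b}) g" "(\<integral>t. g t \<partial>lebesgue_on {a..b}) \<le> \<alpha> b - \<alpha> a"
proof -
  define A where "A = (\<lambda>t. \<alpha> (cl a b t))"
  have Am: "mono A" unfolding A_def by (rule mono_cl) (use ab mono in auto)
  have Ac: "continuous_on S A" for S
    unfolding A_def using ab by (intro continuous_on_subset[OF continuous_cl[OF _ cont]]) auto
  have lim: "((\<lambda>h. (A (t + h) - A t) / \<bar>h\<bar>) \<longlongrightarrow> g t) (at_right 0)" if t: "t \<in> {a<..<b} - N" for t
  proof -
    have "((\<lambda>h. (\<alpha> (t + h) - \<alpha> t) / h) \<longlongrightarrow> g t) (at_right 0)"
      using D[OF t] unfolding DERIV_def by (rule tendsto_within_subset) simp
    moreover have "\<forall>\<^sub>F h in at_right 0. (\<alpha> (t + h) - \<alpha> t) / h = (A (t + h) - A t) / \<bar>h\<bar>"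
    proof -
      have "\<forall>\<^sub>F h in at_right 0. cl a b (t + h) = t + h"
        using eventually_cl[of t a b] t by (auto simp: eventually_at_filter elim!: eventually_mono)
      moreover have "\<forall>\<^sub>F h in at_right (0::real). h > 0" by (rule eventually_at_right_less)
      ultimately show ?thesis by eventually_elim (use t in \<open>auto simp: A_def cl_id\<close>)
    qed
    ultimately show ?thesis by (rule Lim_transform_eventually)
  qed
  have gm: "g \<in> borel_measurable (lebesgue_on {a..b})"
  proof (rule ae_derivative_measurable[where A = "\<lambda>h t. A (t + h) - A t", OF _ N lim])
    show "continuous_on UNIV (\<lambda>t. A (t + h) - A t)" for h
      by (intro continuous_intros continuous_on_compose2[OF Ac[of UNIV]]) auto
  qed
  define H where "H = (\<lambda>n t. (A (t + 1 / Suc n) - A t) / (1 / Suc n))"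
  have Hc: "continuous_on {a..b} (H n)" for n
    unfolding H_def by (intro continuous_intros continuous_on_compose2[OF Ac[of UNIV]] Ac) auto
  have H0: "0 \<le> H n t" for n t
    unfolding H_def using Am by (intro divide_nonneg_nonneg) (auto simp: mono_def)
  have Hi: "integral {a..b} (H n) \<le> A b - A a" for n
  proof -
    define k where "k = 1 / real (Suc n)"
    have k: "k > 0" by (simp add: k_def)
    have Ai: "A integrable_on {u..v}" for u v by (intro integrable_continuous_real Ac)
    have "integral {a..b} (\<lambda>t. A (t + k)) = integral {a + k..b + k} A"
      using integral_shift[of a k b A] Ac by (simp add: o_def add.commute)
    also have "\<dots> = integral {a..b} A + integral {b..b + k} A - integral {a..a + k} A"
      using Henstock_Kurzweil_Integration.integral_combine[of a "a + k" "b + k" A, OF _ _ Ai]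
        Henstock_Kurzweil_Integration.integral_combine[of a b "b + k" A, OF _ _ Ai] ab k by simp
    finally have eq: "integral {a..b} (\<lambda>t. A (t + k)) - integral {a..b} A = integral {b..b + k} A - integral {a..a + k} A" by simp
    have "integral {b..b + k} A \<le> integral {b..b + k} (\<lambda>_. A b)"
      by (rule integral_le[OF Ai]) (use ab in \<open>auto simp: A_def cl_def\<close>)
    moreover have "integral {a..a + k} A \<ge> integral {a..a + k} (\<lambda>_. A a)"
      by (rule integral_le[OF _ Ai]) (use Am in \<open>auto simp: mono_def\<close>)
    ultimately have "integral {a..b} (\<lambda>t. A (t + k)) - integral {a..b} A \<le> k * (A b - A a)"
      using eq k by (simp add: algebra_simps)
    moreover have "integral {a..b} (H n) = (integral {a..b} (\<lambda>t. A (t + k)) - integral {a..b} A) / k"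
    proof -
      have "(\<lambda>t. A (t + k)) integrable_on {a..b}"
        by (intro integrable_continuous_real continuous_on_compose2[OF Ac[of UNIV]] continuous_intros) auto
      then show ?thesis
        unfolding H_def k_def[symmetric] using Ai by (simp add: Henstock_Kurzweil_Integration.integral_diff)
    qed
    ultimately show ?thesis using k by (simp add: divide_le_eq mult.commute)
  qed
  have nnH: "(\<integral>\<^sup>+t. ennreal (H n t) \<partial>lebesgue_on {a..b}) \<le> ennreal (A b - A a)" for n
  proof -
    have abs: "H n absolutely_integrable_on {a..b}" using absolutely_integrable_continuous_real[OF Hc] .
    then have i: "integrable (lebesgue_on {a..b}) (H n)"
      by (simp add: set_integrable_def integrable_restrict_space)
    have "(\<integral>\<^sup>+t. ennreal (H n t) \<partial>lebesgue_on {a..b}) = ennreal (\<integral>t. H n t \<partial>lebesgue_on {a..b})"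
      by (rule nn_integral_eq_integral[OF i]) (simp add: H0)
    also have "(\<integral>t. H n t \<partial>lebesgue_on {a..b}) = integral {a..b} (H n)"
      by (rule lebesgue_integral_eq_integral[OF i]) simp
    finally show ?thesis using Hi by (simp add: ennreal_leI)
  qed
  have AEab: "AE t in lebesgue_on {a..b}. t \<in> {a<..<b} - N"
    by (rule AE_lebesgue_onI[OF N]) auto
  have lim': "AE t in lebesgue_on {a..b}. (\<lambda>n. H n t) \<longlonglongrightarrow> g t"
    using AEab
  proof (rule AE_mp, intro AE_I2 impI)
    fix t assume t: "t \<in> {a<..<b} - N"
    have "filterlim (\<lambda>n. 1 / real (Suc n)) (at_right 0) sequentially"
      using LIMSEQ_inverse_real_of_nat by (auto simp: filterlim_at inverse_eq_divide)
    then have "(\<lambda>n. (A (t + 1 / real (Suc n)) - A t) / \<bar>1 / real (Suc n)\<bar>) \<longlonglongrightarrow> g t"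
      by (rule filterlim_compose[OF lim[OF t]])
    then show "(\<lambda>n. H n t) \<longlonglongrightarrow> g t" by (simp add: H_def)
  qed
  have "(\<integral>\<^sup>+t. ennreal (norm (g t)) \<partial>lebesgue_on {a..b}) = (\<integral>\<^sup>+t. liminf (\<lambda>n. ennreal (H n t)) \<partial>lebesgue_on {a..b})"
  proof (rule nn_integral_cong_AE, use lim' in \<open>rule AE_mp\<close>, intro AE_I2 impI)
    fix t assume l: "(\<lambda>n. H n t) \<longlonglongrightarrow> g t"
    then have "0 \<le> g t" using H0 by (intro LIMSEQ_le_const[OF l]) auto
    moreover have "(\<lambda>n. ennreal (H n t)) \<longlonglongrightarrow> ennreal (g t)" using l by (rule tendsto_ennrealI)
    ultimately show "ennreal (norm (g t)) = liminf (\<lambda>n. ennreal (H n t))"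
      by (simp add: lim_imp_Liminf)
  qed
  also have "\<dots> \<le> liminf (\<lambda>n. \<integral>\<^sup>+t. ennreal (H n t) \<partial>lebesgue_on {a..b})"
  proof (rule nn_integral_liminf)
    have "H n \<in> borel_measurable (lebesgue_on {a..b})" for n
      using Hc by (intro continuous_imp_measurable_on_sets_lebesgue) auto
    then show "(\<lambda>t. ennreal (H n t)) \<in> borel_measurable (lebesgue_on {a..b})" for n by measurable
  qed
  also have "\<dots> \<le> liminf (\<lambda>n. ennreal (A b - A a))"
    by (intro Liminf_mono always_eventually allI nnH)
  finally have nn: "(\<integral>\<^sup>+t. ennreal (norm (g t)) \<partial>lebesgue_on {a..b}) \<le> ennreal (A b - A a)" by (simp add: Liminf_const)
  also have "\<dots> < \<infinity>" by simp
  finally show int: "integrable (lebesgue_on {a..b}) g" using gm by (intro integrableI_bounded)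
  have "ennreal (\<integral>t. norm (g t) \<partial>lebesgue_on {a..b}) \<le> ennreal (A b - A a)"
    using nn by (subst nn_integral_eq_integral[symmetric]) (use int in auto)
  then have "(\<integral>t. norm (g t) \<partial>lebesgue_on {a..b}) \<le> A b - A a"
    using Am ab by (subst (asm) ennreal_le_iff) (auto simp: mono_def)
  moreover have "(\<integral>t. g t \<partial>lebesgue_on {a..b}) \<le> (\<integral>t. norm (g t) \<partial>lebesgue_on {a..b})"
    using int by (intro integral_mono) auto
  moreover have "A a = \<alpha> a" "A b = \<alpha> b" using ab by (auto simp: A_def cl_def)
  ultimately show "(\<integral>t. g t \<partial>lebesgue_on {a..b}) \<le> \<alpha> b - \<alpha> a" by simp
qed

section \<open>Causal curves in generalized cones\<close>

lemma cone_dist_ac_iff: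
  assumes "metric_carrier X d" "(\<lambda>t. snd (\<gamma> t)) ` {a..b} \<subseteq> X"
  shows "metric_ac (cone_dist d) a b \<gamma> \<longleftrightarrow> metric_ac dist a b (\<lambda>t. fst (\<gamma> t)) \<and> metric_ac d a b (\<lambda>t. snd (\<gamma> t))"
proof
  interpret metric_carrier X d by fact
  have *: "0 \<le> d (snd (\<gamma> s)) (snd (\<gamma> t))" if "a \<le> s" "s \<le> t" "t \<le> b" for s t
    using that assms(2) by (intro nonneg) auto
  show "metric_ac dist a b (\<lambda>t. fst (\<gamma> t)) \<and> metric_ac d a b (\<lambda>t. snd (\<gamma> t))" if ac: "metric_ac (cone_dist d) a b \<gamma>"
  proof
    show "metric_ac dist a b (\<lambda>t. fst (\<gamma> t))"
      by (rule metric_ac_comparison[OF ac ac, of 1]) (use * in \<open>auto simp: cone_dist_def dist_real_def\<close>)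
    show "metric_ac d a b (\<lambda>t. snd (\<gamma> t))"
      by (rule metric_ac_comparison[OF ac ac, of 1]) (use * in \<open>auto simp: cone_dist_def dist_real_def\<close>)
  qed
  assume ac: "metric_ac dist a b (\<lambda>t. fst (\<gamma> t)) \<and> metric_ac d a b (\<lambda>t. snd (\<gamma> t))"
  show "metric_ac (cone_dist d) a b \<gamma>"
    by (rule metric_ac_comparison[OF conjunct1[OF ac] conjunct2[OF ac], of 1]) (auto simp: cone_dist_def dist_real_def)
qed

text \<open>The integrand of \<open>cone_L\<close>, named so that lengths can be compared
  pointwise.\<close>

definition lapse :: "(real \<Rightarrow> real) \<Rightarrow> ('a \<Rightarrow> 'a \<Rightarrow> real) \<Rightarrow> (real \<Rightarrow> real \<times> 'a) \<Rightarrow> real \<Rightarrow> real" where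
  "lapse f d \<gamma> t = sqrt ((deriv (\<lambda>t. fst (\<gamma> t)) t)\<^sup>2 - (f (fst (\<gamma> t)))\<^sup>2 * (metric_deriv d (\<lambda>t. snd (\<gamma> t)) t)\<^sup>2)"

lemma cone_L_lapse: "cone_L f d a b \<gamma> = (\<integral>t. lapse f d \<gamma> t \<partial>lebesgue_on {a..b})"
  by (simp add: cone_L_def lapse_def)

locale cone_curve = metric_carrier X d for X :: "'a set" and d +
  fixes tl :: bool and I :: "real set" and f :: "real \<Rightarrow> real" and a b :: real and \<gamma> :: "real \<Rightarrow> real \<times> 'a"
  assumes curve: "cone_fd tl I f X d a b \<gamma>"
    and f_cont: "continuous_on I f" and f_pos: "t \<in> I \<Longrightarrow> f t > 0"
begin

abbreviation "\<alpha> \<equiv> \<lambda>t. fst (\<gamma> t)"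
abbreviation "\<beta> \<equiv> \<lambda>t. snd (\<gamma> t)"
abbreviation "v \<equiv> metric_deriv d \<beta>"

lemma ab: "a < b"
  using curve by (simp add: cone_fd_def)

lemma \<gamma>_in: "t \<in> {a..b} \<Longrightarrow> \<gamma> t \<in> I \<times> X"
  using curve unfolding cone_fd_def by blast

lemma \<alpha>_in: "t \<in> {a..b} \<Longrightarrow> \<alpha> t \<in> I" and \<beta>_in: "t \<in> {a..b} \<Longrightarrow> \<beta> t \<in> X"
  using \<gamma>_in by (auto simp: mem_Times_iff)

lemma \<beta>_img: "\<beta> ` {a..b} \<subseteq> X"
  using \<beta>_in by blast

lemma \<alpha>_ac: "metric_ac dist a b \<alpha>" and \<beta>_ac: "metric_ac d a b \<beta>"
  using curve cone_dist_ac_iff[OF metric_carrier_axioms \<beta>_img] by (auto simp: cone_fd_def)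

text \<open>Collects the almost everywhere properties off a single null set and takes the square
  root in the causality condition, which then reads as a speed limit: \<open>f\<close> times the
  fibre speed is at most \<open>deriv \<alpha>\<close>.\<close>

lemma regular:
  obtains N where "negligible N"
    "\<forall>t\<in>{a<..<b} - N. (\<alpha> has_real_derivative deriv \<alpha> t) (at t)" "\<forall>t\<in>{a<..<b} - N. deriv \<alpha> t > 0"
    "\<forall>t\<in>{a<..<b} - N. ((\<lambda>h. d (\<beta> (t + h)) (\<beta> t) / \<bar>h\<bar>) \<longlongrightarrow> v t) (at 0)"
    "\<forall>t\<in>{a<..<b} - N. v t \<ge> 0"
    "\<forall>t\<in>{a<..<b} - N. f (\<alpha> t) * v t \<le> deriv \<alpha> t" "\<forall>t\<in>{a<..<b} - N. tl \<longrightarrow> f (\<alpha> t) * v t < deriv \<alpha> t"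
proof -
  have "AE t in lebesgue_on {a..b}.
        \<alpha> differentiable (at t) \<and> deriv \<alpha> t > 0 \<and>
        (let q = - (deriv \<alpha> t)\<^sup>2 + (f (\<alpha> t))\<^sup>2 * (v t)\<^sup>2 in if tl then q < 0 else q \<le> 0)"
    using curve by (simp add: cone_fd_def)
  then obtain N1 where N1: "negligible N1" "\<forall>t\<in>{a..b} - N1. \<alpha> differentiable (at t) \<and> deriv \<alpha> t > 0 \<and>
        (let q = - (deriv \<alpha> t)\<^sup>2 + (f (\<alpha> t))\<^sup>2 * (v t)\<^sup>2 in if tl then q < 0 else q \<le> 0)"
    by (rule AE_lebesgue_onE) (rule that)
  obtain N2 where N2: "negligible N2" "\<forall>t\<in>{a<..<b} - N2. ((\<lambda>h. d (\<beta> (t + h)) (\<beta> t) / \<bar>h\<bar>) \<longlongrightarrow> v t) (at 0)"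
    by (rule ac_curve_variation[OF ab \<beta>_ac \<beta>_img]) (rule that)
  have v0: "v t \<ge> 0" if t: "t \<in> {a<..<b} - N2" for t
  proof -
    have "\<forall>\<^sub>F h in at 0. d (\<beta> (t + h)) (\<beta> t) / \<bar>h\<bar> \<ge> 0"
    proof (rule eventually_mono[OF eventually_cl])
      fix h assume "cl a b (t + h) = t + h"
      then have "t + h \<in> {a..b}" using cl_in[of a b "t+h"] ab by auto
      then show "0 \<le> d (\<beta> (t + h)) (\<beta> t) / \<bar>h\<bar>"
        using t by (intro divide_nonneg_nonneg nonneg \<beta>_in) auto
    qed (use t in auto)
    moreover have "((\<lambda>h. d (\<beta> (t + h)) (\<beta> t) / \<bar>h\<bar>) \<longlongrightarrow> v t) (at 0)" using N2(2) t by blast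
    ultimately show ?thesis using tendsto_lowerbound[of _ "v t" "at (0::real)" 0] by simp
  qed
  show ?thesis
  proof (rule that[OF negligible_Un[OF N1(1) N2(1)]]; rule ballI)
    fix t assume t: "t \<in> {a<..<b} - (N1 \<union> N2)"
    then have "\<alpha> differentiable (at t) \<and> deriv \<alpha> t > 0 \<and>
        (let q = - (deriv \<alpha> t)\<^sup>2 + (f (\<alpha> t))\<^sup>2 * (v t)\<^sup>2 in if tl then q < 0 else q \<le> 0)"
      using N1(2) by auto
    then have 1: "\<alpha> differentiable (at t)" "deriv \<alpha> t > 0"
        "(f (\<alpha> t) * v t)\<^sup>2 \<le> (deriv \<alpha> t)\<^sup>2" "tl \<Longrightarrow> (f (\<alpha> t) * v t)\<^sup>2 < (deriv \<alpha> t)\<^sup>2"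
      by (cases tl; simp add: Let_def power_mult_distrib)+
    show "(\<alpha> has_real_derivative deriv \<alpha> t) (at t)"
      using 1(1) by (simp add: DERIV_deriv_iff_real_differentiable)
    show "deriv \<alpha> t > 0" by fact
    show "((\<lambda>h. d (\<beta> (t + h)) (\<beta> t) / \<bar>h\<bar>) \<longlongrightarrow> v t) (at 0)" using N2(2) t by blast
    show "v t \<ge> 0" using v0 t by blast
    show "f (\<alpha> t) * v t \<le> deriv \<alpha> t" using power2_le_imp_le[OF 1(3)] 1(2) by simp
    show "tl \<longrightarrow> f (\<alpha> t) * v t < deriv \<alpha> t" using power2_less_imp_less[OF 1(4)] 1(2) by simp
  qed
qed

text \<open>\<open>cone_fd\<close> also admits strictly decreasing \<open>\<alpha>\<close>; a
  derivative that is positive almost everywhere excludes this, by absolute continuity.\<close>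

lemma \<alpha>_mono:
  assumes "a \<le> s" "s \<le> t" "t \<le> b"
  shows "\<alpha> s \<le> \<alpha> t"
proof -
  obtain N where N: "negligible N" "\<forall>t\<in>{a<..<b} - N. (\<alpha> has_real_derivative deriv \<alpha> t) (at t)" "\<forall>t\<in>{a<..<b} - N. deriv \<alpha> t > 0"
    by (rule regular) (rule that)
  show ?thesis
  proof (rule ac_deriv_nonneg[OF assms(2) metric_ac_subinterval[OF \<alpha>_ac assms(1,3)] N(1)])
    fix r assume "r \<in> {s<..<t} - N"
    then have "r \<in> {a<..<b} - N" using assms by auto
    then show "\<exists>D\<ge>0. (\<alpha> has_real_derivative D) (at r)" using N(2,3) by (meson less_imp_le)
  qed
qed

text \<open>The speed limit gives \<open>v \<le> deriv \<alpha> / m\<close> almost everywhere, and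
  \<open>dist_le_increment\<close> integrates it. This bound is what makes double cones of slope
  \<open>1 / m\<close> causally convex.\<close>

lemma dist_\<beta>_le:
  assumes st: "a \<le> s" "s \<le> t" "t \<le> b" and m: "m > 0" "\<And>r. r \<in> {\<alpha> a..\<alpha> b} \<Longrightarrow> m \<le> f r"
  shows "d (\<beta> s) (\<beta> t) \<le> (\<alpha> t - \<alpha> s) / m"
proof -
  obtain N where N: "negligible N"
    "\<forall>t\<in>{a<..<b} - N. (\<alpha> has_real_derivative deriv \<alpha> t) (at t)" "\<forall>t\<in>{a<..<b} - N. deriv \<alpha> t > 0"
    "\<forall>t\<in>{a<..<b} - N. ((\<lambda>h. d (\<beta> (t + h)) (\<beta> t) / \<bar>h\<bar>) \<longlongrightarrow> v t) (at 0)"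
    "\<forall>t\<in>{a<..<b} - N. v t \<ge> 0"
    "\<forall>t\<in>{a<..<b} - N. f (\<alpha> t) * v t \<le> deriv \<alpha> t"
    by (rule regular) (rule that)
  have "d (\<beta> s) (\<beta> t) \<le> \<alpha> t / m - \<alpha> s / m"
  proof (rule dist_le_increment[OF st(2) metric_ac_subinterval[OF \<beta>_ac st(1,3)] _ _ N(1)])
    show "\<beta> ` {s..t} \<subseteq> X" using st \<beta>_in by auto
    have "metric_ac dist a b (\<lambda>t. \<alpha> t / m)"
      by (rule metric_ac_comparison[OF \<alpha>_ac \<alpha>_ac, of "1/m"])
         (use m in \<open>auto simp: dist_real_def field_simps simp flip: diff_divide_distrib\<close>)
    then show "metric_ac dist s t (\<lambda>t. \<alpha> t / m)" using metric_ac_subinterval st by blast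
    fix r assume r': "r \<in> {s<..<t} - N"
    then have r: "r \<in> {a<..<b} - N" using st by auto
    have "m \<le> f (\<alpha> r)" using r by (intro m(2)) (auto intro: \<alpha>_mono)
    then have "m * v r \<le> f (\<alpha> r) * v r" using N(5) r by (intro mult_right_mono) auto
    then have "v r \<le> deriv \<alpha> r / m" using N(6) r m(1) by (force simp: field_simps)
    moreover have "((\<lambda>t. \<alpha> t / m) has_real_derivative deriv \<alpha> r / m) (at r)"
      using N(2) r by (intro DERIV_cdivide) auto
    ultimately show "\<exists>l g. ((\<lambda>h. d (\<beta> (r + h)) (\<beta> r) / \<bar>h\<bar>) \<longlongrightarrow> l) (at 0) \<and> ((\<lambda>t. \<alpha> t / m) has_real_derivative g) (at r) \<and> l \<le> g"
      using N(4) r by blast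
  qed
  then show ?thesis by (simp add: diff_divide_distrib)
qed

lemma ac_continuous:
  fixes u :: "real \<Rightarrow> real"
  assumes "metric_ac dist a b u"
  shows "continuous_on {a..b} u"
  unfolding continuous_on_iff
proof (intro ballI allI impI)
  fix x e :: real assume x: "x \<in> {a..b}" and e: "e > 0"
  obtain \<delta> where \<delta>: "\<delta> > 0" "\<And>(n::nat) s t. (\<forall>i<n. a \<le> s i \<and> s i \<le> t i \<and> t i \<le> b) \<Longrightarrow>
    (\<forall>i<n. \<forall>j<n. i < j \<longrightarrow> t i \<le> s j) \<Longrightarrow> (\<Sum>i<n. t i - s i) < \<delta> \<Longrightarrow> (\<Sum>i<n. dist (u (s i)) (u (t i))) < e"
    using metric_acE[OF assms e] by blast
  have "dist (u y) (u x) < e" if "y \<in> {a..b}" "dist y x < \<delta>" for y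
    using \<delta>(2)[of 1 "\<lambda>_. min x y" "\<lambda>_. max x y"] that x
    by (cases "x \<le> y") (auto simp: min_def max_def dist_commute dist_real_def)
  then show "\<exists>\<delta>>0. \<forall>y\<in>{a..b}. dist y x < \<delta> \<longrightarrow> dist (u y) (u x) < e" using \<delta>(1) by blast
qed

lemma v_measurable: "v \<in> borel_measurable (lebesgue_on {a..b})"
proof -
  obtain V N where V: "mono V" "continuous_on UNIV V" and "metric_ac dist a b V"
    and le: "\<forall>s t. s \<le> t \<longrightarrow> d (\<beta> (cl a b s)) (\<beta> (cl a b t)) \<le> V t - V s"
    and N: "negligible N"
    and "\<forall>t\<in>{a<..<b} - N. (V has_real_derivative v t) (at t)"
    and lim: "\<forall>t\<in>{a<..<b} - N. ((\<lambda>h. d (\<beta> (t + h)) (\<beta> t) / \<bar>h\<bar>) \<longlongrightarrow> v t) (at 0)"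
    by (rule ac_curve_variation[OF ab \<beta>_ac \<beta>_img]) (rule that)
  have clX: "\<beta> (cl a b t) \<in> X" for t using cl_in[of a b t] ab \<beta>_in by auto
  have le': "d (\<beta> (cl a b s)) (\<beta> (cl a b t)) \<le> \<bar>V s - V t\<bar>" for s t
    using le[rule_format, of s t] le[rule_format, of t s] sym[OF clX clX, of s t] by (cases "s \<le> t") auto
  define A where "A = (\<lambda>h t. d (\<beta> (cl a b (t + h))) (\<beta> (cl a b t)))"
  show ?thesis
  proof (rule ae_derivative_measurable[where A = A, OF _ N])
    show "continuous_on UNIV (A h)" for h
    proof (rule continuous_at_imp_continuous_on, safe)
      fix x
      have Vc: "isCont V y" for y using V(2) by (simp add: continuous_on_eq_continuous_at)
      have "((\<lambda>y. V (y + h)) \<longlongrightarrow> V (x + h)) (at x)"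
        by (rule isCont_tendsto_compose[OF Vc]) (intro tendsto_intros)
      moreover have "(V \<longlongrightarrow> V x) (at x)" using Vc by (simp add: isCont_def)
      ultimately have "((\<lambda>y. \<bar>V (y + h) - V (x + h)\<bar> + \<bar>V y - V x\<bar>) \<longlongrightarrow> \<bar>V (x + h) - V (x + h)\<bar> + \<bar>V x - V x\<bar>) (at x)"
        by (intro tendsto_intros)
      moreover have "\<forall>\<^sub>F y in at x. norm (A h y - A h x) \<le> \<bar>V (y + h) - V (x + h)\<bar> + \<bar>V y - V x\<bar>"
        unfolding A_def real_norm_def
        by (rule always_eventually, rule allI, rule order_trans[OF dist_diff_le[OF clX clX clX clX] add_mono[OF le' le']])
      ultimately have "((\<lambda>y. A h y - A h x) \<longlongrightarrow> 0) (at x)"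
        by (intro Lim_null_comparison[where f = "\<lambda>y. A h y - A h x"]) auto
      then show "isCont (A h) x" by (simp add: isCont_def LIM_zero_iff)
    qed
    fix t assume t: "t \<in> {a<..<b} - N"
    have "\<forall>\<^sub>F h in at 0. d (\<beta> (t + h)) (\<beta> t) / \<bar>h\<bar> = A h t / \<bar>h\<bar>"
      using eventually_cl[of t a b] t by (auto elim!: eventually_mono simp: A_def cl_id)
    then have "((\<lambda>h. A h t / \<bar>h\<bar>) \<longlongrightarrow> v t) (at 0)"
      by (rule Lim_transform_eventually[OF lim[rule_format, OF t]])
    then show "((\<lambda>h. A h t / \<bar>h\<bar>) \<longlongrightarrow> v t) (at_right 0)" by (rule tendsto_within_subset) simp
  qed
qed

text \<open>The lapse lies between 0 and \<open>deriv \<alpha>\<close>, which is integrable.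
  Integrability matters because the Bochner integral would otherwise be 0 by default and lengths
  could not be compared through their integrands.\<close>

lemma lapse_integrable: "integrable (lebesgue_on {a..b}) (lapse f d \<gamma>)"
proof -
  obtain N where N: "negligible N"
    "\<forall>t\<in>{a<..<b} - N. (\<alpha> has_real_derivative deriv \<alpha> t) (at t)" "\<forall>t\<in>{a<..<b} - N. deriv \<alpha> t > 0"
    "\<forall>t\<in>{a<..<b} - N. v t \<ge> 0"
    "\<forall>t\<in>{a<..<b} - N. f (\<alpha> t) * v t \<le> deriv \<alpha> t"
    by (rule regular) (rule that)
  have i: "integrable (lebesgue_on {a..b}) (deriv \<alpha>)"
    by (rule mono_derivative_integrable(1)[OF ab \<alpha>_mono ac_continuous[OF \<alpha>_ac] N(1)]) (use N(2) in auto)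
  have "continuous_on {a..b} (\<lambda>t. f (\<alpha> t))"
    by (rule continuous_on_compose2[OF f_cont ac_continuous[OF \<alpha>_ac]]) (use \<alpha>_in in auto)
  then have fm: "(\<lambda>t. f (\<alpha> t)) \<in> borel_measurable (lebesgue_on {a..b})"
    by (intro continuous_imp_measurable_on_sets_lebesgue) auto
  show ?thesis
  proof (rule Bochner_Integration.integrable_bound[OF i])
    have [measurable]: "deriv \<alpha> \<in> borel_measurable (lebesgue_on {a..b})" using i by (rule borel_measurable_integrable)
    note [measurable] = fm v_measurable
    show "lapse f d \<gamma> \<in> borel_measurable (lebesgue_on {a..b})" unfolding lapse_def by measurable
    show "AE t in lebesgue_on {a..b}. norm (lapse f d \<gamma> t) \<le> norm (deriv \<alpha> t)"
    proof (rule AE_lebesgue_onI[OF N(1)])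
      fix t assume t: "t \<in> {a<..<b} - N"
      have "0 \<le> f (\<alpha> t)" using t by (intro less_imp_le f_pos \<alpha>_in) auto
      then have "(f (\<alpha> t) * v t)\<^sup>2 \<le> (deriv \<alpha> t)\<^sup>2" using N t by (intro power_mono) auto
      then have "lapse f d \<gamma> t \<ge> 0" by (simp add: lapse_def power_mult_distrib)
      moreover have "lapse f d \<gamma> t \<le> sqrt ((deriv \<alpha> t)\<^sup>2)"
        unfolding lapse_def by (rule real_sqrt_le_mono) simp
      ultimately show "norm (lapse f d \<gamma> t) \<le> norm (deriv \<alpha> t)" by simp
    qed
  qed
qed

lemma cone_L_nonneg: "0 \<le> cone_L f d a b \<gamma>"
proof -
  obtain N where N: "negligible N"
    "\<forall>t\<in>{a<..<b} - N. deriv \<alpha> t > 0"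
    "\<forall>t\<in>{a<..<b} - N. v t \<ge> 0"
    "\<forall>t\<in>{a<..<b} - N. f (\<alpha> t) * v t \<le> deriv \<alpha> t"
    by (rule regular) (rule that)
  have "AE t in lebesgue_on {a..b}. 0 \<le> lapse f d \<gamma> t"
  proof (rule AE_lebesgue_onI[OF N(1)])
    fix t assume t: "t \<in> {a<..<b} - N"
    have "0 \<le> f (\<alpha> t)" using t by (intro less_imp_le f_pos \<alpha>_in) auto
    then have "(f (\<alpha> t) * v t)\<^sup>2 \<le> (deriv \<alpha> t)\<^sup>2" using N t by (intro power_mono) auto
    then show "lapse f d \<gamma> t \<ge> 0" unfolding lapse_def by (auto simp: power_mult_distrib)
  qed
  then show ?thesis unfolding cone_L_lapse by (rule integral_nonneg_AE)
qed

text \<open>Replacing the fibre component by a slower curve along a geodesic of another fibre keeps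
  causality and does not decrease the length; this is why only distances in the fibre matter.\<close>

lemma transfer:
  fixes Z :: "'b set" and e :: "'b \<Rightarrow> 'b \<Rightarrow> real"
  assumes Z: "metric_carrier Z e"
    and \<sigma>: "\<And>r. r \<in> {0..l} \<Longrightarrow> \<sigma> r \<in> Z" "\<And>r s. r \<in> {0..l} \<Longrightarrow> s \<in> {0..l} \<Longrightarrow> e (\<sigma> r) (\<sigma> s) = \<bar>r - s\<bar>"
    and \<psi>: "metric_ac dist a b \<psi>" "\<psi> ` {a..b} \<subseteq> {0..l}"
    and M: "negligible M" "\<forall>t\<in>{a<..<b} - M. (\<psi> has_real_derivative D t) (at t) \<and> \<bar>D t\<bar> \<le> v t"
  shows "cone_fd tl I f Z e a b (\<lambda>t. (\<alpha> t, \<sigma> (\<psi> t)))" (is "cone_fd tl I f Z e a b ?\<gamma>")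
    and "cone_L f d a b \<gamma> \<le> cone_L f e a b (\<lambda>t. (\<alpha> t, \<sigma> (\<psi> t)))"
    and "cone_L f d a b \<gamma> = cone_L f e a b (\<lambda>t. (\<alpha> t, \<sigma> (\<psi> t))) \<Longrightarrow>
       \<exists>N. negligible N \<and> (\<forall>t\<in>{a<..<b} - N. v t = \<bar>D t\<bar>)"
proof -
  interpret Z: metric_carrier Z e by fact
  obtain N where N: "negligible N"
    "\<forall>t\<in>{a<..<b} - N. (\<alpha> has_real_derivative deriv \<alpha> t) (at t)" "\<forall>t\<in>{a<..<b} - N. deriv \<alpha> t > 0"
    "\<forall>t\<in>{a<..<b} - N. ((\<lambda>h. d (\<beta> (t + h)) (\<beta> t) / \<bar>h\<bar>) \<longlongrightarrow> v t) (at 0)"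
    "\<forall>t\<in>{a<..<b} - N. v t \<ge> 0"
    "\<forall>t\<in>{a<..<b} - N. f (\<alpha> t) * v t \<le> deriv \<alpha> t" "\<forall>t\<in>{a<..<b} - N. tl \<longrightarrow> f (\<alpha> t) * v t < deriv \<alpha> t"
    by (rule regular) (rule that)
  have \<psi>_in: "\<psi> t \<in> {0..l}" if "t \<in> {a..b}" for t using \<psi>(2) that by blast
  \<comment> \<open>\<open>\<sigma>\<close> is isometric, so the metric speed of the new fibre
    component is the speed of \<open>\<psi>\<close>.\<close>
  have md: "metric_deriv e (\<lambda>t. \<sigma> (\<psi> t)) t = \<bar>D t\<bar>" if t: "t \<in> {a<..<b} - M" for t
  proof -
    have "((\<lambda>h. \<bar>(\<psi> (t + h) - \<psi> t) / h\<bar>) \<longlongrightarrow> \<bar>D t\<bar>) (at 0)"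
      using M(2) t unfolding DERIV_def by (intro tendsto_intros) auto
    moreover have "\<forall>\<^sub>F h in at 0. \<bar>(\<psi> (t + h) - \<psi> t) / h\<bar> = e (\<sigma> (\<psi> (t + h))) (\<sigma> (\<psi> t)) / \<bar>h\<bar>"
    proof (rule eventually_mono[OF eventually_cl])
      fix h assume "cl a b (t + h) = t + h"
      then have "t + h \<in> {a..b}" using cl_in[of a b "t+h"] ab by auto
      then have "e (\<sigma> (\<psi> (t + h))) (\<sigma> (\<psi> t)) = \<bar>\<psi> (t + h) - \<psi> t\<bar>"
        using t by (intro \<sigma>(2) \<psi>_in) auto
      then show "\<bar>(\<psi> (t + h) - \<psi> t) / h\<bar> = e (\<sigma> (\<psi> (t + h))) (\<sigma> (\<psi> t)) / \<bar>h\<bar>"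
        by (simp add: abs_divide)
    qed (use t in auto)
    ultimately have "((\<lambda>h. e (\<sigma> (\<psi> (t + h))) (\<sigma> (\<psi> t)) / \<bar>h\<bar>) \<longlongrightarrow> \<bar>D t\<bar>) (at 0)"
      by (rule Lim_transform_eventually)
    then show ?thesis unfolding metric_deriv_def by (intro tendsto_Lim) auto
  qed
  have NM: "negligible (N \<union> M)" by (rule negligible_Un[OF N(1) M(1)])
  have f0: "f (\<alpha> t) > 0" if "t \<in> {a<..<b}" for t using that by (intro f_pos \<alpha>_in) auto
  show new: "cone_fd tl I f Z e a b ?\<gamma>"
    unfolding cone_fd_def
  proof (intro conjI ab)
    show "?\<gamma> ` {a..b} \<subseteq> I \<times> Z" using \<alpha>_in \<sigma>(1) \<psi>_in by auto
    have "metric_ac e a b (\<lambda>t. \<sigma> (\<psi> t))"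
    proof (rule metric_ac_comparison[OF \<psi>(1) \<psi>(1), of 1])
      fix s t assume "a \<le> s" "s \<le> t" "t \<le> b"
      then have "e (\<sigma> (\<psi> s)) (\<sigma> (\<psi> t)) = \<bar>\<psi> s - \<psi> t\<bar>"
        by (intro \<sigma>(2) \<psi>_in) auto
      then show "e (\<sigma> (\<psi> s)) (\<sigma> (\<psi> t)) \<le> 1 * (dist (\<psi> s) (\<psi> t) + dist (\<psi> s) (\<psi> t))"
        by (simp add: dist_real_def)
    qed simp
    then show "metric_ac (cone_dist e) a b ?\<gamma>"
      using \<alpha>_ac \<sigma>(1) \<psi>_in by (subst cone_dist_ac_iff[OF Z]) auto
    show "strict_mono_on {a..b} (\<lambda>t. fst (?\<gamma> t)) \<or> strict_mono_on {a..b} (\<lambda>t. - fst (?\<gamma> t))"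
      using curve by (simp add: cone_fd_def)
    show "AE t in lebesgue_on {a..b}. (\<lambda>t. fst (?\<gamma> t)) differentiable (at t) \<and>
        deriv (\<lambda>t. fst (?\<gamma> t)) t > 0 \<and>
        (let q = - (deriv (\<lambda>t. fst (?\<gamma> t)) t)\<^sup>2 + (f (fst (?\<gamma> t)))\<^sup>2 * (metric_deriv e (\<lambda>t. snd (?\<gamma> t)) t)\<^sup>2
         in if tl then q < 0 else q \<le> 0)"
    proof (rule AE_lebesgue_onI[OF NM], simp only: fst_conv snd_conv, intro conjI)
      fix t assume t: "t \<in> {a<..<b} - (N \<union> M)"
      show "\<alpha> differentiable (at t)" using N(2) t by (auto simp: real_differentiable_def)
      show "deriv \<alpha> t > 0" using N(3) t by blast
      have Dv: "f (\<alpha> t) * \<bar>D t\<bar> \<le> f (\<alpha> t) * v t" using M(2) t f0[of t] by (intro mult_left_mono) auto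
      have le: "f (\<alpha> t) * \<bar>D t\<bar> \<le> deriv \<alpha> t" using order_trans[OF Dv N(6)[rule_format]] t by blast
      have less: "f (\<alpha> t) * \<bar>D t\<bar> < deriv \<alpha> t" if tl using le_less_trans[OF Dv N(7)[rule_format, OF _ that]] t by blast
      have "(f (\<alpha> t) * \<bar>D t\<bar>)\<^sup>2 \<le> (deriv \<alpha> t)\<^sup>2" using le f0[of t] t by (intro power_mono) auto
      moreover have "(f (\<alpha> t) * \<bar>D t\<bar>)\<^sup>2 < (deriv \<alpha> t)\<^sup>2" if tl using less[OF that] f0[of t] t by (intro power_strict_mono) auto
      ultimately show "let q = - (deriv \<alpha> t)\<^sup>2 + (f (\<alpha> t))\<^sup>2 * (metric_deriv e (\<lambda>t. \<sigma> (\<psi> t)) t)\<^sup>2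
         in if tl then q < 0 else q \<le> 0"
        using md[of t] t by (simp add: Let_def power_mult_distrib)
    qed
  qed
  then interpret N: cone_curve Z e tl I f a b ?\<gamma>
    by unfold_locales (use f_cont f_pos in auto)
  have le: "lapse f d \<gamma> t \<le> lapse f e ?\<gamma> t" if t: "t \<in> {a<..<b} - (N \<union> M)" for t
  proof -
    have "\<bar>D t\<bar>\<^sup>2 \<le> (v t)\<^sup>2" using M(2) t by (intro power_mono) auto
    then have "(f (\<alpha> t))\<^sup>2 * (D t)\<^sup>2 \<le> (f (\<alpha> t))\<^sup>2 * (v t)\<^sup>2" by (intro mult_left_mono) auto
    then show ?thesis using md[of t] t by (simp add: lapse_def)
  qed
  have AEle: "AE t in lebesgue_on {a..b}. lapse f d \<gamma> t \<le> lapse f e ?\<gamma> t"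
    by (rule AE_lebesgue_onI[OF NM le])
  show "cone_L f d a b \<gamma> \<le> cone_L f e a b ?\<gamma>"
    unfolding cone_L_lapse by (rule integral_mono_AE[OF lapse_integrable N.lapse_integrable AEle])
  \<comment> \<open>Under equality a nonnegative difference of lapses has integral 0 and vanishes
    almost everywhere; as \<open>f\<close> is positive, the speeds agree too.\<close>
  assume "cone_L f d a b \<gamma> = cone_L f e a b ?\<gamma>"
  then have "(\<integral>t. lapse f e ?\<gamma> t - lapse f d \<gamma> t \<partial>lebesgue_on {a..b}) = 0"
    unfolding cone_L_lapse using lapse_integrable N.lapse_integrable by simp
  then have "AE t in lebesgue_on {a..b}. lapse f e ?\<gamma> t - lapse f d \<gamma> t = 0"
    using AEle by (subst (asm) integral_nonneg_eq_0_iff_AE) (auto intro: lapse_integrable N.lapse_integrable)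
  then obtain N' where N': "negligible N'" "\<forall>t\<in>{a..b} - N'. lapse f e ?\<gamma> t - lapse f d \<gamma> t = 0"
    by (rule AE_lebesgue_onE) (rule that)
  show "\<exists>N. negligible N \<and> (\<forall>t\<in>{a<..<b} - N. v t = \<bar>D t\<bar>)"
  proof (intro exI[of _ "N \<union> M \<union> N'"] conjI ballI)
    show "negligible (N \<union> M \<union> N')" by (rule negligible_Un[OF NM N'(1)])
    fix t assume t: "t \<in> {a<..<b} - (N \<union> M \<union> N')"
    then have "lapse f e ?\<gamma> t = lapse f d \<gamma> t" using N'(2) by auto
    then have "(f (\<alpha> t))\<^sup>2 * (D t)\<^sup>2 = (f (\<alpha> t))\<^sup>2 * (v t)\<^sup>2"
      using md[of t] t by (simp add: lapse_def)
    then have "\<bar>D t\<bar>\<^sup>2 = (v t)\<^sup>2" using f0[of t] t by simp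
    then show "v t = \<bar>D t\<bar>" using N(5) t by (metis DiffD1 DiffD2 DiffI UnCI abs_ge_zero power2_eq_imp_eq)
  qed
qed

end

section \<open>Comparison of time separations over different fibres\<close>

lemma faster_curve:
  fixes tl :: bool
  assumes X: "metric_carrier X d" and Z: "metric_carrier Z e" "z \<in> Z" "z' \<in> Z"
    and f: "continuous_on I f" "\<forall>t\<in>I. f t > 0"
    and \<gamma>: "cone_fd tl I f X d a b \<gamma>" "\<gamma> a = (s, w)" "\<gamma> b = (s', w')"
    and \<sigma>: "is_geod e Z z z' \<sigma>" and le: "e z z' \<le> d w w'"
  shows "\<exists>\<gamma>'. cone_fd tl I f Z e a b \<gamma>' \<and> \<gamma>' a = (s, z) \<and> \<gamma>' b = (s', z') \<and> cone_L f d a b \<gamma> \<le> cone_L f e a b \<gamma>'"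
proof -
  interpret cone_curve X d tl I f a b \<gamma>
    using X f \<gamma>(1) by (simp add: cone_curve_def cone_curve_axioms_def)
  interpret Z: metric_carrier Z e by fact
  define l where "l = e z z'"
  have \<sigma>': "\<sigma> 0 = z" "\<sigma> l = z'" "\<sigma> ` {0..l} \<subseteq> Z" "\<forall>s\<in>{0..l}. \<forall>t\<in>{0..l}. e (\<sigma> s) (\<sigma> t) = \<bar>s - t\<bar>"
    using \<sigma> by (auto simp: is_geod_def l_def)
  have wX: "w \<in> X" "w' \<in> X" using \<beta>_in[of a] \<beta>_in[of b] ab \<gamma> by auto
  have l0: "0 \<le> l" using Z.nonneg[OF Z(2,3)] by (simp add: l_def)
  \<comment> \<open>Truncation at \<open>l\<close> keeps the motion on the geodesic. It does not
    raise the speed, and because of \<open>l \<le> d w w'\<close> the value at \<open>b\<close> is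
    exactly \<open>l\<close>.\<close>
  define \<psi> where "\<psi> = (\<lambda>t. min (d w (\<beta> t)) l)"
  have lip: "\<bar>\<psi> r - \<psi> t\<bar> \<le> d (\<beta> r) (\<beta> t)" if "r \<in> {a..b}" "t \<in> {a..b}" for r t
  proof -
    have "\<bar>d w (\<beta> r) - d w (\<beta> t)\<bar> \<le> d (\<beta> r) (\<beta> t)"
      using dist_diff_le[OF wX(1) \<beta>_in[OF that(1)] wX(1) \<beta>_in[OF that(2)]] refl0[OF wX(1)] by simp
    then show ?thesis by (auto simp: \<psi>_def)
  qed
  have ac: "metric_ac dist a b \<psi>"
  proof (rule metric_ac_comparison[OF \<beta>_ac \<beta>_ac, of 1])
    fix r t assume rt: "a \<le> r" "r \<le> t" "t \<le> b"
    then have "0 \<le> d (\<beta> r) (\<beta> t)" by (intro nonneg \<beta>_in) auto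
    then show "dist (\<psi> r) (\<psi> t) \<le> 1 * (d (\<beta> r) (\<beta> t) + d (\<beta> r) (\<beta> t))"
      using lip[of r t] rt by (simp add: dist_real_def)
  qed simp
  have rng: "\<psi> ` {a..b} \<subseteq> {0..l}"
    using l0 wX(1) by (auto simp: \<psi>_def intro!: nonneg \<beta>_in)
  obtain M where M: "negligible M" "\<forall>t\<in>{a<..<b} - M. \<psi> differentiable (at t)"
    using ac_real_differentiable[OF ab ac] by blast
  obtain N where N: "negligible N" "\<forall>t\<in>{a<..<b} - N. ((\<lambda>h. d (\<beta> (t + h)) (\<beta> t) / \<bar>h\<bar>) \<longlongrightarrow> v t) (at 0)"
    by (rule regular) (rule that)
  have D: "\<forall>t\<in>{a<..<b} - (M \<union> N). (\<psi> has_real_derivative deriv \<psi> t) (at t) \<and> \<bar>deriv \<psi> t\<bar> \<le> v t"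
  proof
    fix t assume t: "t \<in> {a<..<b} - (M \<union> N)"
    then have d: "(\<psi> has_real_derivative deriv \<psi> t) (at t)"
      using M(2) by (simp add: DERIV_deriv_iff_real_differentiable)
    have "\<bar>deriv \<psi> t\<bar> \<le> v t"
      by (rule deriv_le_metric_deriv[OF _ _ d]) (use t lip N(2) in auto)
    with d show "(\<psi> has_real_derivative deriv \<psi> t) (at t) \<and> \<bar>deriv \<psi> t\<bar> \<le> v t" by blast
  qed
  have NM: "negligible (M \<union> N)" by (rule negligible_Un[OF M(1) N(1)])
  have \<sigma>1: "\<sigma> r \<in> Z" if "r \<in> {0..l}" for r using \<sigma>'(3) that by blast
  have \<sigma>2: "e (\<sigma> r) (\<sigma> t) = \<bar>r - t\<bar>" if "r \<in> {0..l}" "t \<in> {0..l}" for r t using \<sigma>'(4) that by blast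
  note tr = transfer[of Z e l \<sigma> \<psi> "M \<union> N" "deriv \<psi>", OF Z(1) \<sigma>1 \<sigma>2 ac rng NM D]
  have "(fst (\<gamma> a), \<sigma> (\<psi> a)) = (s, z)" "(fst (\<gamma> b), \<sigma> (\<psi> b)) = (s', z')"
    using \<gamma>(2,3) le l0 \<sigma>' wX by (auto simp: \<psi>_def refl0 l_def min_def)
  then show ?thesis using tr(1,2) by blast
qed

text \<open>If no admissible curve joins \<open>p\<close> to \<open>q\<close>, the left side is 0 by
  convention; that case is covered by the nonnegativity of the lengths on the right.\<close>

lemma gtau_mono:
  assumes le: "\<And>a b \<gamma>. C a b \<gamma> \<Longrightarrow> \<gamma> a = p \<Longrightarrow> \<gamma> b = q \<Longrightarrow>
      \<exists>a' b' \<gamma>'. C' a' b' \<gamma>' \<and> \<gamma>' a' = p' \<and> \<gamma>' b' = q' \<and> L a b \<gamma> \<le> L' a' b' \<gamma>'"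
    and pos: "\<And>a b \<gamma>. C' a b \<gamma> \<Longrightarrow> 0 \<le> L' a b \<gamma>"
  shows "gtau C L p q \<le> gtau C' L' p' q'"
proof (cases "\<exists>a b \<gamma>. C a b \<gamma> \<and> \<gamma> a = p \<and> \<gamma> b = q")
  case True
  then have ex: "\<exists>a b \<gamma>. C' a b \<gamma> \<and> \<gamma> a = p' \<and> \<gamma> b = q'"
  proof -
    obtain a b \<gamma> where "C a b \<gamma>" "\<gamma> a = p" "\<gamma> b = q" using True by blast
    from le[OF this] show ?thesis by blast
  qed
  have "Sup {ereal (L a b \<gamma>) | a b \<gamma>. C a b \<gamma> \<and> \<gamma> a = p \<and> \<gamma> b = q}
    \<le> Sup {ereal (L' a b \<gamma>) | a b \<gamma>. C' a b \<gamma> \<and> \<gamma> a = p' \<and> \<gamma> b = q'}"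
  proof (rule Sup_least, clarify)
    fix a b \<gamma> assume "C a b \<gamma>" "p = \<gamma> a" "q = \<gamma> b"
    then obtain a' b' \<gamma>' where *: "C' a' b' \<gamma>'" "\<gamma>' a' = p'" "\<gamma>' b' = q'" "L a b \<gamma> \<le> L' a' b' \<gamma>'"
      using le[of a b \<gamma>] by blast
    then have "ereal (L' a' b' \<gamma>') \<le> Sup {ereal (L' a b \<gamma>) | a b \<gamma>. C' a b \<gamma> \<and> \<gamma> a = p' \<and> \<gamma> b = q'}"
      by (intro Sup_upper) blast
    then show "ereal (L a b \<gamma>) \<le> Sup {ereal (L' a b \<gamma>) | a b \<gamma>. C' a b \<gamma> \<and> \<gamma> a = p' \<and> \<gamma> b = q'}"
      using *(4) by (meson ereal_less_eq(3) order_trans)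
  qed
  then show ?thesis using True ex by (simp add: gtau_def)
next
  case False
  have "0 \<le> gtau C' L' p' q'"
  proof (cases "\<exists>a b \<gamma>. C' a b \<gamma> \<and> \<gamma> a = p' \<and> \<gamma> b = q'")
    case True
    then obtain a b \<gamma> where *: "C' a b \<gamma>" "\<gamma> a = p'" "\<gamma> b = q'" by blast
    then have "ereal (L' a b \<gamma>) \<le> Sup {ereal (L' a b \<gamma>) | a b \<gamma>. C' a b \<gamma> \<and> \<gamma> a = p' \<and> \<gamma> b = q'}"
      by (intro Sup_upper) blast
    with pos[OF *(1)] have "0 \<le> Sup {ereal (L' a b \<gamma>) | a b \<gamma>. C' a b \<gamma> \<and> \<gamma> a = p' \<and> \<gamma> b = q'}"
      by (meson ereal_less_eq(5) order_trans)
    then show ?thesis unfolding gtau_def if_P[OF True] .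
  next
    case False
    show ?thesis unfolding gtau_def if_not_P[OF False] by simp
  qed
  moreover have "gtau C L p q = 0" unfolding gtau_def if_not_P[OF False] ..
  ultimately show ?thesis by simp
qed

lemma gtau_upper:
  "C a b \<gamma> \<Longrightarrow> \<gamma> a = p \<Longrightarrow> \<gamma> b = q \<Longrightarrow> ereal (L a b \<gamma>) \<le> gtau C L p q"
  unfolding gtau_def by (auto intro!: Sup_upper)

lemma cone_tau_mono:
  assumes X: "metric_carrier X d" and Z: "metric_carrier Z e" "z \<in> Z" "z' \<in> Z"
    and f: "continuous_on I f" "\<forall>t\<in>I. f t > 0"
    and \<sigma>: "is_geod e Z z z' \<sigma>" and le: "e z z' \<le> d w w'"
  shows "gtau (cone_fd False I f X d) (cone_L f d) (s, w) (s', w')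
    \<le> gtau (cone_fd False I f Z e) (cone_L f e) (s, z) (s', z')"
proof (rule gtau_mono)
  show "\<exists>a' b' \<gamma>'. cone_fd False I f Z e a' b' \<gamma>' \<and> \<gamma>' a' = (s, z) \<and> \<gamma>' b' = (s', z') \<and> cone_L f d a b \<gamma> \<le> cone_L f e a' b' \<gamma>'"
    if "cone_fd False I f X d a b \<gamma>" "\<gamma> a = (s, w)" "\<gamma> b = (s', w')" for a b \<gamma>
    using faster_curve[OF X Z f that \<sigma> le] by blast
  show "0 \<le> cone_L f e a b \<gamma>" if "cone_fd False I f Z e a b \<gamma>" for a b \<gamma>
  proof -
    interpret cone_curve Z e False I f a b \<gamma>
      using Z(1) f that by (simp add: cone_curve_def cone_curve_axioms_def)
    show ?thesis by (rule cone_L_nonneg)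
  qed
qed

lemma cone_timelike_mono:
  assumes X: "metric_carrier X d" and Z: "metric_carrier Z e" "z \<in> Z" "z' \<in> Z"
    and f: "continuous_on I f" "\<forall>t\<in>I. f t > 0"
    and \<sigma>: "is_geod e Z z z' \<sigma>" and le: "e z z' \<le> d w w'"
    and T: "grel (cone_fd True I f X d) (s, w) (s', w')"
  shows "grel (cone_fd True I f Z e) (s, z) (s', z')"
proof -
  obtain a b \<gamma> where "cone_fd True I f X d a b \<gamma>" "\<gamma> a = (s, w)" "\<gamma> b = (s', w')"
    using T by (auto simp: grel_def)
  from faster_curve[OF X Z f this \<sigma> le] show ?thesis by (auto simp: grel_def)
qed

text \<open>If the fibre component were longer than the distance of its endpoints, slowing it down
  uniformly would strictly increase the length.\<close>

lemma maximal_fibre: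
  assumes X: "metric_carrier X d" and f: "continuous_on I f" "\<forall>t\<in>I. f t > 0"
    and \<gamma>: "cone_fd False I f X d a b \<gamma>"
    and max: "ereal (cone_L f d a b \<gamma>) = gtau (cone_fd False I f X d) (cone_L f d) (\<gamma> a) (\<gamma> b)"
    and \<sigma>: "is_geod d X (snd (\<gamma> a)) (snd (\<gamma> b)) \<sigma>"
  obtains V where "continuous_on {a..b} V"
    "\<forall>r t. a \<le> r \<longrightarrow> r \<le> t \<longrightarrow> t \<le> b \<longrightarrow> d (snd (\<gamma> r)) (snd (\<gamma> t)) = V t - V r"
proof -
  interpret cone_curve X d False I f a b \<gamma>
    using X f \<gamma>(1) by (simp add: cone_curve_def cone_curve_axioms_def)
  obtain V N where V: "mono V" "continuous_on UNIV V" "metric_ac dist a b V"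
    and le: "\<forall>s t. s \<le> t \<longrightarrow> d (\<beta> (cl a b s)) (\<beta> (cl a b t)) \<le> V t - V s"
    and N: "negligible N" "\<forall>t\<in>{a<..<b} - N. (V has_real_derivative v t) (at t)"
    by (rule ac_curve_variation[OF ab \<beta>_ac \<beta>_img]) (rule that)
  have le': "d (\<beta> s) (\<beta> t) \<le> V t - V s" if "a \<le> s" "s \<le> t" "t \<le> b" for s t
    using le[rule_format, of s t] that by (simp add: cl_id)
  define l where "l = d (\<beta> a) (\<beta> b)"
  define \<Lambda> where "\<Lambda> = V b - V a"
  have in_ab: "\<beta> a \<in> X" "\<beta> b \<in> X" using \<beta>_in ab by auto
  have l: "0 \<le> l" "l \<le> \<Lambda>" using le'[of a b] ab nonneg[OF in_ab] by (auto simp: l_def \<Lambda>_def)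
  have "\<Lambda> \<le> l"
  proof (rule ccontr)
    assume "\<not> \<Lambda> \<le> l"
    then have \<Lambda>l: "l < \<Lambda>" by simp
    \<comment> \<open>Scaling by \<open>k\<close> makes the total variation \<open>\<Lambda>\<close>
      fit the distance \<open>l\<close> exactly, so the slowed motion along \<open>\<sigma>\<close>
      has the same endpoints.\<close>
    define k where "k = l / \<Lambda>"
    have k: "0 \<le> k" "k < 1" "k * \<Lambda> = l" using \<Lambda>l l by (auto simp: k_def)
    define \<psi> where "\<psi> = (\<lambda>t. k * (V t - V a))"
    have ac: "metric_ac dist a b \<psi>"
    proof (rule metric_ac_comparison[OF V(3) V(3), of 1])
      fix s t
      have "dist (\<psi> s) (\<psi> t) = k * dist (V s) (V t)"
        using k by (simp add: \<psi>_def dist_real_def abs_mult flip: right_diff_distrib)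
      also have "\<dots> \<le> 1 * dist (V s) (V t)" using k by (intro mult_right_mono) auto
      finally show "dist (\<psi> s) (\<psi> t) \<le> 1 * (dist (V s) (V t) + dist (V s) (V t))"
        by (rule order_trans) simp
    qed simp
    have rng: "\<psi> ` {a..b} \<subseteq> {0..l}"
    proof
      fix y assume "y \<in> \<psi> ` {a..b}"
      then obtain t where t: "t \<in> {a..b}" "y = k * (V t - V a)" by (auto simp: \<psi>_def)
      have "V a \<le> V t" "V t \<le> V b" using V(1) t by (auto simp: mono_def)
      then have "0 \<le> y" "y \<le> k * \<Lambda>" using k t by (auto simp: \<Lambda>_def intro!: mult_left_mono)
      then show "y \<in> {0..l}" using k by simp
    qed
    obtain N' where N': "negligible N'" "\<forall>t\<in>{a<..<b} - N'. v t \<ge> 0"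
      by (rule regular) (rule that)
    have NN: "negligible (N \<union> N')" by (rule negligible_Un[OF N(1) N'(1)])
    have D: "\<forall>t\<in>{a<..<b} - (N \<union> N'). (\<psi> has_real_derivative k * v t) (at t) \<and> \<bar>k * v t\<bar> \<le> v t"
    proof
      fix t assume t: "t \<in> {a<..<b} - (N \<union> N')"
      have "(\<psi> has_real_derivative k * (v t - 0)) (at t)"
        unfolding \<psi>_def using N(2) t by (intro DERIV_cmult DERIV_diff DERIV_const) auto
      moreover have "0 \<le> v t" using N'(2) t by blast
      then have "k * v t \<le> 1 * v t" "0 \<le> k * v t" using k by (intro mult_right_mono, auto)
      ultimately show "(\<psi> has_real_derivative k * v t) (at t) \<and> \<bar>k * v t\<bar> \<le> v t" by simp
    qed
    have \<sigma>1: "\<sigma> r \<in> X" if "r \<in> {0..l}" for r using \<sigma> that by (auto simp: is_geod_def l_def)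
    have \<sigma>2: "d (\<sigma> r) (\<sigma> t) = \<bar>r - t\<bar>" if "r \<in> {0..l}" "t \<in> {0..l}" for r t
      using \<sigma> that by (auto simp: is_geod_def l_def)
    note tr = transfer[of X d l \<sigma> \<psi> "N \<union> N'" "\<lambda>t. k * v t", OF X \<sigma>1 \<sigma>2 ac rng NN D]
    have ends: "(\<alpha> a, \<sigma> (\<psi> a)) = \<gamma> a" "(\<alpha> b, \<sigma> (\<psi> b)) = \<gamma> b"
      using \<sigma> k by (auto simp: \<psi>_def is_geod_def l_def \<Lambda>_def prod_eq_iff)
    have "ereal (cone_L f d a b (\<lambda>t. (\<alpha> t, \<sigma> (\<psi> t)))) \<le> ereal (cone_L f d a b \<gamma>)"
      unfolding max using tr(1) ends by (intro gtau_upper) auto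
    \<comment> \<open>Maximality forbids a gain, so the equality case of \<open>transfer\<close>
      applies: \<open>v = k * v\<close> with \<open>k < 1\<close> forces \<open>v = 0\<close>. Then
      \<open>V\<close> cannot increase, contrary to \<open>0 \<le> l < \<Lambda>\<close>.\<close>
    then have "cone_L f d a b \<gamma> = cone_L f d a b (\<lambda>t. (\<alpha> t, \<sigma> (\<psi> t)))"
      using tr(2) by simp
    then obtain M where M: "negligible M" "\<forall>t\<in>{a<..<b} - M. v t = \<bar>k * v t\<bar>"
      using tr(3) by blast
    have "- V a \<le> - V b"
    proof (rule ac_deriv_nonneg[OF less_imp_le[OF ab] _ negligible_Un[OF NN M(1)]])
      show "metric_ac dist a b (\<lambda>t. - V t)"
        by (rule metric_ac_comparison[OF V(3) V(3), of 1]) (auto simp: dist_real_def abs_minus_commute)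
      fix t assume t: "t \<in> {a<..<b} - ((N \<union> N') \<union> M)"
      have "v t = k * v t" using M(2) N'(2) t k(1) by (metis (no_types, lifting) DiffD1 DiffD2 DiffI UnCI abs_of_nonneg mult_nonneg_nonneg)
      then have "(1 - k) * v t = 0" by (simp add: left_diff_distrib)
      then have "v t = 0" using k by simp
      moreover have "((\<lambda>t. - V t) has_real_derivative - v t) (at t)" using N(2) t by (intro DERIV_minus) auto
      ultimately show "\<exists>D\<ge>0. ((\<lambda>t. - V t) has_real_derivative D) (at t)" by auto
    qed
    then show False using \<Lambda>l l by (simp add: \<Lambda>_def)
  qed
  then have eq: "d (\<beta> a) (\<beta> b) = V b - V a" using l by (simp add: l_def \<Lambda>_def)
  \<comment> \<open>Equality over \<open>[a, b]\<close> localizes: each of the pieces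
    \<open>[a, r]\<close>, \<open>[r, t]\<close>, \<open>[t, b]\<close> satisfies
    \<open>le'\<close>, and by the triangle inequality none of these can be strict.\<close>
  have "d (\<beta> r) (\<beta> t) = V t - V r" if rt: "a \<le> r" "r \<le> t" "t \<le> b" for r t
  proof -
    have "\<beta> r \<in> X" "\<beta> t \<in> X" using rt by (auto intro!: \<beta>_in)
    then have "V b - V a \<le> d (\<beta> a) (\<beta> r) + (d (\<beta> r) (\<beta> t) + d (\<beta> t) (\<beta> b))"
      using tri[of "\<beta> a" "\<beta> r" "\<beta> b"] tri[of "\<beta> r" "\<beta> t" "\<beta> b"] in_ab eq by linarith
    then show ?thesis using le'[of a r] le'[of r t] le'[of t b] rt by linarith
  qed
  then show ?thesis using that[of V] continuous_on_subset[OF V(2)] by blast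
qed

text \<open>A maximal curve moves along a minimizing geodesic \<open>c\<close> of the fibre, and the same motion
  along any geodesic of the same length in another fibre is at least as long.\<close>

lemma maximal_geodesic:
  assumes X: "metric_carrier X d" and f: "continuous_on I f" "\<forall>t\<in>I. f t > 0"
    and \<gamma>: "cone_fd False I f X d a b \<gamma>" "\<gamma> a = (s, w)" "\<gamma> b = (s', w')"
    and max: "ereal (cone_L f d a b \<gamma>) = gtau (cone_fd False I f X d) (cone_L f d) (s, w) (s', w')"
    and \<sigma>: "is_geod d X w w' \<sigma>"
  obtains c where "is_geod d X w w' c" "c ` {0..d w w'} \<subseteq> (\<lambda>t. snd (\<gamma> t)) ` {a..b}"
    "\<forall>t\<in>{a..b}. d w (snd (\<gamma> t)) \<in> {0..d w w'}" "\<forall>t\<in>{a..b}. c (d w (snd (\<gamma> t))) = snd (\<gamma> t)"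
    "\<And>Z e z z' \<tau>. metric_carrier Z e \<Longrightarrow> z \<in> Z \<Longrightarrow> z' \<in> Z \<Longrightarrow> is_geod e Z z z' \<tau> \<Longrightarrow> e z z' = d w w' \<Longrightarrow>
       cone_fd False I f Z e a b (\<lambda>t. (fst (\<gamma> t), \<tau> (d w (snd (\<gamma> t))))) \<and>
       cone_L f d a b \<gamma> \<le> cone_L f e a b (\<lambda>t. (fst (\<gamma> t), \<tau> (d w (snd (\<gamma> t)))))"
proof -
  interpret cone_curve X d False I f a b \<gamma>
    using X f \<gamma>(1) by (simp add: cone_curve_def cone_curve_axioms_def)
  obtain V where V: "continuous_on {a..b} V" "\<forall>r t. a \<le> r \<longrightarrow> r \<le> t \<longrightarrow> t \<le> b \<longrightarrow> d (\<beta> r) (\<beta> t) = V t - V r"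
    by (rule maximal_fibre[OF X f \<gamma>(1), of \<sigma>]) (use max \<sigma> \<gamma> that in auto)
  have w: "\<beta> a = w" "\<beta> b = w'" "w \<in> X" "w' \<in> X" using \<gamma> \<beta>_in[of a] \<beta>_in[of b] ab by auto
  \<comment> \<open>The distance from the start serves as arc length along the fibre
    component.\<close>
  define \<phi> where "\<phi> = (\<lambda>t. d w (\<beta> t))"
  have \<phi>V: "\<phi> t = V t - V a" if "t \<in> {a..b}" for t using V(2) that w by (auto simp: \<phi>_def)
  have d\<phi>: "d (\<beta> r) (\<beta> t) = \<bar>\<phi> r - \<phi> t\<bar>" if rt: "r \<in> {a..b}" "t \<in> {a..b}" for r t
  proof -
    have nn: "0 \<le> d (\<beta> r) (\<beta> t)" "0 \<le> d (\<beta> t) (\<beta> r)" using rt by (auto intro!: nonneg \<beta>_in)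
    have "d (\<beta> r) (\<beta> t) = d (\<beta> t) (\<beta> r)" by (intro sym \<beta>_in rt)
    then show ?thesis
      using V(2)[rule_format, of r t] V(2)[rule_format, of t r] rt nn \<phi>V[OF rt(1)] \<phi>V[OF rt(2)]
      by (cases "r \<le> t") auto
  qed
  define l where "l = d w w'"
  have \<phi>ab: "\<phi> a = 0" "\<phi> b = l" using w by (auto simp: \<phi>_def l_def refl0)
  have \<phi>_in: "\<phi> t \<in> {0..l}" if "t \<in> {a..b}" for t
  proof -
    have "0 \<le> \<phi> t" using that w(3) by (auto simp: \<phi>_def intro!: nonneg \<beta>_in)
    moreover have "0 \<le> d (\<beta> t) (\<beta> b)" using that by (auto intro!: nonneg \<beta>_in)
    ultimately show ?thesis using V(2)[rule_format, of t b] \<phi>V[of t] \<phi>V[of b] \<phi>ab that by auto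
  qed
  have surj: "\<exists>t\<in>{a..b}. \<phi> t = y" if "y \<in> {0..l}" for y
  proof -
    have c\<phi>: "continuous_on {a..b} \<phi>"
      by (rule continuous_on_eq[of _ "\<lambda>t. V t - V a"]) (auto intro!: continuous_intros V(1) simp: \<phi>V)
    show ?thesis using IVT'[of \<phi> a y b] c\<phi> that \<phi>ab ab by auto
  qed
  \<comment> \<open>The fibre component may pause, so several times can share one value of
    \<open>\<phi>\<close>; they carry the same point, hence the choice is immaterial.\<close>
  define c where "c = (\<lambda>y. \<beta> (SOME t. t \<in> {a..b} \<and> \<phi> t = y))"
  have c: "\<exists>t\<in>{a..b}. \<phi> t = y \<and> c y = \<beta> t" if "y \<in> {0..l}" for y
    using someI_ex[of "\<lambda>t. t \<in> {a..b} \<and> \<phi> t = y"] surj[OF that] unfolding c_def by blast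
  have c\<phi>: "c (\<phi> t) = \<beta> t" if t: "t \<in> {a..b}" for t
  proof -
    obtain r where r: "r \<in> {a..b}" "\<phi> r = \<phi> t" "c (\<phi> t) = \<beta> r" using c[OF \<phi>_in[OF t]] by blast
    then have "d (\<beta> r) (\<beta> t) = 0" using d\<phi>[OF r(1) t] by simp
    then show ?thesis using zero_iff[OF \<beta>_in[OF r(1)] \<beta>_in[OF t]] r by simp
  qed
  show ?thesis
  proof (rule that)
    show "is_geod d X w w' c"
      unfolding is_geod_def l_def[symmetric]
    proof (intro conjI ballI)
      show "c 0 = w" using c\<phi>[of a] \<phi>ab w ab by simp
      show "c l = w'" using c\<phi>[of b] \<phi>ab w ab by simp
      show "c ` {0..l} \<subseteq> X"
      proof
        fix x assume "x \<in> c ` {0..l}"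
        then obtain y where "y \<in> {0..l}" "x = c y" by blast
        then show "x \<in> X" using c[of y] \<beta>_in by auto
      qed
      fix x y assume "x \<in> {0..l}" "y \<in> {0..l}"
      then obtain r t where "r \<in> {a..b}" "t \<in> {a..b}" "\<phi> r = x" "\<phi> t = y" "c x = \<beta> r" "c y = \<beta> t"
        using c by meson
      then show "d (c x) (c y) = \<bar>x - y\<bar>" using d\<phi> by simp
    qed
    show "c ` {0..d w w'} \<subseteq> \<beta> ` {a..b}"
    proof
      fix x assume "x \<in> c ` {0..d w w'}"
      then obtain y where "y \<in> {0..l}" "x = c y" by (auto simp: l_def)
      then show "x \<in> \<beta> ` {a..b}" using c[of y] by auto
    qed
    show "\<forall>t\<in>{a..b}. d w (\<beta> t) \<in> {0..d w w'}" using \<phi>_in by (simp add: \<phi>_def l_def)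
    show "\<forall>t\<in>{a..b}. c (d w (\<beta> t)) = \<beta> t" using c\<phi> by (simp add: \<phi>_def)
    fix Z :: "'b set" and e z z' \<tau>
    assume Z: "metric_carrier Z e" "z \<in> Z" "z' \<in> Z" and \<tau>: "is_geod e Z z z' \<tau>" and len: "e z z' = d w w'"
    have ac: "metric_ac dist a b \<phi>"
    proof (rule metric_ac_comparison[OF \<beta>_ac \<beta>_ac, of 1])
      fix r t assume "a \<le> r" "r \<le> t" "t \<le> b"
      then show "dist (\<phi> r) (\<phi> t) \<le> 1 * (d (\<beta> r) (\<beta> t) + d (\<beta> r) (\<beta> t))"
        using d\<phi>[of r t] by (simp add: dist_real_def)
    qed simp
    obtain M where M: "negligible M" "\<forall>t\<in>{a<..<b} - M. \<phi> differentiable (at t)"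
      using ac_real_differentiable[OF ab ac] by blast
    obtain N where N: "negligible N" "\<forall>t\<in>{a<..<b} - N. ((\<lambda>h. d (\<beta> (t + h)) (\<beta> t) / \<bar>h\<bar>) \<longlongrightarrow> v t) (at 0)"
      by (rule regular) (rule that)
    have D: "\<forall>t\<in>{a<..<b} - (M \<union> N). (\<phi> has_real_derivative deriv \<phi> t) (at t) \<and> \<bar>deriv \<phi> t\<bar> \<le> v t"
    proof
      fix t assume t: "t \<in> {a<..<b} - (M \<union> N)"
      then have d: "(\<phi> has_real_derivative deriv \<phi> t) (at t)"
        using M(2) by (simp add: DERIV_deriv_iff_real_differentiable)
      have "\<bar>deriv \<phi> t\<bar> \<le> v t"
        by (rule deriv_le_metric_deriv[OF _ _ d]) (use t d\<phi> N(2) in auto)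
      with d show "(\<phi> has_real_derivative deriv \<phi> t) (at t) \<and> \<bar>deriv \<phi> t\<bar> \<le> v t" by blast
    qed
    have \<tau>1: "\<tau> r \<in> Z" if "r \<in> {0..l}" for r using \<tau> that len by (auto simp: is_geod_def l_def)
    have \<tau>2: "e (\<tau> r) (\<tau> t) = \<bar>r - t\<bar>" if "r \<in> {0..l}" "t \<in> {0..l}" for r t
      using \<tau> that len by (auto simp: is_geod_def l_def)
    have rng: "\<phi> ` {a..b} \<subseteq> {0..l}" using \<phi>_in by blast
    show "cone_fd False I f Z e a b (\<lambda>t. (\<alpha> t, \<tau> (d w (\<beta> t)))) \<and>
       cone_L f d a b \<gamma> \<le> cone_L f e a b (\<lambda>t. (\<alpha> t, \<tau> (d w (\<beta> t))))"
      using transfer(1,2)[of Z e l \<tau> \<phi> "M \<union> N" "deriv \<phi>", OF Z(1) \<tau>1 \<tau>2 ac rng negligible_Un[OF M(1) N(1)] D]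
      by (simp add: \<phi>_def)
  qed
qed

section \<open>The model spaces\<close>

text \<open>The properties of a model surface on which the argument relies. The last clause realizes
  every admissible triple of small side lengths by a triangle with one vertex at a base point; it
  supplies the comparison triangles without reference to a particular law of cosines.\<close>

definition planar_model :: "'a set \<Rightarrow> ('a \<Rightarrow> 'a \<Rightarrow> real) \<Rightarrow> bool" where
  "planar_model Z e \<longleftrightarrow> metric_carrier Z e \<and> (\<forall>p\<in>Z. \<forall>q\<in>Z. \<exists>c. is_geod e Z p q c) \<and>
    (\<exists>z\<in>Z. \<exists>\<rho>>0. \<forall>a b c. 0 \<le> a \<and> a \<le> \<rho> \<and> 0 \<le> b \<and> b \<le> \<rho> \<and> 0 \<le> c \<and> c \<le> \<rho> \<and> a \<le> b + c \<and> b \<le> a + c \<and> c \<le> a + b \<longrightarrow>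
       (\<exists>q\<in>Z. \<exists>s\<in>Z. e z q = a \<and> e q s = b \<and> e z s = c))"

lemma planar_modelI:
  assumes "metric_carrier Z e" "\<And>p q. p \<in> Z \<Longrightarrow> q \<in> Z \<Longrightarrow> \<exists>c. is_geod e Z p q c"
    and "z \<in> Z" "\<rho> > 0"
    and "\<And>a b c. 0 \<le> a \<Longrightarrow> a \<le> \<rho> \<Longrightarrow> 0 \<le> b \<Longrightarrow> b \<le> \<rho> \<Longrightarrow> 0 \<le> c \<Longrightarrow> c \<le> \<rho> \<Longrightarrow> a \<le> b + c \<Longrightarrow> b \<le> a + c \<Longrightarrow> c \<le> a + b \<Longrightarrow>
       \<exists>q\<in>Z. \<exists>s\<in>Z. e z q = a \<and> e q s = b \<and> e z s = c"
  shows "planar_model Z e"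
  unfolding planar_model_def
proof (intro conjI ballI)
  show "\<exists>z\<in>Z. \<exists>\<rho>>0. \<forall>a b c. 0 \<le> a \<and> a \<le> \<rho> \<and> 0 \<le> b \<and> b \<le> \<rho> \<and> 0 \<le> c \<and> c \<le> \<rho> \<and> a \<le> b + c \<and> b \<le> a + c \<and> c \<le> a + b \<longrightarrow>
       (\<exists>q\<in>Z. \<exists>s\<in>Z. e z q = a \<and> e q s = b \<and> e z s = c)"
    by (rule bexI[OF _ assms(3)], rule exI[of _ \<rho>]) (use assms(4,5) in auto)
qed (use assms(1,2) in auto)

text \<open>Solves a law of cosines for the cosine of the angle, up to its sign convention; the
  bounds on \<open>R\<close> correspond to degenerate triangles. For \<open>Q = 0\<close> the angle
  is arbitrary.\<close>

lemma affine_solution: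
  fixes P Q R :: real
  assumes "0 \<le> Q" "P - Q \<le> R" "R \<le> P + Q"
  obtains \<kappa> where "-1 \<le> \<kappa>" "\<kappa> \<le> 1" "P + Q * \<kappa> = R"
proof (cases "Q = 0")
  case True then show ?thesis using that[of 0] assms by simp
next
  case False
  then show ?thesis using that[of "(R - P) / Q"] assms by (simp add: field_simps)
qed

text \<open>A homothety by \<open>k = sqrt \<bar>K\<bar>\<close> reduces the curved models to
  curvature 1 and -1.\<close>

lemma planar_model_scale:
  fixes S :: "'a::real_vector set"
  assumes "planar_model S \<delta>" and k: "k > 0"
  shows "planar_model {x. k *\<^sub>R x \<in> S} (\<lambda>x y. \<delta> (k *\<^sub>R x) (k *\<^sub>R y) / k)" (is "planar_model ?Z ?e")
proof -
  interpret metric_carrier S \<delta> using assms by (simp add: planar_model_def)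
  obtain z \<rho> where z: "z \<in> S" "\<rho> > 0" "\<And>a b c. 0 \<le> a \<and> a \<le> \<rho> \<and> 0 \<le> b \<and> b \<le> \<rho> \<and> 0 \<le> c \<and> c \<le> \<rho> \<and> a \<le> b + c \<and> b \<le> a + c \<and> c \<le> a + b \<Longrightarrow>
       \<exists>q\<in>S. \<exists>s\<in>S. \<delta> z q = a \<and> \<delta> q s = b \<and> \<delta> z s = c"
    using assms(1) unfolding planar_model_def by blast
  have inv: "(1 / k) *\<^sub>R x \<in> ?Z" "k *\<^sub>R (1 / k) *\<^sub>R x = x" if "x \<in> S" for x using that k by auto
  show ?thesis
  proof (rule planar_modelI)
    show "metric_carrier ?Z ?e"
    proof
      fix x y w assume "x \<in> ?Z" "y \<in> ?Z" "w \<in> ?Z"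
      then have "\<delta> (k *\<^sub>R x) (k *\<^sub>R w) \<le> \<delta> (k *\<^sub>R x) (k *\<^sub>R y) + \<delta> (k *\<^sub>R y) (k *\<^sub>R w)" by (simp add: tri)
      then show "?e x w \<le> ?e x y + ?e y w" using k by (simp add: add_divide_distrib[symmetric] divide_right_mono)
    qed (use k sym in \<open>auto simp: nonneg zero_iff\<close>)
    show "(1 / k) *\<^sub>R z \<in> ?Z" using inv z by blast
    show "\<rho> / k > 0" using z k by simp
    fix p q assume pq: "p \<in> ?Z" "q \<in> ?Z"
    then obtain c where c: "is_geod \<delta> S (k *\<^sub>R p) (k *\<^sub>R q) c" using assms(1) unfolding planar_model_def by blast
    have "is_geod ?e ?Z p q (\<lambda>t. (1 / k) *\<^sub>R c (k * t))"
      unfolding is_geod_def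
    proof (intro conjI ballI)
      have *: "k * t \<in> {0..\<delta> (k *\<^sub>R p) (k *\<^sub>R q)}" if "t \<in> {0..?e p q}" for t
        using that k by (auto simp: field_simps)
      show "(1 / k) *\<^sub>R c (k * 0) = p" "(1 / k) *\<^sub>R c (k * ?e p q) = q" using c k by (auto simp: is_geod_def)
      show "(\<lambda>t. (1 / k) *\<^sub>R c (k * t)) ` {0..?e p q} \<subseteq> ?Z"
      proof
        fix x assume "x \<in> (\<lambda>t. (1 / k) *\<^sub>R c (k * t)) ` {0..?e p q}"
        then obtain t where t: "t \<in> {0..?e p q}" "x = (1 / k) *\<^sub>R c (k * t)" by blast
        then have "c (k * t) \<in> S" using c *[OF t(1)] unfolding is_geod_def by blast
        then show "x \<in> ?Z" using inv t by blast
      qed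
      fix s t assume st: "s \<in> {0..?e p q}" "t \<in> {0..?e p q}"
      then have "\<delta> (c (k * s)) (c (k * t)) = \<bar>k * s - k * t\<bar>" using c *[OF st(1)] *[OF st(2)] by (auto simp: is_geod_def)
      then show "?e ((1 / k) *\<^sub>R c (k * s)) ((1 / k) *\<^sub>R c (k * t)) = \<bar>s - t\<bar>"
        using k by (simp add: right_diff_distrib[symmetric] abs_mult)
    qed
    then show "\<exists>c. is_geod ?e ?Z p q c" by blast
  next
    fix a b c assume *: "0 \<le> a" "a \<le> \<rho> / k" "0 \<le> b" "b \<le> \<rho> / k" "0 \<le> c" "c \<le> \<rho> / k" "a \<le> b + c" "b \<le> a + c" "c \<le> a + b"
    have "\<exists>q\<in>S. \<exists>s\<in>S. \<delta> z q = k * a \<and> \<delta> q s = k * b \<and> \<delta> z s = k * c"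
      using * k mult_left_mono[of a "b + c" k] mult_left_mono[of b "a + c" k] mult_left_mono[of c "a + b" k]
      by (intro z(3)) (auto simp: distrib_left pos_le_divide_eq mult.commute[of k])
    then obtain q s where "q \<in> S" "s \<in> S" "\<delta> z q = k * a" "\<delta> q s = k * b" "\<delta> z s = k * c" by blast
    then show "\<exists>q\<in>?Z. \<exists>s\<in>?Z. ?e ((1 / k) *\<^sub>R z) q = a \<and> ?e q s = b \<and> ?e ((1 / k) *\<^sub>R z) s = c"
      using k by (intro bexI[of _ "(1 / k) *\<^sub>R q"] bexI[of _ "(1 / k) *\<^sub>R s"]) auto
  qed
qed

section \<open>The unit sphere\<close>

text \<open>\<open>u\<close> is the normalized component of \<open>y\<close> orthogonal to
  \<open>x\<close>. If \<open>y\<close> is \<open>x\<close> or \<open>- x\<close> there is no such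
  direction, and any unit vector orthogonal to \<open>x\<close> serves, its coefficient being
  0.\<close>

lemma sphere_polar:
  fixes x y :: "real^3"
  assumes "x \<bullet> x = 1" "y \<bullet> y = 1"
  obtains u where "u \<bullet> u = 1" "x \<bullet> u = 0" "y = cos (arccos (x \<bullet> y)) *\<^sub>R x + sin (arccos (x \<bullet> y)) *\<^sub>R u"
proof -
  have nm: "norm x = 1" "norm y = 1" using assms by (auto simp: norm_eq_1)
  have b: "-1 \<le> x \<bullet> y" "x \<bullet> y \<le> 1"
    using Cauchy_Schwarz_ineq2[of x y] nm by auto
  define C where "C = x \<bullet> y"
  define s where "s = sqrt (1 - C\<^sup>2)"
  have cs: "cos (arccos (x \<bullet> y)) = C" "sin (arccos (x \<bullet> y)) = s"
    using b by (auto simp: C_def s_def sin_arccos)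
  have "C\<^sup>2 \<le> 1" using b by (simp add: C_def abs_square_le_1 abs_le_iff)
  then have s2: "s\<^sup>2 = 1 - C\<^sup>2" by (simp add: s_def)
  define w where "w = y - C *\<^sub>R x"
  have w: "x \<bullet> w = 0" "w \<bullet> w = s\<^sup>2"
    using assms s2 by (auto simp: w_def inner_diff_left inner_diff_right C_def[symmetric] inner_commute[of y x] power2_eq_square algebra_simps)
  show ?thesis
  proof (cases "s = 0")
    case True
    then have "w = 0" using w by simp
    then have y: "y = C *\<^sub>R x" by (simp add: w_def)
    obtain u0 :: "real^3" where u0: "u0 \<noteq> 0" "orthogonal x u0"
      using orthogonal_to_vector_exists[of x] by auto
    show ?thesis
      by (rule that[of "(1 / norm u0) *\<^sub>R u0"]) (use u0 y cs True in \<open>auto simp: orthogonal_def dot_square_norm power2_eq_square\<close>)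
  next
    case False
    show ?thesis
      by (rule that[of "(1 / s) *\<^sub>R w"]) (use w False cs in \<open>auto simp: w_def power2_eq_square\<close>)
  qed
qed

lemma sphere_model: "planar_model {x::real^3. x \<bullet> x = 1} (\<lambda>x y. arccos (x \<bullet> y))" (is "planar_model ?S ?d")
proof -
  have b: "-1 \<le> x \<bullet> y" "x \<bullet> y \<le> 1" if "x \<bullet> x = 1" "y \<bullet> y = 1" for x y :: "real^3"
    using Cauchy_Schwarz_ineq2[of x y] that by (auto simp: norm_eq_1[symmetric])
  have acos: "arccos (cos t) = \<bar>t\<bar>" if "\<bar>t\<bar> \<le> pi" for t :: real
    using that arccos_cos[of t] arccos_cos[of "-t"] by (cases "t \<ge> 0") auto
  show ?thesis
  proof (rule planar_modelI)
    show "metric_carrier ?S ?d"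
    proof
      fix x y z :: "real^3" assume xyz: "x \<in> ?S" "y \<in> ?S" "z \<in> ?S"
      show "0 \<le> ?d x y" using xyz b by (auto intro: arccos_lbound)
      show "?d x y = ?d y x" by (simp add: inner_commute)
      obtain u where u: "y = cos (?d x y) *\<^sub>R x + sin (?d x y) *\<^sub>R u" using xyz sphere_polar[of x y] by auto
      show "?d x y = 0 \<longleftrightarrow> x = y" using u xyz by auto
      define A B where "A = ?d y x" and "B = ?d y z"
      obtain u where u: "u \<bullet> u = 1" "y \<bullet> u = 0" "x = cos A *\<^sub>R y + sin A *\<^sub>R u"
        using xyz sphere_polar[of y x] by (auto simp: A_def)
      obtain w where w: "w \<bullet> w = 1" "y \<bullet> w = 0" "z = cos B *\<^sub>R y + sin B *\<^sub>R w"
        using xyz sphere_polar[of y z] by (auto simp: B_def)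
      have AB: "0 \<le> A" "A \<le> pi" "0 \<le> B" "B \<le> pi"
        using xyz b by (auto simp: A_def B_def arccos_lbound arccos_ubound)
      \<comment> \<open>In polar coordinates at the middle point \<open>y\<close>, the inner product
        is smallest when \<open>u\<close> and \<open>w\<close> are opposite. For
        \<open>A + B > pi\<close> the bound is trivial, as no distance exceeds
        \<open>pi\<close>.\<close>
      have "?d x z \<le> A + B"
      proof (cases "A + B \<le> pi")
        case True
        have "x \<bullet> z = cos A * cos B + sin A * sin B * (u \<bullet> w)"
          unfolding u(3) w(3) using u w xyz
          by (simp add: inner_add_left inner_add_right inner_commute[of u y])
        moreover have "sin A * sin B * (u \<bullet> w) \<ge> sin A * sin B * (- 1)"
          using b[OF u(1) w(1)] AB by (intro mult_left_mono mult_nonneg_nonneg sin_ge_zero) auto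
        ultimately have "cos (A + B) \<le> x \<bullet> z" by (simp add: cos_add)
        then have "?d x z \<le> arccos (cos (A + B))" using b xyz by (intro arccos_le_arccos) auto
        then show ?thesis using acos[of "A + B"] True AB by simp
      next
        case False
        then show ?thesis using arccos_ubound[of "x \<bullet> z"] b xyz by force
      qed
      then show "?d x z \<le> ?d x y + ?d y z" by (simp add: A_def B_def inner_commute)
    qed
    define z :: "real^3" where "z = vector [1, 0, 0]"
    show "z \<in> ?S" by (simp add: z_def inner_vec_def sum_3 vector_3)
    \<comment> \<open>Sides up to \<open>pi / 2\<close> keep \<open>A + C\<close> in
      \<open>[0, pi]\<close>, where \<open>cos\<close> is decreasing.\<close>
    show "pi / 2 > 0" by simp
    fix p q :: "real^3" assume pq: "p \<in> ?S" "q \<in> ?S"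
    define l where "l = ?d p q"
    obtain u where u: "u \<bullet> u = 1" "p \<bullet> u = 0" "q = cos l *\<^sub>R p + sin l *\<^sub>R u"
      using pq sphere_polar[of p q] by (auto simp: l_def)
    define c where "c = (\<lambda>t. cos t *\<^sub>R p + sin t *\<^sub>R u)"
    have cc: "c s \<bullet> c t = cos (s - t)" for s t
      using pq u by (simp add: c_def inner_add_left inner_add_right inner_commute[of u p] cos_diff)
    have l: "l \<le> pi" using b pq by (auto simp: l_def arccos_ubound)
    have "is_geod ?d ?S p q c"
      unfolding is_geod_def l_def[symmetric]
    proof (intro conjI ballI)
      show "c 0 = p" "c l = q" using u(3) by (auto simp: c_def)
      show "c ` {0..l} \<subseteq> ?S" using cc by auto
      fix s t assume "s \<in> {0..l}" "t \<in> {0..l}"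
      then show "?d (c s) (c t) = \<bar>s - t\<bar>" unfolding cc using l by (intro acos) auto
    qed
    then show "\<exists>c. is_geod ?d ?S p q c" by blast
  next
    fix A B C :: real
    assume *: "0 \<le> A" "A \<le> pi / 2" "0 \<le> B" "B \<le> pi / 2" "0 \<le> C" "C \<le> pi / 2" "A \<le> B + C" "B \<le> A + C" "C \<le> A + B"
    have Q: "0 \<le> sin A * sin C" using * by (intro mult_nonneg_nonneg sin_ge_zero) auto
    have "cos (A + C) \<le> cos B" using * by (intro cos_monotone_0_pi_le) auto
    moreover have "cos B \<le> cos \<bar>A - C\<bar>" using * by (intro cos_monotone_0_pi_le) auto
    ultimately obtain \<kappa> where \<kappa>: "-1 \<le> \<kappa>" "\<kappa> \<le> 1" "cos A * cos C + (sin A * sin C) * \<kappa> = cos B"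
      using affine_solution[OF Q, of "cos A * cos C" "cos B"] by (auto simp: cos_add cos_diff)
    define r where "r = sqrt (1 - \<kappa>\<^sup>2)"
    have "\<kappa>\<^sup>2 \<le> 1" using \<kappa> by (simp add: abs_square_le_1 abs_le_iff)
    then have r: "\<kappa> * \<kappa> + r * r = 1" by (simp add: r_def power2_eq_square)
    \<comment> \<open>Seen from the base point \<open>(1, 0, 0)\<close>, \<open>q\<close> lies at
      distance \<open>A\<close> in a fixed direction and \<open>s\<close> at distance
      \<open>C\<close> in a direction at angle \<open>arccos \<kappa>\<close> to it.\<close>
    define q s :: "real^3" where "q = vector [cos A, sin A, 0]" and "s = vector [cos C, sin C * \<kappa>, sin C * r]"
    have "q \<bullet> q = 1" by (simp add: q_def inner_vec_def sum_3 vector_3 flip: power2_eq_square)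
    moreover have "s \<bullet> s = 1"
    proof -
      have "s \<bullet> s = cos C * cos C + sin C * sin C * (\<kappa> * \<kappa> + r * r)"
        by (simp add: s_def inner_vec_def sum_3 vector_3 algebra_simps)
      then show ?thesis unfolding r by (simp flip: power2_eq_square)
    qed
    moreover have "q \<bullet> s = cos B" using \<kappa>(3) by (simp add: q_def s_def inner_vec_def sum_3 vector_3 algebra_simps)
    moreover have "vector [1, 0, 0] \<bullet> q = cos A" "vector [1, 0, 0] \<bullet> s = cos C"
      by (auto simp: q_def s_def inner_vec_def sum_3 vector_3)
    ultimately show "\<exists>q\<in>?S. \<exists>s\<in>?S. ?d (vector [1, 0, 0]) q = A \<and> ?d q s = B \<and> ?d (vector [1, 0, 0]) s = C"
      using * by (intro bexI[of _ q] bexI[of _ s]) (auto simp: acos)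
  qed
qed

section \<open>The Euclidean plane\<close>

lemma plane_model: "planar_model {x::real^3. x $ 3 = 0} dist" (is "planar_model ?S dist")
proof (rule planar_modelI)
  show "metric_carrier ?S dist" by unfold_locales (auto simp: dist_commute dist_triangle)
  show "(0::real^3) \<in> ?S" by simp
  show "(1::real) > 0" by simp
  fix p q :: "real^3" assume pq: "p \<in> ?S" "q \<in> ?S"
  define c where "c = (\<lambda>t. p + (t / dist p q) *\<^sub>R (q - p))"
  have "is_geod dist ?S p q c"
    unfolding is_geod_def
  proof (intro conjI ballI)
    show "c 0 = p" "c (dist p q) = q" by (auto simp: c_def)
    show "c ` {0..dist p q} \<subseteq> ?S" using pq by (auto simp: c_def)
    fix s t assume st: "s \<in> {0..dist p q}" "t \<in> {0..dist p q}"
    have "c s - c t = ((s - t) / dist p q) *\<^sub>R (q - p)" by (simp add: c_def algebra_simps diff_divide_distrib)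
    then have "dist (c s) (c t) = \<bar>(s - t) / dist p q\<bar> * dist p q" by (simp add: dist_norm norm_minus_commute)
    then show "dist (c s) (c t) = \<bar>s - t\<bar>" using st by (cases "p = q") auto
  qed
  then show "\<exists>c. is_geod dist ?S p q c" by blast
next
  fix A B C :: real
  assume *: "0 \<le> A" "A \<le> 1" "0 \<le> B" "B \<le> 1" "0 \<le> C" "C \<le> 1" "A \<le> B + C" "B \<le> A + C" "C \<le> A + B"
  have Q: "0 \<le> 2 * A * C" using * by simp
  have "B\<^sup>2 \<le> (A + C)\<^sup>2" using * by (intro power_mono) auto
  moreover have "\<bar>A - C\<bar>\<^sup>2 \<le> B\<^sup>2" using * by (intro power_mono) auto
  \<comment> \<open>Here \<open>\<kappa>\<close> is minus the cosine of the angle at the origin,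
    which explains the sign in \<open>s\<close>.\<close>
  ultimately obtain \<kappa> where \<kappa>: "-1 \<le> \<kappa>" "\<kappa> \<le> 1" "(A\<^sup>2 + C\<^sup>2) + (2 * A * C) * \<kappa> = B\<^sup>2"
    using affine_solution[OF Q, of "A\<^sup>2 + C\<^sup>2" "B\<^sup>2"] by (auto simp: power2_sum power2_diff)
  define r where "r = sqrt (1 - \<kappa>\<^sup>2)"
  have "\<kappa>\<^sup>2 \<le> 1" using \<kappa> by (simp add: abs_square_le_1 abs_le_iff)
  then have r: "\<kappa>\<^sup>2 + r\<^sup>2 = 1" by (simp add: r_def)
  define q s :: "real^3" where "q = vector [A, 0, 0]" and "s = vector [- C * \<kappa>, C * r, 0]"
  have nrm: "norm x = sqrt ((x $ 1)\<^sup>2 + (x $ 2)\<^sup>2 + (x $ 3)\<^sup>2)" for x :: "real^3"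
    by (simp add: norm_vec_def L2_set_def sum_3)
  have "dist 0 q = A" using * by (simp add: dist_norm nrm q_def vector_3)
  moreover have "dist 0 s = C"
  proof -
    have "(C * \<kappa>)\<^sup>2 + (C * r)\<^sup>2 = C\<^sup>2 * (\<kappa>\<^sup>2 + r\<^sup>2)" by (simp add: power_mult_distrib algebra_simps)
    then show ?thesis using * by (simp add: dist_norm nrm s_def vector_3 r)
  qed
  moreover have "dist q s = B"
  proof -
    have "(A + C * \<kappa>)\<^sup>2 + (C * r)\<^sup>2 = A\<^sup>2 + 2 * A * C * \<kappa> + C\<^sup>2 * (\<kappa>\<^sup>2 + r\<^sup>2)"
      by (simp add: power_mult_distrib power2_sum algebra_simps)
    also have "\<dots> = B\<^sup>2" using \<kappa>(3) by (simp add: r)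
    finally show ?thesis using * by (simp add: dist_norm nrm q_def s_def vector_3)
  qed
  ultimately show "\<exists>q\<in>?S. \<exists>s\<in>?S. dist 0 q = A \<and> dist q s = B \<and> dist 0 s = C"
    by (intro bexI[of _ q] bexI[of _ s]) (auto simp: q_def s_def vector_3)
qed

section \<open>The hyperboloid model of the hyperbolic plane\<close>

lemma lor3_simps:
  "lor3 (x + y) z = lor3 x z + lor3 y z" "lor3 z (x + y) = lor3 z x + lor3 z y"
  "lor3 (x - y) z = lor3 x z - lor3 y z" "lor3 z (x - y) = lor3 z x - lor3 z y"
  "lor3 (r *\<^sub>R x) z = r * lor3 x z" "lor3 z (r *\<^sub>R x) = r * lor3 z x"
  by (auto simp: lor3_def algebra_simps)

lemma lor3_commute: "lor3 x y = lor3 y x"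
  by (simp add: lor3_def algebra_simps)

definition hyperboloid :: "(real^3) set" where "hyperboloid = {x. lor3 x x = -1 \<and> x $ 1 > 0}"

text \<open>Reverse Cauchy-Schwarz inequality from a Lagrange identity:
  \<open>(x$1 * y$1)\<^sup>2\<close> exceeds \<open>(1 + p * r + q * s)\<^sup>2\<close> by a sum of
  three squares, which vanishes only for equal spatial parts.\<close>

lemma hyperboloid_lor3:
  assumes "x \<in> hyperboloid" "y \<in> hyperboloid"
  shows "1 \<le> - lor3 x y" "- lor3 x y = 1 \<Longrightarrow> x = y"
proof -
  define p q r s where "p = x$2" and "q = x$3" and "r = y$2" and "s = y$3"
  have x: "(x$1)\<^sup>2 = 1 + p\<^sup>2 + q\<^sup>2" "x$1 > 0" and y: "(y$1)\<^sup>2 = 1 + r\<^sup>2 + s\<^sup>2" "y$1 > 0"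
    using assms by (auto simp: hyperboloid_def lor3_def p_def q_def r_def s_def power2_eq_square)
  have eq: "(x$1 * y$1)\<^sup>2 = (1 + p * r + q * s)\<^sup>2 + ((p - r)\<^sup>2 + (q - s)\<^sup>2 + (p * s - q * r)\<^sup>2)"
    unfolding power_mult_distrib x y by (simp add: power2_eq_square algebra_simps)
  have l: "- lor3 x y = x$1 * y$1 - p * r - q * s" by (simp add: lor3_def p_def q_def r_def s_def)
  have "1 + p * r + q * s \<le> x$1 * y$1"
    by (rule power2_le_imp_le) (use eq x y in auto)
  then show "1 \<le> - lor3 x y" using l by simp
  assume "- lor3 x y = 1"
  then have "x$1 * y$1 = 1 + p * r + q * s" using l by simp
  then have "(p - r)\<^sup>2 + (q - s)\<^sup>2 + (p * s - q * r)\<^sup>2 = 0" using eq by simp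
  then have "(p - r)\<^sup>2 = 0" "(q - s)\<^sup>2 = 0"
    using zero_le_power2[of "p - r"] zero_le_power2[of "q - s"] zero_le_power2[of "p * s - q * r"] by linarith+
  then have pr: "p = r" "q = s" by auto
  then have "(x$1)\<^sup>2 = (y$1)\<^sup>2" using x y by simp
  then have "x$1 = y$1" by (rule power2_eq_imp_eq) (use x y in auto)
  then show "x = y" using pr by (simp add: vec_eq_iff forall_3 p_def q_def r_def s_def)
qed

text \<open>Orthogonality to \<open>y\<close> expresses \<open>v$1 * y$1\<close> through the spatial
  parts, and Cauchy-Schwarz applies to these. The bound on the time component is what keeps
  geodesics on the upper sheet.\<close>

lemma tangent_spacelike:
  assumes y: "y \<in> hyperboloid" and v: "lor3 y v = 0"
  shows "0 \<le> lor3 v v" "(v$1)\<^sup>2 \<le> ((y$1)\<^sup>2 - 1) * lor3 v v"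
proof -
  define V Y where "V = (v$2)\<^sup>2 + (v$3)\<^sup>2" and "Y = (y$1)\<^sup>2"
  have Y: "Y = 1 + (y$2)\<^sup>2 + (y$3)\<^sup>2" "Y > 0"
    using y by (auto simp: hyperboloid_def lor3_def Y_def power2_eq_square)
  have e: "v$1 * y$1 = v$2 * y$2 + v$3 * y$3" using v by (simp add: lor3_def algebra_simps)
  have "(v$1)\<^sup>2 * Y = (v$2 * y$2 + v$3 * y$3)\<^sup>2" unfolding Y_def e[symmetric] by (simp add: power_mult_distrib)
  also have "\<dots> \<le> V * ((y$2)\<^sup>2 + (y$3)\<^sup>2)"
  proof -
    have "V * ((y$2)\<^sup>2 + (y$3)\<^sup>2) - (v$2 * y$2 + v$3 * y$3)\<^sup>2 = (v$2 * y$3 - v$3 * y$2)\<^sup>2"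
      by (simp add: V_def power2_eq_square algebra_simps)
    then show ?thesis using zero_le_power2[of "v$2 * y$3 - v$3 * y$2"] by linarith
  qed
  also have "(y$2)\<^sup>2 + (y$3)\<^sup>2 = Y - 1" using Y by simp
  finally have le: "(v$1)\<^sup>2 * Y \<le> V * (Y - 1)" .
  have lv: "lor3 v v = V - (v$1)\<^sup>2" by (simp add: lor3_def V_def power2_eq_square)
  show "(v$1)\<^sup>2 \<le> ((y$1)\<^sup>2 - 1) * lor3 v v"
    using le unfolding lv Y_def[symmetric] by (simp add: algebra_simps)
  have "0 \<le> V" by (simp add: V_def)
  then have "(v$1)\<^sup>2 * Y \<le> V * Y" using le by (simp add: algebra_simps)
  then show "0 \<le> lor3 v v" using Y(2) lv by simp
qed

text \<open>The form is positive semidefinite on the tangent plane at \<open>y\<close>; expand it on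
  \<open>u + w\<close>.\<close>

lemma tangent_unit_le:
  assumes y: "y \<in> hyperboloid" and "lor3 y u = 0" "lor3 y w = 0" "lor3 u u \<le> 1" "lor3 w w \<le> 1"
  shows "- 1 \<le> lor3 u w"
proof -
  have "0 \<le> lor3 (u + w) (u + w)" using assms by (intro tangent_spacelike[OF y]) (simp add: lor3_simps)
  then show ?thesis using assms by (simp add: lor3_simps lor3_commute[of w u])
qed

lemma arcosh_sinh: "1 \<le> c \<Longrightarrow> (sinh (arcosh c))\<^sup>2 = c\<^sup>2 - (1::real)"
  using cosh_square_eq[of "arcosh c"] by (simp add: cosh_arcosh_real)

text \<open>The counterpart of \<open>sphere_polar\<close>; for \<open>x = y\<close> the direction
  is set to 0, which is harmless because \<open>sinh 0 = 0\<close>.\<close>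

lemma hyperbolic_polar:
  assumes "x \<in> hyperboloid" "y \<in> hyperboloid"
  obtains u where "lor3 u u = 1 \<or> arcosh (- lor3 x y) = 0 \<and> u = 0" "lor3 x u = 0"
    "y = cosh (arcosh (- lor3 x y)) *\<^sub>R x + sinh (arcosh (- lor3 x y)) *\<^sub>R u"
proof -
  define C where "C = - lor3 x y"
  have C: "1 \<le> C" using hyperboloid_lor3[OF assms] by (simp add: C_def)
  define s where "s = sinh (arcosh C)"
  have s2: "s\<^sup>2 = C\<^sup>2 - 1" and ch: "cosh (arcosh C) = C" using C by (auto simp: s_def arcosh_sinh)
  show ?thesis
  proof (cases "C = 1")
    case True
    then have "x = y" using hyperboloid_lor3(2)[OF assms] by (simp add: C_def)
    moreover have "lor3 x 0 = 0" by (simp add: lor3_def)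
    ultimately show ?thesis using True by (intro that[of 0]) (auto simp: C_def)
  next
    case False
    have "C\<^sup>2 \<noteq> 1" using C False by (simp add: power2_eq_1_iff)
    then have s0: "s \<noteq> 0" using s2 by auto
    define w where "w = y - C *\<^sub>R x"
    have xy: "lor3 x x = -1" "lor3 y y = -1" "lor3 x y = - C" "lor3 y x = - C"
      using assms lor3_commute by (auto simp: hyperboloid_def C_def)
    have w: "lor3 x w = 0" "lor3 w w = s\<^sup>2"
      using xy s2 by (auto simp: w_def lor3_simps power2_eq_square algebra_simps)
    show ?thesis
    proof (rule that[of "(1 / s) *\<^sub>R w"])
      have "lor3 ((1 / s) *\<^sub>R w) ((1 / s) *\<^sub>R w) = 1 / s * (1 / s * lor3 w w)" by (simp only: lor3_simps)
      then show "lor3 ((1 / s) *\<^sub>R w) ((1 / s) *\<^sub>R w) = 1 \<or> arcosh (- lor3 x y) = 0 \<and> (1 / s) *\<^sub>R w = 0"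
        unfolding w(2) using s0 by (simp add: power2_eq_square)
      show "lor3 x ((1 / s) *\<^sub>R w) = 0" by (simp only: lor3_simps w(1) mult_zero_right)
      show "y = cosh (arcosh (- lor3 x y)) *\<^sub>R x + sinh (arcosh (- lor3 x y)) *\<^sub>R (1 / s) *\<^sub>R w"
        unfolding C_def[symmetric] s_def[symmetric] ch using s0 by (simp add: w_def)
    qed
  qed
qed

lemma hyperbolic_model: "planar_model hyperboloid (\<lambda>x y. arcosh (- lor3 x y))" (is "planar_model _ ?d")
proof -
  have acosh: "arcosh (cosh t) = \<bar>t\<bar>" for t :: real
    using arcosh_cosh_real[of t] arcosh_cosh_real[of "-t"] by (cases "t \<ge> 0") auto
  note ge1 = hyperboloid_lor3(1)
  have xx: "lor3 x x = -1" if "x \<in> hyperboloid" for x using that by (simp add: hyperboloid_def)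
  show ?thesis
  proof (rule planar_modelI)
    show "metric_carrier hyperboloid ?d"
    proof
      fix x y z assume xyz: "x \<in> hyperboloid" "y \<in> hyperboloid" "z \<in> hyperboloid"
      show "0 \<le> ?d x y" using ge1[OF xyz(1,2)] by simp
      show "?d x y = ?d y x" by (simp add: lor3_commute)
      show "?d x y = 0 \<longleftrightarrow> x = y"
        using hyperboloid_lor3[OF xyz(1,2)] xx[OF xyz(1)] by auto
      define A B where "A = ?d y x" and "B = ?d y z"
      obtain u where u: "lor3 u u = 1 \<or> A = 0 \<and> u = 0" "lor3 y u = 0" "x = cosh A *\<^sub>R y + sinh A *\<^sub>R u"
        using hyperbolic_polar[OF xyz(2,1)] unfolding A_def by metis
      obtain w where w: "lor3 w w = 1 \<or> B = 0 \<and> w = 0" "lor3 y w = 0" "z = cosh B *\<^sub>R y + sinh B *\<^sub>R w"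
        using hyperbolic_polar[OF xyz(2,3)] unfolding B_def by metis
      have AB: "0 \<le> A" "0 \<le> B" using ge1 xyz by (auto simp: A_def B_def)
      have uw: "- 1 \<le> lor3 u w"
        by (rule tangent_unit_le[OF xyz(2) u(2) w(2)]) (use u w in \<open>auto simp: lor3_def\<close>)
      have "lor3 x z = - cosh A * cosh B + sinh A * sinh B * lor3 u w"
        unfolding u(3) w(3) using u(2) w(2) xx[OF xyz(2)] by (simp add: lor3_simps lor3_commute[of u y])
      moreover have "sinh A * sinh B * lor3 u w \<ge> sinh A * sinh B * (- 1)"
        using uw AB by (intro mult_left_mono mult_nonneg_nonneg) auto
      ultimately have "- lor3 x z \<le> cosh (A + B)" by (simp add: cosh_add)
      then have "?d x z \<le> arcosh (cosh (A + B))"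
        using arcosh_less_iff_real[of "cosh (A + B)" "- lor3 x z"] ge1[OF xyz(1,3)] cosh_real_ge_1[of "A + B"] by (meson not_le)
      then show "?d x z \<le> ?d x y + ?d y z" using AB by (simp add: acosh A_def B_def lor3_commute)
    qed
    show "vector [1, 0, 0] \<in> hyperboloid" by (simp add: hyperboloid_def lor3_def vector_3)
    show "(1::real) > 0" by simp
    fix p q assume pq: "p \<in> hyperboloid" "q \<in> hyperboloid"
    define l where "l = ?d p q"
    obtain u where u: "lor3 u u = 1 \<or> l = 0 \<and> u = 0" "lor3 p u = 0" "q = cosh l *\<^sub>R p + sinh l *\<^sub>R u"
      using hyperbolic_polar[OF pq] unfolding l_def by metis
    define c where "c = (\<lambda>t. cosh t *\<^sub>R p + sinh t *\<^sub>R u)"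
    have cc: "lor3 (c s) (c t) = - cosh (s - t)" if "s \<in> {0..l}" "t \<in> {0..l}" for s t
    proof -
      have "lor3 (c s) (c t) = - cosh s * cosh t + sinh s * sinh t * lor3 u u"
        unfolding c_def using u(2) xx[OF pq(1)] by (simp add: lor3_simps lor3_commute[of u p])
      also have "\<dots> = - cosh s * cosh t + sinh s * sinh t" using u(1) that by auto
      finally show ?thesis by (simp add: cosh_diff)
    qed
    \<comment> \<open>The curve stays on the upper sheet because
      \<open>\<bar>u$1\<bar> \<le> p$1\<close> and
      \<open>\<bar>sinh t\<bar> < cosh t\<close>.\<close>
    have pos: "0 < c t $ 1" for t
    proof -
      have p1: "p $ 1 > 0" using pq by (simp add: hyperboloid_def)
      have p2: "0 \<le> (p$1)\<^sup>2 - 1" using pq by (auto simp: hyperboloid_def lor3_def power2_eq_square algebra_simps) (smt (verit) zero_le_square)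
      have "(u$1)\<^sup>2 \<le> ((p$1)\<^sup>2 - 1) * lor3 u u" by (rule tangent_spacelike(2)[OF pq(1) u(2)])
      also have "\<dots> \<le> ((p$1)\<^sup>2 - 1) * 1" using u(1) p2 by (intro mult_left_mono) (auto simp: lor3_def)
      also have "\<dots> \<le> (p$1)\<^sup>2" by simp
      finally have "\<bar>u$1\<bar> \<le> p$1" using p1 by (simp add: abs_le_square_iff[symmetric])
      then have "\<bar>sinh t * u$1\<bar> \<le> \<bar>sinh t\<bar> * p$1" by (simp add: abs_mult mult_left_mono)
      also have "\<dots> < cosh t * p$1"
        using p1 by (intro mult_strict_right_mono) (auto simp: abs_less_iff sinh_less_cosh_real sinh_def cosh_def)
      finally show ?thesis by (simp add: c_def)
    qed
    have "is_geod ?d hyperboloid p q c"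
      unfolding is_geod_def l_def[symmetric]
    proof (intro conjI ballI)
      show "c 0 = p" "c l = q" using u(3) by (auto simp: c_def)
      show "c ` {0..l} \<subseteq> hyperboloid" using cc pos by (auto simp: hyperboloid_def)
      fix s t assume "s \<in> {0..l}" "t \<in> {0..l}"
      then show "?d (c s) (c t) = \<bar>s - t\<bar>" by (simp add: cc acosh)
    qed
    then show "\<exists>c. is_geod ?d hyperboloid p q c" by blast
  next
    fix A B C :: real
    assume *: "0 \<le> A" "A \<le> 1" "0 \<le> B" "B \<le> 1" "0 \<le> C" "C \<le> 1" "A \<le> B + C" "B \<le> A + C" "C \<le> A + B"
    have Q: "0 \<le> sinh A * sinh C" using * by simp
    have mono: "cosh x \<le> cosh y" if "0 \<le> x" "x \<le> y" for x y :: real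
      using that by (simp add: cosh_real_nonneg_le_iff)
    have "cosh B \<le> cosh (A + C)" using * by (intro mono) auto
    moreover have "cosh \<bar>A - C\<bar> \<le> cosh B" using * by (intro mono) auto
    \<comment> \<open>As in the plane, \<open>\<kappa>\<close> is minus the cosine of the angle at
      the base point.\<close>
    ultimately obtain \<kappa> where \<kappa>: "-1 \<le> \<kappa>" "\<kappa> \<le> 1" "cosh A * cosh C + (sinh A * sinh C) * \<kappa> = cosh B"
      using affine_solution[OF Q, of "cosh A * cosh C" "cosh B"] by (auto simp: cosh_add cosh_diff)
    define r where "r = sqrt (1 - \<kappa>\<^sup>2)"
    have "\<kappa>\<^sup>2 \<le> 1" using \<kappa> by (simp add: abs_square_le_1 abs_le_iff)
    then have r: "\<kappa> * \<kappa> + r * r = 1" by (simp add: r_def power2_eq_square)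
    have cs: "cosh t * cosh t = sinh t * sinh t + 1" for t :: real
      using cosh_square_eq[of t] by (simp add: power2_eq_square)
    define q s :: "real^3" where "q = vector [cosh A, sinh A, 0]" and "s = vector [cosh C, - sinh C * \<kappa>, sinh C * r]"
    have "q \<in> hyperboloid" by (simp add: q_def hyperboloid_def lor3_def vector_3 cs)
    moreover have "s \<in> hyperboloid"
    proof -
      have "lor3 s s = - (cosh C * cosh C) + sinh C * sinh C * (\<kappa> * \<kappa> + r * r)"
        by (simp add: s_def lor3_def vector_3 algebra_simps)
      then show ?thesis unfolding r by (simp add: hyperboloid_def cs) (simp add: s_def vector_3)
    qed
    moreover have "- lor3 q s = cosh B" using \<kappa>(3) by (simp add: q_def s_def lor3_def vector_3 algebra_simps)
    moreover have "- lor3 (vector [1, 0, 0]) q = cosh A" "- lor3 (vector [1, 0, 0]) s = cosh C"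
      by (auto simp: q_def s_def lor3_def vector_3)
    ultimately show "\<exists>q\<in>hyperboloid. \<exists>s\<in>hyperboloid. ?d (vector [1, 0, 0]) q = A \<and> ?d q s = B \<and> ?d (vector [1, 0, 0]) s = C"
      using * by (intro bexI[of _ q] bexI[of _ s]) (auto simp: acosh)
  qed
qed

theorem MK_model: "planar_model (MK_set K) (MK_dist K)"
proof -
  consider "K > 0" | "K = 0" | "K < 0" by linarith
  then show ?thesis
  proof cases
    case 1
    have s: "sqrt K * (sqrt K * t) = K * t" for t using 1 by (simp add: mult.assoc[symmetric])
    have "{x. sqrt K *\<^sub>R x \<in> {x::real^3. x \<bullet> x = 1}} = MK_set K"
      using 1 by (auto simp: MK_set_def s eq_divide_eq mult.commute)
    moreover have "(\<lambda>x y::real^3. arccos (sqrt K *\<^sub>R x \<bullet> sqrt K *\<^sub>R y) / sqrt K) = MK_dist K"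
      using 1 by (auto simp: MK_dist_def fun_eq_iff s)
    ultimately show ?thesis using planar_model_scale[OF sphere_model, of "sqrt K"] 1 by simp
  next
    case 2
    then have "MK_set K = {x. x $ 3 = 0}" "MK_dist K = dist" by (auto simp: MK_set_def MK_dist_def fun_eq_iff)
    then show ?thesis using plane_model by simp
  next
    case 3
    have s: "sqrt (- K) * (sqrt (- K) * x) = - K * x" for x using 3 by (simp add: mult.assoc[symmetric])
    have "{x. sqrt (- K) *\<^sub>R x \<in> hyperboloid} = MK_set K"
      using 3 by (auto simp: MK_set_def hyperboloid_def lor3_simps s zero_less_mult_iff field_simps)
    moreover have "(\<lambda>x y. arcosh (- lor3 (sqrt (- K) *\<^sub>R x) (sqrt (- K) *\<^sub>R y)) / sqrt (- K)) = MK_dist K"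
      using 3 by (auto simp: MK_dist_def fun_eq_iff lor3_simps s)
    ultimately show ?thesis using planar_model_scale[OF hyperbolic_model, of "sqrt (- K)"] 3 by simp
  qed
qed

section \<open>Transfer of the triangle condition\<close>

text \<open>The last clause of \<open>tl_curv_bound\<close> with its abbreviations expanded; it is
  the only clause that involves the Lorentzian model plane.\<close>

definition triangle_condition :: "bool \<Rightarrow> real \<Rightarrow> 'p set
    \<Rightarrow> (real \<Rightarrow> real \<Rightarrow> (real \<Rightarrow> 'p) \<Rightarrow> bool) \<Rightarrow> (real \<Rightarrow> real \<Rightarrow> (real \<Rightarrow> 'p) \<Rightarrow> bool)
    \<Rightarrow> (real \<Rightarrow> real \<Rightarrow> (real \<Rightarrow> 'p) \<Rightarrow> real) \<Rightarrow> bool" where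
  "triangle_condition lower K' U C T L \<longleftrightarrow>
       (\<forall>x y z a1 b1 \<sigma>1 a2 b2 \<sigma>2 a3 b3 \<sigma>3.
          x \<in> U \<and> y \<in> U \<and> z \<in> U \<and> grel T x y \<and> grel T y z \<and> gtau C L x z < \<infinity> \<and>
          C a1 b1 \<sigma>1 \<and> \<sigma>1 a1 = x \<and> \<sigma>1 b1 = y \<and> ereal (L a1 b1 \<sigma>1) = gtau C L x y \<and> \<sigma>1 ` {a1..b1} \<subseteq> U \<and>
          C a2 b2 \<sigma>2 \<and> \<sigma>2 a2 = y \<and> \<sigma>2 b2 = z \<and> ereal (L a2 b2 \<sigma>2) = gtau C L y z \<and> \<sigma>2 ` {a2..b2} \<subseteq> U \<and>
          C a3 b3 \<sigma>3 \<and> \<sigma>3 a3 = x \<and> \<sigma>3 b3 = z \<and> ereal (L a3 b3 \<sigma>3) = gtau C L x z \<and> \<sigma>3 ` {a3..b3} \<subseteq> U \<and>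
          size_bounds K' (real_of_ereal (gtau C L x y)) (real_of_ereal (gtau C L y z)) (real_of_ereal (gtau C L x z))
          \<longrightarrow>
          (\<forall>x' y' z' a1' b1' \<sigma>1' a2' b2' \<sigma>2' a3' b3' \<sigma>3'.
             x' \<in> LM_dom K' \<and> y' \<in> LM_dom K' \<and> z' \<in> LM_dom K' \<and>
             grel (LM_fd True K') x' y' \<and> grel (LM_fd True K') y' z' \<and>
             LM_tau K' x' y' = gtau C L x y \<and> LM_tau K' y' z' = gtau C L y z \<and> LM_tau K' x' z' = gtau C L x z \<and>
             LM_fd False K' a1' b1' \<sigma>1' \<and> \<sigma>1' a1' = x' \<and> \<sigma>1' b1' = y' \<and> ereal (LM_L K' a1' b1' \<sigma>1') = LM_tau K' x' y' \<and>
             LM_fd False K' a2' b2' \<sigma>2' \<and> \<sigma>2' a2' = y' \<and> \<sigma>2' b2' = z' \<and> ereal (LM_L K' a2' b2' \<sigma>2') = LM_tau K' y' z' \<and>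
             LM_fd False K' a3' b3' \<sigma>3' \<and> \<sigma>3' a3' = x' \<and> \<sigma>3' b3' = z' \<and> ereal (LM_L K' a3' b3' \<sigma>3') = LM_tau K' x' z'
             \<longrightarrow>
             (\<forall>(p, p')\<in>{(\<sigma>1 t, \<sigma>1' t') | t t'. t \<in> {a1..b1} \<and> t' \<in> {a1'..b1'} \<and> LM_tau K' x' (\<sigma>1' t') = gtau C L x (\<sigma>1 t)} \<union>
                      {(\<sigma>2 t, \<sigma>2' t') | t t'. t \<in> {a2..b2} \<and> t' \<in> {a2'..b2'} \<and> LM_tau K' y' (\<sigma>2' t') = gtau C L y (\<sigma>2 t)} \<union>
                      {(\<sigma>3 t, \<sigma>3' t') | t t'. t \<in> {a3..b3} \<and> t' \<in> {a3'..b3'} \<and> LM_tau K' x' (\<sigma>3' t') = gtau C L x (\<sigma>3 t)}.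
              \<forall>(q, q')\<in>{(\<sigma>1 t, \<sigma>1' t') | t t'. t \<in> {a1..b1} \<and> t' \<in> {a1'..b1'} \<and> LM_tau K' x' (\<sigma>1' t') = gtau C L x (\<sigma>1 t)} \<union>
                      {(\<sigma>2 t, \<sigma>2' t') | t t'. t \<in> {a2..b2} \<and> t' \<in> {a2'..b2'} \<and> LM_tau K' y' (\<sigma>2' t') = gtau C L y (\<sigma>2 t)} \<union>
                      {(\<sigma>3 t, \<sigma>3' t') | t t'. t \<in> {a3..b3} \<and> t' \<in> {a3'..b3'} \<and> LM_tau K' x' (\<sigma>3' t') = gtau C L x (\<sigma>3 t)}.
                   (if lower then gtau C L p q \<le> LM_tau K' p' q' else LM_tau K' p' q' \<le> gtau C L p q))))"

lemma tl_curv_bound_alt: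
  "tl_curv_bound lower K' Y D C T L \<longleftrightarrow>
    (\<forall>y\<in>Y. \<exists>U. U \<subseteq> Y \<and> (\<exists>r>0. {z\<in>Y. D y z < r} \<subseteq> U) \<and>
       (\<forall>p\<in>U. \<forall>q\<in>U. gtau C L p q < \<infinity>) \<and>
       continuous_map (subtopology (prod_topology (Metric_space.mtopology Y D) (Metric_space.mtopology Y D)) (U \<times> U)) euclideanreal
          (\<lambda>(p, q). real_of_ereal (gtau C L p q)) \<and>
       (\<forall>p\<in>U. \<forall>q\<in>U. grel T p q \<longrightarrow>
          (\<exists>a b \<gamma>. C a b \<gamma> \<and> \<gamma> a = p \<and> \<gamma> b = q \<and> \<gamma> ` {a..b} \<subseteq> U \<and> ereal (L a b \<gamma>) = gtau C L p q)) \<and>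
       triangle_condition lower K' U C T L)"
  unfolding tl_curv_bound_def triangle_condition_def Let_def ..

definition maximal_side :: "(real \<Rightarrow> real \<Rightarrow> (real \<Rightarrow> 'p) \<Rightarrow> bool) \<Rightarrow> (real \<Rightarrow> real \<Rightarrow> (real \<Rightarrow> 'p) \<Rightarrow> real)
    \<Rightarrow> 'p \<Rightarrow> 'p \<Rightarrow> real \<Rightarrow> real \<Rightarrow> (real \<Rightarrow> 'p) \<Rightarrow> bool" where
  "maximal_side C L x y a b \<sigma> \<longleftrightarrow> C a b \<sigma> \<and> \<sigma> a = x \<and> \<sigma> b = y \<and> ereal (L a b \<sigma>) = gtau C L x y"

text \<open>The comparison triangles on both sides are the same, so the condition transfers along a
  correspondence \<open>R\<close> of points that respects the parametrizations of the sides.\<close>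

lemma triangle_condition_transfer:
  assumes tri: "triangle_condition lower K' U' C' T' L'"
    and lift: "\<And>x y z a1 b1 \<sigma>1 a2 b2 \<sigma>2 a3 b3 \<sigma>3.
      x \<in> U \<Longrightarrow> y \<in> U \<Longrightarrow> z \<in> U \<Longrightarrow> grel T x y \<Longrightarrow> grel T y z \<Longrightarrow>
      maximal_side C L x y a1 b1 \<sigma>1 \<Longrightarrow> \<sigma>1 ` {a1..b1} \<subseteq> U \<Longrightarrow>
      maximal_side C L y z a2 b2 \<sigma>2 \<Longrightarrow> \<sigma>2 ` {a2..b2} \<subseteq> U \<Longrightarrow>
      maximal_side C L x z a3 b3 \<sigma>3 \<Longrightarrow> \<sigma>3 ` {a3..b3} \<subseteq> U \<Longrightarrow>
      \<exists>u v w \<rho>1 \<rho>2 \<rho>3. u \<in> U' \<and> v \<in> U' \<and> w \<in> U' \<and> grel T' u v \<and> grel T' v w \<and> gtau C' L' u w < \<infinity> \<and>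
        maximal_side C' L' u v a1 b1 \<rho>1 \<and> \<rho>1 ` {a1..b1} \<subseteq> U' \<and>
        maximal_side C' L' v w a2 b2 \<rho>2 \<and> \<rho>2 ` {a2..b2} \<subseteq> U' \<and>
        maximal_side C' L' u w a3 b3 \<rho>3 \<and> \<rho>3 ` {a3..b3} \<subseteq> U' \<and>
        gtau C' L' u v = gtau C L x y \<and> gtau C' L' v w = gtau C L y z \<and> gtau C' L' u w = gtau C L x z \<and>
        (\<forall>t\<in>{a1..b1}. gtau C' L' u (\<rho>1 t) = gtau C L x (\<sigma>1 t)) \<and>
        (\<forall>t\<in>{a2..b2}. gtau C' L' v (\<rho>2 t) = gtau C L y (\<sigma>2 t)) \<and>
        (\<forall>t\<in>{a3..b3}. gtau C' L' u (\<rho>3 t) = gtau C L x (\<sigma>3 t)) \<and>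
        (let R = (\<lambda>t. (\<sigma>1 t, \<rho>1 t)) ` {a1..b1} \<union> (\<lambda>t. (\<sigma>2 t, \<rho>2 t)) ` {a2..b2} \<union> (\<lambda>t. (\<sigma>3 t, \<rho>3 t)) ` {a3..b3}
         in \<forall>(p, p')\<in>R. \<forall>(q, q')\<in>R. if lower then gtau C L p q \<le> gtau C' L' p' q' else gtau C' L' p' q' \<le> gtau C L p q)"
  shows "triangle_condition lower K' U C T L"
  unfolding triangle_condition_def
proof (intro allI impI, elim conjE)
  fix x y z a1 b1 \<sigma>1 a2 b2 \<sigma>2 a3 b3 \<sigma>3 x' y' z' a1' b1' \<sigma>1' a2' b2' \<sigma>2' a3' b3' \<sigma>3'
  assume U: "x \<in> U" "y \<in> U" "z \<in> U" and T: "grel T x y" "grel T y z"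
    and 1: "C a1 b1 \<sigma>1" "\<sigma>1 a1 = x" "\<sigma>1 b1 = y" "ereal (L a1 b1 \<sigma>1) = gtau C L x y" "\<sigma>1 ` {a1..b1} \<subseteq> U"
    and 2: "C a2 b2 \<sigma>2" "\<sigma>2 a2 = y" "\<sigma>2 b2 = z" "ereal (L a2 b2 \<sigma>2) = gtau C L y z" "\<sigma>2 ` {a2..b2} \<subseteq> U"
    and 3: "C a3 b3 \<sigma>3" "\<sigma>3 a3 = x" "\<sigma>3 b3 = z" "ereal (L a3 b3 \<sigma>3) = gtau C L x z" "\<sigma>3 ` {a3..b3} \<subseteq> U"
    and size: "size_bounds K' (real_of_ereal (gtau C L x y)) (real_of_ereal (gtau C L y z)) (real_of_ereal (gtau C L x z))"
    and comp: "x' \<in> LM_dom K'" "y' \<in> LM_dom K'" "z' \<in> LM_dom K'"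
             "grel (LM_fd True K') x' y'" "grel (LM_fd True K') y' z'"
             "LM_tau K' x' y' = gtau C L x y" "LM_tau K' y' z' = gtau C L y z" "LM_tau K' x' z' = gtau C L x z"
             "LM_fd False K' a1' b1' \<sigma>1'" "\<sigma>1' a1' = x'" "\<sigma>1' b1' = y'" "ereal (LM_L K' a1' b1' \<sigma>1') = LM_tau K' x' y'"
             "LM_fd False K' a2' b2' \<sigma>2'" "\<sigma>2' a2' = y'" "\<sigma>2' b2' = z'" "ereal (LM_L K' a2' b2' \<sigma>2') = LM_tau K' y' z'"
             "LM_fd False K' a3' b3' \<sigma>3'" "\<sigma>3' a3' = x'" "\<sigma>3' b3' = z'" "ereal (LM_L K' a3' b3' \<sigma>3') = LM_tau K' x' z'"
  have "maximal_side C L x y a1 b1 \<sigma>1" "maximal_side C L y z a2 b2 \<sigma>2" "maximal_side C L x z a3 b3 \<sigma>3"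
    using 1 2 3 by (simp_all add: maximal_side_def)
  from lift[OF U T this(1) 1(5) this(2) 2(5) this(3) 3(5)]
  obtain u v w \<rho>1 \<rho>2 \<rho>3 where U': "u \<in> U'" "v \<in> U'" "w \<in> U'" and T': "grel T' u v" "grel T' v w" "gtau C' L' u w < \<infinity>"
    and m: "maximal_side C' L' u v a1 b1 \<rho>1" "maximal_side C' L' v w a2 b2 \<rho>2" "maximal_side C' L' u w a3 b3 \<rho>3"
    and img: "\<rho>1 ` {a1..b1} \<subseteq> U'" "\<rho>2 ` {a2..b2} \<subseteq> U'" "\<rho>3 ` {a3..b3} \<subseteq> U'"
    and eq: "gtau C' L' u v = gtau C L x y" "gtau C' L' v w = gtau C L y z" "gtau C' L' u w = gtau C L x z"
    and pt: "\<forall>t\<in>{a1..b1}. gtau C' L' u (\<rho>1 t) = gtau C L x (\<sigma>1 t)"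
        "\<forall>t\<in>{a2..b2}. gtau C' L' v (\<rho>2 t) = gtau C L y (\<sigma>2 t)"
        "\<forall>t\<in>{a3..b3}. gtau C' L' u (\<rho>3 t) = gtau C L x (\<sigma>3 t)"
    and R: "let R = (\<lambda>t. (\<sigma>1 t, \<rho>1 t)) ` {a1..b1} \<union> (\<lambda>t. (\<sigma>2 t, \<rho>2 t)) ` {a2..b2} \<union> (\<lambda>t. (\<sigma>3 t, \<rho>3 t)) ` {a3..b3}
         in \<forall>(p, p')\<in>R. \<forall>(q, q')\<in>R. if lower then gtau C L p q \<le> gtau C' L' p' q' else gtau C' L' p' q' \<le> gtau C L p q"
    by (elim exE conjE) (rule that)
  define R0 where "R0 = (\<lambda>t. (\<sigma>1 t, \<rho>1 t)) ` {a1..b1} \<union> (\<lambda>t. (\<sigma>2 t, \<rho>2 t)) ` {a2..b2} \<union> (\<lambda>t. (\<sigma>3 t, \<rho>3 t)) ` {a3..b3}"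
  define P where "P = {(\<sigma>1 t, \<sigma>1' t') | t t'. t \<in> {a1..b1} \<and> t' \<in> {a1'..b1'} \<and> LM_tau K' x' (\<sigma>1' t') = gtau C L x (\<sigma>1 t)} \<union>
                      {(\<sigma>2 t, \<sigma>2' t') | t t'. t \<in> {a2..b2} \<and> t' \<in> {a2'..b2'} \<and> LM_tau K' y' (\<sigma>2' t') = gtau C L y (\<sigma>2 t)} \<union>
                      {(\<sigma>3 t, \<sigma>3' t') | t t'. t \<in> {a3..b3} \<and> t' \<in> {a3'..b3'} \<and> LM_tau K' x' (\<sigma>3' t') = gtau C L x (\<sigma>3 t)}"
  define P' where "P' = {(\<rho>1 t, \<sigma>1' t') | t t'. t \<in> {a1..b1} \<and> t' \<in> {a1'..b1'} \<and> LM_tau K' x' (\<sigma>1' t') = gtau C' L' u (\<rho>1 t)} \<union>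
                      {(\<rho>2 t, \<sigma>2' t') | t t'. t \<in> {a2..b2} \<and> t' \<in> {a2'..b2'} \<and> LM_tau K' y' (\<sigma>2' t') = gtau C' L' v (\<rho>2 t)} \<union>
                      {(\<rho>3 t, \<sigma>3' t') | t t'. t \<in> {a3..b3} \<and> t' \<in> {a3'..b3'} \<and> LM_tau K' x' (\<sigma>3' t') = gtau C' L' u (\<rho>3 t)}"
  have R': "if lower then gtau C L p q \<le> gtau C' L' r s else gtau C' L' r s \<le> gtau C L p q"
    if "(p, r) \<in> R0" "(q, s) \<in> R0" for p q r s
    using R that unfolding Let_def R0_def[symmetric] by fastforce
  \<comment> \<open>At equal parameters, lifted and original side have the same time separation from
    their first vertex, so a comparison point for one is a comparison point for the other.\<close>
  have PP: "\<exists>r. (p, r) \<in> R0 \<and> (r, p') \<in> P'" if "(p, p') \<in> P" for p p'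
    using that pt unfolding P_def P'_def R0_def by fastforce
  note tri' = tri[unfolded triangle_condition_def, rule_format, of u v w a1 b1 \<rho>1 a2 b2 \<rho>2 a3 b3 \<rho>3
      x' y' z' a1' b1' \<sigma>1' a2' b2' \<sigma>2' a3' b3' \<sigma>3', folded P'_def]
  have main: "case pp of (r, p') \<Rightarrow> \<forall>(s, q')\<in>P'. if lower then gtau C' L' r s \<le> LM_tau K' p' q' else LM_tau K' p' q' \<le> gtau C' L' r s"
    if "pp \<in> P'" for pp
    by (rule tri'[OF _ _ that]) (use U' T' m img comp eq size in \<open>simp_all add: maximal_side_def\<close>)
  show "\<forall>(p, p')\<in>P. \<forall>(q, q')\<in>P. if lower then gtau C L p q \<le> LM_tau K' p' q' else LM_tau K' p' q' \<le> gtau C L p q"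
  proof (clarify)
    fix p p' q q' assume "(p, p') \<in> P" "(q, q') \<in> P"
    then obtain r s where r: "(p, r) \<in> R0" "(r, p') \<in> P'" and s: "(q, s) \<in> R0" "(s, q') \<in> P'" using PP by blast
    have "if lower then gtau C' L' r s \<le> LM_tau K' p' q' else LM_tau K' p' q' \<le> gtau C' L' r s"
      using main[OF r(2)] s(2) by fastforce
    then show "if lower then gtau C L p q \<le> LM_tau K' p' q' else LM_tau K' p' q' \<le> gtau C L p q"
      using R'[OF r(1) s(1)] by (auto split: if_splits)
  qed
qed

section \<open>Continuity of the time separation\<close>

lemma metric_deriv_real:
  assumes "(B has_real_derivative D) (at t)"
  shows "metric_deriv dist B t = \<bar>D\<bar>"
proof -
  have "((\<lambda>h. \<bar>(B (t + h) - B t) / h\<bar>) \<longlongrightarrow> \<bar>D\<bar>) (at 0)"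
    using assms unfolding DERIV_def by (intro tendsto_intros)
  then have "((\<lambda>h. dist (B (t + h)) (B t) / \<bar>h\<bar>) \<longlongrightarrow> \<bar>D\<bar>) (at 0)"
    by (simp add: dist_real_def abs_divide)
  then show ?thesis unfolding metric_deriv_def by (intro tendsto_Lim) auto
qed

lemma strip_curveI:
  fixes A B :: "real \<Rightarrow> real"
  assumes ab: "a < b" and ac: "metric_ac dist a b A" "metric_ac dist a b B"
    and A: "strict_mono_on {a..b} A" "A ` {a..b} \<subseteq> I" and N: "negligible N"
    and D: "\<forall>t\<in>{a<..<b} - N. (A has_real_derivative A' t) (at t) \<and> (B has_real_derivative B' t) (at t) \<and>
        0 < A' t \<and> 0 < f (A t) \<and> f (A t) * \<bar>B' t\<bar> \<le> A' t"
  shows "cone_fd False I f UNIV dist a b (\<lambda>t. (A t, B t))"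
    and "\<forall>t\<in>{a<..<b} - N. lapse f dist (\<lambda>t. (A t, B t)) t = sqrt ((A' t)\<^sup>2 - (f (A t) * B' t)\<^sup>2)"
proof -
  have eqs: "deriv A t = A' t" "metric_deriv dist B t = \<bar>B' t\<bar>" if "t \<in> {a<..<b} - N" for t
    using D that by (auto intro: DERIV_imp_deriv metric_deriv_real)
  show "\<forall>t\<in>{a<..<b} - N. lapse f dist (\<lambda>t. (A t, B t)) t = sqrt ((A' t)\<^sup>2 - (f (A t) * B' t)\<^sup>2)"
    using eqs by (simp add: lapse_def power_mult_distrib)
  show "cone_fd False I f UNIV dist a b (\<lambda>t. (A t, B t))"
    unfolding cone_fd_def
  proof (intro conjI ab)
    show "(\<lambda>t. (A t, B t)) ` {a..b} \<subseteq> I \<times> UNIV" using A(2) by auto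
    show "metric_ac (cone_dist dist) a b (\<lambda>t. (A t, B t))"
      using ac by (subst cone_dist_ac_iff[OF real_metric.metric_carrier_axioms]) auto
    show "strict_mono_on {a..b} (\<lambda>t. fst (A t, B t)) \<or> strict_mono_on {a..b} (\<lambda>t. - fst (A t, B t))"
      using A(1) by simp
    show "AE t in lebesgue_on {a..b}. (\<lambda>t. fst (A t, B t)) differentiable (at t) \<and>
        deriv (\<lambda>t. fst (A t, B t)) t > 0 \<and>
        (let q = - (deriv (\<lambda>t. fst (A t, B t)) t)\<^sup>2 + (f (fst (A t, B t)))\<^sup>2 * (metric_deriv dist (\<lambda>t. snd (A t, B t)) t)\<^sup>2
         in if False then q < 0 else q \<le> 0)"
    proof (rule AE_lebesgue_onI[OF N], simp only: fst_conv snd_conv, intro conjI)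
      fix t assume t: "t \<in> {a<..<b} - N"
      have *: "(A has_real_derivative A' t) (at t)" "0 < A' t" "0 < f (A t)" "f (A t) * \<bar>B' t\<bar> \<le> A' t" using D t by auto
      show "A differentiable (at t)" using *(1) by (auto simp: real_differentiable_def)
      show "0 < deriv A t" using eqs(1)[OF t] *(2) by simp
      have "(f (A t) * \<bar>B' t\<bar>)\<^sup>2 \<le> (A' t)\<^sup>2" using * by (intro power_mono) auto
      then show "let q = - (deriv A t)\<^sup>2 + (f (A t))\<^sup>2 * (metric_deriv dist B t)\<^sup>2 in if False then q < 0 else q \<le> 0"
        using eqs[OF t] by (simp add: power_mult_distrib)
    qed
  qed
qed

section \<open>Length estimates over the real line\<close>

text \<open>\<open>P\<close> is a null coordinate: while its time runs from \<open>s\<close> to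
  \<open>s'\<close>, a null curve that always moves to the right travels \<open>P s' - P s\<close>
  in the fibre. \<open>m\<close> and \<open>F\<close> bound \<open>f\<close> on the strip.\<close>

locale strip =
  fixes I :: "real set" and f :: "real \<Rightarrow> real" and u0 u1 m F :: real and P :: "real \<Rightarrow> real"
  assumes I: "{u0..u1} \<subseteq> I" and f_cont: "continuous_on I f" and f_pos: "\<forall>t\<in>I. f t > 0"
    and m: "0 < m" "\<And>r. r \<in> {u0..u1} \<Longrightarrow> m \<le> f r" "\<And>r. r \<in> {u0..u1} \<Longrightarrow> f r \<le> F"
    and P: "\<And>r. r \<in> {u0<..<u1} \<Longrightarrow> (P has_real_derivative 1 / f r) (at r)"
begin

lemma P_lip:
  assumes "r \<in> {u0<..<u1}" "s \<in> {u0<..<u1}"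
  shows "\<bar>P r - P s\<bar> \<le> (1 / m) * \<bar>r - s\<bar>"
proof -
  have *: "\<bar>P r - P s\<bar> \<le> (1 / m) * \<bar>r - s\<bar>" if rs: "r < s" "r \<in> {u0<..<u1}" "s \<in> {u0<..<u1}" for r s
  proof -
    obtain z where z: "z > r" "z < s" "P s - P r = (s - r) * (1 / f z)"
      using MVT2[of r s P "\<lambda>z. 1 / f z"] P rs by auto
    have "m \<le> f z" using m(2)[of z] z rs by auto
    then have "1 / f z \<le> 1 / m" "0 \<le> 1 / f z" using m(1) by (auto intro: divide_left_mono)
    then have "\<bar>(s - r) * (1 / f z)\<bar> \<le> \<bar>s - r\<bar> * (1 / m)"
      unfolding abs_mult by (intro mult_left_mono) auto
    then have "\<bar>P s - P r\<bar> \<le> \<bar>s - r\<bar> * (1 / m)" by (simp only: z(3))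
    then show ?thesis by (simp only: abs_minus_commute mult.commute)
  qed
  show ?thesis
    using *[of r s] *[of s r] assms by (cases r s rule: linorder_cases) (auto simp: abs_minus_commute)
qed

text \<open>Over the line the fibre component has a signed derivative \<open>\<beta>'\<close> and
  not only a metric speed, so the lapse can be factored and compared with a null curve.\<close>

lemma curve_facts:
  assumes \<gamma>: "cone_fd False I f UNIV dist a b \<gamma>"
  obtains \<alpha>' \<beta>' N where "a < b" "metric_ac dist a b (\<lambda>t. fst (\<gamma> t))" "metric_ac dist a b (\<lambda>t. snd (\<gamma> t))"
    "strict_mono_on {a..b} (\<lambda>t. fst (\<gamma> t))" "(\<lambda>t. fst (\<gamma> t)) ` {a..b} \<subseteq> I" "negligible N"
    "\<forall>t\<in>{a<..<b} - N. ((\<lambda>t. fst (\<gamma> t)) has_real_derivative \<alpha>' t) (at t) \<and> ((\<lambda>t. snd (\<gamma> t)) has_real_derivative \<beta>' t) (at t) \<and>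
        0 < \<alpha>' t \<and> 0 < f (fst (\<gamma> t)) \<and> f (fst (\<gamma> t)) * \<bar>\<beta>' t\<bar> \<le> \<alpha>' t \<and>
        lapse f dist \<gamma> t = sqrt ((\<alpha>' t)\<^sup>2 - (f (fst (\<gamma> t)) * \<beta>' t)\<^sup>2)"
    "integrable (lebesgue_on {a..b}) \<alpha>'" "(\<integral>t. \<alpha>' t \<partial>lebesgue_on {a..b}) \<le> fst (\<gamma> b) - fst (\<gamma> a)"
    "integrable (lebesgue_on {a..b}) (lapse f dist \<gamma>)"
proof -
  interpret cone_curve UNIV dist False I f a b \<gamma>
    using f_cont f_pos \<gamma> real_metric.metric_carrier_axioms by (simp add: cone_curve_def cone_curve_axioms_def)
  obtain N where N: "negligible N"
    "\<forall>t\<in>{a<..<b} - N. (\<alpha> has_real_derivative deriv \<alpha> t) (at t)" "\<forall>t\<in>{a<..<b} - N. deriv \<alpha> t > 0"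
    "\<forall>t\<in>{a<..<b} - N. f (\<alpha> t) * v t \<le> deriv \<alpha> t"
    by (rule regular) (rule that)
  obtain M where M: "negligible M" "\<forall>t\<in>{a<..<b} - M. \<beta> differentiable (at t)"
    using ac_real_differentiable[OF ab \<beta>_ac] by blast
  have sm: "strict_mono_on {a..b} \<alpha>"
  proof (rule ccontr)
    assume "\<not> ?thesis"
    then have "strict_mono_on {a..b} (\<lambda>t. - \<alpha> t)" using \<gamma> by (auto simp: cone_fd_def)
    then have "- \<alpha> a < - \<alpha> b" by (rule strict_mono_onD) (use ab in auto)
    then show False using \<alpha>_mono[of a b] ab by simp
  qed
  have NM: "negligible (N \<union> M)" by (rule negligible_Un[OF N(1) M(1)])
  note int = mono_derivative_integrable[OF ab \<alpha>_mono ac_continuous[OF \<alpha>_ac] N(1), of "deriv \<alpha>"]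
  show ?thesis
  proof (rule that[OF ab \<alpha>_ac \<beta>_ac sm _ NM])
    show "\<alpha> ` {a..b} \<subseteq> I" using \<alpha>_in by auto
    show "\<forall>t\<in>{a<..<b} - (N \<union> M). (\<alpha> has_real_derivative deriv \<alpha> t) (at t) \<and> (\<beta> has_real_derivative deriv \<beta> t) (at t) \<and>
        0 < deriv \<alpha> t \<and> 0 < f (\<alpha> t) \<and> f (\<alpha> t) * \<bar>deriv \<beta> t\<bar> \<le> deriv \<alpha> t \<and>
        lapse f dist \<gamma> t = sqrt ((deriv \<alpha> t)\<^sup>2 - (f (\<alpha> t) * deriv \<beta> t)\<^sup>2)"
    proof
      fix t assume t: "t \<in> {a<..<b} - (N \<union> M)"
      have \<beta>d: "(\<beta> has_real_derivative deriv \<beta> t) (at t)"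
        using M(2) t by (simp add: DERIV_deriv_iff_real_differentiable)
      have v: "v t = \<bar>deriv \<beta> t\<bar>" by (rule metric_deriv_real[OF \<beta>d])
      have "f (\<alpha> t) * v t \<le> deriv \<alpha> t" using N(4) t by blast
      moreover have "0 < f (\<alpha> t)" using t by (intro f_pos[rule_format] \<alpha>_in) auto
      ultimately show "(\<alpha> has_real_derivative deriv \<alpha> t) (at t) \<and> (\<beta> has_real_derivative deriv \<beta> t) (at t) \<and>
        0 < deriv \<alpha> t \<and> 0 < f (\<alpha> t) \<and> f (\<alpha> t) * \<bar>deriv \<beta> t\<bar> \<le> deriv \<alpha> t \<and>
        lapse f dist \<gamma> t = sqrt ((deriv \<alpha> t)\<^sup>2 - (f (\<alpha> t) * deriv \<beta> t)\<^sup>2)"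
        using N(2,3) t \<beta>d unfolding lapse_def v by (simp add: power_mult_distrib)
    qed
    show "integrable (lebesgue_on {a..b}) (deriv \<alpha>)" "(\<integral>t. deriv \<alpha> t \<partial>lebesgue_on {a..b}) \<le> \<alpha> b - \<alpha> a"
      using int N(2) by auto
    show "integrable (lebesgue_on {a..b}) (lapse f dist \<gamma>)" by (rule lapse_integrable)
  qed
qed

text \<open>Compare with the null curve \<open>P\<close>: the defect \<open>P \<circ> \<alpha> - \<beta>\<close> is nondecreasing, and the lapse is
  \<open>sqrt ((\<alpha>' - f \<beta>') (\<alpha>' + f \<beta>'))\<close>, to which the AM-GM inequality with weight \<open>c\<close> is applied.\<close>

lemma length_bound:
  assumes \<gamma>: "cone_fd False I f UNIV dist a b \<gamma>" "\<gamma> a = (s, 0)" "\<gamma> b = (s', l)"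
    and s: "s \<in> {u0<..<u1}" "s' \<in> {u0<..<u1}"
  shows "s < s'" "l \<le> P s' - P s"
    and "c > 0 \<Longrightarrow> cone_L f dist a b \<gamma> \<le> c * (s' - s) + F / (2 * c) * (P s' - P s - l)"
proof -
  obtain \<alpha>' \<beta>' N where ab: "a < b" and ac: "metric_ac dist a b (\<lambda>t. fst (\<gamma> t))" "metric_ac dist a b (\<lambda>t. snd (\<gamma> t))"
    and sm: "strict_mono_on {a..b} (\<lambda>t. fst (\<gamma> t))" and "(\<lambda>t. fst (\<gamma> t)) ` {a..b} \<subseteq> I" and N: "negligible N"
    and D: "\<forall>t\<in>{a<..<b} - N. ((\<lambda>t. fst (\<gamma> t)) has_real_derivative \<alpha>' t) (at t) \<and> ((\<lambda>t. snd (\<gamma> t)) has_real_derivative \<beta>' t) (at t) \<and>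
        0 < \<alpha>' t \<and> 0 < f (fst (\<gamma> t)) \<and> f (fst (\<gamma> t)) * \<bar>\<beta>' t\<bar> \<le> \<alpha>' t \<and>
        lapse f dist \<gamma> t = sqrt ((\<alpha>' t)\<^sup>2 - (f (fst (\<gamma> t)) * \<beta>' t)\<^sup>2)"
    and int: "integrable (lebesgue_on {a..b}) \<alpha>'" "(\<integral>t. \<alpha>' t \<partial>lebesgue_on {a..b}) \<le> fst (\<gamma> b) - fst (\<gamma> a)"
    "integrable (lebesgue_on {a..b}) (lapse f dist \<gamma>)"
    by (rule curve_facts[OF \<gamma>(1)]) (rule that)
  define \<alpha> \<beta> where "\<alpha> = (\<lambda>t. fst (\<gamma> t))" and "\<beta> = (\<lambda>t. snd (\<gamma> t))"
  have ends: "\<alpha> a = s" "\<alpha> b = s'" "\<beta> a = 0" "\<beta> b = l" using \<gamma> by (auto simp: \<alpha>_def \<beta>_def)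
  show "s < s'" using strict_mono_onD[OF sm, of a b] ab \<gamma> by auto
  have \<alpha>m: "\<alpha> r \<le> \<alpha> t" if "a \<le> r" "r \<le> t" "t \<le> b" for r t
    using strict_mono_onD[OF sm, of r t] that by (cases "r = t") (auto simp: \<alpha>_def)
  have \<alpha>_in: "\<alpha> t \<in> {u0<..<u1}" if "t \<in> {a..b}" for t
    using \<alpha>m[of a t] \<alpha>m[of t b] that ends s by auto
  define h where "h = (\<lambda>t. P (\<alpha> t) - \<beta> t)"
  define h' where "h' = (\<lambda>t. \<alpha>' t / f (\<alpha> t) - \<beta>' t)"
  have Dh: "(h has_real_derivative h' t) (at t)" if t: "t \<in> {a<..<b} - N" for t
  proof -
    have a: "(\<alpha> has_real_derivative \<alpha>' t) (at t)" and b: "(\<beta> has_real_derivative \<beta>' t) (at t)"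
      using D t by (auto simp: \<alpha>_def \<beta>_def)
    have "(P has_real_derivative 1 / f (\<alpha> t)) (at (\<alpha> t))" using \<alpha>_in[of t] t by (intro P) auto
    from DERIV_diff[OF DERIV_chain2[OF this a] b] show ?thesis by (simp add: h_def h'_def)
  qed
  have h'0: "h' t \<ge> 0" if t: "t \<in> {a<..<b} - N" for t
  proof -
    have "f (\<alpha> t) * \<beta>' t \<le> f (\<alpha> t) * \<bar>\<beta>' t\<bar>" using D t by (intro mult_left_mono) (auto simp: \<alpha>_def less_imp_le)
    also have "\<dots> \<le> \<alpha>' t" using D t by (auto simp: \<alpha>_def)
    finally show ?thesis using D t by (auto simp: h'_def \<alpha>_def field_simps)
  qed
  have Pac: "metric_ac dist a b (\<lambda>t. P (\<alpha> t))"
  proof (rule metric_ac_comparison[OF ac(1) ac(1), of "1 / m"])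
    fix r t assume "a \<le> r" "r \<le> t" "t \<le> b"
    then have "\<bar>P (\<alpha> r) - P (\<alpha> t)\<bar> \<le> (1 / m) * \<bar>\<alpha> r - \<alpha> t\<bar>" by (intro P_lip \<alpha>_in) auto
    also have "\<dots> \<le> (1 / m) * (dist (\<alpha> r) (\<alpha> t) + dist (\<alpha> r) (\<alpha> t))"
      using m(1) by (intro mult_left_mono) (auto simp: dist_real_def)
    finally show "dist (P (\<alpha> r)) (P (\<alpha> t)) \<le> 1 / m * (dist (fst (\<gamma> r)) (fst (\<gamma> t)) + dist (fst (\<gamma> r)) (fst (\<gamma> t)))"
      by (simp add: dist_real_def \<alpha>_def)
  qed (use m in auto)
  have hac: "metric_ac dist a b h"
    by (rule metric_ac_comparison[OF Pac ac(2), of 1]) (auto simp: dist_real_def h_def \<beta>_def)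
  have hm: "h r \<le> h t" if rt: "a \<le> r" "r \<le> t" "t \<le> b" for r t
  proof (rule ac_deriv_nonneg[OF rt(2) metric_ac_subinterval[OF hac rt(1,3)] N])
    fix q assume "q \<in> {r<..<t} - N"
    then have "q \<in> {a<..<b} - N" using rt by auto
    then show "\<exists>D\<ge>0. (h has_real_derivative D) (at q)" using Dh h'0 by blast
  qed
  have hab: "h b - h a = P s' - P s - l" by (simp add: h_def ends)
  show "l \<le> P s' - P s" using hm[of a b] ab hab by simp
  assume c: "c > 0"
  have hc: "continuous_on {a..b} h"
  proof -
    interpret cone_curve UNIV dist False I f a b \<gamma>
      using f_cont f_pos \<gamma> real_metric.metric_carrier_axioms by (simp add: cone_curve_def cone_curve_axioms_def)
    show ?thesis by (rule ac_continuous[OF hac])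
  qed
  note inth = mono_derivative_integrable[OF ab hm hc N Dh]
  have F: "0 \<le> F" using m(1) m(2,3)[of s] s by auto
  have "cone_L f dist a b \<gamma> \<le> (\<integral>t. F / (2 * c) * h' t + c * \<alpha>' t \<partial>lebesgue_on {a..b})"
    unfolding cone_L_lapse
  proof (rule integral_mono_AE[OF int(3)])
    show "integrable (lebesgue_on {a..b}) (\<lambda>t. F / (2 * c) * h' t + c * \<alpha>' t)" using inth(1) int(1) by auto
    show "AE t in lebesgue_on {a..b}. lapse f dist \<gamma> t \<le> F / (2 * c) * h' t + c * \<alpha>' t"
    proof (rule AE_lebesgue_onI[OF N])
      fix t assume t: "t \<in> {a<..<b} - N"
      have *: "0 < \<alpha>' t" "0 < f (\<alpha> t)" "f (\<alpha> t) * \<bar>\<beta>' t\<bar> \<le> \<alpha>' t"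
        and lap: "lapse f dist \<gamma> t = sqrt ((\<alpha>' t)\<^sup>2 - (f (\<alpha> t) * \<beta>' t)\<^sup>2)"
        using D t by (auto simp: \<alpha>_def)
      define x y where "x = \<alpha>' t - f (\<alpha> t) * \<beta>' t" and "y = \<alpha>' t + f (\<alpha> t) * \<beta>' t"
      have "\<bar>f (\<alpha> t) * \<beta>' t\<bar> \<le> \<alpha>' t" using * by (simp add: abs_mult)
      then have xy: "0 \<le> x" "0 \<le> y" "y \<le> 2 * \<alpha>' t" by (auto simp: x_def y_def abs_le_iff)
      have "lapse f dist \<gamma> t = sqrt (x * y)" unfolding lap by (simp add: x_def y_def power2_eq_square algebra_simps)
      also have "x * y = (x / c) * (c * y)" using c by simp
      also have "sqrt ((x / c) * (c * y)) \<le> (x / c + c * y) / 2"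
        using xy c by (intro arith_geo_mean_sqrt) auto
      also have "\<dots> \<le> (F * h' t / c + c * (2 * \<alpha>' t)) / 2"
      proof -
        have "x = f (\<alpha> t) * h' t" using * by (simp add: x_def h'_def algebra_simps)
        also have "\<dots> \<le> F * h' t" using m(3)[of "\<alpha> t"] \<alpha>_in[of t] t h'0[OF t] by (intro mult_right_mono) auto
        finally have "x \<le> F * h' t" .
        then show ?thesis using c xy by (intro divide_right_mono add_mono mult_left_mono) auto
      qed
      also have "\<dots> = F / (2 * c) * h' t + c * \<alpha>' t" using c by (simp add: field_simps)
      finally show "lapse f dist \<gamma> t \<le> F / (2 * c) * h' t + c * \<alpha>' t" .
    qed
  qed
  also have "\<dots> = F / (2 * c) * (\<integral>t. h' t \<partial>lebesgue_on {a..b}) + c * (\<integral>t. \<alpha>' t \<partial>lebesgue_on {a..b})"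
    using inth(1) int(1) by simp
  also have "\<dots> \<le> F / (2 * c) * (h b - h a) + c * (s' - s)"
    using inth(2) int(2) c F \<gamma> by (intro add_mono mult_left_mono) auto
  finally show "cone_L f dist a b \<gamma> \<le> c * (s' - s) + F / (2 * c) * (P s' - P s - l)"
    unfolding hab by simp
qed

section \<open>Deformation of curves to nearby endpoints\<close>

text \<open>Read a pair as time and space components: the null vector
  \<open>\<theta> * (x, x)\<close> is added to the causal vector
  \<open>(1 - \<theta>) * (x, w)\<close>, and the reverse triangle inequality says that this cannot
  reduce its length.\<close>

lemma reverse_triangle:
  fixes x w z :: real
  assumes "0 \<le> w" "w \<le> x" "\<bar>z\<bar> \<le> (1 - \<theta>) * w + \<theta> * x" "0 \<le> \<theta>" "\<theta> \<le> 1"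
  shows "((1 - \<theta>) * sqrt (x\<^sup>2 - w\<^sup>2)) \<le> sqrt (x\<^sup>2 - z\<^sup>2)"
proof -
  have "\<bar>z\<bar>\<^sup>2 \<le> ((1 - \<theta>) * w + \<theta> * x)\<^sup>2" using assms by (intro power_mono) auto
  moreover have "x\<^sup>2 - ((1 - \<theta>) * w + \<theta> * x)\<^sup>2 - (1 - \<theta>)\<^sup>2 * (x\<^sup>2 - w\<^sup>2) = 2 * \<theta> * (1 - \<theta>) * x * (x - w)"
    by (simp add: power2_eq_square algebra_simps)
  moreover have "0 \<le> 2 * \<theta> * (1 - \<theta>) * x * (x - w)" using assms by (intro mult_nonneg_nonneg) auto
  ultimately have "(1 - \<theta>)\<^sup>2 * (x\<^sup>2 - w\<^sup>2) \<le> x\<^sup>2 - z\<^sup>2"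
    unfolding power2_abs by linarith
  then have "sqrt ((1 - \<theta>)\<^sup>2 * (x\<^sup>2 - w\<^sup>2)) \<le> sqrt (x\<^sup>2 - z\<^sup>2)" by (rule real_sqrt_le_mono)
  then show ?thesis using assms by (simp add: real_sqrt_mult)
qed

text \<open>Time is rescaled affinely by \<open>k\<close>; the fibre component is scaled by
  \<open>(1 - \<theta>) * c * k\<close> and corrected by a multiple \<open>\<mu>\<close> of the null
  curve so as to end at \<open>l2\<close>. The factor \<open>c\<close> absorbs the variation of
  \<open>f\<close> between old and new times, and the share \<open>\<theta>\<close> of the speed
  limit makes room for the correction.\<close>

lemma deformation:
  assumes \<gamma>: "cone_fd False I f UNIV dist a b \<gamma>" "\<gamma> a = (s1, 0)" "\<gamma> b = (s1', l1)"
    and s1: "s1 \<in> {u0<..<u1}" "s1' \<in> {u0<..<u1}" "s1 < s1'"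
    and s2: "s2 \<in> {u0<..<u1}" "s2' \<in> {u0<..<u1}" "s2 < s2'"
    and k: "k = (s2' - s2) / (s1' - s1)" and \<theta>: "0 \<le> \<theta>" "\<theta> \<le> 1" and c: "0 \<le> c"
    and cf: "\<And>r. r \<in> {s1..s1'} \<Longrightarrow> c * f (s2 + k * (r - s1)) \<le> f r"
    and \<mu>: "\<bar>\<mu>\<bar> \<le> \<theta>" and l2: "l2 = (1 - \<theta>) * c * k * l1 + \<mu> * (P s2' - P s2)"
  shows "\<exists>\<gamma>'. cone_fd False I f UNIV dist a b \<gamma>' \<and> \<gamma>' a = (s2, 0) \<and> \<gamma>' b = (s2', l2) \<and>
    (1 - \<theta>) * k * cone_L f dist a b \<gamma> \<le> cone_L f dist a b \<gamma>'"
proof -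
  obtain \<alpha>' \<beta>' N where ab: "a < b" and ac: "metric_ac dist a b (\<lambda>t. fst (\<gamma> t))" "metric_ac dist a b (\<lambda>t. snd (\<gamma> t))"
    and sm: "strict_mono_on {a..b} (\<lambda>t. fst (\<gamma> t))" and "(\<lambda>t. fst (\<gamma> t)) ` {a..b} \<subseteq> I" and N: "negligible N"
    and D: "\<forall>t\<in>{a<..<b} - N. ((\<lambda>t. fst (\<gamma> t)) has_real_derivative \<alpha>' t) (at t) \<and> ((\<lambda>t. snd (\<gamma> t)) has_real_derivative \<beta>' t) (at t) \<and>
        0 < \<alpha>' t \<and> 0 < f (fst (\<gamma> t)) \<and> f (fst (\<gamma> t)) * \<bar>\<beta>' t\<bar> \<le> \<alpha>' t \<and>
        lapse f dist \<gamma> t = sqrt ((\<alpha>' t)\<^sup>2 - (f (fst (\<gamma> t)) * \<beta>' t)\<^sup>2)"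
    and "integrable (lebesgue_on {a..b}) \<alpha>'" "(\<integral>t. \<alpha>' t \<partial>lebesgue_on {a..b}) \<le> fst (\<gamma> b) - fst (\<gamma> a)"
    and int: "integrable (lebesgue_on {a..b}) (lapse f dist \<gamma>)"
    by (rule curve_facts[OF \<gamma>(1)]) (rule that)
  define \<alpha> \<beta> where "\<alpha> = (\<lambda>t. fst (\<gamma> t))" and "\<beta> = (\<lambda>t. snd (\<gamma> t))"
  have ends: "\<alpha> a = s1" "\<alpha> b = s1'" "\<beta> a = 0" "\<beta> b = l1" using \<gamma> by (auto simp: \<alpha>_def \<beta>_def)
  have \<alpha>m: "\<alpha> r \<le> \<alpha> t" if "a \<le> r" "r \<le> t" "t \<le> b" for r t
    using strict_mono_onD[OF sm, of r t] that by (cases "r = t") (auto simp: \<alpha>_def)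
  have \<alpha>_in: "\<alpha> t \<in> {s1..s1'}" if "t \<in> {a..b}" for t
    using \<alpha>m[of a t] \<alpha>m[of t b] that ends by auto
  have k0: "0 < k" using k s1 s2 by simp
  define A where "A = (\<lambda>t. s2 + k * (\<alpha> t - s1))"
  have Ae: "A a = s2" "A b = s2'" using s1 by (auto simp: A_def ends k)
  have Am: "strict_mono_on {a..b} A"
    using sm k0 by (auto simp: strict_mono_on_def A_def \<alpha>_def)
  have A_in: "A t \<in> {s2..s2'}" if "t \<in> {a..b}" for t
  proof -
    have "k * (\<alpha> t - s1) \<le> k * (s1' - s1)" "0 \<le> k * (\<alpha> t - s1)" using \<alpha>_in[OF that] k0 by auto
    moreover have "k * (s1' - s1) = s2' - s2" using s1 by (simp add: k)
    ultimately show ?thesis by (simp add: A_def)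
  qed
  have A_in': "A t \<in> {u0<..<u1}" if "t \<in> {a..b}" for t using A_in[OF that] s2 by auto
  define B where "B = (\<lambda>t. (1 - \<theta>) * c * k * \<beta> t + \<mu> * (P (A t) - P s2))"
  have Aac: "metric_ac dist a b A"
  proof (rule metric_ac_comparison[OF ac(1) ac(1), of k])
    fix r t
    have "dist (A r) (A t) = k * dist (\<alpha> r) (\<alpha> t)" using k0
      by (simp add: A_def dist_real_def abs_mult flip: right_diff_distrib)
    also have "\<dots> \<le> k * (dist (\<alpha> r) (\<alpha> t) + dist (\<alpha> r) (\<alpha> t))" using k0 by (intro mult_left_mono) auto
    finally show "dist (A r) (A t) \<le> k * (dist (fst (\<gamma> r)) (fst (\<gamma> t)) + dist (fst (\<gamma> r)) (fst (\<gamma> t)))" by (simp add: \<alpha>_def)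
  qed (rule k0)
  \<comment> \<open>A Lipschitz constant of \<open>B\<close> relative to \<open>\<beta>\<close> and
    \<open>A\<close>; the summand 1 only makes it positive.\<close>
  define M where "M = (1 - \<theta>) * c * k + \<bar>\<mu>\<bar> / m + 1"
  have M: "(1 - \<theta>) * c * k \<le> M" "\<bar>\<mu>\<bar> / m \<le> M" "0 < M"
  proof -
    have "0 \<le> (1 - \<theta>) * c * k" "0 \<le> \<bar>\<mu>\<bar> / m" using \<theta> c k0 m(1) by auto
    then show "(1 - \<theta>) * c * k \<le> M" "\<bar>\<mu>\<bar> / m \<le> M" "0 < M" by (auto simp: M_def)
  qed
  have Bac: "metric_ac dist a b B"
  proof (rule metric_ac_comparison[OF ac(2) Aac M(3)])
    fix r t assume rt: "a \<le> r" "r \<le> t" "t \<le> b"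
    have "B r - B t = (1 - \<theta>) * c * k * (\<beta> r - \<beta> t) + \<mu> * (P (A r) - P (A t))" by (simp add: B_def algebra_simps)
    then have "\<bar>B r - B t\<bar> \<le> \<bar>(1 - \<theta>) * c * k * (\<beta> r - \<beta> t)\<bar> + \<bar>\<mu> * (P (A r) - P (A t))\<bar>" by simp
    also have "\<dots> \<le> M * \<bar>\<beta> r - \<beta> t\<bar> + M * \<bar>A r - A t\<bar>"
    proof (rule add_mono)
      have "\<bar>(1 - \<theta>) * c * k * (\<beta> r - \<beta> t)\<bar> = (1 - \<theta>) * c * k * \<bar>\<beta> r - \<beta> t\<bar>" using \<theta> c k0 by (simp add: abs_mult)
      then show "\<bar>(1 - \<theta>) * c * k * (\<beta> r - \<beta> t)\<bar> \<le> M * \<bar>\<beta> r - \<beta> t\<bar>" using M(1) by (simp add: mult_right_mono)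
      have "\<bar>\<mu> * (P (A r) - P (A t))\<bar> \<le> \<bar>\<mu>\<bar> * ((1 / m) * \<bar>A r - A t\<bar>)"
        unfolding abs_mult using rt by (intro mult_left_mono P_lip A_in') auto
      also have "\<dots> = \<bar>\<mu>\<bar> / m * \<bar>A r - A t\<bar>" by simp
      also have "\<dots> \<le> M * \<bar>A r - A t\<bar>" by (rule mult_right_mono[OF M(2)]) simp
      finally show "\<bar>\<mu> * (P (A r) - P (A t))\<bar> \<le> M * \<bar>A r - A t\<bar>" .
    qed
    finally show "dist (B r) (B t) \<le> M * (dist (snd (\<gamma> r)) (snd (\<gamma> t)) + dist (A r) (A t))"
      by (simp add: dist_real_def \<beta>_def algebra_simps)
  qed
  define A' B' where "A' = (\<lambda>t. k * \<alpha>' t)" and "B' = (\<lambda>t. (1 - \<theta>) * c * k * \<beta>' t + \<mu> * (1 / f (A t) * (k * \<alpha>' t)))"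
  have pt: "(A has_real_derivative A' t) (at t) \<and> (B has_real_derivative B' t) (at t) \<and>
        0 < A' t \<and> 0 < f (A t) \<and> f (A t) * \<bar>B' t\<bar> \<le> A' t"
    and lap: "(1 - \<theta>) * k * lapse f dist \<gamma> t \<le> sqrt ((A' t)\<^sup>2 - (f (A t) * B' t)\<^sup>2)" if t: "t \<in> {a<..<b} - N" for t
  proof -
    have da: "(\<alpha> has_real_derivative \<alpha>' t) (at t)" and db: "(\<beta> has_real_derivative \<beta>' t) (at t)"
      and *: "0 < \<alpha>' t" "0 < f (\<alpha> t)" "f (\<alpha> t) * \<bar>\<beta>' t\<bar> \<le> \<alpha>' t"
      and l: "lapse f dist \<gamma> t = sqrt ((\<alpha>' t)\<^sup>2 - (f (\<alpha> t) * \<beta>' t)\<^sup>2)"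
      using D t by (auto simp: \<alpha>_def \<beta>_def)
    have t': "t \<in> {a..b}" using t by auto
    have fA: "0 < f (A t)" using m(1) m(2)[of "A t"] A_in'[OF t'] by auto
    have dA: "(A has_real_derivative A' t) (at t)"
      unfolding A_def A'_def using da by (auto intro!: derivative_eq_intros)
    have "(P has_real_derivative 1 / f (A t)) (at (A t))" by (rule P[OF A_in'[OF t']])
    from DERIV_chain2[OF this dA] have "((\<lambda>t. P (A t)) has_real_derivative 1 / f (A t) * (k * \<alpha>' t)) (at t)" by (simp add: A'_def)
    then have dB: "(B has_real_derivative B' t) (at t)"
      unfolding B_def B'_def using db by (auto intro!: derivative_eq_intros)
    \<comment> \<open>The time speed of the new curve, and the fibre speed of the old one, weighted
      by \<open>f\<close> and rescaled by \<open>k\<close>.\<close>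
    define x w where "x = k * \<alpha>' t" and "w = k * (f (\<alpha> t) * \<bar>\<beta>' t\<bar>)"
    have xw: "0 \<le> w" "w \<le> x" using * k0 by (auto simp: x_def w_def intro!: mult_left_mono)
    have "f (A t) * B' t = (1 - \<theta>) * k * (c * f (A t)) * \<beta>' t + \<mu> * x"
      using fA by (simp add: B'_def x_def field_simps)
    then have "\<bar>f (A t) * B' t\<bar> \<le> \<bar>(1 - \<theta>) * k * (c * f (A t)) * \<beta>' t\<bar> + \<bar>\<mu> * x\<bar>" by simp
    also have "\<dots> \<le> (1 - \<theta>) * w + \<theta> * x"
    proof (rule add_mono)
      have "\<bar>(1 - \<theta>) * k * (c * f (A t)) * \<beta>' t\<bar> = (1 - \<theta>) * (k * ((c * f (A t)) * \<bar>\<beta>' t\<bar>))"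
        using \<theta> k0 c fA by (simp add: abs_mult)
      also have "\<dots> \<le> (1 - \<theta>) * (k * (f (\<alpha> t) * \<bar>\<beta>' t\<bar>))"
        using cf[OF \<alpha>_in[OF t']] \<theta> k0 by (intro mult_left_mono mult_right_mono) (auto simp: A_def)
      finally show "\<bar>(1 - \<theta>) * k * (c * f (A t)) * \<beta>' t\<bar> \<le> (1 - \<theta>) * w" by (simp add: w_def)
      show "\<bar>\<mu> * x\<bar> \<le> \<theta> * x" using \<mu> xw by (simp add: abs_mult mult_right_mono)
    qed
    finally have z: "\<bar>f (A t) * B' t\<bar> \<le> (1 - \<theta>) * w + \<theta> * x" .
    also have "\<dots> \<le> (1 - \<theta>) * x + \<theta> * x" using xw \<theta> by (intro add_right_mono mult_left_mono) auto
    finally have "f (A t) * \<bar>B' t\<bar> \<le> A' t" using fA by (simp add: abs_mult A'_def x_def algebra_simps)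
    moreover have "0 < A' t" using k0 * by (simp add: A'_def)
    ultimately show "(A has_real_derivative A' t) (at t) \<and> (B has_real_derivative B' t) (at t) \<and>
        0 < A' t \<and> 0 < f (A t) \<and> f (A t) * \<bar>B' t\<bar> \<le> A' t" using dA dB fA by blast
    have "(1 - \<theta>) * sqrt (x\<^sup>2 - w\<^sup>2) \<le> sqrt (x\<^sup>2 - (f (A t) * B' t)\<^sup>2)"
      by (rule reverse_triangle[OF xw z \<theta>])
    moreover have "sqrt (x\<^sup>2 - w\<^sup>2) = k * lapse f dist \<gamma> t"
    proof -
      have "x\<^sup>2 - w\<^sup>2 = k\<^sup>2 * ((\<alpha>' t)\<^sup>2 - (f (\<alpha> t) * \<beta>' t)\<^sup>2)"
        by (simp add: x_def w_def power_mult_distrib algebra_simps)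
      then show ?thesis using k0 by (simp add: l real_sqrt_mult)
    qed
    ultimately show "(1 - \<theta>) * k * lapse f dist \<gamma> t \<le> sqrt ((A' t)\<^sup>2 - (f (A t) * B' t)\<^sup>2)"
      by (simp add: x_def A'_def)
  qed
  have AI: "A ` {a..b} \<subseteq> I" using A_in' I by force
  have new: "cone_fd False I f UNIV dist a b (\<lambda>t. (A t, B t))"
    and lapn: "\<forall>t\<in>{a<..<b} - N. lapse f dist (\<lambda>t. (A t, B t)) t = sqrt ((A' t)\<^sup>2 - (f (A t) * B' t)\<^sup>2)"
    using strip_curveI[OF ab Aac Bac Am AI N, of A' B' f] pt by blast+
  interpret new: cone_curve UNIV dist False I f a b "\<lambda>t. (A t, B t)"
    using f_cont f_pos new real_metric.metric_carrier_axioms by (simp add: cone_curve_def cone_curve_axioms_def)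
  have "(1 - \<theta>) * k * cone_L f dist a b \<gamma> = (\<integral>t. (1 - \<theta>) * k * lapse f dist \<gamma> t \<partial>lebesgue_on {a..b})"
    by (simp add: cone_L_lapse)
  also have "\<dots> \<le> cone_L f dist a b (\<lambda>t. (A t, B t))"
    unfolding cone_L_lapse
  proof (rule integral_mono_AE)
    show "AE t in lebesgue_on {a..b}. (1 - \<theta>) * k * lapse f dist \<gamma> t \<le> lapse f dist (\<lambda>t. (A t, B t)) t"
      by (rule AE_lebesgue_onI[OF N]) (use lap lapn in auto)
  qed (use int new.lapse_integrable in auto)
  finally show ?thesis
    using new Ae l2 by (intro exI[of _ "\<lambda>t. (A t, B t)"]) (auto simp: B_def ends)
qed

text \<open>Only three real numbers enter; continuity of the time separation over any geodesic fibre
  reduces to continuity of this function.\<close>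

definition G :: "real \<Rightarrow> real \<Rightarrow> real \<Rightarrow> real" where
  "G s s' l = real_of_ereal (gtau (cone_fd False I f UNIV dist) (cone_L f dist) (s, 0) (s', l))"

lemma gtau_bound:
  fixes l :: real
  assumes s: "s \<in> {u0<..<u1}" "s' \<in> {u0<..<u1}" and B: "0 \<le> B"
    and le: "\<And>a b \<gamma>. cone_fd False I f UNIV dist a b \<gamma> \<Longrightarrow> \<gamma> a = (s, 0) \<Longrightarrow> \<gamma> b = (s', l) \<Longrightarrow> cone_L f dist a b \<gamma> \<le> B"
  shows "gtau (cone_fd False I f UNIV dist) (cone_L f dist) (s, 0) (s', l) \<le> ereal B"
  unfolding gtau_def using le B by (auto intro!: Sup_least)

lemma L_nonneg:
  fixes \<gamma> :: "real \<Rightarrow> real \<times> real"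
  assumes "cone_fd False I f UNIV dist a b \<gamma>"
  shows "0 \<le> cone_L f dist a b \<gamma>"
proof -
  interpret cone_curve UNIV dist False I f a b \<gamma>
    using f_cont f_pos assms real_metric.metric_carrier_axioms by (simp add: cone_curve_def cone_curve_axioms_def)
  show ?thesis by (rule cone_L_nonneg)
qed

lemma gtau_nonneg:
  fixes p q :: "real \<times> real"
  shows "0 \<le> gtau (cone_fd False I f UNIV dist) (cone_L f dist) p q"
proof -
  \<comment> \<open>Comparison with the empty family of curves, whose value is 0 by
    convention.\<close>
  have "gtau (\<lambda>_ _ _. False) (\<lambda>_ _ _. 0) p q \<le> gtau (cone_fd False I f UNIV dist) (cone_L f dist) p q"
    by (rule gtau_mono) (use L_nonneg in auto)
  then show ?thesis by (simp add: gtau_def[of "\<lambda>_ _ _. False"])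
qed

lemma F_pos: "u0 < u1 \<Longrightarrow> 0 < F"
  using m(1) m(2,3)[of u0] by auto

text \<open>Replacing \<open>s' - s\<close> by \<open>u1 - u0\<close> makes the first term
  independent of the endpoints, and \<open>max 0\<close> keeps the bound valid when no curve joins
  them.\<close>

lemma G_bound:
  assumes s: "s \<in> {u0<..<u1}" "s' \<in> {u0<..<u1}" and c: "c > 0"
  shows "gtau (cone_fd False I f UNIV dist) (cone_L f dist) (s, 0) (s', l) \<le> ereal (c * (u1 - u0) + F / (2 * c) * max 0 (P s' - P s - l))"
proof (rule gtau_bound[OF s])
  have F: "0 < F" using s by (intro F_pos) auto
  show "0 \<le> c * (u1 - u0) + F / (2 * c) * max 0 (P s' - P s - l)" using c F s by (intro add_nonneg_nonneg mult_nonneg_nonneg) auto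
  fix a b \<gamma> assume \<gamma>: "cone_fd False I f UNIV dist a b \<gamma>" "\<gamma> a = (s, 0)" "\<gamma> b = (s', l)"
  have "cone_L f dist a b \<gamma> \<le> c * (s' - s) + F / (2 * c) * (P s' - P s - l)" by (rule length_bound(3)[OF \<gamma> s c])
  also have "\<dots> \<le> c * (u1 - u0) + F / (2 * c) * max 0 (P s' - P s - l)"
    using c F s by (intro add_mono mult_left_mono) auto
  finally show "cone_L f dist a b \<gamma> \<le> c * (u1 - u0) + F / (2 * c) * max 0 (P s' - P s - l)" .
qed

lemma gtau_G:
  assumes s: "s \<in> {u0<..<u1}" "s' \<in> {u0<..<u1}"
  shows "gtau (cone_fd False I f UNIV dist) (cone_L f dist) (s, 0) (s', l) = ereal (G s s' l)"
proof -
  have "gtau (cone_fd False I f UNIV dist) (cone_L f dist) (s, 0) (s', l) \<noteq> \<infinity>"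
    using G_bound[OF s, of 1 l] by auto
  then show ?thesis using gtau_nonneg[of "(s, 0)" "(s', l)"] unfolding G_def by (subst ereal_real') auto
qed

lemma G_nonneg: "0 \<le> G s s' l"
  unfolding G_def by (rule real_of_ereal_pos[OF gtau_nonneg])

lemma G_le:
  assumes "s \<in> {u0<..<u1}" "s' \<in> {u0<..<u1}" "c > 0"
  shows "G s s' l \<le> c * (u1 - u0) + F / (2 * c) * max 0 (P s' - P s - l)"
  using G_bound[OF assms, of l] unfolding gtau_G[OF assms(1,2)] by simp

lemma G_deformation:
  assumes s1: "s1 \<in> {u0<..<u1}" "s1' \<in> {u0<..<u1}" "s1 < s1'"
    and s2: "s2 \<in> {u0<..<u1}" "s2' \<in> {u0<..<u1}" "s2 < s2'"
    and k: "k = (s2' - s2) / (s1' - s1)" and \<theta>: "0 \<le> \<theta>" "\<theta> < 1" and c: "0 \<le> c"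
    and cf: "\<And>r. r \<in> {s1..s1'} \<Longrightarrow> c * f (s2 + k * (r - s1)) \<le> f r"
    and \<mu>: "\<bar>\<mu>\<bar> \<le> \<theta>" and l2: "l2 = (1 - \<theta>) * c * k * l1 + \<mu> * (P s2' - P s2)"
  shows "(1 - \<theta>) * k * G s1 s1' l1 \<le> G s2 s2' l2"
proof -
  have k0: "0 < (1 - \<theta>) * k" using k s1 s2 \<theta> by simp
  have "gtau (cone_fd False I f UNIV dist) (cone_L f dist) (s1, 0) (s1', l1) \<le> ereal (G s2 s2' l2 / ((1 - \<theta>) * k))"
  proof (rule gtau_bound[OF s1(1,2)])
    show "0 \<le> G s2 s2' l2 / ((1 - \<theta>) * k)" using k0 G_nonneg by (intro divide_nonneg_pos)
    fix a b \<gamma> assume \<gamma>: "cone_fd False I f UNIV dist a b \<gamma>" "\<gamma> a = (s1, 0)" "\<gamma> b = (s1', l1)"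
    obtain \<gamma>' where \<gamma>': "cone_fd False I f UNIV dist a b \<gamma>'" "\<gamma>' a = (s2, 0)" "\<gamma>' b = (s2', l2)"
      "(1 - \<theta>) * k * cone_L f dist a b \<gamma> \<le> cone_L f dist a b \<gamma>'"
      using deformation[OF \<gamma> s1 s2 k \<theta>(1) less_imp_le[OF \<theta>(2)] c cf \<mu> l2] by blast
    have "ereal (cone_L f dist a b \<gamma>') \<le> ereal (G s2 s2' l2)"
      unfolding gtau_G[OF s2(1,2), symmetric] by (rule gtau_upper) (use \<gamma>' in auto)
    then show "cone_L f dist a b \<gamma> \<le> G s2 s2' l2 / ((1 - \<theta>) * k)"
      using \<gamma>'(4) k0 by (simp add: pos_le_divide_eq mult.commute)
  qed
  then show ?thesis unfolding gtau_G[OF s1(1,2)] using k0 by (simp add: pos_le_divide_eq mult.commute)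
qed

lemma P_increasing:
  assumes "r \<in> {u0<..<u1}" "s \<in> {u0<..<u1}" "P r < P s"
  shows "r < s"
proof (rule ccontr)
  assume "\<not> r < s"
  moreover have "r \<noteq> s" using assms by auto
  ultimately have sr: "s < r" by simp
  then obtain z where z: "z > s" "z < r" "P r - P s = (r - s) * (1 / f z)"
    using MVT2[of s r P "\<lambda>z. 1 / f z"] P assms by auto
  have "0 < f z" using m(1) m(2)[of z] z assms by auto
  then have "0 < P r - P s" using z(3) sr by simp
  then show False using assms by simp
qed

text \<open>The two families have the same limit and interchangeable roles, so this single estimate
  gives lower and upper semicontinuity of \<open>G\<close>. The strict inequality
  \<open>l < P s' - P s\<close> leaves the room that the correction \<open>\<mu>\<close>
  needs.\<close>

lemma G_eventually_le:
  assumes s: "s \<in> {u0<..<u1}" "s' \<in> {u0<..<u1}" and l: "0 \<le> l" "l < P s' - P s"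
    and 1: "(S1 \<longlongrightarrow> s) \<Phi>" "(S1' \<longlongrightarrow> s') \<Phi>" "(L1 \<longlongrightarrow> l) \<Phi>"
    and 2: "(S2 \<longlongrightarrow> s) \<Phi>" "(S2' \<longlongrightarrow> s') \<Phi>" "(L2 \<longlongrightarrow> l) \<Phi>"
    and \<theta>: "0 < \<theta>" "\<theta> < 1"
  shows "\<forall>\<^sub>F x in \<Phi>. (1 - \<theta>)\<^sup>2 * G (S1 x) (S1' x) (L1 x) \<le> G (S2 x) (S2' x) (L2 x)"
proof -
  define \<Lambda> where "\<Lambda> = P s' - P s"
  have \<Lambda>: "0 < \<Lambda>" "l < \<Lambda>" using l by (auto simp: \<Lambda>_def)
  have ss': "s < s'" using P_increasing[OF s] l by simp
  \<comment> \<open>Chosen so that the limit of \<open>\<mu>\<close> is below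
    \<open>\<theta>\<close>: with this value,
    \<open>\<theta> * \<Lambda> - l * (\<theta> + \<theta>1)\<close> equals
    \<open>\<theta> * (\<Lambda> - l)\<^sup>2 / \<Lambda>\<close>, which is positive.\<close>
  define \<theta>1 where "\<theta>1 = \<theta> * (\<Lambda> - l) / \<Lambda>"
  have \<theta>1: "0 < \<theta>1" "\<theta>1 \<le> \<theta>" using \<theta> \<Lambda> l by (auto simp: \<theta>1_def field_simps)
  define c where "c = 1 - \<theta>1"
  have c: "0 \<le> c" using \<theta>1 \<theta> by (simp add: c_def)
  define k where "k = (\<lambda>x. (S2' x - S2 x) / (S1' x - S1 x))"
  \<comment> \<open>The solution of the endpoint condition of \<open>G_deformation\<close> for the
    correction.\<close>
  define \<mu> where "\<mu> = (\<lambda>x. (L2 x - (1 - \<theta>) * c * k x * L1 x) / (P (S2' x) - P (S2 x)))"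
  have Pc: "isCont P r" if "r \<in> {u0<..<u1}" for r using P[OF that] by (rule DERIV_isCont)
  have k1: "(k \<longlongrightarrow> 1) \<Phi>"
  proof -
    have "(k \<longlongrightarrow> (s' - s) / (s' - s)) \<Phi>" unfolding k_def using ss' by (intro tendsto_intros 1 2) auto
    then show ?thesis using ss' by simp
  qed
  have P2: "((\<lambda>x. P (S2' x) - P (S2 x)) \<longlongrightarrow> \<Lambda>) \<Phi>"
    unfolding \<Lambda>_def by (intro tendsto_intros isCont_tendsto_compose[OF Pc] s 2)
  have \<mu>0: "(\<mu> \<longlongrightarrow> (l - (1 - \<theta>) * c * 1 * l) / \<Lambda>) \<Phi>"
    unfolding \<mu>_def using \<Lambda> by (intro tendsto_intros P2 k1 1 2) auto
  have "(l - (1 - \<theta>) * c * 1 * l) / \<Lambda> < \<theta>"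
  proof -
    have "(l - (1 - \<theta>) * c * 1 * l) = l * (\<theta> + \<theta>1 * (1 - \<theta>))" by (simp add: c_def algebra_simps)
    also have "\<dots> \<le> l * (\<theta> + \<theta>1)" using l \<theta> \<theta>1 by (intro mult_left_mono) (auto simp: algebra_simps)
    also have "\<dots> < \<theta> * \<Lambda>"
    proof -
      have "\<theta>1 * \<Lambda> = \<theta> * (\<Lambda> - l)" using \<Lambda> by (simp add: \<theta>1_def)
      moreover have "\<Lambda> * (l * (\<theta> + \<theta>1)) = l * (\<theta> * \<Lambda> + \<theta>1 * \<Lambda>)" by (simp add: algebra_simps)
      ultimately have "\<Lambda> * (l * (\<theta> + \<theta>1)) = l * (\<theta> * \<Lambda> + \<theta> * (\<Lambda> - l))" by simp
      also have "\<dots> = \<Lambda> * (\<theta> * \<Lambda>) - \<theta> * (\<Lambda> - l)\<^sup>2" by (simp add: power2_eq_square algebra_simps)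
      also have "\<dots> < \<Lambda> * (\<theta> * \<Lambda>)" using \<theta> \<Lambda> by simp
      finally show ?thesis using \<Lambda> by simp
    qed
    finally show ?thesis using \<Lambda> by (simp add: pos_divide_less_eq)
  qed
  then have e\<mu>1: "\<forall>\<^sub>F x in \<Phi>. \<mu> x < \<theta>" by (rule order_tendstoD(2)[OF \<mu>0])
  have "0 \<le> (l - (1 - \<theta>) * c * 1 * l) / \<Lambda>"
  proof -
    have "(1 - \<theta>) * c \<le> 1 * 1" using \<theta> \<theta>1 c by (intro mult_mono) (auto simp: c_def)
    then have "(1 - \<theta>) * c * l \<le> 1 * l" using l by (intro mult_right_mono) auto
    then show ?thesis using \<Lambda> by simp
  qed
  then have "- \<theta> < (l - (1 - \<theta>) * c * 1 * l) / \<Lambda>" using \<theta> by linarith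
  then have e\<mu>2: "\<forall>\<^sub>F x in \<Phi>. - \<theta> < \<mu> x" by (rule order_tendstoD(1)[OF \<mu>0])
  have ek: "\<forall>\<^sub>F x in \<Phi>. 1 - \<theta> < k x" by (rule order_tendstoD(1)[OF k1]) (use \<theta> in simp)
  have eP: "\<forall>\<^sub>F x in \<Phi>. 0 < P (S2' x) - P (S2 x)" by (rule order_tendstoD(1)[OF P2 \<Lambda>(1)])
  have ein: "\<forall>\<^sub>F x in \<Phi>. f x \<in> {u0<..<u1}" if "(f \<longlongrightarrow> r) \<Phi>" "r \<in> {u0<..<u1}" for f r
    using that by (intro topological_tendstoD) auto
  have lt1: "\<forall>\<^sub>F x in \<Phi>. S1' x - S1 x > 0"
  proof (rule order_tendstoD(1))
    show "((\<lambda>x. S1' x - S1 x) \<longlongrightarrow> s' - s) \<Phi>" by (intro tendsto_intros 1)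
  qed (use ss' in simp)
  have lt2: "\<forall>\<^sub>F x in \<Phi>. S2' x - S2 x > 0"
  proof (rule order_tendstoD(1))
    show "((\<lambda>x. S2' x - S2 x) \<longlongrightarrow> s' - s) \<Phi>" by (intro tendsto_intros 2)
  qed (use ss' in simp)
  \<comment> \<open>A change of \<open>f\<close> by less than \<open>m * \<theta>1\<close> is at
    most the share \<open>\<theta>1\<close> of its value, which the factor
    \<open>c = 1 - \<theta>1\<close> absorbs.\<close>
  have "uniformly_continuous_on {u0..u1} f"
    using f_cont I by (intro compact_uniformly_continuous) (auto intro: continuous_on_subset)
  moreover have "0 < m * \<theta>1" using m(1) \<theta>1 by simp
  ultimately obtain \<delta> where \<delta>: "\<delta> > 0" "\<forall>x\<in>{u0..u1}. \<forall>x'\<in>{u0..u1}. dist x' x < \<delta> \<longrightarrow> dist (f x') (f x) < m * \<theta>1"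
    unfolding uniformly_continuous_on_def by blast
  have d1: "\<forall>\<^sub>F x in \<Phi>. \<bar>S2 x - S1 x\<bar> < \<delta>"
  proof (rule order_tendstoD(2))
    show "((\<lambda>x. \<bar>S2 x - S1 x\<bar>) \<longlongrightarrow> \<bar>s - s\<bar>) \<Phi>" by (intro tendsto_intros 1 2)
  qed (use \<delta> in simp)
  have d2: "\<forall>\<^sub>F x in \<Phi>. \<bar>S2' x - S1' x\<bar> < \<delta>"
  proof (rule order_tendstoD(2))
    show "((\<lambda>x. \<bar>S2' x - S1' x\<bar>) \<longlongrightarrow> \<bar>s' - s'\<bar>) \<Phi>" by (intro tendsto_intros 1 2)
  qed (use \<delta> in simp)
  show ?thesis
    using e\<mu>1 e\<mu>2 ek eP ein[OF 1(1) s(1)] ein[OF 1(2) s(2)] ein[OF 2(1) s(1)] ein[OF 2(2) s(2)] lt1 lt2 d1 d2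
  proof eventually_elim
    case (elim x)
    define A where "A = (\<lambda>r. S2 x + k x * (r - S1 x))"
    have "(1 - \<theta>) * k x * G (S1 x) (S1' x) (L1 x) \<le> G (S2 x) (S2' x) (L2 x)"
    proof (rule G_deformation[OF elim(5,6) _ elim(7,8) _ _ _ \<theta>(2) c])
      show "L2 x = (1 - \<theta>) * c * k x * L1 x + \<mu> x * (P (S2' x) - P (S2 x))"
        using elim(4) by (simp add: \<mu>_def)
      fix r assume r: "r \<in> {S1 x..S1' x}"
      define \<tau> where "\<tau> = (r - S1 x) / (S1' x - S1 x)"
      have \<tau>: "0 \<le> \<tau>" "\<tau> \<le> 1" "r - S1 x = \<tau> * (S1' x - S1 x)" using r elim(9) by (auto simp: \<tau>_def)
      have "k x * (r - S1 x) = \<tau> * (S2' x - S2 x)" using elim(9) unfolding \<tau>(3) k_def by simp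
      then have A: "A r = S2 x + \<tau> * (S2' x - S2 x)" by (simp add: A_def)
      have "\<tau> * (S2' x - S2 x) \<le> 1 * (S2' x - S2 x)" "0 \<le> \<tau> * (S2' x - S2 x)"
        using \<tau> elim(10) by (auto intro!: mult_right_mono)
      then have A_in: "A r \<in> {u0..u1}" unfolding A using elim(7,8) by auto
      have r_in: "r \<in> {u0..u1}" using r elim(5,6) by auto
      \<comment> \<open>The displacement of an intermediate time is a convex combination of the
        displacements of the endpoints.\<close>
      have "A r - r = (1 - \<tau>) * (S2 x - S1 x) + \<tau> * (S2' x - S1' x)"
        unfolding A using \<tau>(3) by (simp add: algebra_simps)
      then have "\<bar>A r - r\<bar> \<le> \<bar>(1 - \<tau>) * (S2 x - S1 x)\<bar> + \<bar>\<tau> * (S2' x - S1' x)\<bar>" by simp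
      also have "\<dots> = (1 - \<tau>) * \<bar>S2 x - S1 x\<bar> + \<tau> * \<bar>S2' x - S1' x\<bar>" using \<tau> by (simp add: abs_mult)
      also have "\<dots> < \<delta>"
        using elim(11,12) \<tau> by (intro convex_bound_lt) auto
      finally have "dist (A r) r < \<delta>" by (simp add: dist_real_def)
      then have "dist (f (A r)) (f r) < m * \<theta>1" using \<delta>(2) A_in r_in by blast
      then have "f (A r) - \<theta>1 * m \<le> f r" by (simp add: dist_real_def abs_less_iff mult.commute)
      moreover have "\<theta>1 * m \<le> \<theta>1 * f (A r)" using m(2)[OF A_in] \<theta>1 by simp
      ultimately show "c * f (S2 x + k x * (r - S1 x)) \<le> f r" by (simp add: c_def A_def algebra_simps)
    qed (use elim \<theta> in \<open>auto simp: k_def abs_le_iff\<close>)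
    moreover have "(1 - \<theta>)\<^sup>2 * G (S1 x) (S1' x) (L1 x) \<le> (1 - \<theta>) * k x * G (S1 x) (S1' x) (L1 x)"
      unfolding power2_eq_square using elim(3) \<theta> by (intro mult_right_mono mult_left_mono G_nonneg) auto
    ultimately show ?case by linarith
  qed
qed

text \<open>Below the null displacement, \<open>G_eventually_le\<close> is applied with either
  family constant and \<open>\<theta>\<close> tends to 0. At or beyond it \<open>G\<close> vanishes,
  and \<open>G_le\<close> with a suitable weight forces the limit 0.\<close>

lemma G_tendsto:
  assumes s: "s \<in> {u0<..<u1}" "s' \<in> {u0<..<u1}" and l: "0 \<le> l"
    and lim: "(S \<longlongrightarrow> s) \<Phi>" "(S' \<longlongrightarrow> s') \<Phi>" "(L \<longlongrightarrow> l) \<Phi>"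
  shows "((\<lambda>x. G (S x) (S' x) (L x)) \<longlongrightarrow> G s s' l) \<Phi>"
proof (cases "l < P s' - P s")
  case True
  define g where "g = G s s' l"
  have g0: "0 \<le> g" by (simp add: g_def G_nonneg)
  have lo: "\<forall>\<^sub>F x in \<Phi>. (1 - \<theta>)\<^sup>2 * g \<le> G (S x) (S' x) (L x)" if "0 < \<theta>" "\<theta> < 1" for \<theta>
    unfolding g_def by (rule G_eventually_le[OF s l True _ _ _ lim that]) auto
  have up: "\<forall>\<^sub>F x in \<Phi>. (1 - \<theta>)\<^sup>2 * G (S x) (S' x) (L x) \<le> g" if "0 < \<theta>" "\<theta> < 1" for \<theta>
    unfolding g_def by (rule G_eventually_le[OF s l True lim _ _ _ that]) auto
  have small: "\<forall>\<^sub>F \<theta> in at_right (0::real). 0 < \<theta> \<and> \<theta> < 1"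
    using eventually_at_right[of 0 "1::real"] by (auto intro!: exI[of _ 1])
  have l1: "((\<lambda>\<theta>. (1 - \<theta>)\<^sup>2 * g) \<longlongrightarrow> (1 - 0)\<^sup>2 * g) (at_right 0)" by (intro tendsto_intros)
  have l2: "((\<lambda>\<theta>. g / (1 - \<theta>)\<^sup>2) \<longlongrightarrow> g / (1 - 0)\<^sup>2) (at_right 0)" by (intro tendsto_intros) auto
  show ?thesis
    unfolding g_def[symmetric]
  proof (rule order_tendstoI)
    fix y assume "y < g"
    then have "\<forall>\<^sub>F \<theta> in at_right 0. y < (1 - \<theta>)\<^sup>2 * g" by (intro order_tendstoD(1)[OF l1]) simp
    then have "\<forall>\<^sub>F \<theta> in at_right 0. y < (1 - \<theta>)\<^sup>2 * g \<and> 0 < \<theta> \<and> \<theta> < 1" using small by eventually_elim auto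
    then obtain \<theta> where "y < (1 - \<theta>)\<^sup>2 * g" "0 < \<theta>" "\<theta> < 1"
      using eventually_happens'[OF trivial_limit_at_right_real] by blast
    then show "\<forall>\<^sub>F x in \<Phi>. y < G (S x) (S' x) (L x)" using lo[of \<theta>] by (auto elim!: eventually_mono)
  next
    fix y assume "g < y"
    then have "\<forall>\<^sub>F \<theta> in at_right 0. g / (1 - \<theta>)\<^sup>2 < y" by (intro order_tendstoD(2)[OF l2]) simp
    then have "\<forall>\<^sub>F \<theta> in at_right 0. g / (1 - \<theta>)\<^sup>2 < y \<and> 0 < \<theta> \<and> \<theta> < 1" using small by eventually_elim auto
    then obtain \<theta> where \<theta>: "g / (1 - \<theta>)\<^sup>2 < y" "0 < \<theta>" "\<theta> < 1"
      using eventually_happens'[OF trivial_limit_at_right_real] by blast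
    show "\<forall>\<^sub>F x in \<Phi>. G (S x) (S' x) (L x) < y"
      using up[OF \<theta>(2,3)]
    proof eventually_elim
      case (elim x)
      then have "G (S x) (S' x) (L x) \<le> g / (1 - \<theta>)\<^sup>2" using \<theta> by (simp add: pos_le_divide_eq mult.commute)
      then show ?case using \<theta>(1) by simp
    qed
  qed
next
  case False
  have u: "0 < u1 - u0" and F: "0 < F" using s F_pos by auto
  have G0: "G s s' l = 0"
  proof (rule antisym)
    show "G s s' l \<le> 0"
    proof (rule field_le_epsilon)
      fix e :: real assume "e > 0"
      have z: "max 0 (P s' - P s - l) = 0" using False by simp
      show "G s s' l \<le> 0 + e"
        using G_le[OF s, of "e / (u1 - u0)" l] \<open>e > 0\<close> u unfolding z by simp
    qed
  qed (rule G_nonneg)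
  have Pc: "isCont P r" if "r \<in> {u0<..<u1}" for r using P[OF that] by (rule DERIV_isCont)
  show ?thesis
    unfolding G0
  proof (rule tendstoI)
    fix e :: real assume e: "e > 0"
    \<comment> \<open>The weight first makes the time term equal to \<open>e / 2\<close>; for this
      fixed \<open>c\<close> the defect term tends to 0.\<close>
    define c where "c = e / (2 * (u1 - u0))"
    have c: "c > 0" "c * (u1 - u0) = e / 2" using e u by (auto simp: c_def field_simps)
    have "((\<lambda>x. F / (2 * c) * max 0 (P (S' x) - P (S x) - L x)) \<longlongrightarrow> F / (2 * c) * max 0 (P s' - P s - l)) \<Phi>"
      by (intro tendsto_intros isCont_tendsto_compose[OF Pc] s lim)
    then have "\<forall>\<^sub>F x in \<Phi>. F / (2 * c) * max 0 (P (S' x) - P (S x) - L x) < e / 2"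
      by (rule order_tendstoD(2)) (use False e in \<open>simp add: max_def\<close>)
    moreover have "\<forall>\<^sub>F x in \<Phi>. S x \<in> {u0<..<u1}" by (rule topological_tendstoD[OF lim(1) _ s(1)]) simp
    moreover have "\<forall>\<^sub>F x in \<Phi>. S' x \<in> {u0<..<u1}" by (rule topological_tendstoD[OF lim(2) _ s(2)]) simp
    ultimately show "\<forall>\<^sub>F x in \<Phi>. dist (G (S x) (S' x) (L x)) 0 < e"
    proof eventually_elim
      case (elim x)
      have "G (S x) (S' x) (L x) < e" using G_le[OF elim(2,3) c(1), of "L x"] elim(1) c(2) by linarith
      then show ?case using G_nonneg[of "S x" "S' x" "L x"] by (simp add: dist_real_def)
    qed
  qed
qed

end

section \<open>The transfer theorem\<close>

lemma nonexpansive_continuous: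
  fixes h :: "'a \<times> 'a \<Rightarrow> real"
  assumes Y: "Metric_space Y D" and S: "S \<subseteq> Y \<times> Y"
    and le: "\<And>p q p' q'. (p, q) \<in> S \<Longrightarrow> (p', q') \<in> S \<Longrightarrow> \<bar>h (p, q) - h (p', q')\<bar> \<le> D p p' + D q q'"
  shows "continuous_map (subtopology (prod_topology (Metric_space.mtopology Y D) (Metric_space.mtopology Y D)) S) euclideanreal h"
proof -
  interpret Y: Metric_space Y D by fact
  have "continuous_map (subtopology (prod_topology Y.mtopology Y.mtopology) S) Met_TC.mtopology h"
    unfolding Met_TC.continuous_map_to_metric
  proof (intro ballI allI impI)
    fix x and \<epsilon> :: real assume "x \<in> topspace (subtopology (prod_topology Y.mtopology Y.mtopology) S)" and \<epsilon>: "\<epsilon> > 0"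
    then obtain p q where x: "x = (p, q)" "(p, q) \<in> S" "p \<in> Y" "q \<in> Y" by auto
    define U where "U = (Y.mball p (\<epsilon> / 2) \<times> Y.mball q (\<epsilon> / 2)) \<inter> S"
    have "openin (subtopology (prod_topology Y.mtopology Y.mtopology) S) U"
      unfolding U_def by (rule openin_subtopology_Int) (simp add: openin_prod_Times_iff)
    moreover have "x \<in> U" using x \<epsilon> by (simp add: U_def)
    moreover have "h y \<in> Met_TC.mball (h x) \<epsilon>" if yU: "y \<in> U" for y
    proof -
      obtain p' q' where "y = (p', q')" by (cases y)
      moreover from this have "(p', q') \<in> S" "D p p' < \<epsilon> / 2" "D q q' < \<epsilon> / 2" using yU by (auto simp: U_def)
      ultimately show ?thesis using le[OF x(2), of p' q'] x by (simp add: dist_real_def)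
    qed
    ultimately show "\<exists>U. openin (subtopology (prod_topology Y.mtopology Y.mtopology) S) U \<and> x \<in> U \<and> (\<forall>y\<in>U. h y \<in> Met_TC.mball (h x) \<epsilon>)"
      by blast
  qed
  then show ?thesis by simp
qed

lemma cone_Metric_space:
  assumes "Metric_space X d"
  shows "Metric_space (I \<times> X) (cone_dist d)"
proof -
  interpret Metric_space X d by fact
  show ?thesis
  proof
    fix p q r :: "real \<times> 'a"
    show "0 \<le> cone_dist d p q" by (simp add: cone_dist_def)
    show "cone_dist d p q = cone_dist d q p" by (simp add: cone_dist_def commute abs_minus_commute)
    show "cone_dist d p q = 0 \<longleftrightarrow> p = q" if "p \<in> I \<times> X" "q \<in> I \<times> X"
      using that nonneg[of "snd p" "snd q"] by (auto simp: cone_dist_def prod_eq_iff mem_Times_iff add_nonneg_eq_0_iff)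
    show "cone_dist d p r \<le> cone_dist d p q + cone_dist d q r" if "p \<in> I \<times> X" "q \<in> I \<times> X" "r \<in> I \<times> X"
      using that triangle[of "snd p" "snd q" "snd r"] by (auto simp: cone_dist_def mem_Times_iff)
  qed
qed

text \<open>The neighbourhood is the double cone over a ball; it is causally convex because causal curves
  have fibre speed at most \<open>1 / m\<close>.\<close>

locale double_cone = metric_carrier X d for X :: "'a set" and d +
  fixes I :: "real set" and f :: "real \<Rightarrow> real" and t0 :: real and x0 :: 'a and m \<delta> \<delta>0 :: real
  assumes x0: "x0 \<in> X" and \<delta>: "0 < \<delta>" "\<delta> \<le> \<delta>0"
    and I: "{t0 - \<delta>0..t0 + \<delta>0} \<subseteq> I" and f_cont: "continuous_on I f" and f_pos: "\<forall>t\<in>I. f t > 0"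
    and m: "0 < m" "m \<le> 1" "\<And>r. r \<in> {t0 - \<delta>0..t0 + \<delta>0} \<Longrightarrow> m \<le> f r"
begin

definition U where "U = {p \<in> I \<times> X. \<bar>fst p - t0\<bar> + m * d x0 (snd p) < \<delta>}"

lemma U_D:
  assumes "p \<in> U"
  shows "fst p \<in> {t0 - \<delta>0<..<t0 + \<delta>0}" "snd p \<in> X" "\<bar>fst p - t0\<bar> < \<delta> / m" "d x0 (snd p) < \<delta> / m"
proof -
  have p: "\<bar>fst p - t0\<bar> + m * d x0 (snd p) < \<delta>" "snd p \<in> X" using assms by (auto simp: U_def)
  have d0: "0 \<le> d x0 (snd p)" by (rule nonneg[OF x0 p(2)])
  have md: "0 \<le> m * d x0 (snd p)" using d0 m by simp
  have "\<bar>fst p - t0\<bar> < \<delta>" using p md by linarith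
  moreover have "\<delta> * m \<le> \<delta> * 1" using m \<delta> by (intro mult_left_mono) auto
  then have "\<delta> \<le> \<delta> / m" using m by (simp add: pos_le_divide_eq)
  ultimately show "\<bar>fst p - t0\<bar> < \<delta> / m" by linarith
  show "fst p \<in> {t0 - \<delta>0<..<t0 + \<delta>0}" using \<open>\<bar>fst p - t0\<bar> < \<delta>\<close> \<delta> by (auto simp: abs_less_iff)
  show "snd p \<in> X" by fact
  have "m * d x0 (snd p) < \<delta>" using p by linarith
  then show "d x0 (snd p) < \<delta> / m" using m by (simp add: pos_less_divide_eq mult.commute)
qed

lemma ball_subset_U: "{z \<in> I \<times> X. cone_dist d (t0, x0) z < \<delta>} \<subseteq> U"
proof
  fix z assume z: "z \<in> {z \<in> I \<times> X. cone_dist d (t0, x0) z < \<delta>}"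
  then have "0 \<le> d x0 (snd z)" using nonneg[OF x0, of "snd z"] by auto
  then have "m * d x0 (snd z) \<le> 1 * d x0 (snd z)" using m by (intro mult_right_mono) auto
  then show "z \<in> U" using z by (auto simp: U_def cone_dist_def abs_minus_commute)
qed

lemma dist_lt:
  assumes "p \<in> U" "q \<in> U"
  shows "d (snd p) (snd q) < 2 * (\<delta> / m)"
  using tri[of "snd p" x0 "snd q"] sym[of "snd p" x0] x0 U_D[OF assms(1)] U_D[OF assms(2)] by linarith

lemma causally_convex:
  assumes \<gamma>: "cone_fd False I f X d a b \<gamma>" and U: "\<gamma> a \<in> U" "\<gamma> b \<in> U"
  shows "\<gamma> ` {a..b} \<subseteq> U"
proof
  interpret cone_curve X d False I f a b \<gamma>
    using f_cont f_pos \<gamma> metric_carrier_axioms by (simp add: cone_curve_def cone_curve_axioms_def)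
  fix p assume "p \<in> \<gamma> ` {a..b}"
  then obtain t where t: "t \<in> {a..b}" "p = \<gamma> t" by blast
  have mf: "m \<le> f r" if "r \<in> {\<alpha> a..\<alpha> b}" for r
    using that U_D(1)[OF U(1)] U_D(1)[OF U(2)] by (intro m(3)) auto
  have A: "m * d (\<beta> a) (\<beta> t) \<le> \<alpha> t - \<alpha> a" "m * d (\<beta> t) (\<beta> b) \<le> \<alpha> b - \<alpha> t"
    using dist_\<beta>_le[of a t, OF _ _ _ m(1) mf] dist_\<beta>_le[of t b, OF _ _ _ m(1) mf] t m(1)
    by (simp_all add: pos_le_divide_eq mult.commute)
  have X: "\<beta> a \<in> X" "\<beta> b \<in> X" "\<beta> t \<in> X" using t ab by (auto intro!: \<beta>_in)
  have ta: "\<bar>\<alpha> a - t0\<bar> + m * d x0 (\<beta> a) < \<delta>" "\<bar>\<alpha> b - t0\<bar> + m * d x0 (\<beta> b) < \<delta>"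
    using U by (auto simp: U_def)
  have "m * d x0 (\<beta> t) \<le> m * (d x0 (\<beta> a) + d (\<beta> a) (\<beta> t))"
    using tri[OF x0 X(1) X(3)] m by (intro mult_left_mono) auto
  then have 1: "m * d x0 (\<beta> t) \<le> m * d x0 (\<beta> a) + (\<alpha> t - \<alpha> a)" using A(1) by (simp add: distrib_left)
  have "m * d x0 (\<beta> t) \<le> m * (d x0 (\<beta> b) + d (\<beta> t) (\<beta> b))"
    using tri[OF x0 X(2) X(3)] sym[OF X(2,3)] m by (intro mult_left_mono) auto
  then have 2: "m * d x0 (\<beta> t) \<le> m * d x0 (\<beta> b) + (\<alpha> b - \<alpha> t)" using A(2) by (simp add: distrib_left)
  \<comment> \<open>At times up to \<open>t0\<close> the past endpoint controls the point through
    the first estimate, later the future endpoint through the second.\<close>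
  have "\<bar>\<alpha> t - t0\<bar> + m * d x0 (\<beta> t) < \<delta>"
    using 1 2 ta \<alpha>_mono[of a t] \<alpha>_mono[of t b] t by (cases "\<alpha> t \<le> t0") auto
  then show "p \<in> U" using \<gamma>_in[OF t(1)] t by (simp add: U_def)
qed

lemma continuous_tau:
  assumes X: "Metric_space X d" and geod: "\<And>p q. p \<in> X \<Longrightarrow> q \<in> X \<Longrightarrow> \<exists>c. is_geod d X p q c"
  shows "continuous_map (subtopology (prod_topology (Metric_space.mtopology (I \<times> X) (cone_dist d))
      (Metric_space.mtopology (I \<times> X) (cone_dist d))) (U \<times> U)) euclideanreal
      (\<lambda>(p, q). real_of_ereal (gtau (cone_fd False I f X d) (cone_L f d) p q))" (is "continuous_map ?T _ ?h")
proof -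
  define J where "J = {t0 - \<delta>0..t0 + \<delta>0}"
  have fJ: "continuous_on J f" using f_cont I continuous_on_subset by (auto simp: J_def)
  have "compact (f ` J)" using fJ by (intro compact_continuous_image) (auto simp: J_def)
  then obtain F where F: "\<And>r. r \<in> J \<Longrightarrow> f r \<le> F"
    using bounded_imp_bdd_above compact_imp_bounded by (metis bdd_above.unfold imageI)
  \<comment> \<open>A primitive of \<open>1 / f\<close>, hence the null coordinate that
    \<open>strip\<close> asks for.\<close>
  define P where "P = (\<lambda>r. integral {t0 - \<delta>0..r} (\<lambda>r. 1 / f r))"
  have nz: "f r \<noteq> 0" if "r \<in> J" for r using m(1) m(3)[of r] that by (auto simp: J_def)
  have "continuous_on J (\<lambda>r. 1 / f r)" using nz by (intro continuous_intros fJ) auto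
  then have Pd: "(P has_real_derivative 1 / f r) (at r)" if "r \<in> {t0 - \<delta>0<..<t0 + \<delta>0}" for r
  proof -
    have "(P has_real_derivative 1 / f r) (at r within J)"
      unfolding P_def J_def using that \<open>continuous_on J (\<lambda>r. 1 / f r)\<close>
      by (intro integral_has_real_derivative) (auto simp: J_def)
    moreover have "at r within J = at r" using that by (intro at_within_interior) (auto simp: J_def)
    ultimately show ?thesis by simp
  qed
  interpret strip I f "t0 - \<delta>0" "t0 + \<delta>0" m F P
    by unfold_locales (use I f_cont f_pos m F Pd in \<open>auto simp: J_def\<close>)
  \<comment> \<open>Both fibres are geodesic, so \<open>cone_tau_mono\<close> in both directions
    identifies the time separations once the fibre distances agree; over the line the identity on
    \<open>[0, l]\<close> is the geodesic.\<close>
  have hG: "gtau (cone_fd False I f X d) (cone_L f d) p q = ereal (G (fst p) (fst q) (d (snd p) (snd q)))"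
    if pq: "p \<in> U" "q \<in> U" for p q
  proof -
    have s: "snd p \<in> X" "snd q \<in> X" using U_D[OF pq(1)] U_D[OF pq(2)] by auto
    define l where "l = d (snd p) (snd q)"
    have l: "0 \<le> l" by (simp add: l_def nonneg s)
    have g: "is_geod dist UNIV 0 l (\<lambda>t. t)" using l by (simp add: is_geod_def dist_real_def)
    obtain c where c: "is_geod d X (snd p) (snd q) c" using geod s by blast
    have "gtau (cone_fd False I f X d) (cone_L f d) (fst p, snd p) (fst q, snd q) \<le> gtau (cone_fd False I f UNIV dist) (cone_L f dist) (fst p, 0) (fst q, l)"
      by (rule cone_tau_mono[OF metric_carrier_axioms real_metric.metric_carrier_axioms _ _ f_cont f_pos g]) (use l in \<open>auto simp: l_def dist_real_def\<close>)
    moreover have "gtau (cone_fd False I f UNIV dist) (cone_L f dist) (fst p, 0) (fst q, l) \<le> gtau (cone_fd False I f X d) (cone_L f d) (fst p, snd p) (fst q, snd q)"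
      by (rule cone_tau_mono[OF real_metric.metric_carrier_axioms metric_carrier_axioms s f_cont f_pos c]) (use l in \<open>auto simp: l_def dist_real_def\<close>)
    ultimately have "gtau (cone_fd False I f X d) (cone_L f d) p q = gtau (cone_fd False I f UNIV dist) (cone_L f dist) (fst p, 0) (fst q, l)"
      by simp
    also have "\<dots> = ereal (G (fst p) (fst q) l)"
      using U_D(1)[OF pq(1)] U_D(1)[OF pq(2)] by (intro gtau_G)
    finally show ?thesis by (simp add: l_def)
  qed
  have MS: "Metric_space (I \<times> X) (cone_dist d)" by (rule cone_Metric_space[OF X])
  have UU: "U \<times> U \<subseteq> (I \<times> X) \<times> (I \<times> X)" by (auto simp: U_def)
  have dnn: "0 \<le> d x y" for x y using X by (rule Metric_space.nonneg)
  have c1: "continuous_map ?T euclideanreal (\<lambda>x. fst (fst x))"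
    by (rule nonexpansive_continuous[OF MS UU]) (use dnn in \<open>auto simp: cone_dist_def add_increasing2\<close>)
  have c2: "continuous_map ?T euclideanreal (\<lambda>x. fst (snd x))"
    by (rule nonexpansive_continuous[OF MS UU]) (use dnn in \<open>auto simp: cone_dist_def add_increasing add_increasing2\<close>)
  have c3: "continuous_map ?T euclideanreal (\<lambda>x. d (snd (fst x)) (snd (snd x)))"
  proof (rule nonexpansive_continuous[OF MS UU])
    fix p q p' q' assume "(p, q) \<in> U \<times> U" "(p', q') \<in> U \<times> U"
    then have "snd p \<in> X" "snd q \<in> X" "snd p' \<in> X" "snd q' \<in> X" by (auto simp: U_def)
    from dist_diff_le[OF this] show "\<bar>d (snd (fst (p, q))) (snd (snd (p, q))) - d (snd (fst (p', q'))) (snd (snd (p', q')))\<bar> \<le> cone_dist d p p' + cone_dist d q q'"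
      by (simp add: cone_dist_def)
  qed
  have top: "topspace ?T = U \<times> U"
    using UU Metric_space.topspace_mtopology[OF MS] by auto
  have "continuous_map ?T euclideanreal (\<lambda>x. G (fst (fst x)) (fst (snd x)) (d (snd (fst x)) (snd (snd x))))"
    unfolding continuous_map_atin limitin_canonical_iff
  proof
    fix x assume x: "x \<in> topspace ?T"
    then have pU: "fst x \<in> U" "snd x \<in> U" unfolding top by auto
    show "((\<lambda>x. G (fst (fst x)) (fst (snd x)) (d (snd (fst x)) (snd (snd x)))) \<longlongrightarrow> G (fst (fst x)) (fst (snd x)) (d (snd (fst x)) (snd (snd x)))) (atin ?T x)"
      using c1 c2 c3 x unfolding continuous_map_atin limitin_canonical_iff
      by (intro G_tendsto U_D(1) pU dnn) auto
  qed
  then show ?thesis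
    by (rule continuous_map_eq) (use hG top in \<open>auto simp: case_prod_beta\<close>)
qed

end

lemma cone_tau_eq:
  assumes X: "metric_carrier X d" "w \<in> X" "w' \<in> X" "is_geod d X w w' c"
    and Z: "metric_carrier Z e" "z \<in> Z" "z' \<in> Z" "is_geod e Z z z' \<epsilon>"
    and f: "continuous_on I f" "\<forall>t\<in>I. f t > 0" and eq: "e z z' = d w w'"
  shows "gtau (cone_fd False I f Z e) (cone_L f e) (s, z) (s', z') = gtau (cone_fd False I f X d) (cone_L f d) (s, w) (s', w')"
  by (rule antisym; rule cone_tau_mono) (use assms in auto)

section \<open>Lifting timelike triangles to the model cone\<close>

text \<open>The lifted curve is causal and at least as long as the side, and it cannot exceed the
  time separation of its endpoints, which is unchanged because the fibre distances agree. Hence it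
  is maximal again.\<close>

lemma lift_side:
  assumes X: "metric_carrier X d" and geod: "\<forall>p\<in>X. \<forall>q\<in>X. \<exists>c. is_geod d X p q c"
    and Z: "metric_carrier Z e" "z \<in> Z" "z' \<in> Z" "is_geod e Z z z' \<epsilon>"
    and f: "continuous_on I f" "\<forall>t\<in>I. f t > 0"
    and w: "w \<in> X" "w' \<in> X" and len: "e z z' = d w w'"
    and side: "maximal_side (cone_fd False I f X d) (cone_L f d) (s, w) (s', w') a b \<sigma>"
  obtains c where "is_geod d X w w' c" "c ` {0..d w w'} \<subseteq> (\<lambda>t. snd (\<sigma> t)) ` {a..b}"
    "\<forall>t\<in>{a..b}. d w (snd (\<sigma> t)) \<in> {0..d w w'} \<and> c (d w (snd (\<sigma> t))) = snd (\<sigma> t)"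
    "\<forall>t\<in>{a..b}. \<epsilon> (d w (snd (\<sigma> t))) \<in> Z \<and> e z (\<epsilon> (d w (snd (\<sigma> t)))) = d w (snd (\<sigma> t))"
    "maximal_side (cone_fd False I f Z e) (cone_L f e) (s, z) (s', z') a b (\<lambda>t. (fst (\<sigma> t), \<epsilon> (d w (snd (\<sigma> t)))))"
proof -
  interpret metric_carrier X d by fact
  have \<sigma>: "cone_fd False I f X d a b \<sigma>" "\<sigma> a = (s, w)" "\<sigma> b = (s', w')"
    and max: "ereal (cone_L f d a b \<sigma>) = gtau (cone_fd False I f X d) (cone_L f d) (s, w) (s', w')"
    using side by (auto simp: maximal_side_def)
  obtain c0 where c0: "is_geod d X w w' c0" using geod w by blast
  obtain c where c: "is_geod d X w w' c" "c ` {0..d w w'} \<subseteq> (\<lambda>t. snd (\<sigma> t)) ` {a..b}"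
    "\<forall>t\<in>{a..b}. d w (snd (\<sigma> t)) \<in> {0..d w w'}" "\<forall>t\<in>{a..b}. c (d w (snd (\<sigma> t))) = snd (\<sigma> t)"
    and lift: "cone_fd False I f Z e a b (\<lambda>t. (fst (\<sigma> t), \<epsilon> (d w (snd (\<sigma> t))))) \<and>
       cone_L f d a b \<sigma> \<le> cone_L f e a b (\<lambda>t. (fst (\<sigma> t), \<epsilon> (d w (snd (\<sigma> t)))))"
  proof (rule maximal_geodesic[OF X f \<sigma> max c0])
    fix c
    assume 1: "is_geod d X w w' c" "c ` {0..d w w'} \<subseteq> (\<lambda>t. snd (\<sigma> t)) ` {a..b}"
      "\<forall>t\<in>{a..b}. d w (snd (\<sigma> t)) \<in> {0..d w w'}" "\<forall>t\<in>{a..b}. c (d w (snd (\<sigma> t))) = snd (\<sigma> t)"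
    assume 2: "\<And>(Z :: 'b set) e z z' \<tau>. metric_carrier Z e \<Longrightarrow> z \<in> Z \<Longrightarrow> z' \<in> Z \<Longrightarrow> is_geod e Z z z' \<tau> \<Longrightarrow> e z z' = d w w' \<Longrightarrow>
       cone_fd False I f Z e a b (\<lambda>t. (fst (\<sigma> t), \<tau> (d w (snd (\<sigma> t))))) \<and>
       cone_L f d a b \<sigma> \<le> cone_L f e a b (\<lambda>t. (fst (\<sigma> t), \<tau> (d w (snd (\<sigma> t)))))"
    show ?thesis by (rule that[OF 1 2[OF Z len]])
  qed
  let ?\<rho> = "\<lambda>t. (fst (\<sigma> t), \<epsilon> (d w (snd (\<sigma> t))))"
  have \<epsilon>: "\<epsilon> 0 = z" "\<epsilon> (d w w') = z'" "\<And>r. r \<in> {0..d w w'} \<Longrightarrow> \<epsilon> r \<in> Z"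
    "\<And>r r'. r \<in> {0..d w w'} \<Longrightarrow> r' \<in> {0..d w w'} \<Longrightarrow> e (\<epsilon> r) (\<epsilon> r') = \<bar>r - r'\<bar>"
    using Z(4) len by (auto simp: is_geod_def)
  have ends: "?\<rho> a = (s, z)" "?\<rho> b = (s', z')" using \<sigma> \<epsilon> w by (auto simp: refl0)
  have tau: "gtau (cone_fd False I f Z e) (cone_L f e) (s, z) (s', z') = gtau (cone_fd False I f X d) (cone_L f d) (s, w) (s', w')"
    by (rule cone_tau_eq[OF X w c0 Z f len])
  have "ereal (cone_L f e a b ?\<rho>) \<le> gtau (cone_fd False I f Z e) (cone_L f e) (s, z) (s', z')"
    by (rule gtau_upper) (use lift ends in auto)
  moreover have "gtau (cone_fd False I f Z e) (cone_L f e) (s, z) (s', z') \<le> ereal (cone_L f e a b ?\<rho>)"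
    unfolding tau max[symmetric] using lift by simp
  ultimately have "maximal_side (cone_fd False I f Z e) (cone_L f e) (s, z) (s', z') a b ?\<rho>"
    unfolding maximal_side_def using lift ends by auto
  moreover have "\<forall>t\<in>{a..b}. \<epsilon> (d w (snd (\<sigma> t))) \<in> Z \<and> e z (\<epsilon> (d w (snd (\<sigma> t)))) = d w (snd (\<sigma> t))"
  proof
    fix t assume "t \<in> {a..b}"
    then have r: "d w (snd (\<sigma> t)) \<in> {0..d w w'}" using c(3) by blast
    then have "e (\<epsilon> 0) (\<epsilon> (d w (snd (\<sigma> t)))) = d w (snd (\<sigma> t))" by (subst \<epsilon>(4)) auto
    then show "\<epsilon> (d w (snd (\<sigma> t))) \<in> Z \<and> e z (\<epsilon> (d w (snd (\<sigma> t)))) = d w (snd (\<sigma> t))"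
      using \<epsilon>(1) \<epsilon>(3)[OF r] by simp
  qed
  ultimately show ?thesis using that[OF c(1,2)] c(3,4) by blast
qed

text \<open>A compact interval around \<open>t0\<close> fits into the open \<open>I\<close>, and
  \<open>f\<close> attains a positive minimum on it. Capping this by 1 ensures
  \<open>\<delta> \<le> \<delta> / m\<close> for the double cone.\<close>

lemma lower_bound_near:
  fixes f :: "real \<Rightarrow> real"
  assumes "open I" "t0 \<in> I" and f: "continuous_on I f" "\<forall>t\<in>I. f t > 0"
  obtains \<delta>0 m where "0 < \<delta>0" "{t0 - \<delta>0..t0 + \<delta>0} \<subseteq> I" "0 < m" "m \<le> 1" "\<forall>r\<in>{t0 - \<delta>0..t0 + \<delta>0}. m \<le> f r"
proof -
  obtain \<delta>0 where \<delta>0: "\<delta>0 > 0" "cball t0 \<delta>0 \<subseteq> I" using assms(1,2) open_contains_cball by blast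
  define J where "J = {t0 - \<delta>0..t0 + \<delta>0}"
  have J: "J \<subseteq> I" "compact J" "J \<noteq> {}" using \<delta>0 by (auto simp: J_def cball_eq_atLeastAtMost)
  obtain r0 where r0: "r0 \<in> J" "\<forall>r\<in>J. f r0 \<le> f r"
    using continuous_attains_inf[OF J(2,3) continuous_on_subset[OF f(1) J(1)]] by blast
  have "0 < f r0" using f(2) r0 J by auto
  then show ?thesis
    using that[of \<delta>0 "min 1 (f r0)"] \<delta>0 J r0 by (auto simp: J_def min.coboundedI2)
qed

theorem theorem5p3:
  fixes lower :: bool and K K' :: real and X :: "'a set" and d :: "'a \<Rightarrow> 'a \<Rightarrow> real"
    and I :: "real set" and f :: "real \<Rightarrow> real"
  assumes "geodesic_length_space X d"
    and "alex_curv_bound lower K X d"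
    and "open I" and "is_interval I" and "I \<noteq> {}"
    and "continuous_on I f" and "\<forall>t\<in>I. f t > 0"
    and "cone_tl_curv_bound lower K' I f (MK_set K) (MK_dist K)"
  shows "cone_tl_curv_bound lower K' I f X d"
  unfolding cone_tl_curv_bound_def tl_curv_bound_alt
proof
  note f = \<open>continuous_on I f\<close> \<open>\<forall>t\<in>I. f t > 0\<close>
  have MS: "Metric_space X d" and geod_all: "\<forall>p\<in>X. \<forall>q\<in>X. \<exists>c. is_geod d X p q c"
    using assms(1) by (auto simp: geodesic_length_space_def)
  have geod: "\<exists>c. is_geod d X p q c" if "p \<in> X" "q \<in> X" for p q
    using geod_all that by blast
  have X: "metric_carrier X d"
    using MS by (auto simp: metric_carrier_def Metric_space_def)
  define Z e where "Z = MK_set K" and "e = MK_dist K"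
  have model: "planar_model Z e" unfolding Z_def e_def by (rule MK_model)
  then have Z: "metric_carrier Z e" and geodZ: "\<And>p q. p \<in> Z \<Longrightarrow> q \<in> Z \<Longrightarrow> \<exists>c. is_geod e Z p q c"
    by (auto simp: planar_model_def)
  interpret Z: metric_carrier Z e by (rule Z)
  obtain z0 \<rho> where z0: "z0 \<in> Z" "\<rho> > 0"
    and triZ: "\<And>a b c. 0 \<le> a \<Longrightarrow> a \<le> \<rho> \<Longrightarrow> 0 \<le> b \<Longrightarrow> b \<le> \<rho> \<Longrightarrow> 0 \<le> c \<Longrightarrow> c \<le> \<rho> \<Longrightarrow> a \<le> b + c \<Longrightarrow> b \<le> a + c \<Longrightarrow> c \<le> a + b \<Longrightarrow>
       \<exists>q\<in>Z. \<exists>s\<in>Z. e z0 q = a \<and> e q s = b \<and> e z0 s = c"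
    using model unfolding planar_model_def by blast
  fix y assume "y \<in> I \<times> X"
  then obtain t0 x0 where y: "y = (t0, x0)" "t0 \<in> I" "x0 \<in> X" by auto
  let ?CX = "cone_fd False I f X d" and ?LX = "cone_L f d" and ?TX = "cone_fd True I f X d"
  let ?CZ = "cone_fd False I f Z e" and ?LZ = "cone_L f e" and ?TZ = "cone_fd True I f Z e"
  have "(t0, z0) \<in> I \<times> Z" using y z0 by simp
  note hyp = bspec[OF assms(8)[unfolded cone_tl_curv_bound_def tl_curv_bound_alt, folded Z_def e_def] this]
  obtain UM rM where rM: "rM > 0" "{z \<in> I \<times> Z. cone_dist e (t0, z0) z < rM} \<subseteq> UM"
    and fin: "\<forall>p\<in>UM. \<forall>q\<in>UM. gtau ?CZ ?LZ p q < \<infinity>"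
    and maxM: "\<forall>p\<in>UM. \<forall>q\<in>UM. grel ?TZ p q \<longrightarrow>
          (\<exists>a b \<gamma>. ?CZ a b \<gamma> \<and> \<gamma> a = p \<and> \<gamma> b = q \<and> \<gamma> ` {a..b} \<subseteq> UM \<and> ereal (?LZ a b \<gamma>) = gtau ?CZ ?LZ p q)"
    and triM: "triangle_condition lower K' UM ?CZ ?TZ ?LZ"
    using hyp by (elim exE conjE) (rule that)
  obtain rA where rA: "rA > 0"
    and alex: "\<forall>p q s c1 c2 c3.
       p \<in> X \<and> q \<in> X \<and> s \<in> X \<and>
       is_geod d X p q c1 \<and> is_geod d X q s c2 \<and> is_geod d X p s c3 \<and>
       c1 ` {0..d p q} \<subseteq> {y\<in>X. d x0 y < rA} \<and>
       c2 ` {0..d q s} \<subseteq> {y\<in>X. d x0 y < rA} \<and>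
       c3 ` {0..d p s} \<subseteq> {y\<in>X. d x0 y < rA} \<and>
       (K > 0 \<longrightarrow> d p q + d q s + d p s < 2 * pi / sqrt K) \<longrightarrow>
       (\<forall>p' q' s' e1 e2 e3.
          p' \<in> Z \<and> q' \<in> Z \<and> s' \<in> Z \<and>
          e p' q' = d p q \<and> e q' s' = d q s \<and> e p' s' = d p s \<and>
          is_geod e Z p' q' e1 \<and> is_geod e Z q' s' e2 \<and> is_geod e Z p' s' e3 \<longrightarrow>
          (\<forall>(u, u')\<in>{(c1 t, e1 t) | t. t \<in> {0..d p q}} \<union>
                   {(c2 t, e2 t) | t. t \<in> {0..d q s}} \<union>
                   {(c3 t, e3 t) | t. t \<in> {0..d p s}}. 
           \<forall>(v, v')\<in>{(c1 t, e1 t) | t. t \<in> {0..d p q}} \<union>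
                   {(c2 t, e2 t) | t. t \<in> {0..d q s}} \<union>
                   {(c3 t, e3 t) | t. t \<in> {0..d p s}}.
                (if lower then e u' v' \<le> d u v else d u v \<le> e u' v')))"
    using bspec[OF assms(2)[unfolded alex_curv_bound_def Let_def, folded Z_def e_def] y(3)]
    by (elim exE conjE) (rule that)
  obtain \<delta>0 m where \<delta>0: "0 < \<delta>0" "{t0 - \<delta>0..t0 + \<delta>0} \<subseteq> I" and m: "0 < m" "m \<le> 1" "\<forall>r\<in>{t0 - \<delta>0..t0 + \<delta>0}. m \<le> f r"
    by (rule lower_bound_near[OF \<open>open I\<close> y(2) f]) (rule that)
  \<comment> \<open>Limits the perimeter of triangles when \<open>K\<close> is positive; for other
    \<open>K\<close> any positive number would do.\<close>
  define \<kappa> where "\<kappa> = (if K > 0 then pi / sqrt K else 1)"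
  have \<kappa>: "\<kappa> > 0" by (simp add: \<kappa>_def)
  \<comment> \<open>Fibre distances in \<open>U\<close> are below \<open>2 * \<eta>\<close>, so
    \<open>6 * \<eta>\<close> bounds a perimeter. It also bounds the distance of lifted points from
    \<open>(t0, z0)\<close>: less than \<open>\<eta>\<close> in time plus less than
    \<open>5 * \<eta>\<close> in the fibre.\<close>
  define \<eta> where "\<eta> = min \<delta>0 (min (min rM \<rho>) (min rA \<kappa>) / 6)"
  have \<eta>: "0 < \<eta>" "\<eta> \<le> \<delta>0" "6 * \<eta> \<le> rM" "6 * \<eta> \<le> \<rho>" "6 * \<eta> \<le> rA" "6 * \<eta> \<le> \<kappa>"
    using \<delta>0 rM z0 rA \<kappa> by (auto simp: \<eta>_def)
  \<comment> \<open>A double cone of time radius \<open>\<delta>\<close> has fibre radius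
    \<open>\<delta> / m\<close>, which becomes \<open>\<eta>\<close>.\<close>
  define \<delta> where "\<delta> = m * \<eta>"
  have "m * \<eta> \<le> 1 * \<eta>" using m \<eta> by (intro mult_right_mono) auto
  then have "\<delta> \<le> \<delta>0" unfolding \<delta>_def using \<eta>(2) by linarith
  then have \<delta>\<eta>: "0 < \<delta>" "\<delta> \<le> \<delta>0" "\<delta> / m = \<eta>" using m \<eta> by (auto simp: \<delta>_def)
  interpret double_cone X d I f t0 x0 m \<delta> \<delta>0
    using X y \<delta>\<eta> \<delta>0 f m by (auto simp: double_cone_def double_cone_axioms_def)
  note U_D = U_D[unfolded \<delta>\<eta>(3)] and dist_lt = dist_lt[unfolded \<delta>\<eta>(3)]
  have U_I: "fst p \<in> I" if "p \<in> U" for p using that by (auto simp: U_def)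
  have in_UM: "(s, z) \<in> UM" if "s \<in> I" "\<bar>s - t0\<bar> < \<eta>" "z \<in> Z" "e z0 z < 5 * \<eta>" for s z
  proof -
    have "cone_dist e (t0, z0) (s, z) < rM" using that \<eta>(3) by (simp add: cone_dist_def abs_minus_commute)
    then show ?thesis using rM(2) that by blast
  qed
  have pair: "\<exists>z\<in>Z. (fst p, z0) \<in> UM \<and> (fst q, z) \<in> UM \<and> e z0 z = d (snd p) (snd q)" if pq: "p \<in> U" "q \<in> U" for p q
  proof -
    define l where "l = d (snd p) (snd q)"
    have l: "0 \<le> l" "l < 2 * \<eta>" using dist_lt[OF pq] nonneg[OF U_D(2)[OF pq(1)] U_D(2)[OF pq(2)]] by (auto simp: l_def)
    \<comment> \<open>A degenerate triangle with sides \<open>l\<close>, 0, \<open>l\<close>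
      supplies a point at distance \<open>l\<close> from \<open>z0\<close>.\<close>
    obtain z where z: "z \<in> Z" "e z0 z = l" using triZ[of l 0 l] l \<eta> by force
    have "(fst p, z0) \<in> UM" using U_D[OF pq(1)] U_I[OF pq(1)] z0 \<eta> by (intro in_UM) (auto simp: Z.refl0)
    moreover have "(fst q, z) \<in> UM" using U_D[OF pq(2)] U_I[OF pq(2)] z l \<eta> by (intro in_UM) auto
    ultimately show ?thesis using z by (auto simp: l_def)
  qed
  have tau_eq: "gtau ?CZ ?LZ (s, z) (s', z') = gtau ?CX ?LX (s, w) (s', w')"
    if h: "w \<in> X" "w' \<in> X" "z \<in> Z" "z' \<in> Z" "e z z' = d w w'" for s s' w w' z z'
  proof -
    obtain c \<epsilon> where "is_geod d X w w' c" "is_geod e Z z z' \<epsilon>" using geod[OF h(1,2)] geodZ[OF h(3,4)] by blast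
    then show ?thesis by (rule cone_tau_eq[OF X h(1,2) _ Z h(3,4) _ f h(5)])
  qed
  have rel: "grel ?TZ (s, z) (s', z')" if h: "w \<in> X" "w' \<in> X" "z \<in> Z" "z' \<in> Z" "e z z' = d w w'" "grel ?TX (s, w) (s', w')" for s s' w w' z z'
  proof -
    obtain \<epsilon> where "is_geod e Z z z' \<epsilon>" using geodZ[OF h(3,4)] by blast
    then show ?thesis by (rule cone_timelike_mono[OF X Z h(3,4) f _ eq_refl[OF h(5)] h(6)])
  qed
  show "\<exists>U. U \<subseteq> I \<times> X \<and> (\<exists>r>0. {z \<in> I \<times> X. cone_dist d y z < r} \<subseteq> U) \<and>
       (\<forall>p\<in>U. \<forall>q\<in>U. gtau ?CX ?LX p q < \<infinity>) \<and>
       continuous_map (subtopology (prod_topology (Metric_space.mtopology (I \<times> X) (cone_dist d)) (Metric_space.mtopology (I \<times> X) (cone_dist d))) (U \<times> U)) euclideanreal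
          (\<lambda>(p, q). real_of_ereal (gtau ?CX ?LX p q)) \<and>
       (\<forall>p\<in>U. \<forall>q\<in>U. grel ?TX p q \<longrightarrow>
          (\<exists>a b \<gamma>. ?CX a b \<gamma> \<and> \<gamma> a = p \<and> \<gamma> b = q \<and> \<gamma> ` {a..b} \<subseteq> U \<and> ereal (?LX a b \<gamma>) = gtau ?CX ?LX p q)) \<and>
       triangle_condition lower K' U ?CX ?TX ?LX"
  proof (intro exI[of _ U] conjI)
    show "U \<subseteq> I \<times> X" by (auto simp: U_def)
    show "\<exists>r>0. {z \<in> I \<times> X. cone_dist d y z < r} \<subseteq> U" using ball_subset_U \<delta>\<eta>(1) y by blast
    show "continuous_map (subtopology (prod_topology (Metric_space.mtopology (I \<times> X) (cone_dist d)) (Metric_space.mtopology (I \<times> X) (cone_dist d))) (U \<times> U)) euclideanreal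
          (\<lambda>(p, q). real_of_ereal (gtau ?CX ?LX p q))"
      by (rule continuous_tau[OF MS geod])
    show "\<forall>p\<in>U. \<forall>q\<in>U. gtau ?CX ?LX p q < \<infinity>"
    proof (intro ballI)
      fix p q assume pq: "p \<in> U" "q \<in> U"
      obtain z where z: "z \<in> Z" "(fst p, z0) \<in> UM" "(fst q, z) \<in> UM" "e z0 z = d (snd p) (snd q)" using pair[OF pq] by blast
      have "gtau ?CZ ?LZ (fst p, z0) (fst q, z) = gtau ?CX ?LX (fst p, snd p) (fst q, snd q)"
        by (rule tau_eq[OF U_D(2)[OF pq(1)] U_D(2)[OF pq(2)] z0(1) z(1,4)])
      moreover have "gtau ?CZ ?LZ (fst p, z0) (fst q, z) < \<infinity>" using fin z by blast
      ultimately show "gtau ?CX ?LX p q < \<infinity>" by simp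
    qed
    show "\<forall>p\<in>U. \<forall>q\<in>U. grel ?TX p q \<longrightarrow>
          (\<exists>a b \<gamma>. ?CX a b \<gamma> \<and> \<gamma> a = p \<and> \<gamma> b = q \<and> \<gamma> ` {a..b} \<subseteq> U \<and> ereal (?LX a b \<gamma>) = gtau ?CX ?LX p q)"
    proof (intro ballI impI)
      fix p q assume pq: "p \<in> U" "q \<in> U" and T: "grel ?TX p q"
      obtain z where z: "z \<in> Z" "(fst p, z0) \<in> UM" "(fst q, z) \<in> UM" "e z0 z = d (snd p) (snd q)" using pair[OF pq] by blast
      note w = U_D(2)[OF pq(1)] U_D(2)[OF pq(2)]
      have T': "grel ?TX (fst p, snd p) (fst q, snd q)" using T by simp
      \<comment> \<open>The model cone provides a maximal curve. Its transplant to \<open>X\<close>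
        is at least as long, hence maximal since the time separations agree, and it stays in
        \<open>U\<close> by causal convexity.\<close>
      obtain a b \<gamma> where \<gamma>: "?CZ a b \<gamma>" "\<gamma> a = (fst p, z0)" "\<gamma> b = (fst q, z)"
        "ereal (?LZ a b \<gamma>) = gtau ?CZ ?LZ (fst p, z0) (fst q, z)"
        using maxM[rule_format, OF z(2,3) rel[OF w z0(1) z(1,4) T']] by (elim exE conjE) (rule that)
      obtain c where c: "is_geod d X (snd p) (snd q) c" using geod w by blast
      obtain \<gamma>' where \<gamma>': "?CX a b \<gamma>'" "\<gamma>' a = (fst p, snd p)" "\<gamma>' b = (fst q, snd q)" "?LZ a b \<gamma> \<le> ?LX a b \<gamma>'"
        using faster_curve[OF Z X w f \<gamma>(1-3) c eq_refl[OF z(4)[symmetric]]] by (elim exE conjE) (rule that)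
      have "ereal (?LX a b \<gamma>') \<le> gtau ?CX ?LX p q" by (rule gtau_upper) (use \<gamma>' in auto)
      moreover have "gtau ?CX ?LX p q \<le> ereal (?LX a b \<gamma>')"
        using tau_eq[OF w z0(1) z(1,4), of "fst p" "fst q"] \<gamma>(4) \<gamma>'(4) by (simp flip: ereal_less_eq(3))
      moreover have "\<gamma>' ` {a..b} \<subseteq> U" by (rule causally_convex[OF \<gamma>'(1)]) (use \<gamma>' pq in auto)
      ultimately show "\<exists>a b \<gamma>. ?CX a b \<gamma> \<and> \<gamma> a = p \<and> \<gamma> b = q \<and> \<gamma> ` {a..b} \<subseteq> U \<and> ereal (?LX a b \<gamma>) = gtau ?CX ?LX p q"
        using \<gamma>' by (intro exI[of _ a] exI[of _ b] exI[of _ \<gamma>']) auto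
    qed
    show "triangle_condition lower K' U ?CX ?TX ?LX"
    proof (rule triangle_condition_transfer[OF triM])
      fix p q r a1 b1 \<sigma>1 a2 b2 \<sigma>2 a3 b3 \<sigma>3
      assume pqr: "p \<in> U" "q \<in> U" "r \<in> U" and T: "grel ?TX p q" "grel ?TX q r"
        and s1: "maximal_side ?CX ?LX p q a1 b1 \<sigma>1" "\<sigma>1 ` {a1..b1} \<subseteq> U"
        and s2: "maximal_side ?CX ?LX q r a2 b2 \<sigma>2" "\<sigma>2 ` {a2..b2} \<subseteq> U"
        and s3: "maximal_side ?CX ?LX p r a3 b3 \<sigma>3" "\<sigma>3 ` {a3..b3} \<subseteq> U"
      define w1 w2 w3 where "w1 = snd p" and "w2 = snd q" and "w3 = snd r"
      define t1 t2 t3 where "t1 = fst p" and "t2 = fst q" and "t3 = fst r"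
      have eqs: "p = (t1, w1)" "q = (t2, w2)" "r = (t3, w3)" by (simp_all add: w1_def w2_def w3_def t1_def t2_def t3_def)
      have w: "w1 \<in> X" "w2 \<in> X" "w3 \<in> X" using pqr U_D(2) by (auto simp: w1_def w2_def w3_def)
      have lt: "d w1 w2 < 2 * \<eta>" "d w2 w3 < 2 * \<eta>" "d w1 w3 < 2 * \<eta>"
        using dist_lt pqr by (auto simp: w1_def w2_def w3_def)
      have nn: "0 \<le> d w1 w2" "0 \<le> d w2 w3" "0 \<le> d w1 w3" using nonneg w by auto
      \<comment> \<open>The comparison triangle of the projected vertices, with the first vertex
        placed at \<open>z0\<close>.\<close>
      have "\<exists>q\<in>Z. \<exists>s\<in>Z. e z0 q = d w1 w2 \<and> e q s = d w2 w3 \<and> e z0 s = d w1 w3"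
        using lt nn \<eta> w tri[of w1 w3 w2] tri[of w1 w2 w3] tri[of w2 w1 w3] sym[of w3 w2] sym[of w2 w1]
        by (intro triZ) auto
      then obtain z2 z3 where z: "z2 \<in> Z" "z3 \<in> Z" "e z0 z2 = d w1 w2" "e z2 z3 = d w2 w3" "e z0 z3 = d w1 w3" by blast
      obtain \<epsilon>1 \<epsilon>2 \<epsilon>3 where \<epsilon>: "is_geod e Z z0 z2 \<epsilon>1" "is_geod e Z z2 z3 \<epsilon>2" "is_geod e Z z0 z3 \<epsilon>3"
        using geodZ z z0 by meson
      \<comment> \<open>Each side keeps its time component and its parameter; the fibre component
        moves along the comparison side, at the same distance from the first vertex.\<close>
      define \<rho>1 where "\<rho>1 = (\<lambda>t. (fst (\<sigma>1 t), \<epsilon>1 (d w1 (snd (\<sigma>1 t)))))"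
      define \<rho>2 where "\<rho>2 = (\<lambda>t. (fst (\<sigma>2 t), \<epsilon>2 (d w2 (snd (\<sigma>2 t)))))"
      define \<rho>3 where "\<rho>3 = (\<lambda>t. (fst (\<sigma>3 t), \<epsilon>3 (d w1 (snd (\<sigma>3 t)))))"
      obtain c1 where c1: "is_geod d X w1 w2 c1" "c1 ` {0..d w1 w2} \<subseteq> (\<lambda>t. snd (\<sigma>1 t)) ` {a1..b1}"
        "\<forall>t\<in>{a1..b1}. d w1 (snd (\<sigma>1 t)) \<in> {0..d w1 w2} \<and> c1 (d w1 (snd (\<sigma>1 t))) = snd (\<sigma>1 t)"
        and \<epsilon>1: "\<forall>t\<in>{a1..b1}. \<epsilon>1 (d w1 (snd (\<sigma>1 t))) \<in> Z \<and> e z0 (\<epsilon>1 (d w1 (snd (\<sigma>1 t)))) = d w1 (snd (\<sigma>1 t))"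
        and m1: "maximal_side ?CZ ?LZ (t1, z0) (t2, z2) a1 b1 \<rho>1"
        unfolding \<rho>1_def
        by (rule lift_side[OF X geod_all Z z0(1) z(1) \<epsilon>(1) f w(1,2) z(3) s1(1)[unfolded eqs]]) (rule that[unfolded \<rho>1_def])
      obtain c2 where c2: "is_geod d X w2 w3 c2" "c2 ` {0..d w2 w3} \<subseteq> (\<lambda>t. snd (\<sigma>2 t)) ` {a2..b2}"
        "\<forall>t\<in>{a2..b2}. d w2 (snd (\<sigma>2 t)) \<in> {0..d w2 w3} \<and> c2 (d w2 (snd (\<sigma>2 t))) = snd (\<sigma>2 t)"
        and \<epsilon>2: "\<forall>t\<in>{a2..b2}. \<epsilon>2 (d w2 (snd (\<sigma>2 t))) \<in> Z \<and> e z2 (\<epsilon>2 (d w2 (snd (\<sigma>2 t)))) = d w2 (snd (\<sigma>2 t))"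
        and m2: "maximal_side ?CZ ?LZ (t2, z2) (t3, z3) a2 b2 \<rho>2"
        unfolding \<rho>2_def
        by (rule lift_side[OF X geod_all Z z(1,2) \<epsilon>(2) f w(2,3) z(4) s2(1)[unfolded eqs]]) (rule that[unfolded \<rho>2_def])
      obtain c3 where c3: "is_geod d X w1 w3 c3" "c3 ` {0..d w1 w3} \<subseteq> (\<lambda>t. snd (\<sigma>3 t)) ` {a3..b3}"
        "\<forall>t\<in>{a3..b3}. d w1 (snd (\<sigma>3 t)) \<in> {0..d w1 w3} \<and> c3 (d w1 (snd (\<sigma>3 t))) = snd (\<sigma>3 t)"
        and \<epsilon>3: "\<forall>t\<in>{a3..b3}. \<epsilon>3 (d w1 (snd (\<sigma>3 t))) \<in> Z \<and> e z0 (\<epsilon>3 (d w1 (snd (\<sigma>3 t)))) = d w1 (snd (\<sigma>3 t))"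
        and m3: "maximal_side ?CZ ?LZ (t1, z0) (t3, z3) a3 b3 \<rho>3"
        unfolding \<rho>3_def
        by (rule lift_side[OF X geod_all Z z0(1) z(2) \<epsilon>(3) f w(1,3) z(5) s3(1)[unfolded eqs]]) (rule that[unfolded \<rho>3_def])
      have \<sigma>X: "snd (\<sigma> t) \<in> X" "d x0 (snd (\<sigma> t)) < rA" "fst (\<sigma> t) \<in> I" "\<bar>fst (\<sigma> t) - t0\<bar> < \<eta>"
        if "\<sigma> ` {a..b} \<subseteq> U" "t \<in> {a..b}" for \<sigma> a b and t :: real
      proof -
        have "\<sigma> t \<in> U" using that by blast
        from U_D[OF this] U_I[OF this] show "snd (\<sigma> t) \<in> X" "d x0 (snd (\<sigma> t)) < rA" "fst (\<sigma> t) \<in> I" "\<bar>fst (\<sigma> t) - t0\<bar> < \<eta>"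
          using \<eta> by auto
      qed
      have in_ball: "S \<subseteq> {y \<in> X. d x0 y < rA}" if h: "S \<subseteq> (\<lambda>t. snd (\<sigma> t)) ` {a..b}" "\<sigma> ` {a..b} \<subseteq> U" for S \<sigma> and a b :: real
      proof
        fix y assume "y \<in> S"
        then obtain t where "t \<in> {a..b}" "y = snd (\<sigma> t)" using h(1) by blast
        then show "y \<in> {y \<in> X. d x0 y < rA}" using \<sigma>X(1,2)[OF h(2)] by simp
      qed
      have img1: "\<rho>1 ` {a1..b1} \<subseteq> UM"
      proof (rule image_subsetI, unfold \<rho>1_def)
        fix t assume t: "t \<in> {a1..b1}"
        then show "(fst (\<sigma>1 t), \<epsilon>1 (d w1 (snd (\<sigma>1 t)))) \<in> UM"
          using \<sigma>X[OF s1(2) t] \<epsilon>1 c1(3) lt \<eta> by (intro in_UM) fastforce+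
      qed
      have img2: "\<rho>2 ` {a2..b2} \<subseteq> UM"
      proof (rule image_subsetI, unfold \<rho>2_def)
        fix t assume t: "t \<in> {a2..b2}"
        define \<zeta> where "\<zeta> = \<epsilon>2 (d w2 (snd (\<sigma>2 t)))"
        have \<zeta>: "\<zeta> \<in> Z" "e z2 \<zeta> = d w2 (snd (\<sigma>2 t))" "d w2 (snd (\<sigma>2 t)) \<le> d w2 w3"
          using \<epsilon>2 c2(3) t by (auto simp: \<zeta>_def)
        \<comment> \<open>Points of the second side are reached from \<open>z0\<close> through
          \<open>z2\<close>, in two steps of length below \<open>2 * \<eta>\<close> each.\<close>
        have "e z0 \<zeta> < 5 * \<eta>" using Z.tri[OF z0(1) z(1) \<zeta>(1)] \<zeta> z(3) lt \<eta> by linarith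
        then show "(fst (\<sigma>2 t), \<epsilon>2 (d w2 (snd (\<sigma>2 t)))) \<in> UM"
          using \<sigma>X[OF s2(2) t] \<zeta> by (auto intro!: in_UM simp: \<zeta>_def)
      qed
      have img3: "\<rho>3 ` {a3..b3} \<subseteq> UM"
      proof (rule image_subsetI, unfold \<rho>3_def)
        fix t assume t: "t \<in> {a3..b3}"
        then show "(fst (\<sigma>3 t), \<epsilon>3 (d w1 (snd (\<sigma>3 t)))) \<in> UM"
          using \<sigma>X[OF s3(2) t] \<epsilon>3 c3(3) lt \<eta> by (intro in_UM) fastforce+
      qed
      have le: "a \<le> b" if "?CZ a b \<rho>" for a b \<rho> using that by (simp add: cone_fd_def)
      have ends: "(t1, z0) \<in> UM" "(t2, z2) \<in> UM" "(t3, z3) \<in> UM"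
      proof -
        have "\<rho>1 a1 = (t1, z0)" "\<rho>1 b1 = (t2, z2)" "a1 \<le> b1" using m1 le by (auto simp: maximal_side_def)
        then show "(t1, z0) \<in> UM" "(t2, z2) \<in> UM" using img1 by (metis atLeastAtMost_iff image_subset_iff order_refl)+
        have "\<rho>3 b3 = (t3, z3)" "a3 \<le> b3" using m3 le by (auto simp: maximal_side_def)
        then show "(t3, z3) \<in> UM" using img3 by (metis atLeastAtMost_iff image_subset_iff order_refl)
      qed
      \<comment> \<open>The pairs of corresponding points to which the curvature bound of
        \<open>X\<close> applies; \<open>c1\<close>, \<open>c2\<close>, \<open>c3\<close> are the
        geodesics traced by the maximal sides themselves.\<close>
      define AP where "AP = {(c1 t, \<epsilon>1 t) | t. t \<in> {0..d w1 w2}} \<union> {(c2 t, \<epsilon>2 t) | t. t \<in> {0..d w2 w3}} \<union> {(c3 t, \<epsilon>3 t) | t. t \<in> {0..d w1 w3}}"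
      have "\<forall>(u, u')\<in>AP. \<forall>(v, v')\<in>AP. if lower then e u' v' \<le> d u v else d u v \<le> e u' v'"
        unfolding AP_def
      proof (rule alex[THEN spec, THEN spec, THEN spec, THEN spec, THEN spec, THEN spec, THEN mp,
            THEN spec, THEN spec, THEN spec, THEN spec, THEN spec, THEN spec, THEN mp])
        have "c1 ` {0..d w1 w2} \<subseteq> {y \<in> X. d x0 y < rA}" by (rule in_ball[OF c1(2) s1(2)])
        moreover have "c2 ` {0..d w2 w3} \<subseteq> {y \<in> X. d x0 y < rA}" by (rule in_ball[OF c2(2) s2(2)])
        moreover have "c3 ` {0..d w1 w3} \<subseteq> {y \<in> X. d x0 y < rA}" by (rule in_ball[OF c3(2) s3(2)])
        moreover have "d w1 w2 + d w2 w3 + d w1 w3 < 2 * pi / sqrt K" if "K > 0"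
        proof -
          have "d w1 w2 + d w2 w3 + d w1 w3 < 6 * \<eta>" using lt by linarith
          also have "\<dots> \<le> pi / sqrt K" using \<eta>(6) that by (simp add: \<kappa>_def)
          also have "\<dots> \<le> 2 * pi / sqrt K" using that by (intro divide_right_mono) auto
          finally show ?thesis .
        qed
        ultimately show "w1 \<in> X \<and> w2 \<in> X \<and> w3 \<in> X \<and> is_geod d X w1 w2 c1 \<and> is_geod d X w2 w3 c2 \<and> is_geod d X w1 w3 c3 \<and>
          c1 ` {0..d w1 w2} \<subseteq> {y \<in> X. d x0 y < rA} \<and> c2 ` {0..d w2 w3} \<subseteq> {y \<in> X. d x0 y < rA} \<and>
          c3 ` {0..d w1 w3} \<subseteq> {y \<in> X. d x0 y < rA} \<and> (K > 0 \<longrightarrow> d w1 w2 + d w2 w3 + d w1 w3 < 2 * pi / sqrt K)"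
          using w c1(1) c2(1) c3(1) by blast
        show "z0 \<in> Z \<and> z2 \<in> Z \<and> z3 \<in> Z \<and> e z0 z2 = d w1 w2 \<and> e z2 z3 = d w2 w3 \<and> e z0 z3 = d w1 w3 \<and>
          is_geod e Z z0 z2 \<epsilon>1 \<and> is_geod e Z z2 z3 \<epsilon>2 \<and> is_geod e Z z0 z3 \<epsilon>3"
          using z0 z \<epsilon> by blast
      qed
      then have cmp: "if lower then e u' v' \<le> d u v else d u v \<le> e u' v'" if "(u, u') \<in> AP" "(v, v') \<in> AP" for u u' v v'
        using that by blast
      define R where "R = (\<lambda>t. (\<sigma>1 t, \<rho>1 t)) ` {a1..b1} \<union> (\<lambda>t. (\<sigma>2 t, \<rho>2 t)) ` {a2..b2} \<union> (\<lambda>t. (\<sigma>3 t, \<rho>3 t)) ` {a3..b3}"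
      \<comment> \<open>Corresponding points of a side and its lift share their time and project to
        corresponding points of the two fibre triangles.\<close>
      have R1: "fst P' = fst P \<and> (snd P, snd P') \<in> AP \<and> snd P \<in> X \<and> snd P' \<in> Z" if "(P, P') \<in> R" for P P'
      proof -
        from that consider t where "t \<in> {a1..b1}" "P = \<sigma>1 t" "P' = \<rho>1 t" | t where "t \<in> {a2..b2}" "P = \<sigma>2 t" "P' = \<rho>2 t"
          | t where "t \<in> {a3..b3}" "P = \<sigma>3 t" "P' = \<rho>3 t"
          by (auto simp: R_def)
        then show ?thesis
        proof cases
          case 1
          then have "(c1 (d w1 (snd P)), \<epsilon>1 (d w1 (snd P))) \<in> AP" using c1(3) unfolding AP_def by blast
          then show ?thesis using 1 c1(3) \<epsilon>1 \<sigma>X(1)[OF s1(2)] by (auto simp: \<rho>1_def)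
        next
          case 2
          then have "(c2 (d w2 (snd P)), \<epsilon>2 (d w2 (snd P))) \<in> AP" using c2(3) unfolding AP_def by blast
          then show ?thesis using 2 c2(3) \<epsilon>2 \<sigma>X(1)[OF s2(2)] by (auto simp: \<rho>2_def)
        next
          case 3
          then have "(c3 (d w1 (snd P)), \<epsilon>3 (d w1 (snd P))) \<in> AP" using c3(3) unfolding AP_def by blast
          then show ?thesis using 3 c3(3) \<epsilon>3 \<sigma>X(1)[OF s3(2)] by (auto simp: \<rho>3_def)
        qed
      qed
      have R2: "if lower then gtau ?CX ?LX P Q \<le> gtau ?CZ ?LZ P' Q' else gtau ?CZ ?LZ P' Q' \<le> gtau ?CX ?LX P Q"
        if PQ: "(P, P') \<in> R" "(Q, Q') \<in> R" for P P' Q Q'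
      proof -
        note 1 = R1[OF PQ(1)] and 2 = R1[OF PQ(2)]
        have P: "P = (fst P, snd P)" "P' = (fst P, snd P')" "Q = (fst Q, snd Q)" "Q' = (fst Q, snd Q')"
          using 1 2 by (auto simp: prod_eq_iff)
        obtain cX cZ where g: "is_geod d X (snd P) (snd Q) cX" "is_geod e Z (snd P') (snd Q') cZ" using geod geodZ 1 2 by meson
        have c: "if lower then e (snd P') (snd Q') \<le> d (snd P) (snd Q) else d (snd P) (snd Q) \<le> e (snd P') (snd Q')"
          using cmp 1 2 by blast
        \<comment> \<open>A larger fibre distance means a smaller time separation, so the inequality
          given by the bound on \<open>X\<close> turns around in either case.\<close>
        show ?thesis
        proof (cases lower)
          case True
          then have "gtau ?CX ?LX (fst P, snd P) (fst Q, snd Q) \<le> gtau ?CZ ?LZ (fst P, snd P') (fst Q, snd Q')"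
            using 1 2 c by (intro cone_tau_mono[OF X Z _ _ f g(2)]) auto
          then show ?thesis using P True by metis
        next
          case False
          then have "gtau ?CZ ?LZ (fst P, snd P') (fst Q, snd Q') \<le> gtau ?CX ?LX (fst P, snd P) (fst Q, snd Q)"
            using 1 2 c by (intro cone_tau_mono[OF Z X _ _ f g(1)]) auto
          then show ?thesis using P False by metis
        qed
      qed
      have pt: "gtau ?CZ ?LZ (t, z) (s, \<epsilon>') = gtau ?CX ?LX (t, w) \<sigma>'"
        if "w \<in> X" "z \<in> Z" "snd \<sigma>' \<in> X" "\<epsilon>' \<in> Z" "e z \<epsilon>' = d w (snd \<sigma>')" "s = fst \<sigma>'" for t z s \<epsilon>' w and \<sigma>' :: "real \<times> 'a"
        using tau_eq[OF that(1,3,2,4,5), of t s] that(6) by simp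
      show "\<exists>u v w \<rho>1 \<rho>2 \<rho>3. u \<in> UM \<and> v \<in> UM \<and> w \<in> UM \<and> grel ?TZ u v \<and> grel ?TZ v w \<and> gtau ?CZ ?LZ u w < \<infinity> \<and>
        maximal_side ?CZ ?LZ u v a1 b1 \<rho>1 \<and> \<rho>1 ` {a1..b1} \<subseteq> UM \<and>
        maximal_side ?CZ ?LZ v w a2 b2 \<rho>2 \<and> \<rho>2 ` {a2..b2} \<subseteq> UM \<and>
        maximal_side ?CZ ?LZ u w a3 b3 \<rho>3 \<and> \<rho>3 ` {a3..b3} \<subseteq> UM \<and>
        gtau ?CZ ?LZ u v = gtau ?CX ?LX p q \<and> gtau ?CZ ?LZ v w = gtau ?CX ?LX q r \<and> gtau ?CZ ?LZ u w = gtau ?CX ?LX p r \<and>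
        (\<forall>t\<in>{a1..b1}. gtau ?CZ ?LZ u (\<rho>1 t) = gtau ?CX ?LX p (\<sigma>1 t)) \<and>
        (\<forall>t\<in>{a2..b2}. gtau ?CZ ?LZ v (\<rho>2 t) = gtau ?CX ?LX q (\<sigma>2 t)) \<and>
        (\<forall>t\<in>{a3..b3}. gtau ?CZ ?LZ u (\<rho>3 t) = gtau ?CX ?LX p (\<sigma>3 t)) \<and>
        (let R = (\<lambda>t. (\<sigma>1 t, \<rho>1 t)) ` {a1..b1} \<union> (\<lambda>t. (\<sigma>2 t, \<rho>2 t)) ` {a2..b2} \<union> (\<lambda>t. (\<sigma>3 t, \<rho>3 t)) ` {a3..b3}
         in \<forall>(p, p')\<in>R. \<forall>(q, q')\<in>R. if lower then gtau ?CX ?LX p q \<le> gtau ?CZ ?LZ p' q' else gtau ?CZ ?LZ p' q' \<le> gtau ?CX ?LX p q)"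
      proof (rule exI[of _ "(t1, z0)"], rule exI[of _ "(t2, z2)"], rule exI[of _ "(t3, z3)"],
          rule exI[of _ \<rho>1], rule exI[of _ \<rho>2], rule exI[of _ \<rho>3], intro conjI)
        show "grel ?TZ (t1, z0) (t2, z2)" "grel ?TZ (t2, z2) (t3, z3)"
          using T rel[OF w(1,2) z0(1) z(1,3)] rel[OF w(2,3) z(1,2,4)] by (auto simp: eqs)
        show "gtau ?CZ ?LZ (t1, z0) (t3, z3) < \<infinity>" using fin ends by blast
        show "gtau ?CZ ?LZ (t1, z0) (t2, z2) = gtau ?CX ?LX p q" "gtau ?CZ ?LZ (t2, z2) (t3, z3) = gtau ?CX ?LX q r"
          "gtau ?CZ ?LZ (t1, z0) (t3, z3) = gtau ?CX ?LX p r"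
          unfolding eqs using tau_eq w z0 z by auto
        show "\<forall>t\<in>{a1..b1}. gtau ?CZ ?LZ (t1, z0) (\<rho>1 t) = gtau ?CX ?LX p (\<sigma>1 t)"
          unfolding eqs \<rho>1_def using pt[OF w(1) z0(1)] \<epsilon>1 \<sigma>X(1)[OF s1(2)] by blast
        show "\<forall>t\<in>{a2..b2}. gtau ?CZ ?LZ (t2, z2) (\<rho>2 t) = gtau ?CX ?LX q (\<sigma>2 t)"
          unfolding eqs \<rho>2_def using pt[OF w(2) z(1)] \<epsilon>2 \<sigma>X(1)[OF s2(2)] by blast
        show "\<forall>t\<in>{a3..b3}. gtau ?CZ ?LZ (t1, z0) (\<rho>3 t) = gtau ?CX ?LX p (\<sigma>3 t)"
          unfolding eqs \<rho>3_def using pt[OF w(1) z0(1)] \<epsilon>3 \<sigma>X(1)[OF s3(2)] by blast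
        show "let R = (\<lambda>t. (\<sigma>1 t, \<rho>1 t)) ` {a1..b1} \<union> (\<lambda>t. (\<sigma>2 t, \<rho>2 t)) ` {a2..b2} \<union> (\<lambda>t. (\<sigma>3 t, \<rho>3 t)) ` {a3..b3}
         in \<forall>(p, p')\<in>R. \<forall>(q, q')\<in>R. if lower then gtau ?CX ?LX p q \<le> gtau ?CZ ?LZ p' q' else gtau ?CZ ?LZ p' q' \<le> gtau ?CX ?LX p q"
          unfolding Let_def R_def[symmetric] using R2 by blast
      qed (fact ends m1 m2 m3 img1 img2 img3)+
    qed
  qed
qed

end
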